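(* Let $m_1<m_2<\cdots<m_N$ and let $(f_i(t,v))_{i=1}^N$ be a solution of the spatially homogeneous (elastic) multi-species mixture Boltzmann equation $\partial_t f_i=\sum_{j=1}^N Q_{ji}(f_j,f_i)$, $1\le i\le N$, for $v\in\mathbb{R}^3$, with cutoff collision kernels and hard potentials $\gamma\in[0,1]$ (as described in the context). Then for any positive time there are functions $a_i(t)>0$ and $b_i(t)>0$, depending on $M_0,E_0,H_0$ and $\gamma$, such that $$f_i(t,v)\ \ge\ a_i(t)\,e^{-b_i(t)|v|^2}.$$ Moreover, $a_i(t)$ and $b_i(t)$ can be chosen uniformly for all $t>t_0$, where $t_0$ is any positive time.
   Context: There are $N$ types of particles with masses $m_1,\dots,m_N>0$; $f_i(t,v)\ge0$ is the density of particles of mass $m_i$ at time $t$ with velocity $v\in\mathbb{R}^3$. When a particle of mass $m_i$ and velocity $v$ collides with a particle of mass $m_j$ and velocity $v_*$, the postcollisional velocities are $$v'=v-\frac{2m_j}{m_i+m_j}\langle v-v_*,n\rangle n,\qquad v_*'=v_*+\frac{2m_i}{m_i+m_j}\langle v-v_*,n\rangle n ,$$ with $n\in\mathbb{S}^{2}_+$, the half sphere of unit vectors with $\langle v-v_*,n\rangle\ge0$. The collision operators are $$Q_{ji}(f_j,f_i)(t,v)=\int B_{ji}(|v-v_*|,\theta)\,\big(f_j(v_*')f_i(v')-f_j(v_* )f_i(v)\big)\,dn\,dv_*,\qquad \cos\theta=\Big\langle\frac{v-v_*}{|v-v_*|},n\Big\rangle,\ \theta\in[0,\tfrac{\pi}{2}];$$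 for $i=j$, $Q_{ii}$ is the standard (elastic, mono-species) Boltzmann operator. Cutoff kernels with hard potentials: $B_{ji}(|v-v_*|,\theta)=h_{ji}(\theta)|v-v_*|^\gamma$ with $\gamma\in[0,1]$ and $\int_0^{\pi/2}h_{ji}(\theta)\,d\theta<\infty$. Mass, momentum and energy are conserved, and the total initial mass, energy and entropy $M_0:=\sum_j\int f_j(0,v)\,dv$, $E_0:=\sum_j\int f_j(0,v)|v|^2dv$, $H_0:=\sum_j\int f_j(0,v)\log f_j(0,v)\,dv$ are finite.
   Formalization: Added: each species has initial mass at least some δ>0, and a_i, b_i may depend on δ (an absent species stays zero); each h_ji is nonnegative with positive integral (no collisions otherwise) and h_ji=h_ij (for conservation). Solutions are mild, so the bound holds for almost every v. *)

theory Defs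
  imports "HOL-Analysis.Analysis"
begin

(* Surface measure on the unit sphere of real^3, as the cone measure
   sigma(A) = 3 * vol {r n | 0 < r < 1, n : A}  (total mass 4 pi).
   The origin, where sgn 0 = 0 leaves the sphere, is a null set. *)
definition sphere_measure :: "(real^3) measure" where
  "sphere_measure = scale_measure 3 (distr (restrict_space lborel (ball 0 1)) borel sgn)"

text \<open>Velocities after the collision of a particle of mass \<open>mi\<close> and velocity \<open>v\<close> with a
  particle of mass \<open>mj\<close> and velocity \<open>w\<close> (the \<open>v\<^sub>*\<close> of the usual notation).\<close>

definition post_vel :: "real \<Rightarrow> real \<Rightarrow> real^3 \<Rightarrow> real^3 \<Rightarrow> real^3 \<Rightarrow> real^3" where
  "post_vel mi mj v w n = v - (2 * mj / (mi + mj) * ((v - w) \<bullet> n)) *\<^sub>R n"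

definition post_vel_star :: "real \<Rightarrow> real \<Rightarrow> real^3 \<Rightarrow> real^3 \<Rightarrow> real^3 \<Rightarrow> real^3" where
  "post_vel_star mi mj v w n = w + (2 * mi / (mi + mj) * ((v - w) \<bullet> n)) *\<^sub>R n"

text \<open>The junk values on the null set \<open>v = w\<close> are irrelevant (the angle, and \<open>0 powr 0 = 0\<close>).\<close>

definition coll_angle :: "real^3 \<Rightarrow> real^3 \<Rightarrow> real^3 \<Rightarrow> real" where
  "coll_angle v w n = arccos (((v - w) /\<^sub>R norm (v - w)) \<bullet> n)"

definition coll_kernel :: "real \<Rightarrow> (real \<Rightarrow> real) \<Rightarrow> real^3 \<Rightarrow> real^3 \<Rightarrow> real^3 \<Rightarrow> real" where
  "coll_kernel \<gamma> hji v w n = hji (coll_angle v w n) * norm (v - w) powr \<gamma>"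

text \<open>The indicator restricts \<open>n\<close> to the half sphere \<open>(v - w) \<bullet> n \<ge> 0\<close>.\<close>

definition coll_integrand ::
  "real \<Rightarrow> (real \<Rightarrow> real) \<Rightarrow> real \<Rightarrow> real \<Rightarrow> (real^3 \<Rightarrow> real) \<Rightarrow> (real^3 \<Rightarrow> real) \<Rightarrow> real^3
    \<Rightarrow> (real^3) \<times> (real^3) \<Rightarrow> real" where
  "coll_integrand \<gamma> hji mj mi fj fi v = (\<lambda>(w, n).
     indicator {n. (v - w) \<bullet> n \<ge> 0} n * coll_kernel \<gamma> hji v w n *
       (fj (post_vel_star mi mj v w n) * fi (post_vel mi mj v w n) - fj w * fi v))"

definition coll_op ::
  "real \<Rightarrow> (real \<Rightarrow> real) \<Rightarrow> real \<Rightarrow> real \<Rightarrow> (real^3 \<Rightarrow> real) \<Rightarrow> (real^3 \<Rightarrow> real) \<Rightarrow> real^3 \<Rightarrow> real" where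
  "coll_op \<gamma> hji mj mi fj fi v =
     (LINT p|(lborel \<Otimes>\<^sub>M sphere_measure). coll_integrand \<gamma> hji mj mi fj fi v p)"

text \<open>Cutoff kernels with hard potentials, \<open>h j i\<close> being the angular factor of \<open>B\<^sub>j\<^sub>i\<close>. The
  symmetry \<open>h j i = h i j\<close> is microreversibility, on which the conservation of momentum and energy
  and the H theorem rest; positivity of the integral says that the species do collide.\<close>

definition cutoff_hard_potentials :: "nat \<Rightarrow> real \<Rightarrow> (nat \<Rightarrow> nat \<Rightarrow> real \<Rightarrow> real) \<Rightarrow> bool" where
  "cutoff_hard_potentials N \<gamma> h \<longleftrightarrow>
     0 \<le> \<gamma> \<and> \<gamma> \<le> 1 \<and>
     (\<forall>j\<in>{1..N}. \<forall>i\<in>{1..N}.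
        (\<forall>\<theta>\<in>{0..pi/2}. 0 \<le> h j i \<theta> \<and> h j i \<theta> = h i j \<theta>) \<and>
        set_integrable lborel {0..pi/2} (h j i) \<and>
        0 < (LINT \<theta>:{0..pi/2}|lborel. h j i \<theta>))"

text \<open>Global mild solutions: the equation holds integrated in time, for almost every velocity. The
  integrability clauses ensure that no Bochner integral takes its default value \<open>0\<close>.\<close>

definition mixture_solution ::
  "nat \<Rightarrow> (nat \<Rightarrow> real) \<Rightarrow> real \<Rightarrow> (nat \<Rightarrow> nat \<Rightarrow> real \<Rightarrow> real) \<Rightarrow> (nat \<Rightarrow> real \<Rightarrow> real^3 \<Rightarrow> real) \<Rightarrow> bool"
where
  "mixture_solution N m \<gamma> h f \<longleftrightarrow>
     (\<forall>i\<in>{1..N}.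
        set_borel_measurable borel ({0..} \<times> UNIV) (\<lambda>(t, v). f i t v) \<and>
        (\<forall>t\<ge>0. \<forall>v. 0 \<le> f i t v) \<and>
        (\<forall>t\<ge>0. integrable lborel (f i t) \<and> integrable lborel (\<lambda>v. f i t v * (norm v)\<^sup>2)) \<and>
        (\<forall>j\<in>{1..N}. AE v in lborel. AE s in lborel. s \<ge> 0 \<longrightarrow>
           integrable (lborel \<Otimes>\<^sub>M sphere_measure)
             (coll_integrand \<gamma> (h j i) (m j) (m i) (f j s) (f i s) v)) \<and>
        (AE v in lborel. \<forall>t\<ge>0.
           set_integrable lborel {0..t}
             (\<lambda>s. \<Sum>j\<in>{1..N}. coll_op \<gamma> (h j i) (m j) (m i) (f j s) (f i s) v) \<and>
           f i t v = f i 0 v +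
             (LINT s:{0..t}|lborel. \<Sum>j\<in>{1..N}. coll_op \<gamma> (h j i) (m j) (m i) (f j s) (f i s) v)))"

definition conservation_laws ::
  "nat \<Rightarrow> (nat \<Rightarrow> real) \<Rightarrow> (nat \<Rightarrow> real \<Rightarrow> real^3 \<Rightarrow> real) \<Rightarrow> bool" where
  "conservation_laws N m f \<longleftrightarrow> (\<forall>t\<ge>0.
     (\<forall>i\<in>{1..N}. (LINT v|lborel. f i t v) = (LINT v|lborel. f i 0 v)) \<and>
     (\<Sum>i\<in>{1..N}. m i *\<^sub>R (LINT v|lborel. f i t v *\<^sub>R v)) =
       (\<Sum>i\<in>{1..N}. m i *\<^sub>R (LINT v|lborel. f i 0 v *\<^sub>R v)) \<and>
     (\<Sum>i\<in>{1..N}. m i * (LINT v|lborel. f i t v * (norm v)\<^sup>2)) =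
       (\<Sum>i\<in>{1..N}. m i * (LINT v|lborel. f i 0 v * (norm v)\<^sup>2)))"

text \<open>Total initial mass, energy and entropy; finiteness of mass and energy is already part of
  \<open>mixture_solution\<close>. Note \<open>0 * ln 0 = 0\<close>.\<close>

definition initial_totals ::
  "nat \<Rightarrow> (nat \<Rightarrow> real \<Rightarrow> real^3 \<Rightarrow> real) \<Rightarrow> real \<Rightarrow> real \<Rightarrow> real \<Rightarrow> bool" where
  "initial_totals N f M\<^sub>0 E\<^sub>0 H\<^sub>0 \<longleftrightarrow>
     (\<forall>i\<in>{1..N}. integrable lborel (\<lambda>v. f i 0 v * ln (f i 0 v))) \<and>
     M\<^sub>0 = (\<Sum>i\<in>{1..N}. LINT v|lborel. f i 0 v) \<and>
     E\<^sub>0 = (\<Sum>i\<in>{1..N}. LINT v|lborel. f i 0 v * (norm v)\<^sup>2) \<and>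
     H\<^sub>0 = (\<Sum>i\<in>{1..N}. LINT v|lborel. f i 0 v * ln (f i 0 v))"

end

theory Submission
  imports Defs "HOL-Probability.Probability"
begin

text \<open>By Duhamel's formula \<open>f\<^sub>i\<close> dominates the gain terms of its own lower bounds, up to a loss of order
  \<open>1 + |v|\<close>. Three steps make a Maxwellian. First, the mass does not concentrate near any velocity,
  uniformly in time: entropy prevents it initially, and a saturated energy about the given velocity,
  of concave shape and on a scale that was exponentially large in the past, propagates this without
  the H theorem. Hence two balls at positive distance carry mass of species \<open>i\<close> and of some species
  \<open>j\<close>. Secondly, a particle from one ball that collides twice with the other ball and then once with
  its own ends up with a velocity that is a local diffeomorphism of the three azimuths. The angular
  factors are merely integrable but do not depend on the azimuths, so the threefold gain term is
  bounded below on a ball; by compactness the constants are uniform. Finally, collisions inside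
  species \<open>i\<close> enlarge that ball by a fixed factor per step, in geometrically decreasing times, and
  reproduce a Maxwellian profile.\<close>

text \<open>At positive times only masses and energies are controlled, and the entropy is known only
  initially. Hence every constant is chosen before the flow, from \<open>\<delta>\<close>,
  \<open>M\<close>, \<open>E\<close> and the initial entropy, and the gain terms have to start from
  densities that are merely integrable. In the saturated energy \<open>S\<close> on the scale
  \<open>k\<close>, collisions destroy at most a multiple of \<open>|v - c|^\<gamma> S / k\<close>
  and create a multiple of \<open>|v - c|^\<gamma> S^2 / k\<close> far from the centre
  \<open>c\<close>. What is left over is a relative loss at rate \<open>K / k\<close>. As
  \<open>k\<close> decays exponentially in time, this rate has a finite integral over the whole
  past, so the final constant does not see the length of the time interval. The polar angles carry
  the rough angular factor, so only azimuths can smooth, and three dimensions take three of them.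
  The third partner must differ from the first two: collisions with one velocity \<open>b\<close>
  keep the particle on a sphere about \<open>b\<close> whose radius the polar angles determine. In
  the last step the loss frequency grows linearly with the radius; the geometric time steps
  compensate for this.\<close>

type_synonym vec = "real^3"

abbreviation finite_entropy :: "nat \<Rightarrow> (nat \<Rightarrow> real \<Rightarrow> vec \<Rightarrow> real) \<Rightarrow> bool" where
  "finite_entropy N f \<equiv> \<forall>i\<in>{1..N}. integrable lborel (\<lambda>v. f i 0 v * ln (f i 0 v))"

abbreviation entropy :: "nat \<Rightarrow> (nat \<Rightarrow> real \<Rightarrow> vec \<Rightarrow> real) \<Rightarrow> real" where
  "entropy N f \<equiv> (\<Sum>i\<in>{1..N}. LINT v|lborel. f i 0 v * ln (f i 0 v))"

abbreviation vint :: "('a::euclidean_space \<Rightarrow> ennreal) \<Rightarrow> ennreal" (binder "VINT " 10)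
  where "vint F \<equiv> (\<integral>\<^sup>+v. F v \<partial>lborel)"

abbreviation sint :: "(vec \<Rightarrow> ennreal) \<Rightarrow> ennreal" (binder "SINT " 10)
  where "sint F \<equiv> (\<integral>\<^sup>+n. F n \<partial>sphere_measure)"

section \<open>Surface measure on the sphere: invariance under isometries and the law of the polar
  angle\<close>

lemma orthogonal_transformation_borel_measurable [measurable_dest]:
  fixes f :: "real^'n \<Rightarrow> real^'n"
  assumes "orthogonal_transformation f"
  shows "f \<in> borel_measurable borel"
  using assms
  by (intro borel_measurable_continuous_onI linear_continuous_on
      linear_conv_bounded_linear[THEN iffD1] orthogonal_transformation_linear)

lemma distr_lborel_orthogonal:
  fixes f :: "vec \<Rightarrow> vec"
  assumes f: "orthogonal_transformation f"
  shows "distr lborel borel f = lborel"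
proof (rule lborel_eqI[symmetric])
  have [measurable]: "f \<in> borel_measurable borel"
    by (rule orthogonal_transformation_borel_measurable[OF f])
  fix l u :: vec
  assume lu: "\<And>b. b \<in> Basis \<Longrightarrow> l \<bullet> b \<le> u \<bullet> b"
  have bij: "bij f" using f by (rule orthogonal_transformation_bij)
  have inv: "orthogonal_transformation (inv f)" using f by (rule orthogonal_transformation_inv)
  have vim: "f -` box l u = inv f ` box l u"
    using bij by (simp add: bij_vimage_eq_inv_image)
  have m: "measure lebesgue (inv f ` box l u) = measure lebesgue (box l u)"
    by (rule measure_orthogonal_image[OF inv]) auto
  have lm: "inv f ` box l u \<in> lmeasurable"
    by (rule measurable_orthogonal_image[OF inv]) auto
  have "f -` box l u \<in> sets borel" using measurable_sets[of f borel borel "box l u"] by simp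
  then have "emeasure lborel (f -` box l u) = emeasure lebesgue (inv f ` box l u)"
    by (simp add: vim)
  also have "\<dots> = ennreal (measure lebesgue (box l u))"
    using lm m by (simp add: emeasure_eq_measure2 fmeasurableD2 fmeasurableD emeasure_eq_ennreal_measure)
  also have "\<dots> = ennreal (\<Prod>b\<in>Basis. (u - l) \<bullet> b)"
    using lu by (simp add: measure_lborel_box_eq)
  finally show "emeasure (distr lborel borel f) (box l u) = ennreal (\<Prod>b\<in>Basis. (u - l) \<bullet> b)"
    by (simp add: emeasure_distr)
qed simp

lemma sets_sphere_measure [simp, measurable_cong]: "sets sphere_measure = sets borel"
  by (simp add: sphere_measure_def)

lemma space_sphere_measure [simp]: "space sphere_measure = UNIV"
  using sets_eq_imp_space_eq[OF sets_sphere_measure] by simp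

lemma sgn_vec_measurable [measurable]: "sgn \<in> borel_measurable (borel :: vec measure)"
  unfolding sgn_div_norm[abs_def] by measurable

lemma ball_pred_measurable [measurable]: "Measurable.pred borel (\<lambda>x::'a::metric_space. x \<in> ball a r)"
  using borel_open[OF open_ball] by (auto simp: pred_def ball_def)

lemma nn_integral_sphere_measure:
  assumes [measurable]: "F \<in> borel_measurable borel"
  shows "(SINT n. F n) = 3 * (VINT x. F (sgn x) * indicator (ball 0 1) x)"
  unfolding sphere_measure_def
  by (simp add: nn_integral_scale_measure nn_integral_distr nn_integral_restrict_space
      measurable_restrict_space1)

lemma AE_sphere_measure_norm: "AE n in sphere_measure. norm n = 1"
proof -
  have "(SINT n. indicator {n. norm n \<noteq> 1} n)
      = 3 * (\<integral>\<^sup>+x. indicator {n. norm n \<noteq> 1} (sgn x) * indicator (ball 0 1) x \<partial>(lborel::vec measure))"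
    by (rule nn_integral_sphere_measure) measurable
  also have "(\<integral>\<^sup>+x. indicator {n. norm n \<noteq> 1} (sgn x) * indicator (ball 0 1) x \<partial>(lborel::vec measure)) = 0"
    by (subst nn_integral_0_iff_AE)
       (auto intro!: AE_I[of _ _ "{0}"] simp: indicator_def norm_sgn)
  finally have "emeasure sphere_measure {n. norm n \<noteq> 1} = 0"
    by (subst (asm) nn_integral_indicator) auto
  then show ?thesis by (intro AE_I[of _ _ "{n. norm n \<noteq> 1}"]) auto
qed

lemma finite_sphere_measure: "finite_measure sphere_measure"
proof
  have "emeasure sphere_measure UNIV = (SINT n. 1)" by simp
  also have "\<dots> = 3 * emeasure lborel (ball 0 1 :: vec set)"
    by (subst nn_integral_sphere_measure) auto
  also have "\<dots> < \<infinity>" using emeasure_lborel_ball_finite[of "0::vec" 1] by (simp add: ennreal_mult_less_top)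
  finally show "emeasure sphere_measure (space sphere_measure) \<noteq> \<infinity>" by simp
qed

interpretation sphere: finite_measure sphere_measure by (rule finite_sphere_measure)

text \<open>An isometry commutes with \<open>sgn\<close> and preserves the unit ball, so the
  invariance of the cone measure is that of Lebesgue measure.\<close>

lemma nn_integral_sphere_orthogonal:
  assumes f: "orthogonal_transformation f" and [measurable]: "F \<in> borel_measurable borel"
  shows "(SINT n. F (f n)) = (SINT n. F n)"
proof -
  have [measurable]: "f \<in> borel_measurable borel"
    by (rule orthogonal_transformation_borel_measurable[OF f])
  have sg: "f (sgn x) = sgn (f x)" for x
    using f by (simp add: sgn_div_norm orthogonal_transformation_norm
        linear_cmul[OF orthogonal_transformation_linear])
  have "(SINT n. F (f n))
      = 3 * (VINT x. F (sgn (f x)) * indicator (ball 0 1) (f x))"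
    using f by (simp add: nn_integral_sphere_measure sg orthogonal_transformation_norm indicator_def)
  also have "(VINT x. F (sgn (f x)) * indicator (ball 0 1) (f x))
     = (\<integral>\<^sup>+x. F (sgn x) * indicator (ball 0 1) x \<partial>distr lborel borel f)"
    by (subst nn_integral_distr) simp_all
  finally show ?thesis
    by (simp add: nn_integral_sphere_measure distr_lborel_orthogonal[OF f])
qed

text \<open>One coordinate is split off from a planar pair, so that Fubini can integrate along the
  first axis for a fixed point of the orthogonal plane.\<close>

definition vec3 :: "real \<times> (real \<times> real) \<Rightarrow> vec" where
  "vec3 p = fst p *\<^sub>R axis 1 1 + fst (snd p) *\<^sub>R axis 2 1 + snd (snd p) *\<^sub>R axis 3 1"

lemma vec3_nth [simp]: "vec3 (a, b, c) $ 1 = a" "vec3 (a, b, c) $ 2 = b" "vec3 (a, b, c) $ 3 = c"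
  by (simp_all add: vec3_def axis_def)

lemma vec3_measurable [measurable]: "vec3 \<in> borel_measurable borel"
  unfolding vec3_def[abs_def] by (intro borel_measurable_continuous_onI continuous_intros)

lemma prod3: "(\<Prod>i\<in>(UNIV :: 3 set). F i) = F 1 * (F 2 * F 3 :: 'a::comm_monoid_mult)"
  unfolding UNIV_3 by simp

lemma Basis_vec3: "(Basis :: vec set) = {axis 1 1, axis 2 1, axis 3 1}"
  by (auto simp: Basis_vec_def UNIV_3)

lemma emeasure_lborel_Times:
  fixes A :: "'a::euclidean_space set" and B :: "'b::euclidean_space set"
  assumes "A \<in> sets borel" "B \<in> sets borel"
  shows "emeasure lborel (A \<times> B) = emeasure lborel A * emeasure lborel B"
  unfolding lborel_prod[symmetric] using assms by (intro lborel.emeasure_pair_measure_Times) auto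

lemma distr_vec3: "distr lborel borel vec3 = lborel"
proof (rule lborel_eqI[symmetric])
  fix l u :: vec
  assume lu: "\<And>b. b \<in> Basis \<Longrightarrow> l \<bullet> b \<le> u \<bullet> b"
  have le: "l $ i \<le> u $ i" for i
    using lu[of "axis i 1"] by (simp add: cart_eq_inner_axis axis_in_Basis_iff)
  have "vec3 -` box l u = box (l $ 1) (u $ 1) \<times> (box (l $ 2) (u $ 2) \<times> box (l $ 3) (u $ 3))"
    by (auto simp: mem_box_cart forall_3)
  then have "emeasure (distr lborel borel vec3) (box l u)
     = emeasure lborel ({l $ 1 <..< u $ 1} \<times> ({l $ 2 <..< u $ 2} \<times> {l $ 3 <..< u $ 3}))"
    by (simp add: emeasure_distr)
  also have "\<dots> = ennreal (\<Prod>i\<in>UNIV. u $ i - l $ i)"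
    using le by (simp add: emeasure_lborel_Times borel_open open_Times prod3 ennreal_mult)
  also have "(\<Prod>i\<in>UNIV. u $ i - l $ i) = (\<Prod>b\<in>Basis. (u - l) \<bullet> b)"
    by (simp add: Basis_vec3 prod3 axis_eq_axis inner_axis)
  finally show "emeasure (distr lborel borel vec3) (box l u) = ennreal (\<Prod>b\<in>Basis. (u - l) \<bullet> b)" .
qed simp

lemma nn_integral_vec3:
  assumes [measurable]: "F \<in> borel_measurable borel"
  shows "(VINT x. F x) = (VINT y. VINT a. F (vec3 (a, y)))"
proof -
  have "(VINT x. F x) = (\<integral>\<^sup>+p. F (vec3 p) \<partial>(lborel \<Otimes>\<^sub>M lborel))"
    by (subst distr_vec3[symmetric]) (simp add: nn_integral_distr lborel_prod)
  also have "\<dots> = (VINT y. VINT a. F (vec3 (a, y)))"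
    by (subst lborel_pair.nn_integral_snd[symmetric]) (simp_all add: lborel_prod)
  finally show ?thesis .
qed

lemma norm_vec3: "norm (vec3 (a, y)) = sqrt (a^2 + (norm y)^2)"
proof -
  have "vec3 (a, y) \<bullet> vec3 (a, y) = a^2 + y \<bullet> y"
    by (cases y) (simp add: inner_vec_def sum_3 power2_eq_square)
  moreover have "(norm y)^2 = y \<bullet> y" by (simp add: power2_norm_eq_inner)
  ultimately show ?thesis by (simp only: norm_eq_sqrt_inner[of "vec3 (a, y)"])
qed

text \<open>\<open>arccos\<close> is a definite description. Outside the interval from -1 to 1 its
  predicate is identically false, so all these arguments share one junk value, represented by
  \<open>arccos 2\<close>.\<close>

lemma borel_measurable_arccos [measurable]: "arccos \<in> borel_measurable borel"
proof -
  have out: "arccos y = arccos 2" if "y \<notin> {-1..1}" for y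
  proof -
    have "cos x \<noteq> y" for x :: real using that cos_ge_minus_one[of x] cos_le_one[of x] by auto
    moreover have "cos x \<noteq> 2" for x :: real using cos_le_one[of x] by linarith
    ultimately show ?thesis unfolding arccos_def by simp
  qed
  have "(\<lambda>y. if y \<in> {-1..1} then arccos y else arccos 2) \<in> borel_measurable borel"
    by (intro borel_measurable_continuous_on_if continuous_on_arccos' continuous_intros) auto
  also have "(\<lambda>y. if y \<in> {-1..1} then arccos y else arccos 2) = arccos"
    by (rule ext) (metis out)
  finally show ?thesis .
qed

text \<open>The total cross section at unit relative speed of a kernel with angular factor
  \<open>H\<close>. The first axis stands for any direction, by rotation invariance.\<close>

definition angle_mass :: "(real \<Rightarrow> ennreal) \<Rightarrow> ennreal" where
  "angle_mass H = (SINT n. indicator {0..} (axis 1 1 \<bullet> n) * H (arccos (axis 1 1 \<bullet> n)))"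

lemma nn_integral_angle:
  assumes e: "norm e = 1" and [measurable]: "H \<in> borel_measurable borel"
  shows "(SINT n. indicator {0..} (e \<bullet> n) * H (arccos (e \<bullet> n))) = angle_mass H"
proof -
  obtain f where f: "orthogonal_transformation f" and fe: "f (axis 1 1 :: vec) = e"
  proof -
    have ne: "norm (axis 1 1 :: vec) = norm e" using e by (simp add: norm_axis_1)
    show ?thesis
    proof (rule orthogonal_transformation_exists[OF ne])
      fix f :: "vec \<Rightarrow> vec" assume "orthogonal_transformation f" "f (axis 1 1 :: vec) = e"
      then show ?thesis using that[of f] by simp
    qed
  qed
  have "e \<bullet> f n = axis 1 1 \<bullet> n" for n
    using f fe by (metis orthogonal_transformation_def)
  then show ?thesis
    unfolding angle_mass_def
    by (subst nn_integral_sphere_orthogonal[OF f, symmetric]) simp_all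
qed

lemma nn_integral_scaleR:
  fixes f :: "'a::euclidean_space \<Rightarrow> ennreal"
  assumes [measurable]: "f \<in> borel_measurable borel" and "0 < c"
  shows "(VINT y. f y) = ennreal (c ^ DIM('a)) * (VINT y. f (c *\<^sub>R y))"
  using assms(2)
  by (subst lborel_affine[of c 0])
     (simp_all add: nn_integral_density nn_integral_distr nn_integral_cmult)

text \<open>The derivative of \<open>tan\<close> is unbounded at \<open>pi/2\<close>, so the
  substitution is made on compact intervals ending at \<open>B n\<close> and passed to the limit by
  monotone convergence.\<close>

lemma nn_integral_tan:
  fixes F :: "real \<Rightarrow> ennreal"
  assumes [measurable]: "F \<in> borel_measurable borel"
  shows "(VINT c. F c * indicator {0..} c)
    = (VINT t. F (tan t) * ennreal (1 + (tan t)^2) * indicator {0..<pi/2} t)"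
proof -
  define b where "b n = pi/2 - 1 / (real n + 1)" for n
  have b: "b n < pi/2" "0 < b (Suc n)" for n
  proof -
    show "b n < pi/2" by (simp add: b_def)
    have "1 / (real (Suc n) + 1) \<le> 1/2" by (simp add: field_simps)
    then show "0 < b (Suc n)" unfolding b_def using pi_gt3 by linarith
  qed
  define B where "B n = b (Suc n)" for n
  have "1 / (real (Suc (Suc n)) + 1) \<le> 1 / (real (Suc n) + 1)" for n
    by (rule divide_left_mono) auto
  then have B: "0 < B n" "B n < pi/2" "B n \<le> B (Suc n)" for n
    unfolding B_def using b(2)[of n] b(1)[of "Suc n"] by (simp_all add: b_def del: of_nat_Suc)
  have incB: "mono B" by (intro incseq_SucI B(3))
  have Blim: "B \<longlonglongrightarrow> pi/2"
  proof -
    have "(\<lambda>n. 1 / (real n + 1)) \<longlonglongrightarrow> 0" using LIMSEQ_inverse_real_of_nat by (simp add: field_simps)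
    then have "b \<longlonglongrightarrow> pi/2 - 0" unfolding b_def[abs_def] by (intro tendsto_intros)
    then show ?thesis unfolding B_def by (simp add: LIMSEQ_Suc)
  qed
  have [measurable]: "(tan :: real \<Rightarrow> real) \<in> borel_measurable borel"
    unfolding tan_def[abs_def] by measurable
  have tanmono: "tan x \<le> tan y" if "0 \<le> x" "x \<le> y" "y < pi/2" for x y
    using that tan_mono_le[of x y] pi_gt_zero by linarith
  have sub: "(VINT c. F c * indicator {0..tan (B n)} c)
    = (VINT t. F (tan t) * ennreal (1 + (tan t)^2) * indicator {0..B n} t)" for n
  proof -
    have cosnz: "cos x \<noteq> 0" if "x \<in> {0..B n}" for x
      using cos_gt_zero_pi[of x] that B[of n] by auto
    have "(VINT c. F c * indicator {tan 0..tan (B n)} c)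
       = (VINT t. F (tan t) * ennreal (1 + (tan t)^2) * indicator {0..B n} t)"
    proof (rule nn_integral_substitution_aux)
      show "(tan has_real_derivative 1 + (tan x)^2) (at x)" if "x \<in> {0..B n}" for x
        using DERIV_tan[OF cosnz[OF that]] tan_sec[OF cosnz[OF that]] by (simp add: power_inverse)
      show "continuous_on {0..B n} (\<lambda>x. 1 + (tan x)^2)"
        using cosnz by (intro continuous_intros) auto
    qed (use B in auto)
    then show ?thesis by simp
  qed
  have "(VINT c. F c * indicator {0..} c) = (VINT c. (SUP n. F c * indicator {0..tan (B n)} c))"
  proof (rule nn_integral_cong)
    fix c :: real
    show "F c * indicator {0..} c = (SUP n. F c * indicator {0..tan (B n)} c)"
    proof (cases "0 \<le> c")
      case True
      have "arctan c < pi/2" by (rule arctan_ubound)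
      then have "eventually (\<lambda>n. arctan c < B n) sequentially"
        by (rule order_tendstoD(1)[OF Blim])
      then obtain n where n: "arctan c < B n" by (auto simp: eventually_sequentially)
      have "c \<le> tan (B n)"
        using tanmono[of "arctan c" "B n"] n B(2)[of n] True by (simp add: tan_arctan)
      then have "F c \<le> (SUP n. F c * indicator {0..tan (B n)} c)"
        using True by (intro SUP_upper2[of n]) auto
      moreover have "(SUP n. F c * indicator {0..tan (B n)} c) \<le> F c"
        by (intro SUP_least) (auto simp: indicator_def)
      ultimately show ?thesis using True by simp
    qed simp
  qed
  also have "\<dots> = (SUP n. (VINT c. F c * indicator {0..tan (B n)} c))"
  proof (rule nn_integral_monotone_convergence_SUP)
    have "indicator {0..tan (B n)} c \<le> (indicator {0..tan (B (Suc n))} c :: ennreal)" for n c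
      using tanmono[of "B n" "B (Suc n)"] B(1)[of n] B(2)[of "Suc n"] B(3)[of n]
      by (auto simp: indicator_def)
    then show "incseq (\<lambda>n c. F c * indicator {0..tan (B n)} c)"
      by (intro incseq_SucI le_funI mult_left_mono) auto
    show "(\<lambda>c. F c * indicator {0..tan (B n)} c) \<in> borel_measurable lborel" for n by measurable
  qed
  also have "\<dots> = (SUP n. (VINT t. F (tan t) * ennreal (1 + (tan t)^2) * indicator {0..B n} t))"
    by (simp only: sub)
  also have "\<dots> = (VINT t. (SUP n. F (tan t) * ennreal (1 + (tan t)^2) * indicator {0..B n} t))"
  proof (rule nn_integral_monotone_convergence_SUP[symmetric])
    have "indicator {0..B n} t \<le> (indicator {0..B (Suc n)} t :: ennreal)" for n t
      using B(3)[of n] by (auto simp: indicator_def)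
    then show "incseq (\<lambda>n t. F (tan t) * ennreal (1 + (tan t)^2) * indicator {0..B n} t)"
      by (intro incseq_SucI le_funI mult_left_mono) auto
    show "(\<lambda>t. F (tan t) * ennreal (1 + (tan t)^2) * indicator {0..B n} t) \<in> borel_measurable lborel" for n by measurable
  qed
  also have "\<dots> = (VINT t. F (tan t) * ennreal (1 + (tan t)^2) * indicator {0..<pi/2} t)"
  proof (rule nn_integral_cong)
    fix t :: real
    let ?F = "F (tan t) * ennreal (1 + (tan t)^2)"
    show "(SUP n. ?F * indicator {0..B n} t) = ?F * indicator {0..<pi/2} t"
    proof (cases "0 \<le> t \<and> t < pi/2")
      case True
      then have "eventually (\<lambda>n. t < B n) sequentially" by (intro order_tendstoD(1)[OF Blim]) simp
      then obtain n where n: "t < B n" by (auto simp: eventually_sequentially)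
      have "?F \<le> (SUP n. ?F * indicator {0..B n} t)"
        using True n by (intro SUP_upper2[of n]) auto
      moreover have "(SUP n. ?F * indicator {0..B n} t) \<le> ?F"
        by (intro SUP_least) (auto simp: indicator_def)
      ultimately show ?thesis using True by simp
    next
      case False
      then have "indicator {0..B n} t = (0::ennreal)" for n using B(2)[of n] by (auto simp: indicator_def)
      moreover have "indicator {0..<pi/2} t = (0::ennreal)" using False by (auto simp: indicator_def)
      ultimately show ?thesis by simp
    qed
  qed
  finally show ?thesis .
qed

text \<open>Spherical coordinates obtained from Fubini: for a fixed point \<open>y\<close> of the
  orthogonal plane the axial coordinate is \<open>norm y * c\<close>, with \<open>c\<close> the
  cotangent of the polar angle, and the \<open>y\<close>-integral scales out. The constant is
  \<open>2 * pi\<close>, but it stays in the form of three times a disc integral since only its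
  positivity and finiteness matter.\<close>

lemma angle_mass_eq:
  obtains Y where "0 < Y" "Y < \<infinity>"
    "\<And>H. H \<in> borel_measurable borel \<Longrightarrow>
       angle_mass H = Y * (VINT t. H t * ennreal (sin t) * indicator {0..pi/2} t)"
proof
  define Y0 :: ennreal where "Y0 = (\<integral>\<^sup>+y. ennreal (norm y) * indicator (ball 0 1) y \<partial>(lborel :: (real \<times> real) measure))"
  have "Y0 \<le> (\<integral>\<^sup>+y. indicator (ball 0 1) y \<partial>(lborel :: (real \<times> real) measure))"
    unfolding Y0_def by (intro nn_integral_mono) (auto simp: indicator_def)
  also have "\<dots> < \<infinity>" using emeasure_lborel_ball_finite by simp
  finally have fin: "Y0 < \<infinity>" .
  have "Y0 \<noteq> 0"
  proof
    assume "Y0 = 0"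
    then have "AE y in (lborel :: (real \<times> real) measure). ennreal (norm y) * indicator (ball 0 1) y = 0"
      unfolding Y0_def by (subst (asm) nn_integral_0_iff_AE) auto
    moreover have "AE y in (lborel :: (real \<times> real) measure). y \<noteq> 0"
      by (rule AE_lborel_singleton)
    ultimately have "AE y in (lborel :: (real \<times> real) measure). y \<notin> ball 0 1"
      by eventually_elim (auto simp: indicator_def split: if_splits)
    then have "emeasure (lborel :: (real \<times> real) measure) (ball 0 1) = 0"
      by (subst (asm) AE_iff_measurable[where N="ball 0 1"]) auto
    then have "measure lborel (ball 0 1 :: (real \<times> real) set) = 0" by (simp add: measure_def)
    then show False using content_ball_pos[of 1 "0 :: real \<times> real"] by simp
  qed
  then show "0 < 3 * Y0" by (simp add: zero_less_iff_neq_zero)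
  show "3 * Y0 < \<infinity>" using fin by (simp add: ennreal_mult_less_top)
  fix H :: "real \<Rightarrow> ennreal" assume [measurable]: "H \<in> borel_measurable borel"
  \<comment> \<open>With \<open>c\<close> the cotangent of the polar angle, \<open>k c\<close> is
    its sine and \<open>c * k c\<close> its cosine.\<close>
  define k :: "real \<Rightarrow> real" where "k c = 1 / sqrt (c^2 + 1)" for c
  have k: "0 < k c" for c by (simp add: k_def add_nonneg_pos)
  have [measurable]: "k \<in> borel_measurable borel" unfolding k_def[abs_def] by measurable
  define G :: "real \<Rightarrow> ennreal" where "G c = indicator {0..} c * H (arccos (c * k c))" for c
  have [measurable]: "G \<in> borel_measurable borel" unfolding G_def[abs_def] by measurable
  have inner: "(VINT a. indicator {0..} (axis 1 1 \<bullet> sgn (vec3 (a, y))) * H (arccos (axis 1 1 \<bullet> sgn (vec3 (a, y))))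
        * indicator (ball 0 1) (vec3 (a, y)))
     = (VINT c. G c * (ennreal (norm y) * indicator (ball 0 1) ((1 / k c) *\<^sub>R y)))" if "y \<noteq> 0" for y
  proof -
    have ny: "0 < norm y" using that by simp
    have sq: "sqrt ((norm y * c)^2 + (norm y)^2) = norm y / k c" for c
    proof -
      have "(norm y * c)^2 + (norm y)^2 = (norm y)^2 * (c^2 + 1)" by (simp add: algebra_simps power_mult_distrib)
      then show ?thesis by (simp add: real_sqrt_mult k_def)
    qed
    have comp: "axis 1 1 \<bullet> sgn (vec3 (norm y * c, y)) = c * k c" for c
    proof -
      have "axis 1 1 \<bullet> sgn (vec3 (norm y * c, y)) = (norm y * c) / norm (vec3 (norm y * c, y))"
        by (cases y) (simp add: sgn_div_norm inner_axis' divide_inverse mult.commute)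
      also have "\<dots> = c * k c" using ny k[of c] by (simp add: norm_vec3 sq)
      finally show ?thesis .
    qed
    have i1: "(c * k c \<in> {0..}) = (c \<in> {0..})" for c
      using k[of c] by (simp add: zero_le_mult_iff not_le)
    have i2: "(vec3 (norm y * c, y) \<in> ball 0 1) = ((1 / k c) *\<^sub>R y \<in> ball 0 1)" for c
      using k[of c] by (simp add: norm_vec3 sq)
    have "(VINT a. indicator {0..} (axis 1 1 \<bullet> sgn (vec3 (a, y))) * H (arccos (axis 1 1 \<bullet> sgn (vec3 (a, y))))
        * indicator (ball 0 1) (vec3 (a, y)))
      = norm y * (VINT c. indicator {0..} (axis 1 1 \<bullet> sgn (vec3 (0 + norm y * c, y))) * H (arccos (axis 1 1 \<bullet> sgn (vec3 (0 + norm y * c, y))))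
        * indicator (ball 0 1) (vec3 (0 + norm y * c, y)))"
      using ny by (subst nn_integral_real_affine[where c="norm y" and t=0]) (auto, measurable)
    also have "\<dots> = norm y * (VINT c. G c * indicator (ball 0 1) ((1 / k c) *\<^sub>R y))"
      by (simp only: add_0_left comp G_def indicator_def i1 i2)
    finally show ?thesis
      by (simp add: nn_integral_cmult[symmetric] mult_ac)
  qed
  \<comment> \<open>Scaling of the plane: two factors \<open>k c\<close> come from the area and one
    from the norm.\<close>
  have Yc: "(\<integral>\<^sup>+y. ennreal (norm y) * indicator (ball 0 1) ((1 / k c) *\<^sub>R y) \<partial>(lborel :: (real\<times>real) measure)) = ennreal (k c ^ 3) * Y0" for c
  proof -
    have "(\<integral>\<^sup>+y. ennreal (norm y) * indicator (ball 0 1) ((1 / k c) *\<^sub>R y) \<partial>(lborel :: (real\<times>real) measure))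
      = ennreal (k c ^ 2) * (\<integral>\<^sup>+y. ennreal (norm (k c *\<^sub>R y)) * indicator (ball 0 1) ((1 / k c) *\<^sub>R (k c *\<^sub>R y)) \<partial>(lborel :: (real\<times>real) measure))"
      using k[of c] by (subst nn_integral_scaleR[where c="k c"]) (auto simp: power2_eq_square)
    also have "\<dots> = ennreal (k c ^ 2) * (\<integral>\<^sup>+y. ennreal (k c) * (ennreal (norm y) * indicator (ball 0 1) y) \<partial>(lborel :: (real\<times>real) measure))"
    proof (rule arg_cong2[where f="(*)", OF refl], rule nn_integral_cong)
      fix y :: "real \<times> real"
      show "ennreal (norm (k c *\<^sub>R y)) * indicator (ball 0 1) ((1 / k c) *\<^sub>R (k c *\<^sub>R y))
        = ennreal (k c) * (ennreal (norm y) * indicator (ball 0 1) y)"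
        using k[of c] by (simp add: ennreal_mult mult.assoc)
    qed
    also have "\<dots> = ennreal (k c ^ 3) * Y0"
      using k[of c] by (simp add: nn_integral_cmult Y0_def power3_eq_cube power2_eq_square ennreal_mult mult.assoc)
    finally show ?thesis .
  qed
  have "angle_mass H = 3 * (\<integral>\<^sup>+x. indicator {0..} (axis 1 1 \<bullet> sgn x) * H (arccos (axis 1 1 \<bullet> sgn x)) * indicator (ball 0 1) x \<partial>(lborel :: vec measure))"
    unfolding angle_mass_def
    by (rule nn_integral_sphere_measure[where F="\<lambda>n. indicator {0..} (axis 1 1 \<bullet> n) * H (arccos (axis 1 1 \<bullet> n))"]) measurable
  also have "(\<integral>\<^sup>+x. indicator {0..} (axis 1 1 \<bullet> sgn x) * H (arccos (axis 1 1 \<bullet> sgn x)) * indicator (ball 0 1) x \<partial>(lborel :: vec measure))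
     = (VINT y. VINT a. indicator {0..} (axis 1 1 \<bullet> sgn (vec3 (a, y))) * H (arccos (axis 1 1 \<bullet> sgn (vec3 (a, y))))
        * indicator (ball 0 1) (vec3 (a, y)))"
    by (rule nn_integral_vec3[where F="\<lambda>x. indicator {0..} (axis 1 1 \<bullet> sgn x) * H (arccos (axis 1 1 \<bullet> sgn x)) * indicator (ball 0 1) x"]) measurable
  also have "\<dots> = (\<integral>\<^sup>+y. (VINT c. G c * (ennreal (norm y) * indicator (ball 0 1) ((1 / k c) *\<^sub>R y))) \<partial>(lborel :: (real \<times> real) measure))"
    by (rule nn_integral_cong_AE, rule eventually_mono[OF AE_lborel_singleton[of "0 :: real \<times> real"]], erule inner)
  also have "\<dots> = (VINT c. \<integral>\<^sup>+y. G c * (ennreal (norm y) * indicator (ball 0 1) ((1 / k c) *\<^sub>R y)) \<partial>(lborel :: (real \<times> real) measure))"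
    by (rule lborel_pair.Fubini'[symmetric]) measurable
  also have "\<dots> = (VINT c. G c * (ennreal (k c ^ 3) * Y0))"
    by (intro nn_integral_cong) (simp add: nn_integral_cmult Yc)
  also have "\<dots> = Y0 * (VINT c. H (arccos (c * k c)) * ennreal (k c ^ 3) * indicator {0..} c)"
    by (subst nn_integral_cmult[symmetric]) (auto intro!: nn_integral_cong simp: G_def mult_ac)
  also have "(VINT c. H (arccos (c * k c)) * ennreal (k c ^ 3) * indicator {0..} c)
     = (VINT t. H (arccos (tan t * k (tan t))) * ennreal (k (tan t) ^ 3) * ennreal (1 + (tan t)^2) * indicator {0..<pi/2} t)"
    by (rule nn_integral_tan[where F="\<lambda>c. H (arccos (c * k c)) * ennreal (k c ^ 3)"]) measurable
  also have "\<dots> = (VINT t. H (pi/2 - t) * ennreal (sin (pi/2 - t)) * indicator {0..<pi/2} t)"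
  proof (intro nn_integral_cong)
    fix t
    show "H (arccos (tan t * k (tan t))) * ennreal (k (tan t) ^ 3) * ennreal (1 + (tan t)^2) * indicator {0..<pi/2} t
      = H (pi/2 - t) * ennreal (sin (pi/2 - t)) * indicator {0..<pi/2} t"
    proof (cases "t \<in> {0..<pi/2}")
      case True
      then have c: "0 < cos t" by (intro cos_gt_zero_pi) auto
      have "(tan t)^2 + 1 = 1 / (cos t)^2"
        using tan_sec[of t] c by (simp add: power_inverse add.commute inverse_eq_divide power_divide)
      then have kt: "k (tan t) = cos t" and s: "1 + (tan t)^2 = 1 / (cos t)^2"
        using c by (simp_all add: k_def real_sqrt_divide add.commute)
      have "tan t * k (tan t) = cos (pi/2 - t)" using c unfolding kt by (simp add: tan_def cos_diff)
      then have "arccos (tan t * k (tan t)) = pi/2 - t"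
        using True by (simp add: arccos_cos)
      moreover have "k (tan t) ^ 3 * (1 + (tan t)^2) = sin (pi/2 - t)"
        using c unfolding kt s by (simp add: sin_diff power3_eq_cube power2_eq_square)
      then have "ennreal (k (tan t) ^ 3) * ennreal (1 + (tan t)^2) = ennreal (sin (pi/2 - t))"
        using k by (subst ennreal_mult[symmetric]) (simp_all add: less_imp_le)
      ultimately show ?thesis by (simp only: mult.assoc[of "H _"])
    qed simp
  qed
  also have "\<dots> = (VINT t. H t * ennreal (sin t) * indicator {0<..pi/2} t)"
    by (subst nn_integral_real_affine[where c="-1" and t="pi/2"])
       (auto intro!: nn_integral_cong simp: indicator_def)
  also have "\<dots> = (VINT t. H t * ennreal (sin t) * indicator {0..pi/2} t)"
    by (intro nn_integral_cong) (auto simp: indicator_def)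
  finally show "angle_mass H = 3 * Y0 * (VINT t. H t * ennreal (sin t) * indicator {0..pi/2} t)"
    by (simp add: mult_ac)
qed

section \<open>Collisions and the gain term\<close>

lemma post_vel_simps:
  "post_vel mi mj v w n = v - (2 * mj / (mi + mj) * ((v - w) \<bullet> n)) *\<^sub>R n"
  "post_vel_star mi mj v w n = w + (2 * mi / (mi + mj) * ((v - w) \<bullet> n)) *\<^sub>R n"
  by (simp_all add: post_vel_def post_vel_star_def)

text \<open>The two mass ratios add up to 2. So for any masses the relative velocity is reflected in
  the plane orthogonal to \<open>n\<close>.\<close>

lemma post_vel_diff:
  assumes "0 < mi" "0 < mj"
  shows "post_vel mi mj v w n - post_vel_star mi mj v w n = (v - w) - (2 * ((v - w) \<bullet> n)) *\<^sub>R n"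
proof -
  have "2 * mj / (mi + mj) * ((v - w) \<bullet> n) + 2 * mi / (mi + mj) * ((v - w) \<bullet> n) = 2 * ((v - w) \<bullet> n)"
    using assms by (simp add: field_simps add_divide_distrib[symmetric])
  then show ?thesis
    by (simp add: post_vel_simps algebra_simps scaleR_add_left[symmetric] del: scaleR_add_left)
qed

lemma post_vel_diff_inner:
  assumes "0 < mi" "0 < mj" "norm n = 1"
  shows "(post_vel mi mj v w n - post_vel_star mi mj v w n) \<bullet> n = - ((v - w) \<bullet> n)"
  using assms by (simp add: post_vel_diff inner_diff_left[of "_ - _"] norm_eq_1)

lemma norm_post_vel_diff:
  assumes "0 < mi" "0 < mj" "norm n = 1"
  shows "norm (post_vel mi mj v w n - post_vel_star mi mj v w n) = norm (v - w)"
proof -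
  let ?g = "v - w"
  have "(?g - (2 * (?g \<bullet> n)) *\<^sub>R n) \<bullet> (?g - (2 * (?g \<bullet> n)) *\<^sub>R n) = ?g \<bullet> ?g"
    using assms by (simp add: inner_diff_left[of ?g] inner_diff_right[of _ ?g] inner_commute[of n ?g] norm_eq_1 power2_eq_square)
  then show ?thesis using assms by (simp add: post_vel_diff norm_eq_sqrt_inner)
qed

lemma post_vel_involution:
  assumes "0 < mi" "0 < mj" "norm n = 1"
  shows "post_vel mi mj (post_vel mi mj v w n) (post_vel_star mi mj v w n) n = v"
    "post_vel_star mi mj (post_vel mi mj v w n) (post_vel_star mi mj v w n) n = w"
  using post_vel_diff_inner[OF assms, of v w]
  by (simp_all add: post_vel_simps[of mi mj "post_vel _ _ _ _ _"]) (simp_all add: post_vel_simps)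

lemma post_vel_uminus:
  "post_vel mi mj v w (- n) = post_vel mi mj v w n"
  "post_vel_star mi mj v w (- n) = post_vel_star mi mj v w n"
  by (simp_all add: post_vel_simps)

lemma post_vel_swap:
  "post_vel_star mj mi w v n = post_vel mi mj v w n"
proof -
  have "(w - v) \<bullet> n = - ((v - w) \<bullet> n)" by (simp add: inner_diff_left)
  then show ?thesis by (simp add: post_vel_simps add.commute)
qed

lemma norm_diff_scaleR_sq:
  fixes x n :: "'a::real_inner"
  assumes "norm n = 1"
  shows "(norm (x - t *\<^sub>R n))^2 = (norm x)^2 - 2 * t * (x \<bullet> n) + t^2"
proof -
  have "(x - t *\<^sub>R n) \<bullet> (x - t *\<^sub>R n) = x \<bullet> x - 2 * t * (x \<bullet> n) + t * t * (n \<bullet> n)"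
    by (simp add: inner_diff_left inner_diff_right inner_commute[of n x] right_diff_distrib)
  moreover have "n \<bullet> n = 1" using assms by (simp add: norm_eq_1)
  ultimately show ?thesis by (simp only: power2_norm_eq_inner mult_1_right power2_eq_square[of t])
qed

text \<open>An arbitrary centre packs the conservation of energy and of momentum into one identity.
  The centre will be the velocity near which concentration has to be excluded.\<close>

lemma post_vel_energy:
  assumes "0 < mi" "0 < mj" "norm n = 1"
  shows "mi * (norm (post_vel mi mj v w n - c))^2 + mj * (norm (post_vel_star mi mj v w n - c))^2
    = mi * (norm (v - c))^2 + mj * (norm (w - c))^2"
proof -
  define s where "s = (v - w) \<bullet> n"
  have s: "s = (v - c) \<bullet> n - (w - c) \<bullet> n" by (simp add: s_def inner_diff_left)
  have 1: "(norm (post_vel mi mj v w n - c))^2 = (norm (v - c))^2 - 2 * (2 * mj / (mi + mj) * s) * ((v - c) \<bullet> n) + (2 * mj / (mi + mj) * s)^2"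
  proof -
    have "post_vel mi mj v w n - c = (v - c) - (2 * mj / (mi + mj) * s) *\<^sub>R n" by (simp add: post_vel_simps s_def)
    then show ?thesis by (simp only: norm_diff_scaleR_sq[OF assms(3)])
  qed
  have 2: "(norm (post_vel_star mi mj v w n - c))^2 = (norm (w - c))^2 + 2 * (2 * mi / (mi + mj) * s) * ((w - c) \<bullet> n) + (2 * mi / (mi + mj) * s)^2"
  proof -
    have "post_vel_star mi mj v w n - c = (w - c) - (- (2 * mi / (mi + mj) * s)) *\<^sub>R n" by (simp add: post_vel_simps s_def)
    then show ?thesis by (simp only: norm_diff_scaleR_sq[OF assms(3)]) simp
  qed
  define x y where "x = 2 * mj / (mi + mj) * s" and "y = 2 * mi / (mi + mj) * s"
  have nz: "mi + mj \<noteq> 0" using assms by simp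
  \<comment> \<open>The momentum lost by one particle is gained by the other.\<close>
  have q: "mi * x = mj * y" by (simp add: x_def y_def)
  have xy: "x + y = 2 * s"
    by (simp add: x_def y_def add_divide_distrib[symmetric] divide_eq_eq nz) (simp add: algebra_simps)
  have "mi * ((norm (v - c))^2 - 2 * x * ((v - c) \<bullet> n) + x^2) + mj * ((norm (w - c))^2 + 2 * y * ((w - c) \<bullet> n) + y^2)
    = mi * (norm (v - c))^2 + mj * (norm (w - c))^2 + (mi * x) * (x - 2 * ((v - c) \<bullet> n)) + (mj * y) * (y + 2 * ((w - c) \<bullet> n))"
    by (simp add: algebra_simps power2_eq_square)
  also have "\<dots> = mi * (norm (v - c))^2 + mj * (norm (w - c))^2 + (mi * x) * ((x + y) - 2 * s)"
    unfolding q s by (simp add: algebra_simps)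
  finally show ?thesis unfolding 1 2 x_def[symmetric] y_def[symmetric] xy by simp
qed

lemma norm_post_vel_le:
  assumes "0 < mi" "0 < mj" "norm n = 1"
  shows "norm (post_vel mi mj v w n - v) \<le> 2 * norm (v - w)"
    "norm (post_vel_star mi mj v w n - w) \<le> 2 * norm (v - w)"
proof -
  have i: "\<bar>(v - w) \<bullet> n\<bar> \<le> norm (v - w)" using Cauchy_Schwarz_ineq2[of "v - w" n] assms by simp
  have m: "\<bar>2 * mj / (mi + mj)\<bar> \<le> 2" "\<bar>2 * mi / (mi + mj)\<bar> \<le> 2" using assms by (simp_all add: field_simps)
  have "\<bar>2 * mj / (mi + mj)\<bar> * \<bar>(v - w) \<bullet> n\<bar> \<le> 2 * norm (v - w)"
    by (rule mult_mono[OF m(1) i]) auto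
  then show "norm (post_vel mi mj v w n - v) \<le> 2 * norm (v - w)"
    using assms by (simp add: post_vel_simps abs_mult)
  have "\<bar>2 * mi / (mi + mj)\<bar> * \<bar>(v - w) \<bullet> n\<bar> \<le> 2 * norm (v - w)"
    by (rule mult_mono[OF m(2) i]) auto
  then show "norm (post_vel_star mi mj v w n - w) \<le> 2 * norm (v - w)"
    using assms by (simp add: post_vel_simps abs_mult)
qed

lemma post_vel_measurable [measurable]:
  assumes [measurable]: "f \<in> borel_measurable M" "g \<in> borel_measurable M" "k \<in> borel_measurable M"
  shows "(\<lambda>x. post_vel mi mj (f x) (g x) (k x)) \<in> borel_measurable M"
    "(\<lambda>x. post_vel_star mi mj (f x) (g x) (k x)) \<in> borel_measurable M"
  unfolding post_vel_def post_vel_star_def by measurable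

lemma nn_integral_lborel_translate:
  fixes F :: "'a::euclidean_space \<Rightarrow> ennreal"
  assumes [measurable]: "F \<in> borel_measurable borel"
  shows "(VINT x. F (a + x)) = (VINT x. F x)"
  by (subst lborel_distr_plus[of a, symmetric], subst nn_integral_distr) auto

lemma orthogonal_transformation_reflect:
  fixes a :: "'a::euclidean_space"
  shows "orthogonal_transformation (\<lambda>x. x - (2 * (x \<bullet> a) / (a \<bullet> a)) *\<^sub>R a)"
  unfolding orthogonal_transformation_def
proof (intro conjI allI)
  show "linear (\<lambda>x. x - (2 * (x \<bullet> a) / (a \<bullet> a)) *\<^sub>R a)"
    by (rule linearI) (simp_all add: inner_add_left distrib_left add_divide_distrib scaleR_add_left scaleR_diff_right)
  fix x y :: 'a
  show "(x - (2 * (x \<bullet> a) / (a \<bullet> a)) *\<^sub>R a) \<bullet> (y - (2 * (y \<bullet> a) / (a \<bullet> a)) *\<^sub>R a) = x \<bullet> y"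
  proof (cases "a = 0")
    case False
    define s t where "s = 2 * (x \<bullet> a) / (a \<bullet> a)" and "t = 2 * (y \<bullet> a) / (a \<bullet> a)"
    have s: "s * (a \<bullet> a) = 2 * (x \<bullet> a)" and t: "t * (a \<bullet> a) = 2 * (y \<bullet> a)"
      using False by (simp_all add: s_def t_def)
    have "(x - s *\<^sub>R a) \<bullet> (y - t *\<^sub>R a) = x \<bullet> y - t * (x \<bullet> a) - s * (y \<bullet> a) + s * (t * (a \<bullet> a))"
      by (simp add: inner_diff_left inner_diff_right inner_commute[of a y] right_diff_distrib)
    also have "\<dots> = x \<bullet> y + s * (y \<bullet> a) - t * (x \<bullet> a)" unfolding t by (simp add: algebra_simps)
    also have "s * (y \<bullet> a) = t * (x \<bullet> a)" by (simp add: s_def t_def)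
    finally show ?thesis unfolding s_def t_def by simp
  qed simp
qed

text \<open>In terms of the centre of mass \<open>G\<close> and the relative velocity
  \<open>g\<close>, a collision fixes \<open>G\<close> and reflects \<open>g\<close>. The passage to
  these coordinates is a composition of translations under the integral, since the weights
  \<open>a\<close> and \<open>b\<close> add up to 1.\<close>

lemma nn_integral_collision:
  fixes F :: "vec \<Rightarrow> vec \<Rightarrow> ennreal"
  assumes m: "0 < mi" "0 < mj" and n: "norm n = 1"
    and [measurable]: "(\<lambda>(v, w). F v w) \<in> borel_measurable (borel \<Otimes>\<^sub>M borel)"
  shows "(VINT v. VINT w. F (post_vel mi mj v w n) (post_vel_star mi mj v w n))
    = (VINT v. VINT w. F v w)"
proof -
  define a b where "a = mi / (mi + mj)" and "b = mj / (mi + mj)"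
  have ab: "a + b = 1" using m by (simp add: a_def b_def add_divide_distrib[symmetric])
  define R where "R g = g - (2 * (g \<bullet> n)) *\<^sub>R n" for g :: vec
  have R: "orthogonal_transformation R"
    using orthogonal_transformation_reflect[of n] n by (simp add: R_def[abs_def] norm_eq_1)
  have [measurable]: "R \<in> borel_measurable borel"
    by (rule orthogonal_transformation_borel_measurable[OF R])
  let ?K = "\<lambda>g G. F (G + b *\<^sub>R g) (G - a *\<^sub>R g)"
  have shear: "(VINT v. VINT w. F' v w) = (VINT g. VINT G. F' (G + b *\<^sub>R g) (G - a *\<^sub>R g))"
    if [measurable]: "(\<lambda>(v, w). F' v w) \<in> borel_measurable (borel \<Otimes>\<^sub>M borel)" for F' :: "vec \<Rightarrow> vec \<Rightarrow> ennreal"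
  proof -
    have "(VINT v. VINT w. F' v w) = (VINT w. VINT v. F' v w)"
      by (rule lborel_pair.Fubini') measurable
    also have "\<dots> = (VINT w. VINT g. F' (w + g) w)"
    proof (rule nn_integral_cong)
      fix w
      show "(VINT v. F' v w) = (VINT g. F' (w + g) w)"
        by (rule nn_integral_lborel_translate[symmetric, of "\<lambda>v. F' v w" w]) measurable
    qed
    also have "\<dots> = (VINT g. VINT w. F' (w + g) w)"
      by (rule lborel_pair.Fubini') measurable
    also have "\<dots> = (VINT g. VINT G. F' ((- a *\<^sub>R g + G) + g) (- a *\<^sub>R g + G))"
    proof (rule nn_integral_cong)
      fix g
      have [measurable]: "(\<lambda>w. F' (w + g) w) \<in> borel_measurable borel" by measurable
      show "(VINT w. F' (w + g) w) = (VINT G. F' ((- a *\<^sub>R g + G) + g) (- a *\<^sub>R g + G))"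
        using nn_integral_lborel_translate[of "\<lambda>w. F' (w + g) w" "- a *\<^sub>R g"] by simp
    qed
    also have "\<dots> = (VINT g. VINT G. F' (G + b *\<^sub>R g) (G - a *\<^sub>R g))"
    proof -
      have eq: "(- a *\<^sub>R g + G) + g = G + b *\<^sub>R g" "- a *\<^sub>R g + G = G - a *\<^sub>R g" for g G :: vec
      proof -
        have "b *\<^sub>R g = g - a *\<^sub>R g" using ab by (metis add_diff_cancel_left' scaleR_left_diff_distrib scaleR_one)
        then show "(- a *\<^sub>R g + G) + g = G + b *\<^sub>R g" "- a *\<^sub>R g + G = G - a *\<^sub>R g" by simp_all
      qed
      show ?thesis unfolding eq(1) unfolding eq(2) ..
    qed
    finally show ?thesis .
  qed
  have pv: "post_vel mi mj (G + b *\<^sub>R g) (G - a *\<^sub>R g) n = G + b *\<^sub>R R g"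
     "post_vel_star mi mj (G + b *\<^sub>R g) (G - a *\<^sub>R g) n = G - a *\<^sub>R R g" for g G
  proof -
    have "(G + b *\<^sub>R g) - (G - a *\<^sub>R g) = (a + b) *\<^sub>R g" by (simp add: scaleR_add_left)
    then have d: "(G + b *\<^sub>R g) - (G - a *\<^sub>R g) = g" by (simp only: ab scaleR_one)
    show "post_vel mi mj (G + b *\<^sub>R g) (G - a *\<^sub>R g) n = G + b *\<^sub>R R g"
      "post_vel_star mi mj (G + b *\<^sub>R g) (G - a *\<^sub>R g) n = G - a *\<^sub>R R g"
      unfolding post_vel_simps d R_def by (simp_all add: scaleR_diff_right a_def b_def)
  qed
  have "(VINT v. VINT w. F (post_vel mi mj v w n) (post_vel_star mi mj v w n))
    = (VINT g. VINT G. F (G + b *\<^sub>R R g) (G - a *\<^sub>R R g))"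
    by (subst shear[of "\<lambda>v w. F (post_vel mi mj v w n) (post_vel_star mi mj v w n)"]) (measurable, simp only: pv)
  also have "\<dots> = (\<integral>\<^sup>+g. (VINT G. F (G + b *\<^sub>R g) (G - a *\<^sub>R g)) \<partial>distr lborel borel R)"
    by (subst nn_integral_distr) simp_all
  also have "\<dots> = (VINT v. VINT w. F v w)"
    unfolding distr_lborel_orthogonal[OF R] by (rule shear[of F, symmetric]) measurable
  finally show ?thesis .
qed

text \<open>The restriction to the half sphere is folded into the kernel, so that sphere integrals
  run over the whole sphere and isometries can act on them.\<close>

definition ckern :: "real \<Rightarrow> (real \<Rightarrow> real) \<Rightarrow> vec \<Rightarrow> vec \<Rightarrow> vec \<Rightarrow> real" where
  "ckern \<gamma> H v w n = indicator {0..} ((v - w) \<bullet> n) * coll_kernel \<gamma> H v w n"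

lemma coll_angle_measurable [measurable]:
  assumes [measurable]: "f \<in> borel_measurable M" "g \<in> borel_measurable M" "k \<in> borel_measurable M"
  shows "(\<lambda>x. coll_angle (f x) (g x) (k x)) \<in> borel_measurable M"
  unfolding coll_angle_def by measurable

lemma ckern_measurable [measurable]:
  assumes [measurable]: "H \<in> borel_measurable borel" "f \<in> borel_measurable M" "g \<in> borel_measurable M" "k \<in> borel_measurable M"
  shows "(\<lambda>x. ckern \<gamma> H (f x) (g x) (k x)) \<in> borel_measurable M"
  unfolding ckern_def coll_kernel_def by measurable

lemma ckern_nonneg: "(\<And>x. 0 \<le> H x) \<Longrightarrow> 0 \<le> ckern \<gamma> H v w n"
  by (simp add: ckern_def coll_kernel_def)

lemma nn_integral_ckern:
  assumes H: "\<And>x. 0 \<le> H x" and [measurable]: "H \<in> borel_measurable borel"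
  shows "(SINT n. ckern \<gamma> H v w n) = ennreal (norm (v - w) powr \<gamma>) * angle_mass H"
proof (cases "v = w")
  case True
  then show ?thesis by (simp add: ckern_def coll_kernel_def)
next
  case False
  define e where "e = (v - w) /\<^sub>R norm (v - w)"
  have e: "norm e = 1" using False by (simp add: e_def)
  have pos: "0 < inverse (norm (v - w))" using False by simp
  have sg: "(e \<bullet> n \<in> {0..}) = ((v - w) \<bullet> n \<in> {0..})" for n
    unfolding e_def inner_scaleR_left atLeast_iff using pos by (simp only: zero_le_mult_iff) auto
  have "ennreal (ckern \<gamma> H v w n) = ennreal (norm (v - w) powr \<gamma>) * (indicator {0..} (e \<bullet> n) * ennreal (H (arccos (e \<bullet> n))))" for n
  proof (cases "(v - w) \<bullet> n \<in> {0..}")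
    case True
    then have "e \<bullet> n \<in> {0..}" using sg by blast
    then have "indicator {0..} (e \<bullet> n) = (1 :: ennreal)" "ckern \<gamma> H v w n = H (arccos (e \<bullet> n)) * norm (v - w) powr \<gamma>"
      using True by (simp_all only: ckern_def coll_kernel_def coll_angle_def e_def[symmetric] indicator_simps mult_1)
    then show ?thesis using H by (simp add: ennreal_mult mult.commute)
  next
    case False
    then have "e \<bullet> n \<notin> {0..}" using sg by blast
    then have "indicator {0..} (e \<bullet> n) = (0 :: ennreal)" "ckern \<gamma> H v w n = 0"
      using False by (simp_all only: ckern_def indicator_simps mult_zero_left not_False_eq_True)
    then show ?thesis by simp
  qed
  then show ?thesis
    by (simp add: nn_integral_cmult nn_integral_angle[OF e, of "\<lambda>x. ennreal (H x)"])
qed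

text \<open>A collision reverses the sign of the relative velocity along \<open>n\<close>. The
  inverse collision therefore belongs to \<open>- n\<close>, with the same angle and the same
  relative speed.\<close>

lemma ckern_collision:
  assumes "0 < mi" "0 < mj" "norm n = 1"
  shows "ckern \<gamma> H (post_vel mi mj v w n) (post_vel_star mi mj v w n) (- n) = ckern \<gamma> H v w n"
proof -
  have i: "(post_vel mi mj v w n - post_vel_star mi mj v w n) \<bullet> (- n) = (v - w) \<bullet> n"
    using post_vel_diff_inner[OF assms, of v w] by simp
  have a: "coll_angle (post_vel mi mj v w n) (post_vel_star mi mj v w n) (- n) = coll_angle v w n"
    unfolding coll_angle_def norm_post_vel_diff[OF assms] inner_scaleR_left i ..
  show ?thesis
    by (simp only: ckern_def coll_kernel_def i a norm_post_vel_diff[OF assms])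
qed

lemma ckern_swap: "ckern \<gamma> H w v (- n) = ckern \<gamma> H v w n"
proof -
  have "w - v = - (v - w)" by simp
  then show ?thesis
    by (simp only: ckern_def coll_kernel_def coll_angle_def inner_minus_left inner_minus_right minus_minus
      norm_minus_cancel scaleR_minus_right)
qed

text \<open>With values in the extended nonnegative reals the gain is monotone in its two densities
  before anything is known about its finiteness.\<close>

definition gain :: "real \<Rightarrow> (real \<Rightarrow> real) \<Rightarrow> real \<Rightarrow> real \<Rightarrow> (vec \<Rightarrow> ennreal) \<Rightarrow> (vec \<Rightarrow> ennreal) \<Rightarrow> vec \<Rightarrow> ennreal" where
  "gain \<gamma> H mj mi fj fi v = (VINT w. SINT n. ennreal (ckern \<gamma> H v w n) *
     (fj (post_vel_star mi mj v w n) * fi (post_vel mi mj v w n)))"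

lemma sphere_pair: "pair_sigma_finite lborel sphere_measure"
  by (simp add: pair_sigma_finite_def lborel.sigma_finite_measure_axioms sphere.sigma_finite_measure_axioms)

interpretation lborel_sphere: pair_sigma_finite "lborel :: vec measure" sphere_measure
  by (rule sphere_pair)

lemma gain_measurable [measurable]:
  assumes [measurable]: "H \<in> borel_measurable borel" "(\<lambda>(x, y). fj x y) \<in> borel_measurable (M \<Otimes>\<^sub>M borel)"
     "(\<lambda>(x, y). fi x y) \<in> borel_measurable (M \<Otimes>\<^sub>M borel)" "k \<in> borel_measurable M"
  shows "(\<lambda>x. gain \<gamma> H mj mi (fj x) (fi x) (k x)) \<in> borel_measurable M"
  unfolding gain_def by measurable

lemma nn_integral_sphere_uminus:
  assumes [measurable]: "F \<in> borel_measurable borel"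
  shows "(SINT n. F (- n)) = (SINT n. F n)"
  by (rule nn_integral_sphere_orthogonal) (auto simp: orthogonal_transformation_neg)

text \<open>This turns joint measurability of a curried function into a rule that applies to
  arbitrary measurable arguments.\<close>

lemma measurable_case_prod3:
  assumes h: "(\<lambda>(x, y, z). F x y z) \<in> measurable (A \<Otimes>\<^sub>M B \<Otimes>\<^sub>M C) D"
    and [measurable]: "f \<in> measurable M A" "g \<in> measurable M B" "k \<in> measurable M C"
  shows "(\<lambda>x. F (f x) (g x) (k x)) \<in> measurable M D"
  using measurable_compose[OF _ h, of "\<lambda>x. (f x, g x, k x)" M] by simp

lemma measurable_case_prod4:
  assumes h: "(\<lambda>(x, y, z, u). F x y z u) \<in> measurable (A \<Otimes>\<^sub>M B \<Otimes>\<^sub>M C \<Otimes>\<^sub>M E) D"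
    and [measurable]: "f \<in> measurable M A" "g \<in> measurable M B" "k \<in> measurable M C" "l \<in> measurable M E"
  shows "(\<lambda>x. F (f x) (g x) (k x) (l x)) \<in> measurable M D"
  using measurable_compose[OF _ h, of "\<lambda>x. (f x, g x, k x, l x)" M] by simp

text \<open>The collision map is a measure preserving involution of the pair of velocities; it turns the
  integral of the gain term against \<open>G\<close> into an average of \<open>G\<close> over post-collisional velocities.\<close>

lemma triple_integral_collision:
  fixes X :: "vec \<Rightarrow> vec \<Rightarrow> vec \<Rightarrow> vec \<Rightarrow> ennreal"
  assumes m: "0 < mi" "0 < mj" and H: "\<And>x. 0 \<le> H x" and [measurable]: "H \<in> borel_measurable borel"
    and X: "(\<lambda>(v, w, v', w'). X v w v' w') \<in> borel_measurable (borel \<Otimes>\<^sub>M borel \<Otimes>\<^sub>M borel \<Otimes>\<^sub>M borel)"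
  shows "(VINT v. VINT w. SINT n. ennreal (ckern \<gamma> H v w n) * X v w (post_vel mi mj v w n) (post_vel_star mi mj v w n))
    = (VINT v. VINT w. SINT n. ennreal (ckern \<gamma> H v w n) * X (post_vel mi mj v w n) (post_vel_star mi mj v w n) v w)"
proof -
  note [measurable] = measurable_case_prod4[OF X]
  let ?P = "post_vel mi mj" and ?S = "post_vel_star mi mj"
  have rot: "(VINT v. VINT w. SINT n. Z v w n) = (SINT n. VINT v. VINT w. Z v w n)"
    if Z: "(\<lambda>(v, w, n). Z v w n) \<in> borel_measurable (borel \<Otimes>\<^sub>M borel \<Otimes>\<^sub>M borel)" for Z :: "vec \<Rightarrow> vec \<Rightarrow> vec \<Rightarrow> ennreal"
  proof -
    note [measurable] = measurable_case_prod3[OF Z]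
    have "(VINT v. VINT w. SINT n. Z v w n) = (VINT v. SINT n. VINT w. Z v w n)"
      by (intro nn_integral_cong lborel_sphere.Fubini'[symmetric]) measurable
    also have "\<dots> = (SINT n. VINT v. VINT w. Z v w n)"
      by (rule lborel_sphere.Fubini'[symmetric]) measurable
    finally show ?thesis .
  qed
  have "(VINT v. VINT w. SINT n. ennreal (ckern \<gamma> H v w n) * X v w (?P v w n) (?S v w n))
    = (SINT n. VINT v. VINT w. ennreal (ckern \<gamma> H v w n) * X v w (?P v w n) (?S v w n))"
    by (rule rot) measurable
  also have "\<dots> = (SINT n. VINT v. VINT w. ennreal (ckern \<gamma> H v w (- n)) * X (?P v w n) (?S v w n) v w)"
  proof (rule nn_integral_cong_AE, use AE_sphere_measure_norm in eventually_elim)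
    fix n :: vec assume n: "norm n = 1"
    let ?F = "\<lambda>v w. ennreal (ckern \<gamma> H v w (- n)) * X (?P v w n) (?S v w n) v w"
    have "(VINT v. VINT w. ennreal (ckern \<gamma> H v w n) * X v w (?P v w n) (?S v w n))
      = (VINT v. VINT w. ?F (?P v w n) (?S v w n))"
      by (simp add: ckern_collision[OF m n] post_vel_involution[OF m n])
    also have "\<dots> = (VINT v. VINT w. ?F v w)"
      by (rule nn_integral_collision[OF m n]) measurable
    finally show "(VINT v. VINT w. ennreal (ckern \<gamma> H v w n) * X v w (?P v w n) (?S v w n))
      = (VINT v. VINT w. ?F v w)" .
  qed
  also have "\<dots> = (VINT v. VINT w. SINT n. ennreal (ckern \<gamma> H v w (- n)) * X (?P v w (- n)) (?S v w (- n)) v w)"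
    unfolding post_vel_uminus by (rule rot[symmetric]) measurable
  also have "\<dots> = (VINT v. VINT w. SINT n. ennreal (ckern \<gamma> H v w n) * X (?P v w n) (?S v w n) v w)"
    by (intro nn_integral_cong nn_integral_sphere_uminus[where F="\<lambda>n. ennreal (ckern _ _ _ _ n) * X (?P _ _ n) (?S _ _ n) _ _"]) measurable
  finally show ?thesis .
qed

lemma nn_integral_gain:
  assumes m: "0 < mi" "0 < mj" and H: "\<And>x. 0 \<le> H x" and [measurable]: "H \<in> borel_measurable borel"
    and [measurable]: "fi \<in> borel_measurable borel" "fj \<in> borel_measurable borel" "G \<in> borel_measurable borel"
  shows "(VINT v. G v * gain \<gamma> H mj mi fj fi v)
    = (VINT v. VINT w. SINT n. ennreal (ckern \<gamma> H v w n) * (fi v * fj w * G (post_vel mi mj v w n)))"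
proof -
  have "(VINT v. G v * gain \<gamma> H mj mi fj fi v)
    = (VINT v. VINT w. SINT n. ennreal (ckern \<gamma> H v w n) * (\<lambda>v w v' w'. fi v' * fj w' * G v) v w (post_vel mi mj v w n) (post_vel_star mi mj v w n))"
    unfolding gain_def by (simp add: nn_integral_cmult[symmetric] mult_ac)
  also have "\<dots> = (VINT v. VINT w. SINT n. ennreal (ckern \<gamma> H v w n) * (\<lambda>v w v' w'. fi v' * fj w' * G v) (post_vel mi mj v w n) (post_vel_star mi mj v w n) v w)"
    by (rule triple_integral_collision[OF m H]) measurable
  finally show ?thesis by simp
qed

text \<open>Exchanging the names of the two particles reverses the relative velocity, which
  replacing \<open>n\<close> by \<open>- n\<close> undoes.\<close>

lemma triple_integral_swap:
  fixes X :: "vec \<Rightarrow> vec \<Rightarrow> vec \<Rightarrow> vec \<Rightarrow> ennreal"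
  assumes [measurable]: "H \<in> borel_measurable borel"
    and X: "(\<lambda>(v, w, v', w'). X v w v' w') \<in> borel_measurable (borel \<Otimes>\<^sub>M borel \<Otimes>\<^sub>M borel \<Otimes>\<^sub>M borel)"
  shows "(VINT v. VINT w. SINT n. ennreal (ckern \<gamma> H v w n) * X v w (post_vel mi mj v w n) (post_vel_star mi mj v w n))
    = (VINT v. VINT w. SINT n. ennreal (ckern \<gamma> H v w n) * X w v (post_vel_star mj mi v w n) (post_vel mj mi v w n))"
proof -
  note [measurable] = measurable_case_prod4[OF X]
  have "(VINT v. VINT w. SINT n. ennreal (ckern \<gamma> H v w n) * X v w (post_vel mi mj v w n) (post_vel_star mi mj v w n))
    = (VINT w. VINT v. SINT n. ennreal (ckern \<gamma> H v w n) * X v w (post_vel mi mj v w n) (post_vel_star mi mj v w n))"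
    by (rule lborel_pair.Fubini') measurable
  also have "\<dots> = (VINT w. VINT v. SINT n. ennreal (ckern \<gamma> H v w (- n)) * X v w (post_vel mi mj v w (- n)) (post_vel_star mi mj v w (- n)))"
    by (intro nn_integral_cong nn_integral_sphere_uminus[symmetric, where F="\<lambda>n. ennreal (ckern _ _ _ _ n) * X _ _ (post_vel mi mj _ _ n) (post_vel_star mi mj _ _ n)"]) measurable
  also have "\<dots> = (VINT v. VINT w. SINT n. ennreal (ckern \<gamma> H v w n) * X w v (post_vel_star mj mi v w n) (post_vel mj mi v w n))"
    by (simp add: ckern_swap post_vel_uminus post_vel_swap)
  finally show ?thesis .
qed

text \<open>Lower bounds for mild solutions hold for almost every velocity only, but the gain
  evaluates them at post-collisional velocities. The collision map preserves null sets of pairs. The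
  densities are quantified inside the \<open>AE\<close>, so that one exceptional set serves all
  times simultaneously.\<close>

lemma gain_mono_AE:
  assumes m: "0 < mi" "0 < mj" and [measurable]: "H \<in> borel_measurable borel"
    and i: "AE v in lborel. Qi v" and j: "AE v in lborel. Qj v"
  shows "AE v in lborel. \<forall>fi fj gi gj. (\<forall>v. Qi v \<longrightarrow> fi v \<le> gi v) \<longrightarrow> (\<forall>v. Qj v \<longrightarrow> fj v \<le> gj v) \<longrightarrow>
     gain \<gamma> H mj mi fj fi v \<le> gain \<gamma> H mj mi gj gi v"
proof -
  obtain Ni where Ni: "{v. \<not> Qi v} \<subseteq> Ni" "emeasure lborel Ni = 0" "Ni \<in> sets borel"
    using i by (auto elim!: AE_E simp: subset_eq)
  obtain Nj where Nj: "{v. \<not> Qj v} \<subseteq> Nj" "emeasure lborel Nj = 0" "Nj \<in> sets borel"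
    using j by (auto elim!: AE_E simp: subset_eq)
  note [measurable] = Ni(3) Nj(3)
  let ?B = "\<lambda>v w n. indicator Ni (post_vel mi mj v w n) + indicator Nj (post_vel_star mi mj v w n) :: ennreal"
  have "(VINT v. VINT w. SINT n. ?B v w n)
     = (VINT v. SINT n. VINT w. ?B v w n)"
    by (intro nn_integral_cong lborel_sphere.Fubini'[symmetric]) measurable
  also have "\<dots> = (SINT n. VINT v. VINT w. ?B v w n)"
    by (rule lborel_sphere.Fubini'[symmetric]) measurable
  also have "\<dots> = (SINT n. VINT v. VINT w. indicator Ni v + indicator Nj w)"
    by (rule nn_integral_cong_AE, use AE_sphere_measure_norm in eventually_elim)
       (rule nn_integral_collision[OF m, where F="\<lambda>v w. indicator Ni v + indicator Nj w"], simp_all)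
  also have "(VINT v. VINT w. indicator Ni v + indicator Nj w) = (VINT v. (VINT w. indicator Ni v))"
    by (simp add: nn_integral_add Nj)
  also have "(\<integral>\<^sup>+v. (\<integral>\<^sup>+w. indicator Ni v \<partial>(lborel::vec measure)) \<partial>(lborel::vec measure)) = 0"
    by (subst lborel_pair.Fubini') (simp_all add: Ni)
  finally have "(VINT v. VINT w. SINT n. ?B v w n) = 0" by simp
  then have "AE v in lborel. (VINT w. SINT n. ?B v w n) = 0"
    by (subst (asm) nn_integral_0_iff_AE) measurable
  then show ?thesis
  proof eventually_elim
    fix v assume "(VINT w. SINT n. ?B v w n) = 0"
    then have "AE w in lborel. (SINT n. ?B v w n) = 0"
      by (subst (asm) nn_integral_0_iff_AE) measurable
    then have AEw: "AE w in lborel. AE n in sphere_measure. ?B v w n = 0"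
      by eventually_elim (subst (asm) nn_integral_0_iff_AE, measurable)
    show "\<forall>fi fj gi gj. (\<forall>v. Qi v \<longrightarrow> fi v \<le> gi v) \<longrightarrow> (\<forall>v. Qj v \<longrightarrow> fj v \<le> gj v) \<longrightarrow>
     gain \<gamma> H mj mi fj fi v \<le> gain \<gamma> H mj mi gj gi v"
    proof (intro allI impI)
      fix fi fj gi gj :: "vec \<Rightarrow> ennreal"
      assume le: "\<forall>v. Qi v \<longrightarrow> fi v \<le> gi v" "\<forall>v. Qj v \<longrightarrow> fj v \<le> gj v"
      show "gain \<gamma> H mj mi fj fi v \<le> gain \<gamma> H mj mi gj gi v"
        unfolding gain_def
      proof (rule nn_integral_mono_AE, use AEw in eventually_elim)
        fix w assume "AE n in sphere_measure. ?B v w n = 0"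
        then show "(SINT n. ennreal (ckern \<gamma> H v w n) * (fj (post_vel_star mi mj v w n) * fi (post_vel mi mj v w n)))
          \<le> (SINT n. ennreal (ckern \<gamma> H v w n) * (gj (post_vel_star mi mj v w n) * gi (post_vel mi mj v w n)))"
          by (intro nn_integral_mono_AE, eventually_elim)
             (intro mult_left_mono mult_mono, use le Ni Nj in \<open>auto simp: indicator_def split: if_splits\<close>)
      qed
    qed
  qed
qed

section \<open>Mild solutions\<close>

text \<open>\<open>F\<close> is only a primitive of an integrable function. The product rule comes
  from Fubini for \<open>w'\<close> times \<open>q\<close> on the triangle below the
  diagonal.\<close>

lemma integration_by_parts_primitive:
  fixes q F w w' :: "real \<Rightarrow> real"
  assumes T: "0 \<le> T" and q: "set_integrable lborel {0..T} q"
    and F: "\<And>t. 0 \<le> t \<Longrightarrow> t \<le> T \<Longrightarrow> F t = F 0 + (LINT s:{0..t}|lborel. q s)"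
    and w: "\<And>t. (w has_real_derivative w' t) (at t)" and w': "\<And>t. isCont w' t"
  shows "integrable lborel (\<lambda>t. indicator {0..T} t * (w t * q t + w' t * F t))"
    and "(\<integral>t. indicator {0..T} t * (w t * q t + w' t * F t) \<partial>lborel) = w T * F T - w 0 * F 0"
proof -
  define A B where "A t = indicator {0..T} t * w' t" and "B t = indicator {0..T} t * q t" for t :: real
  have cw': "continuous_on S w'" for S
    using w' by (simp add: continuous_at_imp_continuous_on)
  have cw: "continuous_on S w" for S
    by (intro continuous_at_imp_continuous_on ballI DERIV_isCont[OF w])
  have intA: "integrable lborel A"
    using borel_integrable_atLeastAtMost'[OF cw'[of "{0..T}"]] by (simp add: A_def[abs_def] set_integrable_def)
  have intB: "integrable lborel B"
    using q by (simp add: B_def[abs_def] set_integrable_def)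
  note [measurable] = borel_measurable_integrable[OF intA] borel_measurable_integrable[OF intB]
  \<comment> \<open>The integrand on the triangle \<open>s \<le> t\<close>: integrating out
    \<open>s\<close> recovers the increment of \<open>F\<close>, integrating out \<open>t\<close>
    that of \<open>w\<close>.\<close>
  define J where "J p = (if snd p \<le> fst p then A (fst p) * B (snd p) else 0)" for p
  have [measurable]: "J \<in> borel_measurable (lborel \<Otimes>\<^sub>M lborel)" unfolding J_def[abs_def] by measurable
  have "integrable (lborel \<Otimes>\<^sub>M lborel) (\<lambda>p. A (fst p) * B (snd p))"
  proof (rule lborel_pair.Fubini_integrable)
    have "integrable lborel (\<lambda>x. \<bar>A x\<bar> * (\<integral>y. \<bar>B y\<bar> \<partial>lborel))" using intA by simp
    then show "integrable lborel (\<lambda>x. \<integral>y. norm (A (fst (x, y)) * B (snd (x, y))) \<partial>lborel)"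
      by (simp add: abs_mult)
    show "AE x in lborel. integrable lborel (\<lambda>y. A (fst (x, y)) * B (snd (x, y)))"
      using intB by simp
  qed measurable
  then have intJ: "integrable (lborel \<Otimes>\<^sub>M lborel) J"
    by (rule Bochner_Integration.integrable_bound) (auto simp: J_def)
  have J1: "(\<integral>s. J (t, s) \<partial>lborel) = A t * (F t - F 0)" for t
  proof (cases "t \<in> {0..T}")
    case True
    have "(\<integral>s. J (t, s) \<partial>lborel) = A t * (LINT s:{0..t}|lborel. q s)"
      unfolding set_lebesgue_integral_def integral_mult_right_zero[symmetric]
      using True by (intro Bochner_Integration.integral_cong) (auto simp: J_def B_def indicator_def)
    then show ?thesis using F[of t] True by simp
  next
    case False
    then have At: "A t = 0" by (simp add: A_def)
    then have "J (t, s) = 0" for s by (simp add: J_def)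
    then show ?thesis using At by simp
  qed
  have J2: "(\<integral>t. J (t, s) \<partial>lborel) = B s * (w T - w s)" for s
  proof (cases "s \<in> {0..T}")
    case True
    have "(\<integral>t. J (t, s) \<partial>lborel) = B s * (\<integral>t. w' t * indicator {s..T} t \<partial>lborel)"
      unfolding integral_mult_right_zero[symmetric]
      using True by (intro Bochner_Integration.integral_cong) (auto simp: J_def A_def indicator_def)
    also have "(\<integral>t. w' t * indicator {s..T} t \<partial>lborel) = w T - w s"
      using True w w' by (intro integral_FTC_Icc_real) auto
    finally show ?thesis .
  next
    case False
    then have Bs: "B s = 0" by (simp add: B_def)
    then have "J (t, s) = 0" for t by (simp add: J_def)
    then show ?thesis using Bs by simp
  qed
  have eq: "(\<integral>t. A t * (F t - F 0) \<partial>lborel) = (\<integral>s. B s * (w T - w s) \<partial>lborel)"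
    unfolding J1[symmetric] J2[symmetric]
    using lborel_pair.Fubini_integral[of "\<lambda>t s. J (t, s)"] intJ by simp
  have intAF: "integrable lborel (\<lambda>t. A t * (F t - F 0))"
    using lborel_pair.integrable_fst'[OF intJ] by (simp add: J1)
  obtain K where K: "\<And>t. t \<in> {0..T} \<Longrightarrow> norm (w t) \<le> K"
    using compact_imp_bounded[OF compact_continuous_image[OF cw compact_Icc, of 0 T]] unfolding bounded_iff by (metis image_eqI)
  have [measurable]: "w \<in> borel_measurable borel"
    by (rule borel_measurable_continuous_onI[OF cw])
  have intBw: "integrable lborel (\<lambda>s. B s * w s)"
  proof (rule Bochner_Integration.integrable_bound[where f="\<lambda>s. K * B s"])
    show "integrable lborel (\<lambda>s. K * B s)" using intB by simp
    show "AE s in lborel. norm (B s * w s) \<le> norm (K * B s)"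
    proof (rule AE_I2)
      fix s show "norm (B s * w s) \<le> norm (K * B s)"
      proof (cases "s \<in> {0..T}")
        case True
        have "\<bar>w s\<bar> \<le> \<bar>K\<bar>" using K[OF True] by simp
        then have "\<bar>w s\<bar> * \<bar>B s\<bar> \<le> \<bar>K\<bar> * \<bar>B s\<bar>" by (rule mult_right_mono) simp
        then show ?thesis by (simp only: real_norm_def abs_mult mult.commute[of "\<bar>B s\<bar>" "\<bar>w s\<bar>"])
      qed (simp add: B_def)
    qed
  qed measurable
  have id: "indicator {0..T} t * (w t * q t + w' t * F t) = B t * w t + (A t * (F t - F 0) + F 0 * A t)" for t
    by (simp add: A_def B_def algebra_simps)
  show "integrable lborel (\<lambda>t. indicator {0..T} t * (w t * q t + w' t * F t))"
    unfolding id using intBw intAF intA by (intro Bochner_Integration.integrable_add) auto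
  have IB: "(\<integral>s. B s \<partial>lborel) = F T - F 0"
    using F[of T] T by (simp add: B_def set_lebesgue_integral_def)
  have IA: "(\<integral>s. A s \<partial>lborel) = w T - w 0"
    using integral_FTC_Icc_real[of 0 T w w'] T w w' by (simp add: A_def mult.commute)
  have "(\<integral>t. indicator {0..T} t * (w t * q t + w' t * F t) \<partial>lborel)
     = (\<integral>t. B t * w t \<partial>lborel) + ((\<integral>t. A t * (F t - F 0) \<partial>lborel) + F 0 * (w T - w 0))"
    unfolding id using intBw intAF intA by (subst Bochner_Integration.integral_add) (auto simp: IA)
  also have "(\<integral>t. A t * (F t - F 0) \<partial>lborel) = w T * (F T - F 0) - (\<integral>t. B t * w t \<partial>lborel)"
  proof -
    have "(\<integral>s. B s * (w T - w s) \<partial>lborel) = (\<integral>s. w T * B s - B s * w s \<partial>lborel)"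
      by (intro Bochner_Integration.integral_cong) (auto simp: algebra_simps)
    then show ?thesis unfolding eq using intB intBw by (simp add: IB)
  qed
  finally show "(\<integral>t. indicator {0..T} t * (w t * q t + w' t * F t) \<partial>lborel) = w T * F T - w 0 * F 0"
    by (simp add: algebra_simps)
qed

text \<open>The integrating factor \<open>exp (L * \<tau>)\<close>: integration by parts on
  \<open>{0..t}\<close> and on \<open>{0..s}\<close> is subtracted, and on the difference the
  integrand is at least \<open>exp (L * s) * g\<close>.\<close>

lemma duhamel_lower:
  fixes q F :: "real \<Rightarrow> real"
  assumes st: "0 \<le> s" "s \<le> t" and q: "set_integrable lborel {0..t} q"
    and F: "\<And>\<tau>. 0 \<le> \<tau> \<Longrightarrow> \<tau> \<le> t \<Longrightarrow> F \<tau> = F 0 + (LINT \<sigma>:{0..\<tau>}|lborel. q \<sigma>)"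
    and g: "0 \<le> g" and L: "0 \<le> L"
    and ge: "AE \<sigma> in lborel. \<sigma> \<in> {s..t} \<longrightarrow> g - L * F \<sigma> \<le> q \<sigma>"
  shows "exp (- L * (t - s)) * (F s + (t - s) * g) \<le> F t"
proof -
  let ?w = "\<lambda>\<tau>. exp (L * \<tau>)" and ?w' = "\<lambda>\<tau>. L * exp (L * \<tau>)"
  have w: "(?w has_real_derivative ?w' \<tau>) (at \<tau>)" "isCont ?w' \<tau>" for \<tau>
    by (auto intro!: derivative_eq_intros)
  have qs: "set_integrable lborel {0..s} q"
    by (rule set_integrable_subset[OF q]) (use st in auto)
  let ?u = "\<lambda>\<tau>. ?w \<tau> * q \<tau> + ?w' \<tau> * F \<tau>"
  note ibp = integration_by_parts_primitive[where w="?w" and w'="?w'" and F=F and q=q, OF _ _ _ w(1) w(2)]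
  have t: "integrable lborel (\<lambda>\<tau>. indicator {0..t} \<tau> * ?u \<tau>)" "(\<integral>\<tau>. indicator {0..t} \<tau> * ?u \<tau> \<partial>lborel) = ?w t * F t - ?w 0 * F 0"
    using st by - (rule ibp(1)[OF _ q F], auto, rule ibp(2)[OF _ q F, simplified], auto)
  have s: "integrable lborel (\<lambda>\<tau>. indicator {0..s} \<tau> * ?u \<tau>)" "(\<integral>\<tau>. indicator {0..s} \<tau> * ?u \<tau> \<partial>lborel) = ?w s * F s - ?w 0 * F 0"
    using st by - (rule ibp(1)[OF _ qs F], auto, rule ibp(2)[OF _ qs F, simplified], auto)
  have "(t - s) * (exp (L * s) * g) = (\<integral>\<tau>. indicator {s<..t} \<tau> * (exp (L * s) * g) \<partial>lborel)"
    using st by simp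
  also have "\<dots> \<le> (\<integral>\<tau>. indicator {0..t} \<tau> * ?u \<tau> - indicator {0..s} \<tau> * ?u \<tau> \<partial>lborel)"
  proof (rule integral_mono_AE)
    show "integrable lborel (\<lambda>\<tau>. indicator {s<..t} \<tau> * (exp (L * s) * g))"
      using st by (intro integrable_mult_left) (simp add: integrable_indicator_iff)
    show "integrable lborel (\<lambda>\<tau>. indicator {0..t} \<tau> * ?u \<tau> - indicator {0..s} \<tau> * ?u \<tau>)"
      using t(1) s(1) by (rule Bochner_Integration.integrable_diff)
    show "AE \<tau> in lborel. indicator {s<..t} \<tau> * (exp (L * s) * g) \<le> indicator {0..t} \<tau> * ?u \<tau> - indicator {0..s} \<tau> * ?u \<tau>"
      using ge
    proof eventually_elim
      fix \<tau> assume *: "\<tau> \<in> {s..t} \<longrightarrow> g - L * F \<tau> \<le> q \<tau>"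
      show "indicator {s<..t} \<tau> * (exp (L * s) * g) \<le> indicator {0..t} \<tau> * ?u \<tau> - indicator {0..s} \<tau> * ?u \<tau>"
      proof (cases "\<tau> \<in> {s<..t}")
        case True
        have "exp (L * s) * g \<le> exp (L * \<tau>) * g" using True g L by (intro mult_right_mono) (auto intro: mult_left_mono)
        also have "\<dots> \<le> exp (L * \<tau>) * (q \<tau> + L * F \<tau>)" using * True by (intro mult_left_mono) auto
        also have "\<dots> = ?u \<tau>" by (simp add: algebra_simps)
        finally show ?thesis using True st by (simp add: indicator_def)
      next
        case False
        then have "indicator {0..t} \<tau> = (indicator {0..s} \<tau> :: real)" using st by (auto simp: indicator_def)
        moreover have "indicator {s<..t} \<tau> = (0 :: real)" using False by (auto simp: indicator_def)
        ultimately show ?thesis by simp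
      qed
    qed
  qed
  also have "\<dots> = ?w t * F t - ?w s * F s"
    using t s by simp
  finally have "exp (L * s) * (F s + (t - s) * g) \<le> exp (L * t) * F t" by (simp add: algebra_simps)
  then have "exp (- (L * t)) * (exp (L * s) * (F s + (t - s) * g)) \<le> exp (- (L * t)) * (exp (L * t) * F t)"
    by (intro mult_left_mono) auto
  also have "exp (- (L * t)) * (exp (L * t) * F t) = F t" by (simp add: exp_minus)
  also have "exp (- (L * t)) * (exp (L * s) * (F s + (t - s) * g)) = exp (- L * (t - s)) * (F s + (t - s) * g)"
  proof -
    have "exp (- (L * t)) * exp (L * s) = exp (- L * (t - s))"
      unfolding mult_exp_exp by (simp add: right_diff_distrib)
    then show ?thesis by (simp only: mult.assoc[symmetric])
  qed
  finally show ?thesis .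
qed

lemma powr_le_one_plus:
  assumes "0 \<le> \<gamma>" "\<gamma> \<le> 1" "0 \<le> (x::real)"
  shows "x powr \<gamma> \<le> 1 + x"
proof (cases "x \<le> 1")
  case True
  have "x powr \<gamma> \<le> 1 powr \<gamma>" using assms True by (intro powr_mono2) auto
  then show ?thesis using assms by simp
next
  case False
  have "x powr \<gamma> \<le> x powr 1" using assms False by (intro powr_mono) auto
  then show ?thesis using assms by simp
qed

section \<open>Cutoff kernels, and what a mild solution satisfies for almost every velocity\<close>

locale collision_kernels =
  fixes N :: nat and m :: "nat \<Rightarrow> real" and \<gamma> :: real and h :: "nat \<Rightarrow> nat \<Rightarrow> real \<Rightarrow> real"
  assumes mass_pos: "\<And>i. i \<in> {1..N} \<Longrightarrow> 0 < m i"
    and cutoff: "cutoff_hard_potentials N \<gamma> h"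
begin

lemma gamma: "0 \<le> \<gamma>" "\<gamma> \<le> 1"
  using cutoff by (simp_all add: cutoff_hard_potentials_def)

text \<open>Extension by zero: \<open>h\<close> is known to be nonnegative, symmetric and integrable
  only for species in \<open>{1..N}\<close> and angles in \<open>{0..pi/2}\<close>, and later
  integrals use these properties everywhere.\<close>

definition H :: "nat \<Rightarrow> nat \<Rightarrow> real \<Rightarrow> real" where
  "H j i \<theta> = (if j \<in> {1..N} \<and> i \<in> {1..N} then indicator {0..pi/2} \<theta> * h j i \<theta> else 0)"

lemma H_measurable [measurable]: "H j i \<in> borel_measurable borel"
proof (cases "j \<in> {1..N} \<and> i \<in> {1..N}")
  case True
  then have "set_integrable lborel {0..pi/2} (h j i)" using cutoff by (simp add: cutoff_hard_potentials_def)
  then have "(\<lambda>\<theta>. indicator {0..pi/2} \<theta> * h j i \<theta>) \<in> borel_measurable lborel"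
    unfolding set_integrable_def by (auto dest: borel_measurable_integrable)
  then show ?thesis using True by (simp add: H_def[abs_def])
next
  case False
  then have "H j i = (\<lambda>_. 0)" by (auto simp: H_def)
  then show ?thesis by simp
qed

lemma H_nonneg: "0 \<le> H j i \<theta>"
  using cutoff by (auto simp: H_def indicator_def cutoff_hard_potentials_def)

lemma H_sym: "H j i = H i j"
  using cutoff by (auto simp: H_def indicator_def cutoff_hard_potentials_def fun_eq_iff)

lemma integrable_H: "integrable lborel (H j i)"
proof (cases "j \<in> {1..N} \<and> i \<in> {1..N}")
  case True
  then show ?thesis using cutoff by (simp add: H_def[abs_def] set_integrable_def cutoff_hard_potentials_def)
next
  case False
  then have "H j i = (\<lambda>_. 0)" by (auto simp: H_def)
  then show ?thesis by simp
qed

lemma integral_H_pos: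
  assumes "j \<in> {1..N}" "i \<in> {1..N}"
  shows "0 < (\<integral>\<theta>. H j i \<theta> \<partial>lborel)"
  using cutoff assms by (simp add: H_def cutoff_hard_potentials_def set_lebesgue_integral_def)

lemma angle_mass_H_finite: "angle_mass (\<lambda>\<theta>. ennreal (H j i \<theta>)) < \<infinity>"
proof -
  obtain Y where Y: "Y < \<infinity>" and eq: "\<And>H. H \<in> borel_measurable borel \<Longrightarrow>
       angle_mass H = Y * (VINT t. H t * ennreal (sin t) * indicator {0..pi/2} t)"
    using angle_mass_eq by metis
  have "(VINT t. ennreal (H j i t) * ennreal (sin t) * indicator {0..pi/2} t) \<le> (VINT t. ennreal (H j i t))"
  proof (rule nn_integral_mono)
    fix t
    have "ennreal (H j i t) * ennreal (sin t) * indicator {0..pi/2} t \<le> ennreal (H j i t) * 1 * 1"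
      by (intro mult_mono) (auto simp: indicator_def)
    then show "ennreal (H j i t) * ennreal (sin t) * indicator {0..pi/2} t \<le> ennreal (H j i t)" by simp
  qed
  also have "\<dots> < \<infinity>" using integrable_H[of j i] H_nonneg by (simp add: integrable_iff_bounded)
  finally show ?thesis using Y by (simp add: eq ennreal_mult_less_top)
qed

text \<open>A single bound for the cross sections of all pairs of species; the summand 1 makes it
  positive.\<close>

definition CA :: real where
  "CA = 1 + (\<Sum>j\<in>{1..N}. \<Sum>i\<in>{1..N}. enn2real (angle_mass (\<lambda>\<theta>. ennreal (H j i \<theta>))))"

lemma CA_pos: "0 < CA" "0 \<le> CA"
proof -
  have "0 \<le> (\<Sum>j\<in>{1..N}. \<Sum>i\<in>{1..N}. enn2real (angle_mass (\<lambda>\<theta>. ennreal (H j i \<theta>))))"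
    by (intro sum_nonneg) auto
  then show "0 < CA" "0 \<le> CA" by (simp_all add: CA_def)
qed

lemma angle_mass_H_le: "angle_mass (\<lambda>\<theta>. ennreal (H j i \<theta>)) \<le> ennreal CA"
proof (cases "j \<in> {1..N} \<and> i \<in> {1..N}")
  case True
  let ?a = "\<lambda>j i. enn2real (angle_mass (\<lambda>\<theta>. ennreal (H j i \<theta>)))"
  have "?a j i \<le> (\<Sum>i\<in>{1..N}. ?a j i)" using True by (intro member_le_sum) auto
  also have "\<dots> \<le> (\<Sum>j\<in>{1..N}. \<Sum>i\<in>{1..N}. ?a j i)"
    using True by (intro member_le_sum[where f="\<lambda>j. \<Sum>i\<in>{1..N}. ?a j i"]) (auto intro!: sum_nonneg)
  finally have "?a j i \<le> CA" by (simp add: CA_def)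
  then have "ennreal (?a j i) \<le> ennreal CA" by (rule ennreal_leI)
  then show ?thesis using angle_mass_H_finite[of j i] by (simp add: ennreal_enn2real)
next
  case False
  then have "H j i = (\<lambda>_. 0)" by (auto simp: H_def)
  then show ?thesis by (simp add: angle_mass_def)
qed

lemma nn_integral_ckern_le:
  "(SINT n. ckern \<gamma> (H j i) v w n) \<le> ennreal CA * ennreal (norm (v - w) powr \<gamma>)"
  unfolding mult.commute[of "ennreal CA"] nn_integral_ckern[OF H_nonneg H_measurable]
  by (intro mult_left_mono angle_mass_H_le) auto

text \<open>For unit \<open>n\<close> in the half sphere the Cauchy-Schwarz inequality puts the
  angle into \<open>{0..pi/2}\<close>, where \<open>H\<close> and \<open>h\<close> agree.\<close>

lemma coll_integrand_eq:
  assumes ij: "j \<in> {1..N}" "i \<in> {1..N}" and n: "norm n = 1"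
  shows "coll_integrand \<gamma> (h j i) (m j) (m i) fj fi v (w, n)
    = ckern \<gamma> (H j i) v w n * (fj (post_vel_star (m i) (m j) v w n) * fi (post_vel (m i) (m j) v w n) - fj w * fi v)"
proof (cases "0 \<le> (v - w) \<bullet> n")
  case True
  let ?x = "((v - w) /\<^sub>R norm (v - w)) \<bullet> n"
  have "?x \<le> norm ((v - w) /\<^sub>R norm (v - w)) * norm n" by (rule norm_cauchy_schwarz)
  also have "\<dots> \<le> 1" using n by (cases "v = w") auto
  finally have x1: "?x \<le> 1" .
  have x0: "0 \<le> ?x" using True by simp
  have "0 \<le> arccos ?x" "arccos ?x \<le> pi/2"
    using x0 x1 arccos_lbound[of ?x] arccos_le_pi2[of ?x] by linarith+
  then have "H j i (coll_angle v w n) = h j i (coll_angle v w n)"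
    using ij by (simp add: H_def coll_angle_def)
  then show ?thesis by (simp add: coll_integrand_def ckern_def coll_kernel_def indicator_def)
next
  case False
  then show ?thesis by (simp add: coll_integrand_def ckern_def)
qed

end

text \<open>Of the conservation laws only bounds that are uniform in time are kept. Constants built
  from \<open>\<delta>\<close>, \<open>M\<close> and \<open>E\<close> are then common to all flows
  with these bounds.\<close>

locale mixture_flow = collision_kernels +
  fixes f :: "nat \<Rightarrow> real \<Rightarrow> vec \<Rightarrow> real" and \<delta> M E :: real
  assumes solution: "mixture_solution N m \<gamma> h f"
    and mass_ge: "\<And>i t. i \<in> {1..N} \<Longrightarrow> 0 \<le> t \<Longrightarrow> \<delta> \<le> (LINT v|lborel. f i t v)"
    and mass_le: "\<And>i t. i \<in> {1..N} \<Longrightarrow> 0 \<le> t \<Longrightarrow> (LINT v|lborel. f i t v) \<le> M"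
    and energy_le: "\<And>i t. i \<in> {1..N} \<Longrightarrow> 0 \<le> t \<Longrightarrow> (LINT v|lborel. f i t v * (norm v)^2) \<le> E"
    and delta_pos: "0 < \<delta>" and M_pos: "0 < M" and E_pos: "0 < E"
begin

text \<open>The solution is measurable and nonnegative only for nonnegative times; the cutoff gives
  a function with both properties on all of space-time.\<close>

definition ff :: "nat \<Rightarrow> real \<Rightarrow> vec \<Rightarrow> real" where
  "ff i t v = indicator {0..} t * f i t v"

lemma ff_eq: "0 \<le> t \<Longrightarrow> ff i t = f i t"
  by (simp add: ff_def fun_eq_iff)

lemma f_nonneg: "i \<in> {1..N} \<Longrightarrow> 0 \<le> t \<Longrightarrow> 0 \<le> f i t v"
  using solution by (auto simp: mixture_solution_def)

lemma ff_nonneg: "i \<in> {1..N} \<Longrightarrow> 0 \<le> ff i t v"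
  using f_nonneg by (simp add: ff_def indicator_def)

lemma ff_measurable_pair:
  assumes "i \<in> {1..N}"
  shows "(\<lambda>(t, v). ff i t v) \<in> borel_measurable (borel \<Otimes>\<^sub>M borel)"
proof -
  have "set_borel_measurable borel ({0..} \<times> UNIV) (\<lambda>(t, v). f i t v)"
    using solution assms by (auto simp: mixture_solution_def)
  then have "(\<lambda>x. indicator ({0..} \<times> UNIV) x *\<^sub>R (case x of (t, v) \<Rightarrow> f i t v)) \<in> borel_measurable borel"
    by (simp add: set_borel_measurable_def)
  also have "(\<lambda>x. indicator ({0..} \<times> UNIV) x *\<^sub>R (case x of (t, v) \<Rightarrow> f i t v)) = (\<lambda>(t, v). ff i t v)"
    by (auto simp: ff_def indicator_def fun_eq_iff)
  finally show ?thesis by (simp add: borel_prod)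
qed

lemma integrable_f:
  assumes "i \<in> {1..N}" "0 \<le> t"
  shows "integrable lborel (f i t)" "integrable lborel (\<lambda>v. f i t v * (norm v)^2)"
  using solution assms by (auto simp: mixture_solution_def)

lemma f_measurable:
  assumes "i \<in> {1..N}" "0 \<le> t"
  shows "f i t \<in> borel_measurable borel"
  using integrable_f(1)[OF assms] by (auto dest: borel_measurable_integrable)

lemma nn_integral_f_le:
  assumes "i \<in> {1..N}" "0 \<le> t"
  shows "(VINT v. ennreal (f i t v)) \<le> ennreal M"
    "(VINT v. ennreal (f i t v) * ennreal ((norm v)^2)) \<le> ennreal E"
proof -
  show "(VINT v. ennreal (f i t v)) \<le> ennreal M"
    using integrable_f(1)[OF assms] f_nonneg[OF assms] mass_le[OF assms]
    by (subst nn_integral_eq_integral) (auto intro!: ennreal_leI)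
  have "(VINT v. ennreal (f i t v * (norm v)^2)) \<le> ennreal E"
    using integrable_f(2)[OF assms] f_nonneg[OF assms] energy_le[OF assms]
    by (subst nn_integral_eq_integral) (auto intro!: ennreal_leI)
  then show "(VINT v. ennreal (f i t v) * ennreal ((norm v)^2)) \<le> ennreal E"
    using f_nonneg[OF assms] by (simp add: ennreal_mult)
qed

definition freq :: "nat \<Rightarrow> nat \<Rightarrow> real \<Rightarrow> vec \<Rightarrow> ennreal" where
  "freq j i t v = (VINT w. SINT n. ennreal (ckern \<gamma> (H j i) v w n) * ennreal (ff j t w))"

definition CL :: real where "CL = CA * (2 * M + E)"

lemma CL_pos: "0 < CL" "0 \<le> CL"
  using CA_pos M_pos E_pos by (auto simp: CL_def intro!: mult_pos_pos add_pos_pos)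

text \<open>Since \<open>|v - w|^\<gamma> \<le> 2 + |v| + |w|^2\<close>, mass and energy of the
  partner suffice. The linear growth in \<open>|v|\<close> is what the shrinking time steps of the
  final spreading argument have to offset.\<close>

lemma freq_le:
  assumes j: "j \<in> {1..N}" and t: "0 \<le> t"
  shows "freq j i t v \<le> ennreal (CL * (1 + norm v))"
proof -
  note [measurable] = f_measurable[OF j t]
  have "freq j i t v \<le> (VINT w. ennreal (f j t w) * (ennreal CA * ennreal (norm (v - w) powr \<gamma>)))"
    unfolding freq_def ff_eq[OF t]
  proof (rule nn_integral_mono)
    fix w
    have "(SINT n. ennreal (ckern \<gamma> (H j i) v w n) * ennreal (f j t w))
      = ennreal (f j t w) * (SINT n. ennreal (ckern \<gamma> (H j i) v w n))"
      by (subst nn_integral_multc) (auto simp: mult.commute)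
    also have "\<dots> \<le> ennreal (f j t w) * (ennreal CA * ennreal (norm (v - w) powr \<gamma>))"
      by (intro mult_left_mono nn_integral_ckern_le) auto
    finally show "(SINT n. ennreal (ckern \<gamma> (H j i) v w n) * ennreal (f j t w))
       \<le> ennreal (f j t w) * (ennreal CA * ennreal (norm (v - w) powr \<gamma>))" .
  qed
  also have "\<dots> \<le> (VINT w. ennreal CA * (ennreal (2 + norm v) * ennreal (f j t w) + ennreal (f j t w) * ennreal ((norm w)^2)))"
  proof (rule nn_integral_mono)
    fix w :: vec
    have "norm (v - w) powr \<gamma> \<le> 1 + norm (v - w)" using gamma by (intro powr_le_one_plus) auto
    also have "\<dots> \<le> 1 + norm v + norm w" using norm_triangle_ineq4[of v w] by simp
    also have "norm w \<le> 1 + (norm w)^2"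
    proof -
      have "0 \<le> (norm w - 1)^2" by simp
      then have "2 * norm w \<le> 1 + (norm w)^2" by (simp add: power2_eq_square algebra_simps)
      then show ?thesis using norm_ge_zero[of w] by linarith
    qed
    finally have "norm (v - w) powr \<gamma> \<le> (2 + norm v) + (norm w)^2" by simp
    then have "f j t w * (CA * norm (v - w) powr \<gamma>) \<le> f j t w * (CA * ((2 + norm v) + (norm w)^2))"
      using f_nonneg[OF j t] CA_pos by (intro mult_left_mono) auto
    also have "\<dots> = CA * ((2 + norm v) * f j t w + f j t w * (norm w)^2)" by (simp add: algebra_simps)
    finally have "ennreal (f j t w * (CA * norm (v - w) powr \<gamma>)) \<le> ennreal (CA * ((2 + norm v) * f j t w + f j t w * (norm w)^2))"
      by (rule ennreal_leI)
    then show "ennreal (f j t w) * (ennreal CA * ennreal (norm (v - w) powr \<gamma>))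
      \<le> ennreal CA * (ennreal (2 + norm v) * ennreal (f j t w) + ennreal (f j t w) * ennreal ((norm w)^2))"
      using f_nonneg[OF j t] CA_pos by (simp add: ennreal_mult ennreal_plus)
  qed
  also have "\<dots> = ennreal CA * (ennreal (2 + norm v) * (VINT w. ennreal (f j t w)) + (VINT w. ennreal (f j t w) * ennreal ((norm w)^2)))"
    using j t by (subst nn_integral_cmult, measurable) (subst nn_integral_add, measurable, subst nn_integral_cmult, measurable)
  also have "\<dots> \<le> ennreal CA * (ennreal (2 + norm v) * ennreal M + ennreal E)"
    by (intro mult_left_mono add_mono nn_integral_f_le j t) auto
  also have "\<dots> = ennreal (CA * ((2 + norm v) * M + E))"
    using CA_pos M_pos E_pos by (simp add: ennreal_mult ennreal_plus)
  also have "\<dots> \<le> ennreal (CL * (1 + norm v))"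
  proof (rule ennreal_leI)
    have "(2 + norm v) * M + E \<le> (2 * M + E) * (1 + norm v)"
      using M_pos E_pos by (simp add: algebra_simps)
    then show "CA * ((2 + norm v) * M + E) \<le> CL * (1 + norm v)"
      unfolding CL_def mult.assoc using CA_pos by (intro mult_left_mono) auto
  qed
  finally show ?thesis .
qed

abbreviation gn :: "nat \<Rightarrow> nat \<Rightarrow> real \<Rightarrow> vec \<Rightarrow> ennreal" where
  "gn j i t v \<equiv> gain \<gamma> (H j i) (m j) (m i) (\<lambda>w. ennreal (ff j t w)) (\<lambda>w. ennreal (ff i t w)) v"

abbreviation coll :: "nat \<Rightarrow> nat \<Rightarrow> real \<Rightarrow> vec \<Rightarrow> real" where
  "coll j i t v \<equiv> coll_op \<gamma> (h j i) (m j) (m i) (f j t) (f i t) v"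

text \<open>The Bochner integral of the difference splits once both parts are integrable: the loss
  is, by \<open>freq_le\<close>, and the gain is the integrable difference plus the loss.\<close>

lemma coll_op_eq:
  assumes ij: "j \<in> {1..N}" "i \<in> {1..N}" and t: "0 \<le> t"
    and int: "integrable (lborel \<Otimes>\<^sub>M sphere_measure) (coll_integrand \<gamma> (h j i) (m j) (m i) (f j t) (f i t) v)"
  shows "gn j i t v < \<infinity>" and "coll j i t v = enn2real (gn j i t v) - f i t v * enn2real (freq j i t v)"
proof -
  note [measurable] = f_measurable[OF ij(1) t] f_measurable[OF ij(2) t]
  let ?G = "\<lambda>p. ckern \<gamma> (H j i) v (fst p) (snd p) * (f j t (post_vel_star (m i) (m j) v (fst p) (snd p)) * f i t (post_vel (m i) (m j) v (fst p) (snd p)))"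
  let ?L = "\<lambda>p. ckern \<gamma> (H j i) v (fst p) (snd p) * f j t (fst p)"
  have [measurable]: "?G \<in> borel_measurable (lborel \<Otimes>\<^sub>M sphere_measure)" "?L \<in> borel_measurable (lborel \<Otimes>\<^sub>M sphere_measure)"
    using ij t by measurable
  have nn: "0 \<le> ?G p" "0 \<le> ?L p" for p
    using f_nonneg[OF ij(1) t] f_nonneg[OF ij(2) t] ckern_nonneg[OF H_nonneg] by auto
  have AE1: "AE p in (lborel :: vec measure) \<Otimes>\<^sub>M sphere_measure. norm (snd p) = 1"
    by (rule lborel_sphere.AE_pair_measure, measurable) (simp add: AE_sphere_measure_norm)
  have eqAE: "AE p in lborel \<Otimes>\<^sub>M sphere_measure. coll_integrand \<gamma> (h j i) (m j) (m i) (f j t) (f i t) v p = ?G p - f i t v * ?L p"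
    using AE1
  proof eventually_elim
    fix p :: "vec \<times> vec" assume "norm (snd p) = 1"
    then show "coll_integrand \<gamma> (h j i) (m j) (m i) (f j t) (f i t) v p = ?G p - f i t v * ?L p"
      using coll_integrand_eq[OF ij, of "snd p" "f j t" "f i t" v "fst p"] by (simp add: algebra_simps)
  qed
  have nnL: "(\<integral>\<^sup>+p. ennreal (?L p) \<partial>(lborel \<Otimes>\<^sub>M sphere_measure)) = freq j i t v"
    unfolding freq_def ff_eq[OF t] using nn(2)
    by (subst sphere.nn_integral_fst[symmetric]) (auto simp: ennreal_mult'[OF ckern_nonneg[OF H_nonneg]])
  have fL: "freq j i t v < \<infinity>" using freq_le[OF ij(1) t, of i v] by (simp add: le_less_trans)
  have intL: "integrable (lborel \<Otimes>\<^sub>M sphere_measure) ?L"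
    by (rule integrableI_nonneg) (use nn nnL fL in auto)
  have IL: "(\<integral>p. ?L p \<partial>(lborel \<Otimes>\<^sub>M sphere_measure)) = enn2real (freq j i t v)"
    by (subst integral_eq_nn_integral) (use nn nnL in auto)
  have intG: "integrable (lborel \<Otimes>\<^sub>M sphere_measure) ?G"
  proof (rule integrable_cong_AE_imp)
    show "integrable (lborel \<Otimes>\<^sub>M sphere_measure) (\<lambda>p. coll_integrand \<gamma> (h j i) (m j) (m i) (f j t) (f i t) v p + f i t v * ?L p)"
      using int intL by (intro Bochner_Integration.integrable_add) auto
    show "AE p in lborel \<Otimes>\<^sub>M sphere_measure. coll_integrand \<gamma> (h j i) (m j) (m i) (f j t) (f i t) v p + f i t v * ?L p = ?G p"
      using eqAE by eventually_elim simp
  qed measurable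
  have nnG: "(\<integral>\<^sup>+p. ennreal (?G p) \<partial>(lborel \<Otimes>\<^sub>M sphere_measure)) = gn j i t v"
    unfolding gain_def ff_eq[OF t] using nn(1) f_nonneg[OF ij(1) t] f_nonneg[OF ij(2) t] ckern_nonneg[OF H_nonneg]
    by (subst sphere.nn_integral_fst[symmetric]) (auto simp: ennreal_mult)
  show "gn j i t v < \<infinity>"
    using intG nn(1) unfolding nnG[symmetric] integrable_iff_bounded by simp
  have IG: "(\<integral>p. ?G p \<partial>(lborel \<Otimes>\<^sub>M sphere_measure)) = enn2real (gn j i t v)"
    by (subst integral_eq_nn_integral) (use nn nnG in auto)
  have "coll j i t v = (\<integral>p. ?G p - f i t v * ?L p \<partial>(lborel \<Otimes>\<^sub>M sphere_measure))"
    unfolding coll_op_def using int eqAE by (intro integral_cong_AE) auto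
  also have "\<dots> = enn2real (gn j i t v) - f i t v * enn2real (freq j i t v)"
    using intG intL by (simp add: IL IG)
  finally show "coll j i t v = enn2real (gn j i t v) - f i t v * enn2real (freq j i t v)" .
qed

lemma AE_coll_op_eq:
  assumes i: "i \<in> {1..N}"
  shows "AE v in lborel. AE s in lborel. 0 \<le> s \<longrightarrow> (\<forall>j\<in>{1..N}. gn j i s v < \<infinity> \<and>
    coll j i s v = enn2real (gn j i s v) - f i s v * enn2real (freq j i s v))"
proof -
  have "\<forall>j\<in>{1..N}. AE v in lborel. AE s in lborel. s \<ge> 0 \<longrightarrow>
     integrable (lborel \<Otimes>\<^sub>M sphere_measure) (coll_integrand \<gamma> (h j i) (m j) (m i) (f j s) (f i s) v)"
    using solution i by (auto simp: mixture_solution_def)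
  then have "AE v in lborel. \<forall>j\<in>{1..N}. AE s in lborel. s \<ge> 0 \<longrightarrow>
     integrable (lborel \<Otimes>\<^sub>M sphere_measure) (coll_integrand \<gamma> (h j i) (m j) (m i) (f j s) (f i s) v)"
    by (intro AE_finite_allI) auto
  then show ?thesis
  proof eventually_elim
    fix v
    assume "\<forall>j\<in>{1..N}. AE s in lborel. s \<ge> 0 \<longrightarrow>
     integrable (lborel \<Otimes>\<^sub>M sphere_measure) (coll_integrand \<gamma> (h j i) (m j) (m i) (f j s) (f i s) v)"
    then have "AE s in lborel. \<forall>j\<in>{1..N}. s \<ge> 0 \<longrightarrow>
     integrable (lborel \<Otimes>\<^sub>M sphere_measure) (coll_integrand \<gamma> (h j i) (m j) (m i) (f j s) (f i s) v)"
      by (intro AE_finite_allI) auto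
    then show "AE s in lborel. 0 \<le> s \<longrightarrow> (\<forall>j\<in>{1..N}. gn j i s v < \<infinity> \<and>
       coll j i s v = enn2real (gn j i s v) - f i s v * enn2real (freq j i s v))"
      by eventually_elim (use i coll_op_eq in auto)
  qed
qed

lemma AE_mild:
  assumes "i \<in> {1..N}"
  shows "AE v in lborel. \<forall>t\<ge>0. set_integrable lborel {0..t} (\<lambda>s. \<Sum>j\<in>{1..N}. coll j i s v) \<and>
    f i t v = f i 0 v + (LINT s:{0..t}|lborel. \<Sum>j\<in>{1..N}. coll j i s v)"
  using solution assms by (auto simp: mixture_solution_def)

definition L :: "vec \<Rightarrow> real" where "L v = real N * CL * (1 + norm v)"

lemma L_nonneg: "0 \<le> L v"
  using CL_pos by (simp add: L_def)

text \<open>The loss frequency is replaced by its bound \<open>L v\<close>, and among the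
  nonnegative gains only that of species \<open>j\<close> is kept. The exceptional set does not
  depend on \<open>s\<close>, \<open>t\<close> or \<open>g\<close>.\<close>

lemma duhamel_gain:
  assumes ij: "j \<in> {1..N}" "i \<in> {1..N}"
  shows "AE v in lborel. \<forall>s t g. 0 \<le> s \<longrightarrow> s \<le> t \<longrightarrow> 0 \<le> g \<longrightarrow> (\<forall>\<sigma>\<in>{s..t}. ennreal g \<le> gn j i \<sigma> v) \<longrightarrow>
    exp (- L v * (t - s)) * (f i s v + (t - s) * g) \<le> f i t v"
  using AE_mild[OF ij(2)] AE_coll_op_eq[OF ij(2)]
proof (eventually_elim, intro allI impI)
  fix v s t g
  assume mild: "\<forall>t\<ge>0. set_integrable lborel {0..t} (\<lambda>s. \<Sum>j\<in>{1..N}. coll j i s v) \<and>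
    f i t v = f i 0 v + (LINT s:{0..t}|lborel. \<Sum>j\<in>{1..N}. coll j i s v)"
   and co: "AE s in lborel. 0 \<le> s \<longrightarrow> (\<forall>j\<in>{1..N}. gn j i s v < \<infinity> \<and>
    coll j i s v = enn2real (gn j i s v) - f i s v * enn2real (freq j i s v))"
   and st: "0 \<le> s" "s \<le> t" and g: "0 \<le> (g::real)" "\<forall>\<sigma>\<in>{s..t}. ennreal g \<le> gn j i \<sigma> v"
  show "exp (- L v * (t - s)) * (f i s v + (t - s) * g) \<le> f i t v"
  proof (rule duhamel_lower[where F="\<lambda>t. f i t v"])
    show "set_integrable lborel {0..t} (\<lambda>s. \<Sum>j\<in>{1..N}. coll j i s v)"
      using mild[THEN spec, of t] st by (meson order_trans)
    show "f i \<tau> v = f i 0 v + (LINT s:{0..\<tau>}|lborel. \<Sum>j\<in>{1..N}. coll j i s v)" if "0 \<le> \<tau>" "\<tau> \<le> t" for \<tau>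
      using mild[THEN spec, of \<tau>] that by blast
    show "AE \<sigma> in lborel. \<sigma> \<in> {s..t} \<longrightarrow> g - L v * f i \<sigma> v \<le> (\<Sum>j\<in>{1..N}. coll j i \<sigma> v)"
      using co
    proof (eventually_elim, intro impI)
      fix \<sigma> assume c: "0 \<le> \<sigma> \<longrightarrow> (\<forall>j\<in>{1..N}. gn j i \<sigma> v < \<infinity> \<and> coll j i \<sigma> v = enn2real (gn j i \<sigma> v) - f i \<sigma> v * enn2real (freq j i \<sigma> v))"
        and \<sigma>: "\<sigma> \<in> {s..t}"
      have \<sigma>0: "0 \<le> \<sigma>" using \<sigma> st by auto
      have fr: "enn2real (freq k i \<sigma> v) \<le> CL * (1 + norm v)" if "k \<in> {1..N}" for k
        using freq_le[OF that \<sigma>0, of i v] CL_pos by (intro enn2real_leI) auto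
      have "g \<le> enn2real (gn j i \<sigma> v)"
        using g \<sigma> c \<sigma>0 ij(1) by (metis enn2real_ennreal enn2real_mono infinity_ennreal_def)
      also have "\<dots> \<le> (\<Sum>k\<in>{1..N}. enn2real (gn k i \<sigma> v))"
        using ij(1) by (intro member_le_sum[where f="\<lambda>k. enn2real (gn k i \<sigma> v)"]) auto
      finally have 1: "g \<le> (\<Sum>k\<in>{1..N}. enn2real (gn k i \<sigma> v))" .
      have 2: "(\<Sum>k\<in>{1..N}. f i \<sigma> v * enn2real (freq k i \<sigma> v)) \<le> (\<Sum>k\<in>{1..N}. f i \<sigma> v * (CL * (1 + norm v)))"
        by (intro sum_mono mult_left_mono fr f_nonneg[OF ij(2) \<sigma>0]) auto
      have "(\<Sum>k\<in>{1..N}. coll k i \<sigma> v) = (\<Sum>k\<in>{1..N}. enn2real (gn k i \<sigma> v)) - (\<Sum>k\<in>{1..N}. f i \<sigma> v * enn2real (freq k i \<sigma> v))"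
        using c \<sigma>0 by (simp add: sum_subtractf)
      then show "g - L v * f i \<sigma> v \<le> (\<Sum>j\<in>{1..N}. coll j i \<sigma> v)"
        using 1 2 by (simp add: L_def mult_ac)
    qed
  qed (use st g L_nonneg in auto)
qed

text \<open>The form in which the mild equation is used: lower bounds that hold on a whole time interval
  are improved by the gain term they generate.\<close>

lemma duhamel_step:
  fixes Fi Fj :: "vec \<Rightarrow> ennreal"
  assumes ij: "j \<in> {1..N}" "i \<in> {1..N}" and s: "0 \<le> s"
    and Fi: "AE v in lborel. \<forall>\<sigma>\<in>{s..T}. Fi v \<le> ennreal (f i \<sigma> v)"
    and Fj: "AE v in lborel. \<forall>\<sigma>\<in>{s..T}. Fj v \<le> ennreal (f j \<sigma> v)"
  shows "AE v in lborel. \<forall>t\<in>{s..T}. ennreal (exp (- L v * (t - s)) * (t - s)) * gain \<gamma> (H j i) (m j) (m i) Fj Fi v \<le> ennreal (f i t v)"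
proof -
  have "AE v in lborel. \<forall>\<sigma>\<in>{s..T}. gain \<gamma> (H j i) (m j) (m i) Fj Fi v \<le> gn j i \<sigma> v"
    using gain_mono_AE[OF mass_pos[OF ij(2)] mass_pos[OF ij(1)] H_measurable Fi Fj, of \<gamma> j i]
  proof eventually_elim
    fix v assume *: "\<forall>fi fj gi gj. (\<forall>v. (\<forall>\<sigma>\<in>{s..T}. Fi v \<le> ennreal (f i \<sigma> v)) \<longrightarrow> fi v \<le> gi v) \<longrightarrow>
         (\<forall>v. (\<forall>\<sigma>\<in>{s..T}. Fj v \<le> ennreal (f j \<sigma> v)) \<longrightarrow> fj v \<le> gj v) \<longrightarrow>
         gain \<gamma> (H j i) (m j) (m i) fj fi v \<le> gain \<gamma> (H j i) (m j) (m i) gj gi v"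
    show "\<forall>\<sigma>\<in>{s..T}. gain \<gamma> (H j i) (m j) (m i) Fj Fi v \<le> gn j i \<sigma> v"
      using s by (intro ballI *[rule_format]) (auto simp: ff_eq)
  qed
  then show ?thesis using duhamel_gain[OF ij]
  proof (eventually_elim, intro ballI)
    fix v t
    assume g: "\<forall>\<sigma>\<in>{s..T}. gain \<gamma> (H j i) (m j) (m i) Fj Fi v \<le> gn j i \<sigma> v"
      and d: "\<forall>s t g. 0 \<le> s \<longrightarrow> s \<le> t \<longrightarrow> 0 \<le> g \<longrightarrow> (\<forall>\<sigma>\<in>{s..t}. ennreal g \<le> gn j i \<sigma> v) \<longrightarrow>
        exp (- L v * (t - s)) * (f i s v + (t - s) * g) \<le> f i t v"
      and t: "t \<in> {s..T}"
    let ?Q = "gain \<gamma> (H j i) (m j) (m i) Fj Fi v"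
    have key: "exp (- L v * (t - s)) * (t - s) * g \<le> f i t v" if "0 \<le> g" "ennreal g \<le> ?Q" for g
    proof -
      have "\<forall>\<sigma>\<in>{s..t}. ennreal g \<le> gn j i \<sigma> v" using g t that(2) by (auto intro: order_trans)
      then have "exp (- L v * (t - s)) * (f i s v + (t - s) * g) \<le> f i t v" using d s t that(1) by auto
      moreover have "exp (- L v * (t - s)) * ((t - s) * g) \<le> exp (- L v * (t - s)) * (f i s v + (t - s) * g)"
        using f_nonneg[OF ij(2) s] by (intro mult_left_mono) auto
      ultimately have "exp (- L v * (t - s)) * ((t - s) * g) \<le> f i t v" by linarith
      then show ?thesis by (simp only: mult.assoc)
    qed
    show "ennreal (exp (- L v * (t - s)) * (t - s)) * ?Q \<le> ennreal (f i t v)"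
    proof (cases "t = s")
      case False
      then have c: "0 < exp (- L v * (t - s)) * (t - s)" using t by auto
      show ?thesis
      proof (cases ?Q)
        case (real g)
        then show ?thesis using key[of g] c by (simp add: ennreal_mult[symmetric] ennreal_leI)
      next
        \<comment> \<open>An infinite gain would allow an arbitrarily large \<open>g\<close>; this
          choice forces \<open>f i t v\<close> to exceed itself by one.\<close>
        case top
        have "f i t v + 1 \<le> f i t v"
          using key[of "(f i t v + 1) / (exp (- L v * (t - s)) * (t - s))"] c top False f_nonneg[OF ij(2), of t v] s t by auto
        then show ?thesis by simp
      qed
    qed simp
  qed
qed

lemma persistence:
  assumes i: "i \<in> {1..N}"
  shows "AE v in lborel. \<forall>s t. 0 \<le> s \<longrightarrow> s \<le> t \<longrightarrow> exp (- L v * (t - s)) * f i s v \<le> f i t v"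
  using duhamel_gain[OF i i]
proof eventually_elim
  case (elim v)
  show ?case
  proof (intro allI impI)
    fix s t :: real assume "0 \<le> s" "s \<le> t"
    then show "exp (- L v * (t - s)) * f i s v \<le> f i t v" using elim[rule_format, of s t 0] by simp
  qed
qed

end

section \<open>Non-concentration\<close>

text \<open>The parallel sum: \<open>1 / sat k x = 1 / k + 1 / x\<close>. Concave in
  \<open>x\<close>, zero at zero and bounded by \<open>k\<close>, it detects mass away from the
  centre without being dominated by very fast particles. Its derivative in \<open>k\<close> is
  \<open>(sat k x / k)^2\<close>, which makes the moving scale computable.\<close>

definition sat :: "real \<Rightarrow> real \<Rightarrow> real" where "sat k x = k * x / (k + x)"

lemma sat_bounds:
  assumes "0 < k" "0 \<le> x"
  shows "0 \<le> sat k x" "sat k x \<le> x" "sat k x \<le> k"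
proof -
  have d: "0 < k + x" using assms by simp
  show "0 \<le> sat k x" using assms by (simp add: sat_def)
  have "k * x \<le> x * (k + x)" "k * x \<le> k * (k + x)" using assms by (simp_all add: algebra_simps)
  then show "sat k x \<le> x" "sat k x \<le> k" using d by (simp_all add: sat_def pos_divide_le_eq)
qed

lemma sat_mono:
  assumes "0 < k" "k \<le> l" "0 \<le> x" "x \<le> y"
  shows "sat k x \<le> sat l y"
proof -
  have e: "sat k x = 1 / (1 / k + 1 / x)" if "0 < k" "0 < x" for k x :: real
    using that by (simp add: sat_def field_simps)
  show ?thesis
  proof (cases "x = 0")
    case True
    then show ?thesis using assms sat_bounds(1)[of l y] by (simp add: sat_def)
  next
    case False
    then have "0 < x" "0 < y" "0 < l" using assms by auto
    moreover have "1 / l + 1 / y \<le> 1 / k + 1 / x"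
      using assms \<open>0 < x\<close> by (intro add_mono divide_left_mono) auto
    ultimately show ?thesis using assms(1)
      by (simp only: e) (intro divide_left_mono mult_pos_pos add_pos_pos, auto)
  qed
qed

lemma sat_ge_half:
  assumes "0 < k" "c \<le> k" "c \<le> x" "0 \<le> c"
  shows "c / 2 \<le> sat k x"
proof (cases "c = 0")
  case True
  then show ?thesis using sat_bounds(1)[OF assms(1), of x] assms by simp
next
  case False
  then have "sat c c \<le> sat k x" using assms by (intro sat_mono) auto
  moreover have "sat c c = c / 2" using False by (simp add: sat_def)
  ultimately show ?thesis by simp
qed

lemma sat_scale:
  assumes "0 < k" "0 \<le> x" "0 \<le> c" "c \<le> 1"
  shows "c * sat k x \<le> sat k (c * x)"
proof -
  have "k * (c * x) / (k + x) \<le> k * (c * x) / (k + c * x)"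
  proof (rule divide_left_mono)
    show "k + c * x \<le> k + x" using assms by (simp add: mult_left_le_one_le)
    show "0 \<le> k * (c * x)" using assms by simp
    show "0 < (k + x) * (k + c * x)" using assms by (intro mult_pos_pos add_pos_nonneg) auto
  qed
  then show ?thesis by (simp add: sat_def mult_ac)
qed

text \<open>The defect of additivity due to concavity. A collision conserves the sum of the two
  energies about a centre, so it changes the saturated energy of the pair by the defect after minus
  the defect before.\<close>

definition sat_defect :: "real \<Rightarrow> real \<Rightarrow> real \<Rightarrow> real" where
  "sat_defect k x y = sat k x + sat k y - sat k (x + y)"

text \<open>The defect equals \<open>sat k x * sat k y / k\<close> times the factor
  \<open>r\<close>, which lies between 1 and 2.\<close>

lemma sat_defect_bounds:
  assumes "0 < k" "0 \<le> x" "0 \<le> y"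
  shows "sat k x * sat k y / k \<le> sat_defect k x y" "sat_defect k x y \<le> 2 * (sat k x * sat k y) / k"
proof -
  define r where "r = (2 * k + x + y) / (k + x + y)"
  have d: "0 < k + x" "0 < k + y" "0 < k + x + y" "0 < k + (x + y)" using assms by auto
  have r: "1 \<le> r" "r \<le> 2" using d assms by (simp_all add: r_def field_simps)
  have "sat_defect k x y = (sat k x * sat k y / k) * r"
    using d assms(1) unfolding sat_defect_def sat_def r_def
    by (simp add: divide_simps) (simp add: algebra_simps)
  moreover have "0 \<le> sat k x * sat k y / k"
    using assms sat_bounds(1) by simp
  ultimately show "sat k x * sat k y / k \<le> sat_defect k x y" "sat_defect k x y \<le> 2 * (sat k x * sat k y) / k"
    using mult_left_mono[OF r(1), of "sat k x * sat k y / k"] mult_left_mono[OF r(2), of "sat k x * sat k y / k"]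
    by (simp_all add: mult.commute mult.left_commute)
qed

lemma sat_measurable [measurable]:
  assumes [measurable]: "f \<in> borel_measurable M" "g \<in> borel_measurable M"
  shows "(\<lambda>x. sat (f x) (g x)) \<in> borel_measurable M"
  unfolding sat_def by measurable

lemma sat_defect_measurable [measurable]:
  assumes [measurable]: "f \<in> borel_measurable M" "g \<in> borel_measurable M" "l \<in> borel_measurable M"
  shows "(\<lambda>x. sat_defect (f x) (g x) (l x)) \<in> borel_measurable M"
  unfolding sat_defect_def by measurable

lemma powr_add_le:
  assumes "0 \<le> \<gamma>" "\<gamma> \<le> 1" "0 \<le> x" "0 \<le> (y::real)"
  shows "(x + y) powr \<gamma> \<le> x powr \<gamma> + y powr \<gamma>"
proof (cases "x = 0 \<or> y = 0")
  case False
  then have xy: "0 < x" "0 < y" using assms by auto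
  define s where "s = x + y"
  have s: "0 < s" using xy by (simp add: s_def)
  have p: "t \<le> t powr \<gamma>" if "0 < t" "t \<le> 1" for t :: real
  proof -
    have "t powr 1 \<le> t powr \<gamma>" using that assms by (intro powr_mono') auto
    then show ?thesis using that by simp
  qed
  have "1 = x / s + y / s" using s by (simp add: s_def add_divide_distrib[symmetric])
  also have "\<dots> \<le> (x / s) powr \<gamma> + (y / s) powr \<gamma>"
    using xy s by (intro add_mono p) (auto simp: s_def)
  also have "\<dots> = (x powr \<gamma> + y powr \<gamma>) / s powr \<gamma>"
    using xy s by (simp add: powr_divide add_divide_distrib)
  finally show ?thesis using s by (simp add: s_def[symmetric] pos_le_divide_eq)
qed (use assms in auto)

section \<open>Collisions inside one species, away from the ends of the angular range\<close>

context collision_kernels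
begin

text \<open>For equal masses the outgoing velocities differ from \<open>w\<close> by
  \<open>|v - w|\<close> times the cosine or the sine of the angle. In this window both factors lie
  between \<open>sin \<theta>1\<close> and \<open>cos \<theta>1\<close>.\<close>

definition Hw :: "real \<Rightarrow> nat \<Rightarrow> real \<Rightarrow> real" where
  "Hw \<theta>1 i \<theta> = indicator {\<theta>1..pi/2 - \<theta>1} \<theta> * H i i \<theta>"

lemma Hw_measurable [measurable]: "Hw \<theta>1 i \<in> borel_measurable borel"
  unfolding Hw_def[abs_def] by measurable

lemma Hw_bounds: "0 \<le> Hw \<theta>1 i \<theta>" "Hw \<theta>1 i \<theta> \<le> H i i \<theta>"
  using H_nonneg[of i i \<theta>] by (simp_all add: Hw_def indicator_def)

lemma angle_mass_Hw_mono:
  assumes "a \<le> b"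
  shows "angle_mass (\<lambda>\<theta>. ennreal (Hw b i \<theta>)) \<le> angle_mass (\<lambda>\<theta>. ennreal (Hw a i \<theta>))"
  unfolding angle_mass_def
proof (intro nn_integral_mono mult_left_mono ennreal_leI)
  show "Hw b i \<theta> \<le> Hw a i \<theta>" for \<theta> using assms H_nonneg[of i i \<theta>] by (auto simp: Hw_def indicator_def)
qed simp

text \<open>The windows exhaust the open angular interval. If none had mass, \<open>H i i\<close>
  would vanish almost everywhere, against the positivity of its integral.\<close>

lemma angle_mass_Hw_pos:
  assumes "i \<in> {1..N}"
  shows "\<exists>n. 0 < angle_mass (\<lambda>\<theta>. ennreal (Hw (1 / (real n + 1)) i \<theta>))"
proof (rule ccontr)
  assume "\<not> ?thesis"
  then have z: "angle_mass (\<lambda>\<theta>. ennreal (Hw (1 / (real n + 1)) i \<theta>)) = 0" for n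
    by (simp add: not_less)
  obtain Y where Y: "0 < Y" and eq: "\<And>H. H \<in> borel_measurable borel \<Longrightarrow>
       angle_mass H = Y * (VINT t. H t * ennreal (sin t) * indicator {0..pi/2} t)"
    using angle_mass_eq by metis
  have "AE t in lborel. ennreal (Hw (1 / (real n + 1)) i t) * ennreal (sin t) * indicator {0..pi/2} t = 0" for n
  proof -
    have "(VINT t. ennreal (Hw (1 / (real n + 1)) i t) * ennreal (sin t) * indicator {0..pi/2} t) = 0"
      using z[of n] Y by (auto simp: eq)
    then show ?thesis by (subst (asm) nn_integral_0_iff_AE) auto
  qed
  then have "AE t in lborel. \<forall>n. ennreal (Hw (1 / (real n + 1)) i t) * ennreal (sin t) * indicator {0..pi/2} t = 0"
    by (subst AE_all_countable) blast
  then have "AE t in lborel. H i i t = 0"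
    using AE_lborel_singleton[of "0::real"] AE_lborel_singleton[of "pi/2"]
  proof eventually_elim
    fix t assume *: "\<forall>n. ennreal (Hw (1 / (real n + 1)) i t) * ennreal (sin t) * indicator {0..pi/2} t = 0"
      and t: "t \<noteq> 0" "t \<noteq> pi/2"
    show "H i i t = 0"
    proof (cases "t \<in> {0..pi/2}")
      case False
      then show ?thesis by (auto simp: H_def)
    next
      case True
      then have t': "0 < t" "t < pi/2" using t by auto
      then have "0 < min t (pi/2 - t)" by simp
      then obtain n where n: "inverse (real (Suc n)) < min t (pi/2 - t)" using reals_Archimedean by blast
      then have "t \<in> {1 / (real n + 1)..pi/2 - 1 / (real n + 1)}"
        by (simp add: inverse_eq_divide add.commute)
      moreover have "0 < sin t" using t' by (intro sin_gt_zero) auto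
      ultimately show ?thesis using *[rule_format, of n] True H_nonneg[of i i t]
        by (auto simp: Hw_def)
    qed
  qed
  then have "(\<integral>t. H i i t \<partial>lborel) = 0" by (simp cong: integral_cong_AE add: integral_eq_zero_AE)
  then show False using integral_H_pos[OF assms assms] by simp
qed

text \<open>There are finitely many species, and narrowing \<open>\<theta>1\<close> only enlarges
  the window, so one window and one lower bound serve all of them.\<close>

lemma window:
  obtains \<theta>1 AW where "0 < \<theta>1" "\<theta>1 < pi/4" "0 < AW" "\<And>i. i \<in> {1..N} \<Longrightarrow> ennreal AW \<le> angle_mass (\<lambda>\<theta>. ennreal (Hw \<theta>1 i \<theta>))"
proof -
  obtain n where n: "\<And>i. i \<in> {1..N} \<Longrightarrow> 0 < angle_mass (\<lambda>\<theta>. ennreal (Hw (1 / (real (n i) + 1)) i \<theta>))"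
    using angle_mass_Hw_pos by metis
  define k where "k = Max (insert 1 (n ` {1..N}))"
  have k: "n i \<le> k" if "i \<in> {1..N}" for i unfolding k_def using that by (intro Max_ge) auto
  have k1: "1 \<le> k" by (simp add: k_def)
  define \<theta>1 where "\<theta>1 = 1 / (real k + 1)"
  have pos: "0 < angle_mass (\<lambda>\<theta>. ennreal (Hw \<theta>1 i \<theta>))" if "i \<in> {1..N}" for i
    using n[OF that] angle_mass_Hw_mono[of \<theta>1 "1 / (real (n i) + 1)" i] k[OF that]
    by (simp add: \<theta>1_def frac_le less_le_trans)
  define AW where "AW = Min (insert 1 ((\<lambda>i. enn2real (min 1 (angle_mass (\<lambda>\<theta>. ennreal (Hw \<theta>1 i \<theta>))))) ` {1..N}))"
  show thesis
  proof (rule that)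
    show "0 < \<theta>1" by (simp add: \<theta>1_def)
    have "\<theta>1 \<le> 1/2" using k1 by (simp add: \<theta>1_def field_simps)
    then show "\<theta>1 < pi/4" using pi_gt3 by simp
    show "0 < AW" using pos by (auto simp: AW_def enn2real_positive_iff min_less_iff_disj)
    show "ennreal AW \<le> angle_mass (\<lambda>\<theta>. ennreal (Hw \<theta>1 i \<theta>))" if i: "i \<in> {1..N}" for i
    proof -
      have "AW \<le> enn2real (min 1 (angle_mass (\<lambda>\<theta>. ennreal (Hw \<theta>1 i \<theta>))))"
        unfolding AW_def using i by (intro Min_le) auto
      then have "ennreal AW \<le> ennreal (enn2real (min 1 (angle_mass (\<lambda>\<theta>. ennreal (Hw \<theta>1 i \<theta>)))))" by (rule ennreal_leI)
      also have "\<dots> = min 1 (angle_mass (\<lambda>\<theta>. ennreal (Hw \<theta>1 i \<theta>)))" by (intro ennreal_enn2real) (simp add: min_less_iff_disj)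
      finally show ?thesis by simp
    qed
  qed
qed

lemma ckern_mono: "(\<And>\<theta>. H1 \<theta> \<le> H2 \<theta>) \<Longrightarrow> ckern \<gamma> H1 v w n \<le> ckern \<gamma> H2 v w n"
  by (simp add: ckern_def coll_kernel_def indicator_def mult_right_mono)

text \<open>After an equal mass collision inside the angular window both velocities are comparable to the
  fast incoming one, if the other one is slow.\<close>

lemma window_post_vel:
  assumes mi: "0 < mi" and th: "0 < \<theta>1" "\<theta>1 < pi/4" and n: "norm n = 1"
    and k: "ckern \<gamma> (Hw \<theta>1 i) v w n \<noteq> 0"
    and w: "norm (w - c) \<le> sin \<theta>1 / 4 * norm (v - c)"
  shows "sin \<theta>1 / 2 * norm (v - c) \<le> norm (post_vel mi mi v w n - c)"
    "sin \<theta>1 / 2 * norm (v - c) \<le> norm (post_vel_star mi mi v w n - c)"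
proof -
  define g where "g = v - w"
  define z where "z = norm (v - c)"
  have s: "0 < sin \<theta>1" "sin \<theta>1 \<le> 1" using th by (auto intro!: sin_gt_zero)
  have gn: "0 \<le> g \<bullet> n" and ang: "coll_angle v w n \<in> {\<theta>1..pi/2 - \<theta>1}" and g0: "v \<noteq> w"
    using k by (auto simp: ckern_def coll_kernel_def Hw_def g_def indicator_def split: if_splits)
  define y where "y = (g /\<^sub>R norm g) \<bullet> n"
  have gy: "g \<bullet> n = norm g * y" using g0 by (simp add: y_def g_def)
  have "y \<le> norm (g /\<^sub>R norm g) * norm n" unfolding y_def by (rule norm_cauchy_schwarz)
  then have y1: "y \<le> 1" using n g0 by (simp add: g_def)
  have y0: "0 \<le> y" using gn by (simp add: y_def)
  have ca: "coll_angle v w n = arccos y" by (simp add: coll_angle_def y_def g_def)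
  have cy: "cos (arccos y) = y" using y0 y1 by simp
  have "cos (pi/2 - \<theta>1) \<le> cos (arccos y)"
    using ang th y0 y1 arccos_lbound[of y] by (intro cos_monotone_0_pi_le) (auto simp: ca)
  then have ylo: "sin \<theta>1 \<le> y" unfolding cy by (simp add: cos_diff)
  have "cos (arccos y) \<le> cos \<theta>1"
    using ang th y0 y1 arccos_ubound[of y] by (intro cos_monotone_0_pi_le) (auto simp: ca)
  then have yhi: "y \<le> cos \<theta>1" unfolding cy .
  have "(sin \<theta>1)^2 \<le> 1 - y\<^sup>2"
    using power_mono[OF yhi y0, of 2] sin_cos_squared_add[of \<theta>1] by linarith
  then have ysq: "sin \<theta>1 \<le> sqrt (1 - y\<^sup>2)" by (intro real_le_rsqrt)
  have ng: "norm g \<ge> z - norm (w - c)"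
    using norm_triangle_ineq4[of "v - w" "c - w"] norm_minus_commute[of w c] by (simp add: g_def z_def)
  have wz: "norm (w - c) \<le> sin \<theta>1 / 4 * z" using w by (simp add: z_def)
  have z0: "0 \<le> z" by (simp add: z_def)
  have szz: "sin \<theta>1 * z \<le> z" using s z0 by (simp add: mult_left_le_one_le)
  have ng34: "3/4 * z \<le> norm g" using ng wz szz by simp
  have sng: "3/4 * (sin \<theta>1 * z) \<le> sin \<theta>1 * norm g" using mult_left_mono[OF ng34, of "sin \<theta>1"] s by simp
  have half: "2 * mi / (mi + mi) = 1" using mi by simp
  \<comment> \<open>For equal masses the outgoing velocities are \<open>w\<close> plus the two
    orthogonal components of \<open>g\<close>, along \<open>n\<close> and across it, of lengths
    \<open>norm g * y\<close> and \<open>norm g * sqrt (1 - y^2)\<close>.\<close>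
  have ps: "post_vel_star mi mi v w n - c = (w - c) + (g \<bullet> n) *\<^sub>R n"
    unfolding post_vel_simps half by (simp add: g_def)
  have pv: "post_vel mi mi v w n - c = (w - c) + (g - (g \<bullet> n) *\<^sub>R n)"
    unfolding post_vel_simps half by (simp add: g_def)
  have "norm ((g \<bullet> n) *\<^sub>R n) = norm g * y" using n y0 by (simp add: gy)
  then have a: "sin \<theta>1 * norm g \<le> norm ((g \<bullet> n) *\<^sub>R n)" using mult_right_mono[OF ylo norm_ge_zero[of g]] by (simp add: mult.commute)
  have "(norm (g - (g \<bullet> n) *\<^sub>R n))^2 = (norm g)^2 * (1 - y\<^sup>2)"
    unfolding norm_diff_scaleR_sq[OF n] gy by (simp add: power2_eq_square algebra_simps)
  then have "norm (g - (g \<bullet> n) *\<^sub>R n) = norm g * sqrt (1 - y\<^sup>2)"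
    by (metis abs_norm_cancel real_sqrt_abs real_sqrt_mult)
  then have b: "sin \<theta>1 * norm g \<le> norm (g - (g \<bullet> n) *\<^sub>R n)" using mult_right_mono[OF ysq norm_ge_zero[of g]] by (simp add: mult.commute)
  have tri: "norm x - norm y \<le> norm (y + x)" for x y :: vec
    using norm_triangle_ineq2[of x "- y"] by (simp add: add.commute)
  have "sin \<theta>1 / 2 * z \<le> norm ((w - c) + (g - (g \<bullet> n) *\<^sub>R n))"
    using b sng wz tri[of "g - (g \<bullet> n) *\<^sub>R n" "w - c"] by linarith
  then show "sin \<theta>1 / 2 * norm (v - c) \<le> norm (post_vel mi mi v w n - c)" by (simp add: pv z_def)
  have "sin \<theta>1 / 2 * z \<le> norm ((w - c) + (g \<bullet> n) *\<^sub>R n)"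
    using a sng wz tri[of "(g \<bullet> n) *\<^sub>R n" "w - c"] by linarith
  then show "sin \<theta>1 / 2 * norm (v - c) \<le> norm (post_vel_star mi mi v w n - c)" by (simp add: ps z_def)
qed

end

lemma nn_integral_sphere_multc:
  assumes [measurable]: "F \<in> borel_measurable borel"
  shows "(SINT n. F n * C) = (SINT n. F n) * C"
  by (rule nn_integral_multc) simp

lemma ennreal_plus3: "0 \<le> a \<Longrightarrow> 0 \<le> b \<Longrightarrow> 0 \<le> d \<Longrightarrow> ennreal a + ennreal b + ennreal d = ennreal (a + b + d)"
  by (simp add: ennreal_plus)

lemma nn_integral_product:
  fixes F G :: "'a::euclidean_space \<Rightarrow> ennreal"
  assumes [measurable]: "F \<in> borel_measurable borel" "G \<in> borel_measurable borel"
  shows "(VINT v. VINT w. F v * G w) = (VINT v. F v) * (VINT w. G w)"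
  by (simp add: nn_integral_cmult nn_integral_multc)

section \<open>Production and destruction of saturated energy\<close>

context mixture_flow
begin

lemma ff_measurable [measurable]: "i \<in> {1..N} \<Longrightarrow> ff i t \<in> borel_measurable borel"
  using measurable_compose[OF _ ff_measurable_pair, of "\<lambda>v. (t, v)" borel i] by simp

text \<open>The weak form of the collision operator: the average of \<open>X\<close>, a function of
  all four velocities, over the collisions between species \<open>i\<close> and
  \<open>j\<close>.\<close>

definition pairI :: "real \<Rightarrow> nat \<Rightarrow> nat \<Rightarrow> (vec \<Rightarrow> vec \<Rightarrow> vec \<Rightarrow> vec \<Rightarrow> ennreal) \<Rightarrow> ennreal" where
  "pairI t i j X = (VINT v. VINT w. SINT n. ennreal (ckern \<gamma> (H j i) v w n) * (ennreal (ff i t v) * ennreal (ff j t w) *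
     X v w (post_vel (m i) (m j) v w n) (post_vel_star (m i) (m j) v w n)))"

abbreviation meas4 :: "(vec \<Rightarrow> vec \<Rightarrow> vec \<Rightarrow> vec \<Rightarrow> ennreal) \<Rightarrow> bool" where
  "meas4 X \<equiv> (\<lambda>(v, w, v', w'). X v w v' w') \<in> borel_measurable (borel \<Otimes>\<^sub>M borel \<Otimes>\<^sub>M borel \<Otimes>\<^sub>M borel)"

lemma pairI_add:
  assumes [measurable]: "i \<in> {1..N}" "j \<in> {1..N}" and X: "meas4 X" and Y: "meas4 Y"
  shows "pairI t i j (\<lambda>v w v' w'. X v w v' w' + Y v w v' w') = pairI t i j X + pairI t i j Y"
proof -
  note [measurable] = measurable_case_prod4[OF X] measurable_case_prod4[OF Y]
  let ?A = "\<lambda>v w n. ennreal (ckern \<gamma> (H j i) v w n)" and ?B = "\<lambda>v w. ennreal (ff i t v) * ennreal (ff j t w)"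
  let ?X = "\<lambda>v w n. X v w (post_vel (m i) (m j) v w n) (post_vel_star (m i) (m j) v w n)"
    and ?Y = "\<lambda>v w n. Y v w (post_vel (m i) (m j) v w n) (post_vel_star (m i) (m j) v w n)"
  have "pairI t i j (\<lambda>v w v' w'. X v w v' w' + Y v w v' w')
    = (VINT v. VINT w. (SINT n. ?A v w n * (?B v w * ?X v w n)) + (SINT n. ?A v w n * (?B v w * ?Y v w n)))"
    unfolding pairI_def distrib_left by (intro nn_integral_cong nn_integral_add) measurable
  also have "\<dots> = (VINT v. (VINT w. SINT n. ?A v w n * (?B v w * ?X v w n)) + (VINT w. SINT n. ?A v w n * (?B v w * ?Y v w n)))"
    by (intro nn_integral_cong nn_integral_add) measurable
  also have "\<dots> = pairI t i j X + pairI t i j Y"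
    unfolding pairI_def by (rule nn_integral_add) measurable
  finally show ?thesis .
qed

lemma pairI_swap:
  assumes [measurable]: "i \<in> {1..N}" "j \<in> {1..N}" and X: "meas4 X"
  shows "pairI t i j X = pairI t j i (\<lambda>v w v' w'. X w v w' v')"
proof -
  note [measurable] = measurable_case_prod4[OF X]
  have "pairI t i j X = (VINT v. VINT w. SINT n. ennreal (ckern \<gamma> (H j i) v w n) *
    (\<lambda>v w v' w'. ennreal (ff i t v) * ennreal (ff j t w) * X v w v' w') v w (post_vel (m i) (m j) v w n) (post_vel_star (m i) (m j) v w n))"
    by (simp add: pairI_def)
  also have "\<dots> = (VINT v. VINT w. SINT n. ennreal (ckern \<gamma> (H j i) v w n) *
    (\<lambda>v w v' w'. ennreal (ff i t v) * ennreal (ff j t w) * X v w v' w') w v (post_vel_star (m j) (m i) v w n) (post_vel (m j) (m i) v w n))"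
    by (rule triple_integral_swap) measurable
  also have "\<dots> = pairI t j i (\<lambda>v w v' w'. X w v w' v')"
    unfolding pairI_def H_sym[of i j] by (simp add: mult.commute mult.left_commute)
  finally show ?thesis .
qed

lemma pairI_mono:
  assumes ij: "i \<in> {1..N}" "j \<in> {1..N}"
    and le: "\<And>v w v' w'. m i * (norm (v' - c))^2 + m j * (norm (w' - c))^2 = m i * (norm (v - c))^2 + m j * (norm (w - c))^2 \<Longrightarrow> X v w v' w' \<le> Y v w v' w'"
  shows "pairI t i j X \<le> pairI t i j Y"
  unfolding pairI_def
  by (rule nn_integral_mono, rule nn_integral_mono, rule nn_integral_mono_AE, rule eventually_mono[OF AE_sphere_measure_norm])
     (intro mult_left_mono le post_vel_energy mass_pos ij, auto)

lemma pairI_gain: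
  assumes ij: "i \<in> {1..N}" "j \<in> {1..N}" and [measurable]: "G \<in> borel_measurable borel"
  shows "(VINT v. G v * gn j i t v) = pairI t i j (\<lambda>v w v' w'. G v')"
proof -
  note [measurable] = ff_measurable[OF ij(1)] ff_measurable[OF ij(2)]
  show ?thesis unfolding pairI_def
    by (rule nn_integral_gain[OF mass_pos[OF ij(1)] mass_pos[OF ij(2)] H_nonneg]) measurable
qed

lemma pairI_loss:
  assumes ij: "i \<in> {1..N}" "j \<in> {1..N}" and [measurable]: "G \<in> borel_measurable borel"
  shows "(VINT v. G v * (ennreal (ff i t v) * freq j i t v)) = pairI t i j (\<lambda>v w v' w'. G v)"
proof -
  note [measurable] = ff_measurable[OF ij(1)] ff_measurable[OF ij(2)]
  show ?thesis unfolding pairI_def freq_def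
    by (simp add: nn_integral_cmult[symmetric] mult.commute mult.left_commute)
qed

text \<open>Pointwise this is \<open>S' + S'_* + D = S + S_* + D'\<close>, primes being
  post-collisional: the energy about \<open>c\<close> is conserved, so the saturated total energy
  cancels. Exchanging the two particles produces the factors 2. Nothing is subtracted because the
  integrals may be infinite.\<close>

lemma balance:
  fixes c :: vec and k t :: real
  assumes k: "0 < k"
  defines "S \<equiv> \<lambda>i v. ennreal (sat k (m i * (norm (v - c))^2))"
    and "D \<equiv> \<lambda>i j v w. ennreal (sat_defect k (m i * (norm (v - c))^2) (m j * (norm (w - c))^2))"
  shows "2 * (\<Sum>i\<in>{1..N}. \<Sum>j\<in>{1..N}. (VINT v. S i v * gn j i t v)) + (\<Sum>i\<in>{1..N}. \<Sum>j\<in>{1..N}. pairI t i j (\<lambda>v w v' w'. D i j v w))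
    = 2 * (\<Sum>i\<in>{1..N}. \<Sum>j\<in>{1..N}. (VINT v. S i v * (ennreal (ff i t v) * freq j i t v))) + (\<Sum>i\<in>{1..N}. \<Sum>j\<in>{1..N}. pairI t i j (\<lambda>v w v' w'. D i j v' w'))"
proof -
  let ?I = "{1..N}"
  have Sm [measurable]: "S i \<in> borel_measurable borel" for i unfolding S_def by measurable
  have Dm [measurable]: "(\<lambda>x. D i j (f1 x) (f2 x)) \<in> borel_measurable A"
    if [measurable]: "f1 \<in> borel_measurable A" "f2 \<in> borel_measurable A" for i j f1 f2 and A :: "'z measure"
    unfolding D_def by measurable
  have 1: "(\<Sum>i\<in>?I. \<Sum>j\<in>?I. pairI t i j (\<lambda>v w v' w'. S i v')) = (\<Sum>i\<in>?I. \<Sum>j\<in>?I. pairI t i j (\<lambda>v w v' w'. S j w'))"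
    by (subst sum.swap) (intro sum.cong refl pairI_swap, measurable)
  have 2: "(\<Sum>i\<in>?I. \<Sum>j\<in>?I. pairI t i j (\<lambda>v w v' w'. S i v)) = (\<Sum>i\<in>?I. \<Sum>j\<in>?I. pairI t i j (\<lambda>v w v' w'. S j w))"
    by (subst sum.swap) (intro sum.cong refl pairI_swap, measurable)
  have eg: "(\<Sum>i\<in>?I. \<Sum>j\<in>?I. (VINT v. S i v * gn j i t v)) = (\<Sum>i\<in>?I. \<Sum>j\<in>?I. pairI t i j (\<lambda>v w v' w'. S i v'))"
    by (intro sum.cong refl pairI_gain Sm)
  have el: "(\<Sum>i\<in>?I. \<Sum>j\<in>?I. (VINT v. S i v * (ennreal (ff i t v) * freq j i t v))) = (\<Sum>i\<in>?I. \<Sum>j\<in>?I. pairI t i j (\<lambda>v w v' w'. S i v))"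
    by (intro sum.cong refl pairI_loss Sm)
  have "2 * (\<Sum>i\<in>?I. \<Sum>j\<in>?I. (VINT v. S i v * gn j i t v)) + (\<Sum>i\<in>?I. \<Sum>j\<in>?I. pairI t i j (\<lambda>v w v' w'. D i j v w))
    = (\<Sum>i\<in>?I. \<Sum>j\<in>?I. pairI t i j (\<lambda>v w v' w'. S i v')) + (\<Sum>i\<in>?I. \<Sum>j\<in>?I. pairI t i j (\<lambda>v w v' w'. S j w')) + (\<Sum>i\<in>?I. \<Sum>j\<in>?I. pairI t i j (\<lambda>v w v' w'. D i j v w))"
    by (simp only: eg mult_2 1[symmetric])
  also have "\<dots> = (\<Sum>i\<in>?I. \<Sum>j\<in>?I. pairI t i j (\<lambda>v w v' w'. S i v' + S j w' + D i j v w))"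
    unfolding sum.distrib[symmetric] by (intro sum.cong refl) (subst pairI_add, simp, simp, measurable, subst pairI_add, simp, simp, measurable)
  also have "\<dots> = (\<Sum>i\<in>?I. \<Sum>j\<in>?I. pairI t i j (\<lambda>v w v' w'. S i v + S j w + D i j v' w'))"
  proof (intro sum.cong refl)
    fix i j assume ij: "i \<in> ?I" "j \<in> ?I"
    have eq: "S i v' + S j w' + D i j v w = S i v + S j w + D i j v' w'"
      if "m i * (norm (v' - c))^2 + m j * (norm (w' - c))^2 = m i * (norm (v - c))^2 + m j * (norm (w - c))^2" for v w v' w' :: vec
    proof -
      have p: "0 \<le> m i * (norm (v - c))^2" "0 \<le> m j * (norm (v - c))^2" for v
        using mass_pos[OF ij(1)] mass_pos[OF ij(2)] by simp_all
      have D0: "0 \<le> sat_defect k (m i * (norm (v - c))^2) (m j * (norm (w - c))^2)" for v w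
      proof -
        have "0 \<le> sat k (m i * (norm (v - c))^2) * sat k (m j * (norm (w - c))^2) / k" using k p sat_bounds(1) by simp
        then show ?thesis using sat_defect_bounds(1)[OF k p(1)[of v] p(2)[of w]] by linarith
      qed
      have S0: "0 \<le> sat k (m i * (norm (v - c))^2)" "0 \<le> sat k (m j * (norm (v - c))^2)" for v
        using k p sat_bounds(1) by simp_all
      show ?thesis unfolding S_def D_def
        unfolding ennreal_plus3[OF S0(1) S0(2) D0] unfolding sat_defect_def that
        by (rule arg_cong[where f=ennreal]) simp
    qed
    show "pairI t i j (\<lambda>v w v' w'. S i v' + S j w' + D i j v w) = pairI t i j (\<lambda>v w v' w'. S i v + S j w + D i j v' w')"
      by (rule antisym) (rule pairI_mono[OF ij, where c=c], simp add: eq)+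
  qed
  also have "\<dots> = (\<Sum>i\<in>?I. \<Sum>j\<in>?I. pairI t i j (\<lambda>v w v' w'. S i v)) + (\<Sum>i\<in>?I. \<Sum>j\<in>?I. pairI t i j (\<lambda>v w v' w'. S j w)) + (\<Sum>i\<in>?I. \<Sum>j\<in>?I. pairI t i j (\<lambda>v w v' w'. D i j v' w'))"
    unfolding sum.distrib[symmetric] by (intro sum.cong refl) (subst pairI_add, simp, simp, measurable, subst pairI_add, simp, simp, measurable)
  also have "\<dots> = 2 * (\<Sum>i\<in>?I. \<Sum>j\<in>?I. (VINT v. S i v * (ennreal (ff i t v) * freq j i t v))) + (\<Sum>i\<in>?I. \<Sum>j\<in>?I. pairI t i j (\<lambda>v w v' w'. D i j v' w'))"
    by (simp only: el mult_2 2[symmetric])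
  finally show ?thesis .
qed

definition Ec :: "real \<Rightarrow> real" where "Ec R = 2 * (E + R^2 * M)"

lemma Ec_pos: "0 < Ec R"
  using E_pos M_pos by (simp add: Ec_def add_pos_nonneg)

lemma energy_centre:
  assumes i: "i \<in> {1..N}" and t: "0 \<le> t" and c: "norm c \<le> R"
  shows "(VINT v. ennreal (ff i t v) * ennreal ((norm (v - c))^2)) \<le> ennreal (Ec R)"
proof -
  note [measurable] = f_measurable[OF i t]
  have "(VINT v. ennreal (ff i t v) * ennreal ((norm (v - c))^2))
    \<le> (VINT v. 2 * (ennreal (f i t v) * ennreal ((norm v)^2)) + ennreal (2 * R^2) * ennreal (f i t v))"
  proof (rule nn_integral_mono)
    fix v :: vec
    have "norm (v - c) \<le> norm v + norm c" by (rule norm_triangle_ineq4)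
    then have "(norm (v - c))^2 \<le> (norm v + norm c)^2" by (intro power_mono) auto
    also have "\<dots> \<le> 2 * (norm v)^2 + 2 * (norm c)^2"
      using sum_squares_bound[of "norm v" "norm c"] by (simp add: power2_sum)
    also have "(norm c)^2 \<le> R^2" using c by (intro power_mono) auto
    finally have "(norm (v - c))^2 \<le> 2 * (norm v)^2 + 2 * R^2" by simp
    then have "f i t v * (norm (v - c))^2 \<le> f i t v * (2 * (norm v)^2 + 2 * R^2)"
      using f_nonneg[OF i t] by (rule mult_left_mono)
    also have "\<dots> = 2 * (f i t v * (norm v)^2) + (2 * R^2) * f i t v" by (simp add: algebra_simps)
    finally have "ennreal (f i t v * (norm (v - c))^2) \<le> ennreal (2 * (f i t v * (norm v)^2) + (2 * R^2) * f i t v)" by (rule ennreal_leI)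
    then show "ennreal (ff i t v) * ennreal ((norm (v - c))^2)
       \<le> 2 * (ennreal (f i t v) * ennreal ((norm v)^2)) + ennreal (2 * R^2) * ennreal (f i t v)"
      using f_nonneg[OF i t] by (simp add: ff_eq[OF t] ennreal_mult ennreal_plus)
  qed
  also have "\<dots> = 2 * (VINT v. ennreal (f i t v) * ennreal ((norm v)^2)) + ennreal (2 * R^2) * (VINT v. ennreal (f i t v))"
    by (subst nn_integral_add, measurable, subst nn_integral_cmult, measurable, subst nn_integral_cmult, measurable)
  also have "\<dots> \<le> 2 * ennreal E + ennreal (2 * R^2) * ennreal M"
    by (intro add_mono mult_left_mono nn_integral_f_le i t) auto
  also have "\<dots> = ennreal (Ec R)"
    using E_pos M_pos by (simp add: Ec_def ennreal_mult ennreal_plus distrib_left mult.assoc)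
  finally show ?thesis .
qed

lemma nn_integral_mass_ge:
  assumes i: "i \<in> {1..N}" and t: "0 \<le> t"
  shows "ennreal \<delta> \<le> (VINT v. ennreal (ff i t v))"
  using integrable_f(1)[OF i t] f_nonneg[OF i t] mass_ge[OF i t]
  by (simp add: ff_eq[OF t] nn_integral_eq_integral ennreal_leI)

text \<open>Chebyshev's inequality: the mass farther than \<open>r\<close> from \<open>c\<close> is
  at most \<open>Ec R / r^2\<close>, hence at most half of \<open>\<delta>\<close>.\<close>

lemma near_mass:
  assumes i: "i \<in> {1..N}" and t: "0 \<le> t" and c: "norm c \<le> R" and r: "0 < r" "2 * Ec R \<le> \<delta> * r^2"
  shows "ennreal (\<delta> / 2) \<le> (VINT v. ennreal (ff i t v) * indicator {v. norm (v - c) \<le> r} v)"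
proof -
  note [measurable] = f_measurable[OF i t] ff_measurable[OF i]
  let ?F = "\<lambda>v. ennreal (ff i t v)" and ?A = "{v. norm (v - c) \<le> r}"
  have [measurable]: "?A \<in> sets borel" by measurable
  have far: "(VINT v. ?F v * indicator (- ?A) v) \<le> ennreal (\<delta> / 2)"
  proof -
    have "(VINT v. ?F v * indicator (- ?A) v) \<le> (VINT v. ennreal (1 / r^2) * (?F v * ennreal ((norm (v - c))^2)))"
    proof (rule nn_integral_mono)
      fix v
      show "?F v * indicator (- ?A) v \<le> ennreal (1 / r^2) * (?F v * ennreal ((norm (v - c))^2))"
      proof (cases "v \<in> ?A")
        case False
        then have "r^2 \<le> (norm (v - c))^2" using r by (intro power_mono) auto
        then have "1 \<le> 1 / r^2 * (norm (v - c))^2" using r by (simp add: field_simps)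
        then have "ennreal 1 \<le> ennreal (1 / r^2 * (norm (v - c))^2)" by (rule ennreal_leI)
        also have "\<dots> = ennreal (1 / r^2) * ennreal ((norm (v - c))^2)" by (intro ennreal_mult) auto
        finally have "?F v * 1 \<le> ?F v * (ennreal (1 / r^2) * ennreal ((norm (v - c))^2))" by (intro mult_left_mono) auto
        then have *: "?F v * 1 \<le> ennreal (1 / r^2) * (?F v * ennreal ((norm (v - c))^2))" by (simp only: mult.left_commute)
        have "indicator (- ?A) v = (1 :: ennreal)" using False by simp
        then show ?thesis by (simp only: *)
      qed simp
    qed
    also have "\<dots> = ennreal (1 / r^2) * (VINT v. ?F v * ennreal ((norm (v - c))^2))"
      by (rule nn_integral_cmult) measurable
    also have "\<dots> \<le> ennreal (1 / r^2) * ennreal (Ec R)"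
      by (intro mult_left_mono energy_centre i t c) auto
    also have "\<dots> \<le> ennreal (\<delta> / 2)"
      using r Ec_pos[of R] by (simp add: ennreal_mult[symmetric] field_simps ennreal_leI)
    finally show ?thesis .
  qed
  have "ennreal \<delta> \<le> (VINT v. ?F v)" by (rule nn_integral_mass_ge[OF i t])
  also have "\<dots> = (VINT v. ?F v * indicator ?A v + ?F v * indicator (- ?A) v)"
    by (intro nn_integral_cong) (auto simp: indicator_def)
  also have "\<dots> = (VINT v. ?F v * indicator ?A v) + (VINT v. ?F v * indicator (- ?A) v)"
    by (rule nn_integral_add) measurable
  also have "\<dots> \<le> (VINT v. ?F v * indicator ?A v) + ennreal (\<delta> / 2)"
    by (intro add_left_mono far)
  finally have "ennreal (\<delta> / 2) + ennreal (\<delta> / 2) \<le> (VINT v. ?F v * indicator ?A v) + ennreal (\<delta> / 2)"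
    using delta_pos by (simp add: ennreal_plus[symmetric])
  then show ?thesis by (simp add: ennreal_add_left_cancel_le add.commute)
qed

definition Etot :: "real \<Rightarrow> real" where "Etot R = (\<Sum>i\<in>{1..N}. m i * Ec R)"

lemma Etot_nonneg: "0 \<le> Etot R"
  unfolding Etot_def using mass_pos Ec_pos[of R] by (intro sum_nonneg mult_nonneg_nonneg) (auto intro: less_imp_le)

lemma sum_sat_le:
  assumes k: "0 < k" and t: "0 \<le> t" and c: "norm c \<le> R"
  shows "(\<Sum>i\<in>{1..N}. (VINT v. ennreal (ff i t v) * ennreal (sat k (m i * (norm (v - c))^2)))) \<le> ennreal (Etot R)"
proof -
  have "(VINT v. ennreal (ff i t v) * ennreal (sat k (m i * (norm (v - c))^2))) \<le> ennreal (m i * Ec R)" if i: "i \<in> {1..N}" for i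
  proof -
    note [measurable] = ff_measurable[OF i]
    have mi: "0 \<le> m i" using mass_pos[OF i] by simp
    have "(VINT v. ennreal (ff i t v) * ennreal (sat k (m i * (norm (v - c))^2)))
      \<le> (VINT v. ennreal (m i) * (ennreal (ff i t v) * ennreal ((norm (v - c))^2)))"
    proof (rule nn_integral_mono)
      fix v
      have "ennreal (sat k (m i * (norm (v - c))^2)) \<le> ennreal (m i * (norm (v - c))^2)"
        using sat_bounds(2)[OF k, of "m i * (norm (v - c))^2"] mi by (intro ennreal_leI) auto
      also have "\<dots> = ennreal (m i) * ennreal ((norm (v - c))^2)" using mi by (intro ennreal_mult) auto
      finally have "ennreal (ff i t v) * ennreal (sat k (m i * (norm (v - c))^2)) \<le> ennreal (ff i t v) * (ennreal (m i) * ennreal ((norm (v - c))^2))"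
        by (rule mult_left_mono) simp
      then show "ennreal (ff i t v) * ennreal (sat k (m i * (norm (v - c))^2)) \<le> ennreal (m i) * (ennreal (ff i t v) * ennreal ((norm (v - c))^2))"
        by (simp only: mult.left_commute)
    qed
    also have "\<dots> = ennreal (m i) * (VINT v. ennreal (ff i t v) * ennreal ((norm (v - c))^2))"
      by (rule nn_integral_cmult) measurable
    also have "\<dots> \<le> ennreal (m i) * ennreal (Ec R)" by (intro mult_left_mono energy_centre i t c) auto
    finally show ?thesis using mi Ec_pos[of R] by (simp add: ennreal_mult)
  qed
  then have "(\<Sum>i\<in>{1..N}. (VINT v. ennreal (ff i t v) * ennreal (sat k (m i * (norm (v - c))^2)))) \<le> (\<Sum>i\<in>{1..N}. ennreal (m i * Ec R))"
    by (rule sum_mono)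
  also have "\<dots> = ennreal (Etot R)"
    unfolding Etot_def using mass_pos Ec_pos[of R] by (intro sum_ennreal mult_nonneg_nonneg) (auto intro: less_imp_le)
  finally show ?thesis .
qed

text \<open>The defect is at most \<open>2 S S_* / k\<close>, and the kernel splits by
  \<open>|v - w|^\<gamma> \<le> |v - c|^\<gamma> + |w - c|^\<gamma>\<close>. The particle left
  without a weight integrates to at most \<open>Etot R\<close>. The result is linear in
  \<open>S\<close>; the other factor 2 comes from the symmetry.\<close>

lemma defect_loss:
  assumes k: "0 < k" and t: "0 \<le> t" and c: "norm c \<le> R"
  shows "(\<Sum>i\<in>{1..N}. \<Sum>j\<in>{1..N}. pairI t i j (\<lambda>v w v' w'. ennreal (sat_defect k (m i * (norm (v - c))^2) (m j * (norm (w - c))^2))))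
   \<le> (\<Sum>i\<in>{1..N}. (VINT v. ennreal (ff i t v) * ennreal (4 * CA * Etot R / k * (norm (v - c) powr \<gamma> * sat k (m i * (norm (v - c))^2)))))"
proof -
  let ?I = "{1..N}"
  define S where "S i v = sat k (m i * (norm (v - c))^2)" for i and v :: vec
  define P where "P i v = ennreal (ff i t v) * ennreal (S i v)" for i v
  define Q where "Q i v = ennreal (norm (v - c) powr \<gamma>) * P i v" for i v
  have S0: "0 \<le> S i v" if "i \<in> ?I" for i v
    unfolding S_def using mass_pos[OF that] by (intro sat_bounds(1) k mult_nonneg_nonneg) auto
  have [measurable]: "S i \<in> borel_measurable borel" for i unfolding S_def by measurable
  have Pm [measurable]: "P i \<in> borel_measurable borel" if "i \<in> ?I" for i
    unfolding P_def using ff_measurable[OF that] by measurable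
  have Qm [measurable]: "Q i \<in> borel_measurable borel" if "i \<in> ?I" for i
    unfolding Q_def using Pm[OF that] by measurable
  define C where "C = ennreal (2 * CA / k)"
  have one: "pairI t i j (\<lambda>v w v' w'. ennreal (sat_defect k (m i * (norm (v - c))^2) (m j * (norm (w - c))^2)))
     \<le> C * ((VINT v. Q i v) * (VINT w. P j w) + (VINT v. P i v) * (VINT w. Q j w))"
    if ij: "i \<in> ?I" "j \<in> ?I" for i j
  proof -
    note [measurable] = Pm[OF ij(1)] Pm[OF ij(2)] Qm[OF ij(1)] Qm[OF ij(2)]
    have "pairI t i j (\<lambda>v w v' w'. ennreal (sat_defect k (m i * (norm (v - c))^2) (m j * (norm (w - c))^2)))
      \<le> (VINT v. VINT w. C * (Q i v * P j w + P i v * Q j w))"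
      unfolding pairI_def
    proof (intro nn_integral_mono)
      fix v w
      let ?D = "sat_defect k (m i * (norm (v - c))^2) (m j * (norm (w - c))^2)"
      have "(SINT n. ennreal (ckern \<gamma> (H j i) v w n) * (ennreal (ff i t v) * ennreal (ff j t w) * ennreal ?D))
        = (SINT n. ennreal (ckern \<gamma> (H j i) v w n)) * (ennreal (ff i t v) * ennreal (ff j t w) * ennreal ?D)"
        by (rule nn_integral_sphere_multc) measurable
      also have "\<dots> \<le> (ennreal CA * (ennreal (norm (v - c) powr \<gamma>) + ennreal (norm (w - c) powr \<gamma>))) * (ennreal (ff i t v) * ennreal (ff j t w) * (ennreal (2 / k) * (ennreal (S i v) * ennreal (S j w))))"
      proof (intro mult_mono)
        have "norm (v - w) powr \<gamma> \<le> (norm (v - c) + norm (w - c)) powr \<gamma>"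
          using gamma norm_triangle_ineq4[of "v - c" "w - c"] by (intro powr_mono2) auto
        also have "\<dots> \<le> norm (v - c) powr \<gamma> + norm (w - c) powr \<gamma>"
          using gamma by (intro powr_add_le) auto
        finally have "ennreal (norm (v - w) powr \<gamma>) \<le> ennreal (norm (v - c) powr \<gamma> + norm (w - c) powr \<gamma>)" by (rule ennreal_leI)
        then have "ennreal CA * ennreal (norm (v - w) powr \<gamma>) \<le> ennreal CA * (ennreal (norm (v - c) powr \<gamma>) + ennreal (norm (w - c) powr \<gamma>))"
          by (intro mult_left_mono) (auto simp: ennreal_plus)
        then show "(SINT n. ennreal (ckern \<gamma> (H j i) v w n)) \<le> ennreal CA * (ennreal (norm (v - c) powr \<gamma>) + ennreal (norm (w - c) powr \<gamma>))"
          using nn_integral_ckern_le[of j i v w] by (rule order_trans[rotated])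
        have "?D \<le> 2 * (S i v * S j w) / k"
          unfolding S_def using mass_pos[OF ij(1)] mass_pos[OF ij(2)] by (intro sat_defect_bounds(2) k mult_nonneg_nonneg) auto
        also have "\<dots> = 2 / k * (S i v * S j w)" by simp
        finally have "ennreal ?D \<le> ennreal (2 / k * (S i v * S j w))" by (rule ennreal_leI)
        also have "\<dots> = ennreal (2 / k) * (ennreal (S i v) * ennreal (S j w))"
          using k S0[OF ij(1)] S0[OF ij(2)] by (subst ennreal_mult, simp, simp, subst ennreal_mult) auto
        finally show "ennreal ?D \<le> ennreal (2 / k) * (ennreal (S i v) * ennreal (S j w))" .
      qed auto
      also have "\<dots> = (ennreal CA * ennreal (2 / k)) * (Q i v * P j w + P i v * Q j w)"
        by (simp add: P_def Q_def distrib_left distrib_right mult_ac)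
      also have "ennreal CA * ennreal (2 / k) = C" using CA_pos k by (simp add: C_def ennreal_mult[symmetric] mult.commute)
      finally show "(SINT n. ennreal (ckern \<gamma> (H j i) v w n) * (ennreal (ff i t v) * ennreal (ff j t w) * ennreal ?D))
        \<le> C * (Q i v * P j w + P i v * Q j w)" .
    qed
    also have "\<dots> = C * ((VINT v. VINT w. Q i v * P j w) + (VINT v. VINT w. P i v * Q j w))"
    proof -
      have "(VINT v. VINT w. C * (Q i v * P j w + P i v * Q j w)) = (VINT v. C * (VINT w. Q i v * P j w + P i v * Q j w))"
        by (intro nn_integral_cong nn_integral_cmult) measurable
      also have "\<dots> = C * (VINT v. VINT w. Q i v * P j w + P i v * Q j w)"
        by (rule nn_integral_cmult) measurable
      also have "(VINT v. VINT w. Q i v * P j w + P i v * Q j w) = (VINT v. (VINT w. Q i v * P j w) + (VINT w. P i v * Q j w))"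
        by (intro nn_integral_cong nn_integral_add) measurable
      also have "\<dots> = (VINT v. VINT w. Q i v * P j w) + (VINT v. VINT w. P i v * Q j w)"
        by (rule nn_integral_add) measurable
      finally show ?thesis .
    qed
    finally show ?thesis by (simp only: nn_integral_product[OF Qm[OF ij(1)] Pm[OF ij(2)]] nn_integral_product[OF Pm[OF ij(1)] Qm[OF ij(2)]])
  qed
  let ?q = "\<lambda>i. (VINT v. Q i v)" and ?p = "\<lambda>i. (VINT v. P i v)"
  have "(\<Sum>i\<in>?I. \<Sum>j\<in>?I. pairI t i j (\<lambda>v w v' w'. ennreal (sat_defect k (m i * (norm (v - c))^2) (m j * (norm (w - c))^2))))
    \<le> (\<Sum>i\<in>?I. \<Sum>j\<in>?I. C * (?q i * ?p j + ?p i * ?q j))"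
    by (intro sum_mono one) auto
  also have "\<dots> = C * ((\<Sum>i\<in>?I. ?q i) * (\<Sum>j\<in>?I. ?p j) + (\<Sum>i\<in>?I. ?p i) * (\<Sum>j\<in>?I. ?q j))"
    by (simp add: sum_distrib_left[symmetric] sum.distrib sum_product)
  also have "\<dots> = (\<Sum>i\<in>?I. ?q i) * (2 * C * (\<Sum>j\<in>?I. ?p j))"
    by (simp add: mult_2 distrib_left distrib_right mult_ac)
  also have "\<dots> \<le> (\<Sum>i\<in>?I. ?q i) * (2 * C * ennreal (Etot R))"
    using sum_sat_le[OF k t c] by (intro mult_left_mono) (auto simp: P_def S_def)
  also have "2 * C * ennreal (Etot R) = ennreal (4 * CA * Etot R / k)"
    using CA_pos k Etot_nonneg[of R] by (simp add: C_def ennreal_mult[symmetric] ennreal_numeral[symmetric] del: ennreal_numeral)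
  also have "(\<Sum>i\<in>?I. ?q i) * ennreal (4 * CA * Etot R / k) = (\<Sum>i\<in>?I. (VINT v. ennreal (4 * CA * Etot R / k) * Q i v))"
    unfolding sum_distrib_right
  proof (intro sum.cong refl)
    fix i assume "i \<in> ?I"
    then show "?q i * ennreal (4 * CA * Etot R / k) = (VINT v. ennreal (4 * CA * Etot R / k) * Q i v)"
      using Qm[of i] by (subst nn_integral_cmult) (auto simp: mult.commute)
  qed
  also have "\<dots> = (\<Sum>i\<in>?I. (VINT v. ennreal (ff i t v) * ennreal (4 * CA * Etot R / k * (norm (v - c) powr \<gamma> * S i v))))"
  proof (intro sum.cong refl nn_integral_cong)
    fix i v assume i: "i \<in> ?I"
    have "0 \<le> 4 * CA * Etot R / k" using CA_pos k Etot_nonneg[of R] by simp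
    then show "ennreal (4 * CA * Etot R / k) * Q i v = ennreal (ff i t v) * ennreal (4 * CA * Etot R / k * (norm (v - c) powr \<gamma> * S i v))"
      using S0[OF i] by (simp only: Q_def P_def ennreal_mult mult_nonneg_nonneg powr_ge_zero mult_ac)
  qed
  finally show ?thesis unfolding S_def .
qed

text \<open>Only collisions of a fast particle with a slow one of its own species, inside the
  angular window, are kept. Both outgoing particles are then fast, so the defect is at least a
  multiple of \<open>S^2 / k\<close>, and \<open>near_mass\<close> provides slow partners of mass
  \<open>\<delta> / 2\<close>. Being quadratic in \<open>S\<close>, this beats the linear loss where
  \<open>S\<close> is large.\<close>

lemma defect_gain:
  assumes k: "0 < k" and t: "0 \<le> t" and c: "norm c \<le> R" and i: "i \<in> {1..N}"
    and th: "0 < \<theta>1" "\<theta>1 < pi/4" and AW: "0 < AW" "ennreal AW \<le> angle_mass (\<lambda>\<theta>. ennreal (Hw \<theta>1 i \<theta>))"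
    and Z: "0 < Z" "2 * Ec R \<le> \<delta> * (sin \<theta>1 / 4 * Z)^2"
  shows "(VINT v. ennreal (ff i t v) * ennreal (((sin \<theta>1 / 2)^2)^2 * AW * \<delta> / 4 / k * (indicator {Z..} (norm (v - c)) * norm (v - c) powr \<gamma> * (sat k (m i * (norm (v - c))^2))^2)))
   \<le> pairI t i i (\<lambda>v w v' w'. ennreal (sat_defect k (m i * (norm (v' - c))^2) (m i * (norm (w' - c))^2)))"
proof -
  note [measurable] = ff_measurable[OF i]
  have mi: "0 < m i" by (rule mass_pos[OF i])
  have s: "0 < sin \<theta>1" "sin \<theta>1 \<le> 1" using th by (auto intro!: sin_gt_zero)
  define c2 where "c2 = (sin \<theta>1 / 2)^2"
  have c2: "0 < c2" "c2 \<le> 1" using s(1) power_le_one[of "sin \<theta>1 / 2" 2] order_trans[OF s(2), of 2] by (auto simp: c2_def)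
  define S where "S v = sat k (m i * (norm (v - c))^2)" for v
  have S0: "0 \<le> S v" for v unfolding S_def using mi by (intro sat_bounds(1) k) auto
  have [measurable]: "S \<in> borel_measurable borel" unfolding S_def by measurable
  define near where "near v w = (indicator {w. norm (w - c) \<le> sin \<theta>1 / 4 * norm (v - c)} w :: ennreal)" for v w
  show ?thesis unfolding pairI_def
  proof (rule nn_integral_mono)
    fix v
    let ?D = "\<lambda>w n. sat_defect k (m i * (norm (post_vel (m i) (m i) v w n - c))^2) (m i * (norm (post_vel_star (m i) (m i) v w n - c))^2)"
    show "ennreal (ff i t v) * ennreal (((sin \<theta>1 / 2)^2)^2 * AW * \<delta> / 4 / k * (indicator {Z..} (norm (v - c)) * norm (v - c) powr \<gamma> * (sat k (m i * (norm (v - c))^2))^2))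
      \<le> (VINT w. SINT n. ennreal (ckern \<gamma> (H i i) v w n) * (ennreal (ff i t v) * ennreal (ff i t w) * ennreal (?D w n)))"
    proof (cases "Z \<le> norm (v - c)")
      case False
      then show ?thesis by simp
    next
      case True
      define z where "z = norm (v - c)"
      have z: "0 < z" "Z \<le> z" using True Z by (auto simp: z_def)
      define L where "L = z powr \<gamma> / 2 * AW * (c2 * S v)^2 / k"
      have L0: "0 \<le> L" using AW k by (simp add: L_def)
      have [measurable]: "near v \<in> borel_measurable borel" unfolding near_def by measurable
      have inner: "ennreal (ff i t v) * ennreal L * (ennreal (ff i t w) * near v w)
        \<le> (SINT n. ennreal (ckern \<gamma> (H i i) v w n) * (ennreal (ff i t v) * ennreal (ff i t w) * ennreal (?D w n)))" for w
      proof (cases "norm (w - c) \<le> sin \<theta>1 / 4 * z")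
        case False
        then show ?thesis by (simp add: near_def z_def)
      next
        case w: True
        have n1: "near v w = 1" using w by (simp add: near_def z_def)
        have "sin \<theta>1 / 4 \<le> 1 / 2" using s(2) by linarith
        then have "sin \<theta>1 / 4 * z \<le> 1 / 2 * z" using z by (intro mult_right_mono) auto
        then have "sin \<theta>1 / 4 * z \<le> z / 2" by simp
        then have vw: "z / 2 \<le> norm (v - w)"
          using w norm_triangle_ineq2[of "v - c" "w - c"] by (simp add: z_def)
        have "z powr \<gamma> / 2 \<le> norm (v - w) powr \<gamma>"
        proof -
          have "z powr \<gamma> * (1/2) \<le> z powr \<gamma> * (1/2) powr \<gamma>"
            using gamma powr_mono'[of \<gamma> 1 "1/2::real"] by (intro mult_left_mono) auto
          also have "\<dots> = (z / 2) powr \<gamma>" using z by (simp add: powr_mult[symmetric])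
          also have "\<dots> \<le> norm (v - w) powr \<gamma>" using gamma vw z by (intro powr_mono2) auto
          finally show ?thesis by simp
        qed
        then have "ennreal (z powr \<gamma> / 2) * ennreal AW \<le> ennreal (norm (v - w) powr \<gamma>) * angle_mass (\<lambda>\<theta>. ennreal (Hw \<theta>1 i \<theta>))"
          using AW by (intro mult_mono ennreal_leI) auto
        also have "\<dots> = (SINT n. ennreal (ckern \<gamma> (Hw \<theta>1 i) v w n))"
          by (rule nn_integral_ckern[symmetric]) (auto simp: Hw_bounds)
        finally have kern: "ennreal (z powr \<gamma> / 2) * ennreal AW \<le> (SINT n. ennreal (ckern \<gamma> (Hw \<theta>1 i) v w n))" .
        have "ennreal (ff i t v) * ennreal L * (ennreal (ff i t w) * near v w)
          = (ennreal (z powr \<gamma> / 2) * ennreal AW) * (ennreal (ff i t v) * ennreal (ff i t w) * ennreal ((c2 * S v)^2 / k))"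
        proof -
          have "ennreal L = ennreal (z powr \<gamma> / 2) * ennreal AW * ennreal ((c2 * S v)^2 / k)"
            using AW k by (simp add: L_def ennreal_mult[symmetric])
          then show ?thesis by (simp add: n1 mult_ac)
        qed
        also have "\<dots> \<le> (SINT n. ennreal (ckern \<gamma> (Hw \<theta>1 i) v w n)) * (ennreal (ff i t v) * ennreal (ff i t w) * ennreal ((c2 * S v)^2 / k))"
          by (intro mult_right_mono kern) auto
        also have "\<dots> = (SINT n. ennreal (ckern \<gamma> (Hw \<theta>1 i) v w n) * (ennreal (ff i t v) * ennreal (ff i t w) * ennreal ((c2 * S v)^2 / k)))"
          by (rule nn_integral_sphere_multc[symmetric]) measurable
        also have "\<dots> \<le> (SINT n. ennreal (ckern \<gamma> (H i i) v w n) * (ennreal (ff i t v) * ennreal (ff i t w) * ennreal (?D w n)))"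
        proof (rule nn_integral_mono_AE, use AE_sphere_measure_norm in eventually_elim)
          fix n :: vec assume n: "norm n = 1"
          show "ennreal (ckern \<gamma> (Hw \<theta>1 i) v w n) * (ennreal (ff i t v) * ennreal (ff i t w) * ennreal ((c2 * S v)^2 / k))
            \<le> ennreal (ckern \<gamma> (H i i) v w n) * (ennreal (ff i t v) * ennreal (ff i t w) * ennreal (?D w n))"
          proof (cases "ckern \<gamma> (Hw \<theta>1 i) v w n = 0")
            case False
            have far: "c2 * S v \<le> sat k (m i * (norm (u - c))^2)" if "sin \<theta>1 / 2 * norm (v - c) \<le> norm (u - c)" for u
            proof -
              have "(sin \<theta>1 / 2 * norm (v - c))^2 \<le> (norm (u - c))^2" using that s by (intro power_mono) auto
              then have "c2 * (norm (v - c))^2 \<le> (norm (u - c))^2" by (simp only: power_mult_distrib c2_def)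
              then have "m i * (c2 * (norm (v - c))^2) \<le> m i * (norm (u - c))^2" using mi by (intro mult_left_mono) auto
              then have le: "c2 * (m i * (norm (v - c))^2) \<le> m i * (norm (u - c))^2" by (simp only: mult.left_commute)
              have "c2 * S v \<le> sat k (c2 * (m i * (norm (v - c))^2))"
                unfolding S_def using c2 mi k by (intro sat_scale) auto
              also have "\<dots> \<le> sat k (m i * (norm (u - c))^2)" using le c2 mi k by (intro sat_mono) auto
              finally show ?thesis .
            qed
            note pv = window_post_vel[OF mi th n False w[unfolded z_def]]
            have "(c2 * S v)^2 / k \<le> sat k (m i * (norm (post_vel (m i) (m i) v w n - c))^2) * sat k (m i * (norm (post_vel_star (m i) (m i) v w n - c))^2) / k"
              unfolding power2_eq_square[of "c2 * S v"] 
              using far[OF pv(1)] far[OF pv(2)] c2 S0[of v] k mi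
              by (intro divide_right_mono mult_mono sat_bounds(1)) (simp_all add: less_imp_le)
            also have "\<dots> \<le> ?D w n" using mi by (intro sat_defect_bounds(1) k) auto
            finally have le: "(c2 * S v)^2 / k \<le> ?D w n" .
            show ?thesis by (intro mult_mono ennreal_leI ckern_mono Hw_bounds le) auto
          qed simp
        qed
        finally show ?thesis .
      qed
      have rad: "2 * Ec R \<le> \<delta> * (sin \<theta>1 / 4 * z)^2"
      proof -
        have "(sin \<theta>1 / 4 * Z)^2 \<le> (sin \<theta>1 / 4 * z)^2" using s z Z by (intro power_mono mult_left_mono) auto
        then show ?thesis using Z(2) delta_pos by (meson order_trans mult_left_mono less_imp_le)
      qed
      have eqc: "((sin \<theta>1 / 2)^2)^2 * AW * \<delta> / 4 / k * (indicator {Z..} (norm (v - c)) * norm (v - c) powr \<gamma> * (sat k (m i * (norm (v - c))^2))^2) = L * (\<delta> / 2)"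
        using True by (simp add: L_def S_def z_def c2_def power_mult_distrib)
      have "ennreal (ff i t v) * ennreal (L * (\<delta> / 2)) = ennreal (ff i t v) * ennreal L * ennreal (\<delta> / 2)"
      proof -
        have "ennreal (L * (\<delta> / 2)) = ennreal L * ennreal (\<delta> / 2)" using L0 delta_pos by (intro ennreal_mult) auto
        then show ?thesis by (simp only: mult.assoc)
      qed
      also have "\<dots> \<le> ennreal (ff i t v) * ennreal L * (VINT w. ennreal (ff i t w) * near v w)"
        unfolding near_def z_def[symmetric] using s z by (intro mult_left_mono near_mass[OF i t c] rad) auto
      also have "\<dots> = (VINT w. ennreal (ff i t v) * ennreal L * (ennreal (ff i t w) * near v w))"
        by (rule nn_integral_cmult[symmetric]) measurable
      also have "\<dots> \<le> (VINT w. SINT n. ennreal (ckern \<gamma> (H i i) v w n) * (ennreal (ff i t v) * ennreal (ff i t w) * ennreal (?D w n)))"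
        by (intro nn_integral_mono inner)
      finally show ?thesis unfolding eqc .
    qed
  qed
qed

end

lemma ennreal_two_mult_le_cancel:
  assumes "2 * a \<le> 2 * (b :: ennreal)"
  shows "a \<le> b"
proof -
  have h: "ennreal (1/2) * 2 = 1"
    using ennreal_mult[of "1/2" 2] by simp
  have "ennreal (1/2) * (2 * a) \<le> ennreal (1/2) * (2 * b)" using assms by (rule mult_left_mono) simp
  then show ?thesis by (simp only: mult.assoc[symmetric] h mult_1)
qed

lemma ennreal_two_mult_add:
  assumes "0 \<le> a" "0 \<le> b"
  shows "2 * (F * ennreal a) + F * ennreal b = F * ennreal (2 * a + b)"
proof -
  have "ennreal (2 * a + b) = 2 * ennreal a + ennreal b"
    using assms by (simp add: ennreal_plus ennreal_mult)
  then show ?thesis by (simp only: distrib_left mult.left_commute)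
qed

context mixture_flow
begin

text \<open>The differential inequality at a frozen time, as a comparison of \<open>balance\<close>
  with the bounds on both defects. The term with \<open>al\<close> on the left is reserved for the
  derivative of \<open>sat\<close> in its shrinking scale; the term with \<open>K\<close> is the
  deficit that a growing weight will absorb.\<close>

lemma fixed_time:
  fixes c :: vec and k t :: real
  assumes k: "0 < k" and t: "0 \<le> t" and c: "norm c \<le> R"
    and th: "0 < \<theta>1" "\<theta>1 < pi/4" and AW: "0 < AW" "\<And>i. i \<in> {1..N} \<Longrightarrow> ennreal AW \<le> angle_mass (\<lambda>\<theta>. ennreal (Hw \<theta>1 i \<theta>))"
    and Z: "0 < Z" "2 * Ec R \<le> \<delta> * (sin \<theta>1 / 4 * Z)^2"
    and al: "0 \<le> al" and K: "0 \<le> K"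
    and PW: "\<And>i z s. i \<in> {1..N} \<Longrightarrow> 0 \<le> z \<Longrightarrow> s = sat k (m i * z^2) \<Longrightarrow>
       al * s^2 + 2 * CA * Etot R * (z powr \<gamma> * s) \<le> ((sin \<theta>1 / 2)^2)^2 * AW * \<delta> / 4 / 2 * (indicator {Z..} z * z powr \<gamma> * s^2) + K * s"
  defines "S \<equiv> \<lambda>i v. sat k (m i * (norm (v - c))^2)"
  shows "(\<Sum>i\<in>{1..N}. \<Sum>j\<in>{1..N}. (VINT v. ennreal (S i v) * (ennreal (ff i t v) * freq j i t v)))
      + (\<Sum>i\<in>{1..N}. (VINT v. ennreal (ff i t v) * ennreal (al / k * (S i v)^2)))
    \<le> (\<Sum>i\<in>{1..N}. \<Sum>j\<in>{1..N}. (VINT v. ennreal (S i v) * gn j i t v))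
      + (\<Sum>i\<in>{1..N}. (VINT v. ennreal (ff i t v) * ennreal (K / k * S i v)))"
proof -
  let ?I = "{1..N}"
  define c3 where "c3 = ((sin \<theta>1 / 2)^2)^2 * AW * \<delta> / 4"
  define A where "A = (\<Sum>i\<in>?I. \<Sum>j\<in>?I. (VINT v. ennreal (S i v) * gn j i t v))"
  define B where "B = (\<Sum>i\<in>?I. \<Sum>j\<in>?I. (VINT v. ennreal (S i v) * (ennreal (ff i t v) * freq j i t v)))"
  define P where "P = (\<Sum>i\<in>?I. \<Sum>j\<in>?I. pairI t i j (\<lambda>v w v' w'. ennreal (sat_defect k (m i * (norm (v - c))^2) (m j * (norm (w - c))^2))))"
  define P' where "P' = (\<Sum>i\<in>?I. \<Sum>j\<in>?I. pairI t i j (\<lambda>v w v' w'. ennreal (sat_defect k (m i * (norm (v' - c))^2) (m j * (norm (w' - c))^2))))"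
  define r1 where "r1 i v = 4 * CA * Etot R / k * (norm (v - c) powr \<gamma> * S i v)" for i v
  define r2 where "r2 i v = c3 / k * (indicator {Z..} (norm (v - c)) * norm (v - c) powr \<gamma> * (S i v)^2)" for i v
  define R1 where "R1 = (\<Sum>i\<in>?I. (VINT v. ennreal (ff i t v) * ennreal (r1 i v)))"
  define R2 where "R2 = (\<Sum>i\<in>?I. (VINT v. ennreal (ff i t v) * ennreal (r2 i v)))"
  define Ka where "Ka = (\<Sum>i\<in>?I. (VINT v. ennreal (ff i t v) * ennreal (K / k * S i v)))"
  define Al where "Al = (\<Sum>i\<in>?I. (VINT v. ennreal (ff i t v) * ennreal (al / k * (S i v)^2)))"
  have S0: "0 \<le> S i v" "S i v \<le> k" if "i \<in> ?I" for i v
    unfolding S_def using mass_pos[OF that] by (auto intro!: sat_bounds(1) sat_bounds(3) k)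
  have [measurable]: "S i \<in> borel_measurable borel" for i unfolding S_def by measurable
  have [measurable]: "r1 i \<in> borel_measurable borel" "r2 i \<in> borel_measurable borel" for i unfolding r1_def[abs_def] r2_def[abs_def] by measurable
  have bal: "2 * A + P = 2 * B + P'"
    unfolding A_def B_def P_def P'_def S_def by (rule balance[OF k])
  have loss: "P \<le> R1"
    unfolding P_def R1_def r1_def S_def by (rule defect_loss[OF k t c])
  have "R2 \<le> (\<Sum>i\<in>?I. pairI t i i (\<lambda>v w v' w'. ennreal (sat_defect k (m i * (norm (v' - c))^2) (m i * (norm (w' - c))^2))))"
    unfolding R2_def r2_def S_def c3_def by (intro sum_mono defect_gain[OF k t c _ th AW(1) AW(2) Z])
  also have "\<dots> \<le> P'"
    unfolding P'_def by (intro sum_mono member_le_sum[where f="\<lambda>j. pairI t _ j (\<lambda>v w v' w'. ennreal (sat_defect k (m _ * (norm (v' - c))^2) (m j * (norm (w' - c))^2)))"]) auto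
  finally have gain: "R2 \<le> P'" .
  have pw: "2 * Al + R1 \<le> R2 + 2 * Ka"
  proof -
    have "2 * (VINT v. ennreal (ff i t v) * ennreal (al / k * (S i v)^2)) + (VINT v. ennreal (ff i t v) * ennreal (r1 i v))
      \<le> (VINT v. ennreal (ff i t v) * ennreal (r2 i v)) + 2 * (VINT v. ennreal (ff i t v) * ennreal (K / k * S i v))" if i: "i \<in> ?I" for i
    proof -
      note [measurable] = ff_measurable[OF i]
      have r0: "0 \<le> r1 i v" "0 \<le> r2 i v" for v
        using S0[OF i] CA_pos Etot_nonneg[of R] k AW(1) delta_pos by (simp_all add: r1_def r2_def c3_def)
      have "2 * (VINT v. ennreal (ff i t v) * ennreal (al / k * (S i v)^2)) + (VINT v. ennreal (ff i t v) * ennreal (r1 i v))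
        = (VINT v. 2 * (ennreal (ff i t v) * ennreal (al / k * (S i v)^2)) + ennreal (ff i t v) * ennreal (r1 i v))"
        by (subst nn_integral_cmult[symmetric], measurable) (rule nn_integral_add[symmetric], measurable)
      also have "\<dots> \<le> (VINT v. ennreal (ff i t v) * ennreal (r2 i v) + 2 * (ennreal (ff i t v) * ennreal (K / k * S i v)))"
      proof (rule nn_integral_mono)
        fix v
        let ?s = "S i v" and ?z = "norm (v - c)"
        have "al * ?s\<^sup>2 + 2 * CA * Etot R * (?z powr \<gamma> * ?s) \<le> c3 / 2 * (indicator {Z..} ?z * ?z powr \<gamma> * ?s\<^sup>2) + K * ?s"
          unfolding c3_def by (rule PW[OF i]) (simp_all add: S_def)
        then have "2 / k * (al * ?s\<^sup>2 + 2 * CA * Etot R * (?z powr \<gamma> * ?s)) \<le> 2 / k * (c3 / 2 * (indicator {Z..} ?z * ?z powr \<gamma> * ?s\<^sup>2) + K * ?s)"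
          using k by (intro mult_left_mono) auto
        then have le: "2 * (al / k * ?s\<^sup>2) + r1 i v \<le> r2 i v + 2 * (K / k * ?s)"
          by (simp add: r1_def r2_def algebra_simps)
        have "2 * (ennreal (ff i t v) * ennreal (al / k * ?s\<^sup>2)) + ennreal (ff i t v) * ennreal (r1 i v) = ennreal (ff i t v) * ennreal (2 * (al / k * ?s\<^sup>2) + r1 i v)"
          using al k r0(1)[of v] by (intro ennreal_two_mult_add) auto
        also have "\<dots> \<le> ennreal (ff i t v) * ennreal (r2 i v + 2 * (K / k * ?s))"
          by (intro mult_left_mono ennreal_leI le) auto
        also have "\<dots> = ennreal (ff i t v) * ennreal (r2 i v) + 2 * (ennreal (ff i t v) * ennreal (K / k * ?s))"
          using K k r0(2)[of v] S0(1)[OF i, of v] ennreal_two_mult_add[of "K / k * ?s" "r2 i v" "ennreal (ff i t v)"] by (simp only: add.commute mult_nonneg_nonneg divide_nonneg_nonneg less_imp_le)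
        finally show "2 * (ennreal (ff i t v) * ennreal (al / k * ?s\<^sup>2)) + ennreal (ff i t v) * ennreal (r1 i v)
          \<le> ennreal (ff i t v) * ennreal (r2 i v) + 2 * (ennreal (ff i t v) * ennreal (K / k * ?s))" .
      qed
      also have "\<dots> = (VINT v. ennreal (ff i t v) * ennreal (r2 i v)) + 2 * (VINT v. ennreal (ff i t v) * ennreal (K / k * S i v))"
        by (subst nn_integral_add, measurable, subst nn_integral_cmult, measurable)
      finally show ?thesis .
    qed
    then show ?thesis
      unfolding Al_def R1_def R2_def Ka_def sum_distrib_left sum.distrib[symmetric] by (rule sum_mono)
  qed
  \<comment> \<open>\<open>R1\<close> appears on both sides of the final comparison and can be
    cancelled only if it is finite.\<close>
  have fin: "R1 \<noteq> \<top>"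
  proof -
    have "(VINT v. ennreal (ff i t v) * ennreal (r1 i v)) < \<top>" if i: "i \<in> ?I" for i
    proof -
      note [measurable] = ff_measurable[OF i]
      define C where "C = 4 * CA * Etot R"
      have C: "0 \<le> C" using CA_pos Etot_nonneg[of R] by (simp add: C_def)
      have "(VINT v. ennreal (ff i t v) * ennreal (r1 i v))
         \<le> (VINT v. ennreal (2 * C) * ennreal (ff i t v) + ennreal C * (ennreal (ff i t v) * ennreal ((norm (v - c))^2)))"
      proof (rule nn_integral_mono)
        fix v :: vec
        let ?z = "norm (v - c)"
        have "?z powr \<gamma> \<le> 1 + ?z" using gamma by (intro powr_le_one_plus) auto
        also have "?z \<le> 1 + ?z\<^sup>2"
        proof -
          have "0 \<le> (?z - 1)^2" by simp
          then have "2 * ?z \<le> 1 + ?z\<^sup>2" by (simp add: power2_eq_square algebra_simps)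
          then show ?thesis using norm_ge_zero[of "v - c"] by linarith
        qed
        finally have "?z powr \<gamma> * S i v \<le> (2 + ?z\<^sup>2) * k" using S0[OF i, of v] by (intro mult_mono) auto
        then have "C / k * (?z powr \<gamma> * S i v) \<le> C / k * ((2 + ?z\<^sup>2) * k)" using C k by (intro mult_left_mono) auto
        moreover have "C / k * ((2 + ?z\<^sup>2) * k) = 2 * C + C * ?z\<^sup>2" using k by (simp add: distrib_left distrib_right)
        ultimately have "r1 i v \<le> 2 * C + C * ?z\<^sup>2" by (simp only: r1_def C_def)
        then have "ennreal (ff i t v) * ennreal (r1 i v) \<le> ennreal (ff i t v) * ennreal (2 * C + C * ?z\<^sup>2)"
          by (intro mult_left_mono ennreal_leI) auto
        also have "\<dots> = ennreal (2 * C) * ennreal (ff i t v) + ennreal C * (ennreal (ff i t v) * ennreal (?z\<^sup>2))"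
        proof -
          have "ennreal (2 * C + C * ?z\<^sup>2) = ennreal (2 * C) + ennreal C * ennreal (?z\<^sup>2)"
            using C by (subst ennreal_plus) (auto simp: ennreal_mult)
          then show ?thesis by (simp only: distrib_left mult.commute mult.left_commute)
        qed
        finally show "ennreal (ff i t v) * ennreal (r1 i v) \<le> ennreal (2 * C) * ennreal (ff i t v) + ennreal C * (ennreal (ff i t v) * ennreal (?z\<^sup>2))" .
      qed
      also have "\<dots> = ennreal (2 * C) * (VINT v. ennreal (ff i t v)) + ennreal C * (VINT v. ennreal (ff i t v) * ennreal ((norm (v - c))^2))"
        by (subst nn_integral_add, measurable, subst nn_integral_cmult, measurable, subst nn_integral_cmult, measurable)
      also have "\<dots> \<le> ennreal (2 * C) * ennreal M + ennreal C * ennreal (Ec R)"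
        using nn_integral_f_le(1)[OF i t] by (intro add_mono mult_left_mono energy_centre i t c) (auto simp: ff_eq[OF t])
      also have "\<dots> < \<top>" by (simp add: ennreal_mult_less_top)
      finally show ?thesis .
    qed
    then show ?thesis unfolding R1_def by (simp add: less_top)
  qed
  have "R1 + 2 * (B + Al) = 2 * B + (2 * Al + R1)" by (simp add: distrib_left add_ac)
  also have "\<dots> \<le> 2 * B + (P' + 2 * Ka)" using pw gain by (intro add_left_mono) (meson add_right_mono order_trans)
  also have "\<dots> = (2 * A + P) + 2 * Ka" unfolding bal by (simp add: add.assoc)
  also have "\<dots> \<le> (2 * A + R1) + 2 * Ka" by (intro add_right_mono add_left_mono loss)
  also have "\<dots> = R1 + 2 * (A + Ka)" by (simp add: distrib_left add_ac)
  finally have "2 * (B + Al) \<le> 2 * (A + Ka)" using fin by (simp add: ennreal_add_left_cancel_le)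
  then have "B + Al \<le> A + Ka" by (rule ennreal_two_mult_le_cancel)
  then show ?thesis unfolding A_def B_def Al_def Ka_def .
qed

text \<open>Loss frequency against mass and energy. The gain has the same integral, since collisions
  conserve the number of particles: the test function is constant.\<close>

lemma total_gain_loss:
  assumes ij: "i \<in> {1..N}" "j \<in> {1..N}" and t: "0 \<le> t"
  shows "(VINT v. ennreal (ff i t v) * freq j i t v) \<le> ennreal (CL * (2 * M + E))"
    and "(VINT v. gn j i t v) \<le> ennreal (CL * (2 * M + E))"
proof -
  note [measurable] = f_measurable[OF ij(1) t]
  show 1: "(VINT v. ennreal (ff i t v) * freq j i t v) \<le> ennreal (CL * (2 * M + E))"
  proof -
    have "(VINT v. ennreal (ff i t v) * freq j i t v) \<le> (VINT v. ennreal CL * (2 * ennreal (f i t v) + ennreal (f i t v) * ennreal ((norm v)^2)))"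
    proof (rule nn_integral_mono)
      fix v
      have f0: "0 \<le> f i t v" by (rule f_nonneg[OF ij(1) t])
      have "0 \<le> (norm v - 1)^2" by simp
      then have "2 * norm v \<le> 1 + (norm v)^2" by (simp add: power2_eq_square algebra_simps)
      then have "1 + norm v \<le> 2 + (norm v)^2" using norm_ge_zero[of v] by linarith
      then have "CL * (1 + norm v) \<le> CL * (2 + (norm v)^2)" using CL_pos by (intro mult_left_mono) auto
      then have "freq j i t v \<le> ennreal (CL * (2 + (norm v)^2))"
        using freq_le[OF ij(2) t, of i v] by (meson ennreal_leI order_trans)
      then have "ennreal (ff i t v) * freq j i t v \<le> ennreal (f i t v) * ennreal (CL * (2 + (norm v)^2))"
        unfolding ff_eq[OF t] by (rule mult_left_mono) simp
      also have "\<dots> = ennreal (CL * (2 * f i t v + f i t v * (norm v)^2))"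
        using f0 CL_pos by (simp add: ennreal_mult[symmetric] algebra_simps)
      also have "\<dots> = ennreal CL * (2 * ennreal (f i t v) + ennreal (f i t v) * ennreal ((norm v)^2))"
        using f0 CL_pos by (simp add: ennreal_mult ennreal_plus)
      finally show "ennreal (ff i t v) * freq j i t v \<le> ennreal CL * (2 * ennreal (f i t v) + ennreal (f i t v) * ennreal ((norm v)^2))" .
    qed
    also have "\<dots> = ennreal CL * (2 * (VINT v. ennreal (f i t v)) + (VINT v. ennreal (f i t v) * ennreal ((norm v)^2)))"
      by (subst nn_integral_cmult, measurable) (subst nn_integral_add, measurable, subst nn_integral_cmult, measurable)
    also have "\<dots> \<le> ennreal CL * (2 * ennreal M + ennreal E)"
      by (intro mult_left_mono add_mono nn_integral_f_le ij t) auto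
    also have "\<dots> = ennreal (CL * (2 * M + E))"
      using CL_pos M_pos E_pos by (simp add: ennreal_mult ennreal_plus)
    finally show ?thesis .
  qed
  have "(VINT v. gn j i t v) = (VINT v. ennreal (ff i t v) * freq j i t v)"
    using pairI_gain[OF ij, of "\<lambda>_. 1" t] pairI_loss[OF ij, of "\<lambda>_. 1" t] by simp
  then show "(VINT v. gn j i t v) \<le> ennreal (CL * (2 * M + E))" using 1 by simp
qed

lemma gn_measurable [measurable]:
  assumes "i \<in> {1..N}" "j \<in> {1..N}" and [measurable]: "s \<in> borel_measurable A" "g \<in> borel_measurable A"
  shows "(\<lambda>x. gn j i (s x) (g x)) \<in> borel_measurable A"
proof -
  note [measurable] = ff_measurable_pair[OF assms(1)] ff_measurable_pair[OF assms(2)]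
  show ?thesis by measurable
qed

lemma freq_measurable [measurable]:
  assumes "i \<in> {1..N}" "j \<in> {1..N}" and [measurable]: "s \<in> borel_measurable A" "g \<in> borel_measurable A"
  shows "(\<lambda>x. freq j i (s x) (g x)) \<in> borel_measurable A"
proof -
  note [measurable] = ff_measurable_pair[OF assms(2)]
  show ?thesis unfolding freq_def by measurable
qed

end

lemma ennreal_mult_sum_add:
  assumes "0 \<le> a" "\<And>j. j \<in> I \<Longrightarrow> 0 \<le> g j" "0 \<le> b" "0 \<le> d"
  shows "ennreal (a * (\<Sum>j\<in>I. g j) + b * d) = (\<Sum>j\<in>I. ennreal a * ennreal (g j)) + ennreal b * ennreal d"
proof -
  have "(\<Sum>j\<in>I. ennreal a * ennreal (g j)) = (\<Sum>j\<in>I. ennreal (a * g j))"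
    using assms by (intro sum.cong refl) (simp add: ennreal_mult)
  also have "\<dots> = ennreal (a * (\<Sum>j\<in>I. g j))"
    unfolding sum_distrib_left using assms by (intro sum_ennreal) simp
  finally show ?thesis using assms by (simp add: ennreal_plus sum_nonneg ennreal_mult)
qed

lemma nn_integral_sum_add:
  assumes "\<And>j. j \<in> I \<Longrightarrow> u j \<in> borel_measurable A" "w \<in> borel_measurable A"
  shows "(\<integral>\<^sup>+x. (\<Sum>j\<in>I. u j x) + w x \<partial>A) = (\<Sum>j\<in>I. \<integral>\<^sup>+x. u j x \<partial>A) + (\<integral>\<^sup>+x. w x \<partial>A)"
proof -
  have "(\<lambda>x. \<Sum>j\<in>I. u j x) \<in> borel_measurable A" using assms(1) by (rule borel_measurable_sum)
  then show ?thesis using assms by (simp add: nn_integral_add nn_integral_sum)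
qed

context mixture_flow
begin

lemma ff_measurable_pair' [measurable]:
  assumes "i \<in> {1..N}" and [measurable]: "s \<in> borel_measurable A" "g \<in> borel_measurable A"
  shows "(\<lambda>x. ff i (s x) (g x)) \<in> borel_measurable A"
  using measurable_compose[OF _ ff_measurable_pair[OF assms(1)], of "\<lambda>x. (s x, g x)" A] by simp

text \<open>The saturated energy about a centre, measured on a scale that was exponentially large in the
  past, does not decrease: this replaces the H-theorem.\<close>

lemma saturated_energy_mono:
  fixes c :: vec and k0 T :: real
  assumes k0: "0 < k0" and T: "0 \<le> T" and c: "norm c \<le> R"
    and th: "0 < \<theta>1" "\<theta>1 < pi/4" and AW: "0 < AW" "\<And>i. i \<in> {1..N} \<Longrightarrow> ennreal AW \<le> angle_mass (\<lambda>\<theta>. ennreal (Hw \<theta>1 i \<theta>))"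
    and Z: "0 < Z" "2 * Ec R \<le> \<delta> * (sin \<theta>1 / 4 * Z)^2"
    and al: "0 < al" and K: "0 \<le> K"
    and PW: "\<And>k i z s. k0 \<le> k \<Longrightarrow> i \<in> {1..N} \<Longrightarrow> 0 \<le> z \<Longrightarrow> s = sat k (m i * z^2) \<Longrightarrow>
       al * s^2 + 2 * CA * Etot R * (z powr \<gamma> * s) \<le> ((sin \<theta>1 / 2)^2)^2 * AW * \<delta> / 4 / 2 * (indicator {Z..} z * z powr \<gamma> * s^2) + K * s"
  shows "(\<Sum>i\<in>{1..N}. LINT v|lborel. f i 0 v * sat k0 (m i * (norm (v - c))^2))
    \<le> exp (K / (al * k0)) * (\<Sum>i\<in>{1..N}. LINT v|lborel. f i T v * sat k0 (m i * (norm (v - c))^2))"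
proof -
  let ?I = "{1..N}"
  \<comment> \<open>The scale obeys \<open>\<kappa>' = - al * \<kappa>\<close> and reaches
    \<open>k0\<close> at time \<open>T\<close>.\<close>
  define \<kappa> where "\<kappa> s = k0 * exp (al * (T - s))" for s
  \<comment> \<open>The solution of \<open>\<omega>' = \<omega> * K / \<kappa>\<close> that tends to
    1 in the infinite past. As the integral of \<open>K / \<kappa>\<close> up to \<open>T\<close> is
    \<open>K / (al * k0)\<close>, the weight stays between 1 and \<open>W\<close> for every
    \<open>T\<close>.\<close>
  define \<omega> where "\<omega> s = exp (K / (al * k0) * exp (- al * (T - s)))" for s
  define x where "x i v = m i * (norm (v - c))^2" for i and v :: vec
  define S where "S i s v = sat (\<kappa> s) (x i v)" for i s v
  define \<phi> where "\<phi> i s v = \<omega> s * S i s v" for i s v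
  define \<phi>d where "\<phi>d i s v = \<omega> s * (K / \<kappa> s * S i s v - al / \<kappa> s * (S i s v)^2)" for i s v
  have \<kappa>0: "0 < \<kappa> s" for s using k0 by (simp add: \<kappa>_def)
  have \<kappa>ge: "k0 \<le> \<kappa> s" if "s \<le> T" for s using k0 al that by (simp add: \<kappa>_def)
  have \<kappa>le: "\<kappa> s \<le> \<kappa> 0" if "0 \<le> s" for s using k0 al that by (simp add: \<kappa>_def)
  have \<omega>0: "1 \<le> \<omega> s" "0 < \<omega> s" "0 \<le> \<omega> s" for s using K al k0 by (auto simp: \<omega>_def)
  define W where "W = exp (K / (al * k0))"
  have \<omega>W: "\<omega> s \<le> W" if "s \<le> T" for s
  proof -
    have "K / (al * k0) * exp (- al * (T - s)) \<le> K / (al * k0) * 1"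
      using K al k0 that by (intro mult_left_mono) auto
    then show ?thesis by (simp add: \<omega>_def W_def)
  qed
  have \<omega>T: "\<omega> T = W" by (simp add: \<omega>_def W_def)
  have x0: "0 \<le> x i v" if "i \<in> ?I" for i v using mass_pos[OF that] by (simp add: x_def)
  have S0: "0 \<le> S i s v" "S i s v \<le> \<kappa> s" if "i \<in> ?I" for i s v
    unfolding S_def using x0[OF that] by (auto intro!: sat_bounds \<kappa>0)
  have [measurable]: "\<kappa> \<in> borel_measurable borel" "\<omega> \<in> borel_measurable borel" unfolding \<kappa>_def[abs_def] \<omega>_def[abs_def] by measurable
  have [measurable]: "x i \<in> borel_measurable borel" for i unfolding x_def by measurable
  have Sm [measurable]: "(\<lambda>p. S i (f1 p) (f2 p)) \<in> borel_measurable A" if [measurable]: "f1 \<in> borel_measurable A" "f2 \<in> borel_measurable A"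
    for i f1 f2 and A :: "'z measure" unfolding S_def by measurable
  have \<phi>m [measurable]: "(\<lambda>p. \<phi> i (f1 p) (f2 p)) \<in> borel_measurable A" "(\<lambda>p. \<phi>d i (f1 p) (f2 p)) \<in> borel_measurable A"
    if [measurable]: "f1 \<in> borel_measurable A" "f2 \<in> borel_measurable A"
    for i f1 f2 and A :: "'z measure" unfolding \<phi>_def \<phi>d_def by measurable
  have d\<kappa>: "(\<kappa> has_real_derivative - al * \<kappa> s) (at s)" for s
    unfolding \<kappa>_def[abs_def] by (auto intro!: derivative_eq_intros)
  have d\<omega>: "(\<omega> has_real_derivative \<omega> s * (K / \<kappa> s)) (at s)" for s
  proof -
    have "K / (al * k0) * (exp (- al * (T - s)) * al) = K / \<kappa> s"
    proof -
      define X where "X = exp (al * (T - s))"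
      have "exp (- al * (T - s)) = 1 / X" by (simp add: X_def exp_minus inverse_eq_divide)
      moreover have "0 < X" by (simp add: X_def)
      ultimately show ?thesis unfolding \<kappa>_def X_def[symmetric] using al k0 by (simp add: field_simps)
    qed
    moreover have "(\<omega> has_real_derivative \<omega> s * (K / (al * k0) * (exp (- al * (T - s)) * al))) (at s)"
      unfolding \<omega>_def[abs_def] using k0 by (auto intro!: derivative_eq_intros)
    ultimately show ?thesis by simp
  qed
  \<comment> \<open>The derivative of \<open>sat\<close> in its scale is \<open>(sat / k)^2\<close>,
    multiplied here by \<open>- al * \<kappa> s\<close>.\<close>
  have dS: "((\<lambda>s. S i s v) has_real_derivative - (al / \<kappa> s) * (S i s v)^2) (at s)" if i: "i \<in> ?I" for i s v
  proof -
    have nz: "\<kappa> s + x i v \<noteq> 0" "\<kappa> s \<noteq> 0" using \<kappa>0[of s] x0[OF i, of v] by auto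
    have "((\<lambda>s. \<kappa> s * x i v / (\<kappa> s + x i v)) has_real_derivative
      ((- al * \<kappa> s) * x i v * (\<kappa> s + x i v) - (\<kappa> s * x i v) * (- al * \<kappa> s)) / ((\<kappa> s + x i v) * (\<kappa> s + x i v))) (at s)"
      using nz by (auto intro!: derivative_eq_intros d\<kappa>)
    moreover have "((- al * \<kappa> s) * x i v * (\<kappa> s + x i v) - (\<kappa> s * x i v) * (- al * \<kappa> s)) / ((\<kappa> s + x i v) * (\<kappa> s + x i v))
      = - (al / \<kappa> s) * (S i s v)^2"
      unfolding S_def sat_def using nz by (simp add: divide_simps power2_eq_square) (simp add: algebra_simps)
    ultimately show ?thesis unfolding S_def sat_def by simp
  qed
  have d\<phi>: "((\<lambda>s. \<phi> i s v) has_real_derivative \<phi>d i s v) (at s)" if i: "i \<in> ?I" for i s v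
  proof -
    have "((\<lambda>s. \<omega> s * S i s v) has_real_derivative (\<omega> s * (K / \<kappa> s)) * S i s v + (- (al / \<kappa> s) * (S i s v)^2) * \<omega> s) (at s)"
      by (rule DERIV_mult[OF d\<omega> dS[OF i]])
    moreover have "(\<omega> s * (K / \<kappa> s)) * S i s v + (- (al / \<kappa> s) * (S i s v)^2) * \<omega> s = \<phi>d i s v"
      by (simp add: \<phi>d_def algebra_simps)
    ultimately show ?thesis unfolding \<phi>_def by simp
  qed
  have c\<phi>d: "isCont (\<lambda>s. \<phi>d i s v) s" if i: "i \<in> ?I" for i s v
  proof -
    have "isCont \<omega> s" "isCont \<kappa> s" "isCont (\<lambda>s. S i s v) s"
      using DERIV_isCont[OF d\<omega>] DERIV_isCont[OF d\<kappa>] DERIV_isCont[OF dS[OF i]] by auto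
    then show ?thesis unfolding \<phi>d_def using \<kappa>0[of s] by (intro continuous_intros) auto
  qed
  define G where "G j i s v = enn2real (gn j i s v)" for j i s v
  define Q where "Q j i s v = ff i s v * enn2real (freq j i s v)" for j i s v
  have G0: "0 \<le> G j i s v" for j i s v by (simp add: G_def)
  have Q0: "0 \<le> Q j i s v" if "i \<in> ?I" for j i s v using ff_nonneg[OF that] by (simp add: Q_def)
  have Gm [measurable]: "(\<lambda>p. G j i (f1 p) (f2 p)) \<in> borel_measurable A" "(\<lambda>p. Q j i (f1 p) (f2 p)) \<in> borel_measurable A"
    if "i \<in> ?I" "j \<in> ?I" and [measurable]: "f1 \<in> borel_measurable A" "f2 \<in> borel_measurable A" for i j f1 f2 and A :: "'z measure"
    unfolding G_def Q_def using that(1,2) by measurable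
  \<comment> \<open>The time derivative of \<open>\<phi> * f\<close>, restricted to
    \<open>{0..T}\<close>. It is written with the separate gain and loss, which are jointly
    measurable, and agrees almost everywhere with the one formed from the collision
    operator.\<close>
  define Y where "Y i s v = indicator {0..T} s * (\<phi> i s v * (\<Sum>j\<in>?I. G j i s v - Q j i s v) + \<phi>d i s v * ff i s v)" for i s v
  have Ym [measurable]: "(\<lambda>p. Y i (f1 p) (f2 p)) \<in> borel_measurable A"
    if "i \<in> ?I" and [measurable]: "f1 \<in> borel_measurable A" "f2 \<in> borel_measurable A" for i f1 f2 and A :: "'z measure"
    unfolding Y_def using that(1) by measurable
  have AEY: "AE v in lborel. (\<integral>s. Y i s v \<partial>lborel) = \<phi> i T v * f i T v - \<phi> i 0 v * f i 0 v" if i: "i \<in> ?I" for i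
    using AE_mild[OF i] AE_coll_op_eq[OF i]
  proof eventually_elim
    fix v assume mild: "\<forall>t\<ge>0. set_integrable lborel {0..t} (\<lambda>s. \<Sum>j\<in>?I. coll j i s v) \<and>
        f i t v = f i 0 v + (LINT s:{0..t}|lborel. \<Sum>j\<in>?I. coll j i s v)"
      and co: "AE s in lborel. 0 \<le> s \<longrightarrow> (\<forall>j\<in>?I. gn j i s v < \<infinity> \<and> coll j i s v = enn2real (gn j i s v) - f i s v * enn2real (freq j i s v))"
    have qi: "set_integrable lborel {0..T} (\<lambda>s. \<Sum>j\<in>?I. coll j i s v)" using mild T by blast
    have mi: "f i t v = f i 0 v + (LINT s:{0..t}|lborel. \<Sum>j\<in>?I. coll j i s v)" if "0 \<le> t" for t using mild that by blast
    note ibp = integration_by_parts_primitive[where w="\<lambda>s. \<phi> i s v" and w'="\<lambda>s. \<phi>d i s v" and F="\<lambda>s. f i s v", OF T qi mi d\<phi>[OF i] c\<phi>d[OF i]]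
    have "(\<integral>s. Y i s v \<partial>lborel) = (\<integral>s. indicator {0..T} s * (\<phi> i s v * (\<Sum>j\<in>?I. coll j i s v) + \<phi>d i s v * f i s v) \<partial>lborel)"
    proof (rule integral_cong_AE)
      show "AE s in lborel. Y i s v = indicator {0..T} s * (\<phi> i s v * (\<Sum>j\<in>?I. coll j i s v) + \<phi>d i s v * f i s v)"
        using co
      proof eventually_elim
        fix s assume *: "0 \<le> s \<longrightarrow> (\<forall>j\<in>?I. gn j i s v < \<infinity> \<and> coll j i s v = enn2real (gn j i s v) - f i s v * enn2real (freq j i s v))"
        show "Y i s v = indicator {0..T} s * (\<phi> i s v * (\<Sum>j\<in>?I. coll j i s v) + \<phi>d i s v * f i s v)"
        proof (cases "s \<in> {0..T}")
          case True
          then have "ff i s v = f i s v" by (simp add: ff_eq)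
          moreover have "(\<Sum>j\<in>?I. G j i s v - Q j i s v) = (\<Sum>j\<in>?I. coll j i s v)"
            using * True by (intro sum.cong refl) (simp add: G_def Q_def ff_eq)
          ultimately show ?thesis by (simp only: Y_def)
        qed (simp add: Y_def)
      qed
      show "(\<lambda>s. Y i s v) \<in> borel_measurable lborel" using i by measurable
      show "(\<lambda>s. indicator {0..T} s * (\<phi> i s v * (\<Sum>j\<in>?I. coll j i s v) + \<phi>d i s v * f i s v)) \<in> borel_measurable lborel"
        using ibp(1) by (rule borel_measurable_integrable) auto
    qed
    also have "\<dots> = \<phi> i T v * f i T v - \<phi> i 0 v * f i 0 v"
      by (rule ibp(2)) auto
    finally show "(\<integral>s. Y i s v \<partial>lborel) = \<phi> i T v * f i T v - \<phi> i 0 v * f i 0 v" .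
  qed
  define C1 where "C1 = CL * (2 * M + E)"
  have nG: "(VINT v. ennreal (G j i s v)) \<le> ennreal C1" if "i \<in> ?I" "j \<in> ?I" "0 \<le> s" for i j s
  proof -
    have "(VINT v. ennreal (G j i s v)) \<le> (VINT v. gn j i s v)"
    proof (rule nn_integral_mono)
      show "ennreal (G j i s v) \<le> gn j i s v" for v unfolding G_def by (cases "gn j i s v") auto
    qed
    then show ?thesis using total_gain_loss(2)[OF that] by (simp add: C1_def)
  qed
  have Qeq: "ennreal (Q j i s v) = ennreal (ff i s v) * freq j i s v" if "i \<in> ?I" "j \<in> ?I" "0 \<le> s" for i j s v
  proof -
    have "freq j i s v < \<top>" using freq_le[OF that(2,3), of i v] by (simp add: le_less_trans)
    then show ?thesis using ff_nonneg[OF that(1)] by (simp add: Q_def ennreal_mult ennreal_enn2real)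
  qed
  have nQ: "(VINT v. ennreal (Q j i s v)) \<le> ennreal C1" if "i \<in> ?I" "j \<in> ?I" "0 \<le> s" for i j s
    using total_gain_loss(1)[OF that] by (simp add: Qeq[OF that] C1_def)
  have nF: "(VINT v. ennreal (ff i s v)) \<le> ennreal M" if "i \<in> ?I" "0 \<le> s" for i s
    using nn_integral_f_le(1)[OF that] by (simp add: ff_eq[OF that(2)])
  have iG: "integrable lborel (G j i s)" "integrable lborel (Q j i s)" if ij: "i \<in> ?I" "j \<in> ?I" and s: "0 \<le> s" for i j s
    using nG[OF ij s] nQ[OF ij s] Gm[OF ij, of "\<lambda>_. s" borel "\<lambda>v. v"] G0 Q0[OF ij(1)]
    by (auto intro!: integrableI_nonneg intro: le_less_trans)
  have iF: "integrable lborel (ff i s)" if i: "i \<in> ?I" and s: "0 \<le> s" for i s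
    using integrable_f(1)[OF i s] by (simp add: ff_eq[OF s])
  have \<phi>b: "0 \<le> \<phi> i s v" "\<phi> i s v \<le> W * \<kappa> 0" "\<bar>\<phi>d i s v\<bar> \<le> W * (K + al * \<kappa> 0)" if i: "i \<in> ?I" and s: "s \<in> {0..T}" for i s v
  proof -
    note s0 = S0[OF i, of s v]
    have w: "0 \<le> \<omega> s" "\<omega> s \<le> W" using \<omega>0[of s] \<omega>W[of s] s by auto
    have k: "0 < \<kappa> s" "\<kappa> s \<le> \<kappa> 0" using \<kappa>0[of s] \<kappa>le[of s] s by auto
    show "0 \<le> \<phi> i s v" using w s0 by (simp add: \<phi>_def)
    show "\<phi> i s v \<le> W * \<kappa> 0" unfolding \<phi>_def using w s0 k by (intro mult_mono) auto
    have "K / \<kappa> s * S i s v \<le> K / \<kappa> s * \<kappa> s" using s0 K k by (intro mult_left_mono) auto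
    then have a: "K / \<kappa> s * S i s v \<le> K" "0 \<le> K / \<kappa> s * S i s v" using k s0 K by auto
    have "(S i s v)^2 \<le> (\<kappa> s)^2" using s0 by (intro power_mono) auto
    then have "al / \<kappa> s * (S i s v)^2 \<le> al / \<kappa> s * (\<kappa> s)^2" using al k by (intro mult_left_mono) auto
    also have "\<dots> = al * \<kappa> s" using k by (simp add: power2_eq_square)
    also have "\<dots> \<le> al * \<kappa> 0" using k al by (intro mult_left_mono) auto
    finally have b: "al / \<kappa> s * (S i s v)^2 \<le> al * \<kappa> 0" "0 \<le> al / \<kappa> s * (S i s v)^2" using al k by auto
    have "\<bar>K / \<kappa> s * S i s v - al / \<kappa> s * (S i s v)\<^sup>2\<bar> \<le> K + al * \<kappa> 0" using a b by linarith
    then show "\<bar>\<phi>d i s v\<bar> \<le> W * (K + al * \<kappa> 0)"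
      unfolding \<phi>d_def abs_mult using w by (intro mult_mono) auto
  qed
  have W0: "0 < W" by (simp add: W_def)
  define B where "B = W * \<kappa> 0 + W * (K + al * \<kappa> 0)"
  have B: "W * \<kappa> 0 \<le> B" "W * (K + al * \<kappa> 0) \<le> B" "0 \<le> B"
    using W0 \<kappa>0[of 0] K al by (auto simp: B_def)
  have absY: "\<bar>Y i s v\<bar> \<le> indicator {0..T} s * (B * ((\<Sum>j\<in>?I. G j i s v + Q j i s v) + ff i s v))" if i: "i \<in> ?I" for i s v
  proof (cases "s \<in> {0..T}")
    case True
    have "\<bar>\<Sum>j\<in>?I. G j i s v - Q j i s v\<bar> \<le> (\<Sum>j\<in>?I. G j i s v + Q j i s v)"
    proof (rule order_trans[OF sum_abs], rule sum_mono)
      fix j show "\<bar>G j i s v - Q j i s v\<bar> \<le> G j i s v + Q j i s v" using G0[of j i s v] Q0[OF i, of j s v] by linarith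
    qed
    then have "\<bar>\<phi> i s v * (\<Sum>j\<in>?I. G j i s v - Q j i s v)\<bar> \<le> B * (\<Sum>j\<in>?I. G j i s v + Q j i s v)"
      unfolding abs_mult using \<phi>b[OF i True, of v] B by (intro mult_mono) auto
    moreover have "\<bar>\<phi>d i s v * ff i s v\<bar> \<le> B * ff i s v"
      unfolding abs_mult using \<phi>b[OF i True, of v] B ff_nonneg[OF i, of s v] by (intro mult_mono) auto
    ultimately have "\<bar>\<phi> i s v * (\<Sum>j\<in>?I. G j i s v - Q j i s v) + \<phi>d i s v * ff i s v\<bar> \<le> B * (\<Sum>j\<in>?I. G j i s v + Q j i s v) + B * ff i s v"
      by linarith
    then show ?thesis using True by (simp add: Y_def distrib_left)
  qed (simp add: Y_def)
  have iY: "integrable (lborel \<Otimes>\<^sub>M lborel) (\<lambda>p. Y i (fst p) (snd p))" if i: "i \<in> ?I" for i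
  proof (rule integrableI_bounded)
    show "(\<lambda>p. Y i (fst p) (snd p)) \<in> borel_measurable (lborel \<Otimes>\<^sub>M lborel)" using i by measurable
    have "(\<integral>\<^sup>+p. ennreal (norm (Y i (fst p) (snd p))) \<partial>(lborel \<Otimes>\<^sub>M lborel)) = (VINT s. VINT v. ennreal \<bar>Y i s v\<bar>)"
    proof -
      have m: "(\<lambda>p. ennreal (norm (Y i (fst p) (snd p)))) \<in> borel_measurable (lborel \<Otimes>\<^sub>M lborel)" using i by measurable
      show ?thesis by (subst lborel.nn_integral_fst[OF m, symmetric]) simp
    qed
    also have "\<dots> \<le> (VINT s. ennreal (B * (real N * (2 * C1) + M)) * indicator {0..T} s)"
    proof (rule nn_integral_mono)
      fix s :: real
      show "(VINT v. ennreal \<bar>Y i s v\<bar>) \<le> ennreal (B * (real N * (2 * C1) + M)) * indicator {0..T} s"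
      proof (cases "s \<in> {0..T}")
        case True
        then have s: "0 \<le> s" by simp
        note [measurable] = Gm(1)[OF i, of _ "\<lambda>_. s" borel "\<lambda>v. v"] Gm(2)[OF i, of _ "\<lambda>_. s" borel "\<lambda>v. v"] ff_measurable[OF i]
        have C10: "0 \<le> C1" using CL_pos M_pos E_pos by (simp add: C1_def)
        have "(VINT v. ennreal \<bar>Y i s v\<bar>) \<le> (VINT v. ennreal B * ((\<Sum>j\<in>?I. ennreal (G j i s v) + ennreal (Q j i s v)) + ennreal (ff i s v)))"
        proof (rule nn_integral_mono)
          fix v
          have "ennreal \<bar>Y i s v\<bar> \<le> ennreal (B * ((\<Sum>j\<in>?I. G j i s v + Q j i s v) + ff i s v))"
            using absY[OF i, of s v] True by (intro ennreal_leI) simp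
          also have "\<dots> = ennreal B * ((\<Sum>j\<in>?I. ennreal (G j i s v) + ennreal (Q j i s v)) + ennreal (ff i s v))"
            using B(3) G0 Q0[OF i] ff_nonneg[OF i]
            by (simp add: ennreal_mult ennreal_plus sum_nonneg sum_ennreal[symmetric])
          finally show "ennreal \<bar>Y i s v\<bar> \<le> ennreal B * ((\<Sum>j\<in>?I. ennreal (G j i s v) + ennreal (Q j i s v)) + ennreal (ff i s v))" .
        qed
        also have "\<dots> = ennreal B * ((\<Sum>j\<in>?I. (VINT v. ennreal (G j i s v)) + (VINT v. ennreal (Q j i s v))) + (VINT v. ennreal (ff i s v)))"
        proof -
          have "(VINT v. (\<Sum>j\<in>?I. ennreal (G j i s v) + ennreal (Q j i s v))) = (\<Sum>j\<in>?I. (VINT v. ennreal (G j i s v)) + (VINT v. ennreal (Q j i s v)))"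
            by (subst nn_integral_sum) (auto intro!: sum.cong nn_integral_add)
          then show ?thesis
            by (subst nn_integral_cmult, measurable) (subst nn_integral_add, measurable)
        qed
        also have "\<dots> \<le> ennreal B * ((\<Sum>j\<in>?I. ennreal C1 + ennreal C1) + ennreal M)"
          by (intro mult_left_mono add_mono sum_mono nG nQ nF i s) auto
        also have "\<dots> = ennreal B * ((\<Sum>j\<in>?I. ennreal (2 * C1)) + ennreal M)"
          using C10 by (simp add: ennreal_plus[symmetric] del: ennreal_plus)
        also have "\<dots> = ennreal (B * (real N * (2 * C1) + M))"
          using B(3) C10 M_pos by (simp add: ennreal_mult ennreal_plus ennreal_of_nat_eq_real_of_nat)
        finally show ?thesis using True by simp
      qed (simp add: Y_def)
    qed
    also have "\<dots> < \<infinity>" using T by (simp add: nn_integral_cmult ennreal_mult_less_top)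
    finally show "(\<integral>\<^sup>+p. ennreal (norm (Y i (fst p) (snd p))) \<partial>(lborel \<Otimes>\<^sub>M lborel)) < \<infinity>" .
  qed
  \<comment> \<open>The sign of the total derivative is \<open>fixed_time\<close> at the scale
    \<open>\<kappa> s\<close>. The rest transfers that inequality from extended to real
    integrals.\<close>
  have nonneg: "0 \<le> (\<Sum>i\<in>?I. \<integral>v. Y i s v \<partial>lborel)" for s
  proof (cases "s \<in> {0..T}")
    case True
    then have s: "0 \<le> s" "s \<le> T" by auto
    define Pos where "Pos i v = S i s v * (\<Sum>j\<in>?I. G j i s v) + ff i s v * (K / \<kappa> s * S i s v)" for i v
    define Neg where "Neg i v = S i s v * (\<Sum>j\<in>?I. Q j i s v) + ff i s v * (al / \<kappa> s * (S i s v)^2)" for i v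
    have YPN: "Y i s v = \<omega> s * (Pos i v - Neg i v)" for i v
      using True by (simp add: Y_def Pos_def Neg_def \<phi>_def \<phi>d_def sum_subtractf algebra_simps)
    have PN0: "0 \<le> Pos i v" "0 \<le> Neg i v" if i: "i \<in> ?I" for i v
      using S0[OF i, of s v] G0 Q0[OF i] ff_nonneg[OF i, of s v] K al \<kappa>0[of s]
      by (auto simp: Pos_def Neg_def intro!: add_nonneg_nonneg mult_nonneg_nonneg sum_nonneg)
    have iS: "integrable lborel (\<lambda>v. S i s v * u v)" if i: "i \<in> ?I" and u: "integrable lborel u" for i and u :: "vec \<Rightarrow> real"
    proof (rule Bochner_Integration.integrable_bound[where f="\<lambda>v. \<kappa> s * u v"])
      show "integrable lborel (\<lambda>v. \<kappa> s * u v)" using u by simp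
      show "(\<lambda>v. S i s v * u v) \<in> borel_measurable lborel" using borel_measurable_integrable[OF u] by measurable
      show "AE v in lborel. norm (S i s v * u v) \<le> norm (\<kappa> s * u v)"
        using S0[OF i, of s] \<kappa>0[of s] by (auto simp: abs_mult intro!: mult_right_mono)
    qed
    have iPN: "integrable lborel (Pos i)" "integrable lborel (Neg i)" if i: "i \<in> ?I" for i
    proof -
      have "integrable lborel (\<lambda>v. S i s v * (\<Sum>j\<in>?I. G j i s v))" "integrable lborel (\<lambda>v. S i s v * (\<Sum>j\<in>?I. Q j i s v))"
        by (rule iS[OF i], intro Bochner_Integration.integrable_sum iG(1)[OF i _ s(1)], assumption)
          (rule iS[OF i], intro Bochner_Integration.integrable_sum iG(2)[OF i _ s(1)], assumption)
      moreover have "integrable lborel (\<lambda>v. ff i s v * (K / \<kappa> s * S i s v))"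
        using integrable_mult_right[OF iS[OF i iF[OF i s(1)]], of "K / \<kappa> s"] by (simp add: mult_ac)
      moreover have "integrable lborel (\<lambda>v. ff i s v * (al / \<kappa> s * (S i s v)^2))"
        using integrable_mult_right[OF iS[OF i iS[OF i iF[OF i s(1)]]], of "al / \<kappa> s"] by (simp add: mult_ac power2_eq_square)
      ultimately show "integrable lborel (Pos i)" "integrable lborel (Neg i)"
        unfolding Pos_def[abs_def] Neg_def[abs_def] by auto
    qed
    have nP: "(VINT v. ennreal (Pos i v)) = (\<Sum>j\<in>?I. (VINT v. ennreal (S i s v) * gn j i s v)) + (VINT v. ennreal (ff i s v) * ennreal (K / \<kappa> s * S i s v))" if i: "i \<in> ?I" for i
    proof -
      note [measurable] = ff_measurable[OF i]
      have gfin: "AE v in lborel. \<forall>j\<in>?I. ennreal (G j i s v) = gn j i s v"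
      proof (intro AE_finite_allI)
        fix j assume j: "j \<in> ?I"
        have "(VINT v. gn j i s v) \<noteq> \<infinity>" using total_gain_loss(2)[OF i j s(1)] by (auto simp: top_unique)
        then have "AE v in lborel. gn j i s v \<noteq> \<infinity>" using i j by (intro nn_integral_PInf_AE) measurable
        then show "AE v in lborel. ennreal (G j i s v) = gn j i s v"
          by eventually_elim (simp add: G_def ennreal_enn2real less_top)
      qed simp
      have "(VINT v. ennreal (Pos i v)) = (VINT v. (\<Sum>j\<in>?I. ennreal (S i s v) * gn j i s v) + ennreal (ff i s v) * ennreal (K / \<kappa> s * S i s v))"
      proof (rule nn_integral_cong_AE, use gfin in eventually_elim)
        fix v assume g: "\<forall>j\<in>?I. ennreal (G j i s v) = gn j i s v"
        have "ennreal (Pos i v) = (\<Sum>j\<in>?I. ennreal (S i s v) * ennreal (G j i s v)) + ennreal (ff i s v) * ennreal (K / \<kappa> s * S i s v)"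
          unfolding Pos_def using S0[OF i, of s v] G0 ff_nonneg[OF i, of s v] K \<kappa>0[of s]
          by (intro ennreal_mult_sum_add mult_nonneg_nonneg divide_nonneg_nonneg) auto
        then show "ennreal (Pos i v) = (\<Sum>j\<in>?I. ennreal (S i s v) * gn j i s v) + ennreal (ff i s v) * ennreal (K / \<kappa> s * S i s v)"
          using g by simp
      qed
      also have "\<dots> = (\<Sum>j\<in>?I. (VINT v. ennreal (S i s v) * gn j i s v)) + (VINT v. ennreal (ff i s v) * ennreal (K / \<kappa> s * S i s v))"
        using i by (intro nn_integral_sum_add) measurable
      finally show ?thesis .
    qed
    have nN: "(VINT v. ennreal (Neg i v)) = (\<Sum>j\<in>?I. (VINT v. ennreal (S i s v) * (ennreal (ff i s v) * freq j i s v))) + (VINT v. ennreal (ff i s v) * ennreal (al / \<kappa> s * (S i s v)^2))" if i: "i \<in> ?I" for i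
    proof -
      note [measurable] = ff_measurable[OF i]
      have "(VINT v. ennreal (Neg i v)) = (VINT v. (\<Sum>j\<in>?I. ennreal (S i s v) * (ennreal (ff i s v) * freq j i s v)) + ennreal (ff i s v) * ennreal (al / \<kappa> s * (S i s v)^2))"
      proof (rule nn_integral_cong)
        fix v
        have "ennreal (Neg i v) = (\<Sum>j\<in>?I. ennreal (S i s v) * ennreal (Q j i s v)) + ennreal (ff i s v) * ennreal (al / \<kappa> s * (S i s v)^2)"
          unfolding Neg_def using S0[OF i, of s v] Q0[OF i] ff_nonneg[OF i, of s v] al \<kappa>0[of s]
          by (intro ennreal_mult_sum_add mult_nonneg_nonneg divide_nonneg_nonneg) auto
        then show "ennreal (Neg i v) = (\<Sum>j\<in>?I. ennreal (S i s v) * (ennreal (ff i s v) * freq j i s v)) + ennreal (ff i s v) * ennreal (al / \<kappa> s * (S i s v)^2)"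
          using Qeq[OF i _ s(1)] by simp
      qed
      also have "\<dots> = (\<Sum>j\<in>?I. (VINT v. ennreal (S i s v) * (ennreal (ff i s v) * freq j i s v))) + (VINT v. ennreal (ff i s v) * ennreal (al / \<kappa> s * (S i s v)^2))"
        using i by (intro nn_integral_sum_add) measurable
      finally show ?thesis .
    qed
    have "(\<Sum>i\<in>?I. (VINT v. ennreal (Neg i v))) \<le> (\<Sum>i\<in>?I. (VINT v. ennreal (Pos i v)))"
      using fixed_time[OF \<kappa>0[of s] s(1) c th AW Z less_imp_le[OF al] K PW[OF \<kappa>ge[OF s(2)]]]
      by (simp add: nP nN sum.distrib S_def x_def)
    moreover have "(VINT v. ennreal (Pos i v)) = ennreal (\<integral>v. Pos i v \<partial>lborel)" "(VINT v. ennreal (Neg i v)) = ennreal (\<integral>v. Neg i v \<partial>lborel)" if "i \<in> ?I" for i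
      using iPN[OF that] PN0[OF that] by (auto intro!: nn_integral_eq_integral)
    then have "(\<Sum>i\<in>?I. (VINT v. ennreal (Pos i v))) = (\<Sum>i\<in>?I. ennreal (\<integral>v. Pos i v \<partial>lborel))"
      "(\<Sum>i\<in>?I. (VINT v. ennreal (Neg i v))) = (\<Sum>i\<in>?I. ennreal (\<integral>v. Neg i v \<partial>lborel))"
      by (auto intro!: sum.cong)
    ultimately have "(\<Sum>i\<in>?I. ennreal (\<integral>v. Neg i v \<partial>lborel)) \<le> (\<Sum>i\<in>?I. ennreal (\<integral>v. Pos i v \<partial>lborel))"
      by (simp only:)
    moreover have "(\<Sum>i\<in>?I. ennreal (\<integral>v. Neg i v \<partial>lborel)) = ennreal (\<Sum>i\<in>?I. \<integral>v. Neg i v \<partial>lborel)"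
      "(\<Sum>i\<in>?I. ennreal (\<integral>v. Pos i v \<partial>lborel)) = ennreal (\<Sum>i\<in>?I. \<integral>v. Pos i v \<partial>lborel)"
      using PN0 by (auto intro!: sum_ennreal Bochner_Integration.integral_nonneg)
    ultimately have "ennreal (\<Sum>i\<in>?I. \<integral>v. Neg i v \<partial>lborel) \<le> ennreal (\<Sum>i\<in>?I. \<integral>v. Pos i v \<partial>lborel)"
      by simp
    then have "(\<Sum>i\<in>?I. \<integral>v. Neg i v \<partial>lborel) \<le> (\<Sum>i\<in>?I. \<integral>v. Pos i v \<partial>lborel)"
      using PN0 by (subst (asm) ennreal_le_iff) (auto intro!: sum_nonneg Bochner_Integration.integral_nonneg)
    moreover have "(\<Sum>i\<in>?I. \<integral>v. Y i s v \<partial>lborel) = \<omega> s * ((\<Sum>i\<in>?I. \<integral>v. Pos i v \<partial>lborel) - (\<Sum>i\<in>?I. \<integral>v. Neg i v \<partial>lborel))"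
      unfolding YPN sum_subtractf[symmetric] sum_distrib_left using iPN by (intro sum.cong refl) simp
    ultimately show ?thesis using \<omega>0[of s] by simp
  qed (simp add: Y_def)
  have fin: "(\<integral>v. \<phi> i T v * f i T v - \<phi> i 0 v * f i 0 v \<partial>lborel) = (\<integral>s. \<integral>v. Y i s v \<partial>lborel \<partial>lborel)" if i: "i \<in> ?I" for i
  proof -
    note [measurable] = f_measurable[OF i T] f_measurable[OF i order_refl]
    have "(\<integral>v. \<phi> i T v * f i T v - \<phi> i 0 v * f i 0 v \<partial>lborel) = (\<integral>v. \<integral>s. Y i s v \<partial>lborel \<partial>lborel)"
      using AEY[OF i] i by (intro integral_cong_AE) (measurable, auto)
    also have "\<dots> = (\<integral>s. \<integral>v. Y i s v \<partial>lborel \<partial>lborel)"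
      using iY[OF i] by (intro lborel_pair.Fubini_integral) (simp add: split_beta')
    finally show ?thesis .
  qed
  have "0 \<le> (\<integral>s. (\<Sum>i\<in>?I. \<integral>v. Y i s v \<partial>lborel) \<partial>lborel)" by (intro Bochner_Integration.integral_nonneg nonneg)
  also have "\<dots> = (\<Sum>i\<in>?I. \<integral>s. \<integral>v. Y i s v \<partial>lborel \<partial>lborel)"
    using lborel_pair.integrable_fst'[OF iY] by (intro Bochner_Integration.integral_sum) simp
  also have "\<dots> = (\<Sum>i\<in>?I. \<integral>v. \<phi> i T v * f i T v - \<phi> i 0 v * f i 0 v \<partial>lborel)" by (simp add: fin)
  also have "\<dots> = (\<Sum>i\<in>?I. (\<integral>v. \<phi> i T v * f i T v \<partial>lborel) - (\<integral>v. \<phi> i 0 v * f i 0 v \<partial>lborel))"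
  proof (intro sum.cong refl Bochner_Integration.integral_diff)
    fix i assume i: "i \<in> ?I"
    have *: "integrable lborel (\<lambda>v. \<phi> i s v * f i s v)" if s: "s \<in> {0..T}" for s
    proof (rule Bochner_Integration.integrable_bound[where f="\<lambda>v. W * \<kappa> 0 * f i s v"])
      have s0: "0 \<le> s" using s by simp
      show "integrable lborel (\<lambda>v. W * \<kappa> 0 * f i s v)" using integrable_f(1)[OF i s0] by simp
      show "(\<lambda>v. \<phi> i s v * f i s v) \<in> borel_measurable lborel" using f_measurable[OF i s0] by measurable
      show "AE v in lborel. norm (\<phi> i s v * f i s v) \<le> norm (W * \<kappa> 0 * f i s v)"
        using \<phi>b[OF i s] W0 \<kappa>0[of 0] by (auto simp: abs_mult intro!: mult_right_mono)
    qed
    show "integrable lborel (\<lambda>v. \<phi> i T v * f i T v)" "integrable lborel (\<lambda>v. \<phi> i 0 v * f i 0 v)"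
      using * T by auto
  qed
  finally have main: "(\<Sum>i\<in>?I. \<integral>v. \<phi> i 0 v * f i 0 v \<partial>lborel) \<le> (\<Sum>i\<in>?I. \<integral>v. \<phi> i T v * f i T v \<partial>lborel)"
    by (simp add: sum_subtractf)
  \<comment> \<open>At time 0 both the larger scale and the weight \<open>\<omega> 0 \<ge> 1\<close>
    only increase the integrand.\<close>
  have "(\<Sum>i\<in>?I. \<integral>v. f i 0 v * sat k0 (m i * (norm (v - c))^2) \<partial>lborel) \<le> (\<Sum>i\<in>?I. \<integral>v. \<phi> i 0 v * f i 0 v \<partial>lborel)"
  proof (rule sum_mono)
    fix i assume i: "i \<in> ?I"
    note [measurable] = f_measurable[OF i order_refl]
    have le: "sat k0 (x i v) \<le> \<phi> i 0 v" for v
    proof -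
      have "sat k0 (x i v) \<le> S i 0 v" unfolding S_def using x0[OF i] \<kappa>ge[OF T] k0 by (intro sat_mono) auto
      also have "\<dots> \<le> \<omega> 0 * S i 0 v" using \<omega>0(1)[of 0] S0[OF i, of 0 v] by (simp add: mult_le_cancel_right1)
      finally show ?thesis by (simp add: \<phi>_def)
    qed
    show "(\<integral>v. f i 0 v * sat k0 (m i * (norm (v - c))^2) \<partial>lborel) \<le> (\<integral>v. \<phi> i 0 v * f i 0 v \<partial>lborel)"
    proof (rule integral_mono')
      show "integrable lborel (\<lambda>v. \<phi> i 0 v * f i 0 v)"
      proof (rule Bochner_Integration.integrable_bound[where f="\<lambda>v. W * \<kappa> 0 * f i 0 v"])
        show "integrable lborel (\<lambda>v. W * \<kappa> 0 * f i 0 v)" using integrable_f(1)[OF i order_refl] by simp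
        show "AE v in lborel. norm (\<phi> i 0 v * f i 0 v) \<le> norm (W * \<kappa> 0 * f i 0 v)"
          using \<phi>b[OF i, of 0] T W0 \<kappa>0[of 0] by (auto simp: abs_mult intro!: mult_right_mono)
      qed measurable
      fix v
      show "f i 0 v * sat k0 (m i * (norm (v - c))^2) \<le> \<phi> i 0 v * f i 0 v"
        using mult_right_mono[OF le f_nonneg[OF i order_refl]] by (simp add: x_def mult.commute)
      show "0 \<le> \<phi> i 0 v * f i 0 v" using \<phi>b(1)[OF i, of 0 v] T f_nonneg[OF i order_refl, of v] by simp
    qed
  qed
  also have "\<dots> \<le> (\<Sum>i\<in>?I. \<integral>v. \<phi> i T v * f i T v \<partial>lborel)" by (rule main)
  also have "\<dots> = W * (\<Sum>i\<in>?I. \<integral>v. f i T v * sat k0 (m i * (norm (v - c))^2) \<partial>lborel)"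
    by (simp add: \<phi>_def \<omega>T S_def x_def \<kappa>_def sum_distrib_left mult_ac)
  finally show ?thesis by (simp add: W_def)
qed

end

section \<open>Entropy keeps the initial mass from concentrating; uniform non-concentration\<close>

lemma nn_integral_gaussian_vec: "(\<integral>\<^sup>+v. ennreal (exp (- (norm v)\<^sup>2)) \<partial>(lborel :: vec measure)) < \<infinity>"
proof -
  have g: "(\<integral>\<^sup>+x. ennreal (exp (- x\<^sup>2)) \<partial>(lborel :: real measure)) < \<infinity>"
  proof -
    have "(\<lambda>x::real. exp (- x\<^sup>2)) = (\<lambda>x. sqrt pi * normal_density 0 (sqrt (1/2)) x)"
      by (simp add: normal_density_def fun_eq_iff power_divide real_sqrt_divide)
    then have "integrable lborel (\<lambda>x::real. exp (- x\<^sup>2))"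
      by (simp add: integrable_normal_density)
    then show ?thesis by (simp add: integrable_iff_bounded)
  qed
  have e: "ennreal (exp (- (norm v)\<^sup>2)) = (\<Prod>b\<in>Basis. ennreal (exp (- (v \<bullet> b)\<^sup>2)))" for v :: vec
  proof -
    have "(norm v)^2 = (\<Sum>b\<in>Basis. (v \<bullet> b)\<^sup>2)" by (subst power2_norm_eq_inner, subst euclidean_inner) (simp add: power2_eq_square)
    then show ?thesis by (simp add: exp_sum[symmetric] sum_negf prod_ennreal)
  qed
  have "(\<integral>\<^sup>+v. ennreal (exp (- (norm v)\<^sup>2)) \<partial>(lborel :: vec measure)) = (\<Prod>b\<in>(Basis :: vec set). (VINT x. ennreal (exp (- x\<^sup>2))))"
    unfolding e by (rule nn_integral_lborel_prod) auto
  also have "\<dots> < \<infinity>" using g by (simp add: ennreal_prod_eq_top less_top power_less_top_ennreal)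
  finally show ?thesis .
qed

definition gauss :: real where "gauss = (LINT v|(lborel :: vec measure). exp (- (norm v)\<^sup>2))"

lemma integrable_gauss: "integrable (lborel :: vec measure) (\<lambda>v. exp (- (norm v)\<^sup>2))"
  using nn_integral_gaussian_vec by (simp add: integrable_iff_bounded)

lemma gauss_nonneg: "0 \<le> gauss"
  unfolding gauss_def by (rule Bochner_Integration.integral_nonneg) simp

text \<open>Convex duality, from \<open>ln x \<le> x - 1\<close> at
  \<open>x = 1 / (y * exp q)\<close>. With \<open>q = |v|^2\<close> it bounds the negative part of
  the entropy by the energy and a Gaussian.\<close>

lemma minus_entropy_le:
  assumes "0 \<le> (y::real)"
  shows "- (y * ln y) \<le> y * q + exp (- q)"
proof (cases "y = 0")
  case False
  then have y: "0 < y" using assms by simp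
  define u where "u = y * exp q"
  have u: "0 < u" using y by (simp add: u_def)
  have "ln (inverse u) \<le> inverse u - 1" using u by (intro ln_le_minus_one) simp
  then have "u * (- ln u) \<le> u * (inverse u - 1)" using u by (intro mult_left_mono) (auto simp: ln_inverse)
  also have "\<dots> \<le> 1" using u by (simp add: algebra_simps)
  finally have "exp (- q) * (u * (- ln u)) \<le> exp (- q) * 1" by (intro mult_left_mono) auto
  moreover have "exp (- q) * (u * (- ln u)) = - (y * ln y) - y * q"
    using y by (simp add: u_def ln_mult exp_minus field_simps)
  ultimately show ?thesis by simp
qed simp

text \<open>All three parts use \<open>minus_entropy_le\<close> with \<open>q = |v|^2\<close>: the
  negative part of \<open>g ln g\<close> costs at most \<open>E + gauss\<close>, and the positive
  part is the entropy plus that.\<close>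

lemma entropy_bounds:
  fixes g :: "vec \<Rightarrow> real"
  assumes g0: "\<And>v. 0 \<le> g v" and g1: "integrable lborel g" and g2: "integrable lborel (\<lambda>v. g v * (norm v)^2)"
    and gl: "integrable lborel (\<lambda>v. g v * ln (g v))" and E: "(LINT v|lborel. g v * (norm v)^2) \<le> E"
  shows "- (E + gauss) \<le> (LINT v|lborel. g v * ln (g v))"
    and "integrable lborel (\<lambda>v. g v * max 0 (ln (g v)))"
    and "(LINT v|lborel. g v * max 0 (ln (g v))) \<le> (LINT v|lborel. g v * ln (g v)) + E + gauss"
proof -
  note [measurable] = borel_measurable_integrable[OF g1]
  have "(LINT v|lborel. - (g v * ln (g v))) \<le> (LINT v|lborel. g v * (norm v)^2 + exp (- (norm v)\<^sup>2))"
    using gl g2 integrable_gauss by (intro integral_mono Bochner_Integration.integrable_add minus_entropy_le g0) auto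
  also have "\<dots> \<le> E + gauss" using E g2 integrable_gauss by (simp add: gauss_def)
  finally show "- (E + gauss) \<le> (LINT v|lborel. g v * ln (g v))" by simp
  show i: "integrable lborel (\<lambda>v. g v * max 0 (ln (g v)))"
    by (rule Bochner_Integration.integrable_bound[OF gl]) (auto simp: abs_mult max_def mult_nonneg_nonpos intro!: mult_left_mono)
  have "(LINT v|lborel. g v * max 0 (ln (g v))) \<le> (LINT v|lborel. g v * ln (g v) + (g v * (norm v)^2 + exp (- (norm v)\<^sup>2)))"
  proof (rule integral_mono[OF i])
    show "integrable lborel (\<lambda>v. g v * ln (g v) + (g v * (norm v)^2 + exp (- (norm v)\<^sup>2)))"
      using gl g2 integrable_gauss by auto
    fix v
    show "g v * max 0 (ln (g v)) \<le> g v * ln (g v) + (g v * (norm v)^2 + exp (- (norm v)\<^sup>2))"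
      using minus_entropy_le[OF g0, of v "(norm v)^2"] g0[of v] mult_nonneg_nonneg[OF g0[of v], of "(norm v)^2"]
      by (auto simp: max_def)
  qed
  also have "\<dots> \<le> (LINT v|lborel. g v * ln (g v)) + E + gauss"
    using gl g2 integrable_gauss E by (simp add: gauss_def)
  finally show "(LINT v|lborel. g v * max 0 (ln (g v))) \<le> (LINT v|lborel. g v * ln (g v)) + E + gauss" .
qed

text \<open>Where \<open>g \<le> K\<close> the volume of the ball counts; where \<open>g > K\<close>
  the factor \<open>ln g / ln K\<close> exceeds 1.\<close>

lemma ball_mass_le:
  fixes g :: "vec \<Rightarrow> real"
  assumes g0: "\<And>v. 0 \<le> g v" and g1: "integrable lborel g" and i: "integrable lborel (\<lambda>v. g v * max 0 (ln (g v)))"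
    and K: "1 < K"
  shows "(LINT v|lborel. g v * indicator (ball c r) v) \<le> K * measure lborel (ball c r) + (LINT v|lborel. g v * max 0 (ln (g v))) / ln K"
proof -
  have lK: "0 < ln K" using K by simp
  have ib: "integrable lborel (\<lambda>v. K * indicator (ball c r) v :: real)"
    using emeasure_lborel_ball_finite[of c r] by (intro integrable_mult_right) (simp add: integrable_indicator_iff)
  have "(LINT v|lborel. g v * indicator (ball c r) v) \<le> (LINT v|lborel. K * indicator (ball c r) v + (g v * max 0 (ln (g v))) / ln K)"
  proof (rule integral_mono)
    show "integrable lborel (\<lambda>v. g v * indicator (ball c r) v)" using g1 by (rule integrable_mult_indicator[of _ _ g, simplified mult.commute real_scaleR_def, rotated]) simp
    show "integrable lborel (\<lambda>v. K * indicator (ball c r) v + (g v * max 0 (ln (g v))) / ln K)" using ib i by auto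
    fix v
    define P where "P = g v * max 0 (ln (g v)) / ln K"
    have nn: "0 \<le> P" unfolding P_def using g0[of v] lK by (intro divide_nonneg_nonneg mult_nonneg_nonneg) auto
    show "g v * indicator (ball c r) v \<le> K * indicator (ball c r) v + (g v * max 0 (ln (g v))) / ln K"
    proof (cases "v \<in> ball c r \<and> K < g v")
      case True
      then have "ln K \<le> ln (g v)" using K by (subst ln_le_cancel_iff) auto
      then have "1 \<le> max 0 (ln (g v)) / ln K" using lK by (simp add: pos_le_divide_eq)
      then have "g v * 1 \<le> g v * (max 0 (ln (g v)) / ln K)" using g0[of v] by (intro mult_left_mono) auto
      then show ?thesis using True K by (simp add: indicator_def)
    next
      case False
      then show ?thesis using nn g0[of v] K unfolding P_def[symmetric] by (auto simp: indicator_def)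
    qed
  qed
  also have "\<dots> = K * measure lborel (ball c r) + (LINT v|lborel. g v * max 0 (ln (g v))) / ln K"
    using ib i by simp
  finally show ?thesis .
qed

context collision_kernels
begin

text \<open>This fixes the constants of \<open>saturated_energy_mono\<close> from
  \<open>\<delta>\<close>, \<open>M\<close>, \<open>E\<close> and \<open>R\<close> alone. The work
  is the pointwise inequality \<open>PW\<close>, split at the distance \<open>Z\<close> from the
  centre.\<close>

lemma saturated_energy_const:
  assumes pos: "0 < \<delta>" "0 < M" "0 < E"
  shows "\<exists>k0>0. \<exists>C>0. \<forall>f. mixture_flow N m \<gamma> h f \<delta> M E \<longrightarrow> (\<forall>c T. norm c \<le> R \<longrightarrow> 0 \<le> T \<longrightarrow>
     (\<Sum>i\<in>{1..N}. LINT v|lborel. f i 0 v * sat k0 (m i * (norm (v - c))^2))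
     \<le> C * (\<Sum>i\<in>{1..N}. LINT v|lborel. f i T v * sat k0 (m i * (norm (v - c))^2)))"
proof -
  obtain \<theta>1 AW where th: "0 < \<theta>1" "\<theta>1 < pi/4" and AW: "0 < AW" "\<And>i. i \<in> {1..N} \<Longrightarrow> ennreal AW \<le> angle_mass (\<lambda>\<theta>. ennreal (Hw \<theta>1 i \<theta>))"
    using window by metis
  define mmin where "mmin = Min (insert 1 (m ` {1..N}))"
  define mmax where "mmax = Max (insert 1 (m ` {1..N}))"
  have mm: "mmin \<le> m i" "m i \<le> mmax" if "i \<in> {1..N}" for i
    unfolding mmin_def mmax_def using that by (intro Min_le, simp, simp, intro Max_ge, simp, simp)
  have mmin: "0 < mmin" unfolding mmin_def using mass_pos by (subst Min_gr_iff) auto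
  have mmax: "1 \<le> mmax" by (simp add: mmax_def)
  have s1: "0 < sin \<theta>1" using th by (intro sin_gt_zero) auto
  define Ecv where "Ecv = 2 * (E + R^2 * M)"
  define Etv where "Etv = (\<Sum>i\<in>{1..N}. m i * Ecv)"
  have Ecv: "0 < Ecv" using pos by (simp add: Ecv_def add_pos_nonneg)
  have Etv: "0 \<le> Etv" unfolding Etv_def using mass_pos Ecv by (intro sum_nonneg mult_nonneg_nonneg) (auto intro: less_imp_le)
  define c3 where "c3 = ((sin \<theta>1 / 2)^2)^2 * AW * \<delta> / 4"
  have c3: "0 < c3" using s1 AW(1) pos by (simp add: c3_def)
  \<comment> \<open>The smallest scale. Beyond \<open>Z\<close> one has
    \<open>S \<ge> X / 2\<close>, and then a quarter of \<open>c3\<close> times \<open>S^2\<close>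
    already covers the linear loss; another quarter is left for \<open>al\<close>.\<close>
  define X where "X = 16 * CA * Etv / c3 + 1"
  have X: "1 \<le> X" using CA_pos Etv c3 by (simp add: X_def)
  have X': "2 * CA * Etv \<le> c3 / 4 * (X / 2)" using c3 by (simp add: X_def field_simps)
  \<comment> \<open>The three summands provide \<open>Z \<le> Z^2\<close>,
    \<open>X \<le> mmin * Z^2\<close> and the radius that \<open>near_mass\<close> asks for.\<close>
  define Z where "Z = 1 + X / mmin + 2 * Ecv / (\<delta> * (sin \<theta>1 / 4)^2)"
  have Zp: "0 \<le> X / mmin" "0 \<le> 2 * Ecv / (\<delta> * (sin \<theta>1 / 4)^2)" using X mmin Ecv pos by auto
  have Z1: "1 \<le> Z" using Zp by (simp add: Z_def)
  then have ZZ: "Z \<le> Z^2" by (simp add: power2_eq_square)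
  have Zm: "X \<le> mmin * Z^2"
  proof -
    have "X / mmin \<le> Z^2" using Zp ZZ by (simp add: Z_def)
    then show ?thesis using mmin by (simp add: pos_divide_le_eq mult.commute)
  qed
  have ZE: "2 * Ecv \<le> \<delta> * (sin \<theta>1 / 4 * Z)^2"
  proof -
    have p: "0 < \<delta> * (sin \<theta>1 / 4)^2" using pos s1 by simp
    have "2 * Ecv / (\<delta> * (sin \<theta>1 / 4)^2) \<le> Z^2" using Zp ZZ unfolding Z_def by linarith
    then have "2 * Ecv \<le> Z^2 * (\<delta> * (sin \<theta>1 / 4)^2)" using p by (simp only: pos_divide_le_eq)
    also have "\<dots> = \<delta> * (sin \<theta>1 / 4 * Z)^2" by (simp only: power_mult_distrib mult.commute mult.left_commute)
    finally show ?thesis .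
  qed
  define al where "al = c3 / 4"
  have al: "0 < al" using c3 by (simp add: al_def)
  \<comment> \<open>The price for the region inside \<open>Z\<close>, where
    \<open>S \<le> mmax * Z^2\<close> and \<open>z powr \<gamma> \<le> 1 + Z\<close>.\<close>
  define K where "K = al * (mmax * Z^2) + 2 * CA * Etv * (1 + Z)"
  have K: "0 \<le> K" using al mmax CA_pos Etv Z1 by (simp add: K_def)
  have PW: "al * s^2 + 2 * CA * Etv * (z powr \<gamma> * s) \<le> c3 / 2 * (indicator {Z..} z * z powr \<gamma> * s^2) + K * s"
    if k: "X \<le> k" and i: "i \<in> {1..N}" and z: "0 \<le> z" and s: "s = sat k (m i * z^2)" for k i z s
  proof -
    have k0: "0 < k" using k X by simp
    have mi: "0 < m i" by (rule mass_pos[OF i])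
    have s0: "0 \<le> s" "s \<le> m i * z^2" unfolding s using k0 mi by (auto intro!: sat_bounds)
    have zp: "z powr \<gamma> \<le> 1 + z" using gamma z by (intro powr_le_one_plus) auto
    show ?thesis
    proof (cases "Z \<le> z")
      case True
      have "Z^2 \<le> z^2" using True Z1 by (intro power_mono) auto
      then have "mmin * Z^2 \<le> m i * z^2" using mm(1)[OF i] mmin by (intro mult_mono) auto
      then have sX: "X / 2 \<le> s" unfolding s using k X Zm by (intro sat_ge_half k0) auto
      have z1: "1 \<le> z powr \<gamma>" using True Z1 gamma by (intro ge_one_powr_ge_zero) auto
      have "2 * CA * Etv * (z powr \<gamma> * s) \<le> c3 / 4 * s * (z powr \<gamma> * s)"
      proof (rule mult_right_mono)
        have "c3 / 4 * (X / 2) \<le> c3 / 4 * s" using sX c3 by (intro mult_left_mono) auto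
        then show "2 * CA * Etv \<le> c3 / 4 * s" using X' by linarith
      qed (use s0 in auto)
      moreover have "al * s^2 \<le> c3 / 4 * (z powr \<gamma> * s^2)"
      proof -
        have "1 * s^2 \<le> z powr \<gamma> * s^2" using z1 by (intro mult_right_mono) auto
        then show ?thesis using c3 unfolding al_def by (intro mult_left_mono) auto
      qed
      moreover have "0 \<le> K * s" using K s0 by simp
      ultimately show ?thesis using True by (simp add: power2_eq_square algebra_simps)
    next
      case False
      have "z^2 \<le> Z^2" using False z by (intro power_mono) auto
      then have "m i * z^2 \<le> mmax * Z^2" using mm(2)[OF i] mi by (intro mult_mono) auto
      then have "s \<le> mmax * Z^2" using s0 by linarith
      then have "al * s * s \<le> al * (mmax * Z^2) * s" using al s0 by (intro mult_right_mono mult_left_mono) auto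
      moreover have "2 * CA * Etv * (z powr \<gamma> * s) \<le> 2 * CA * Etv * ((1 + Z) * s)"
        using zp False CA_pos Etv s0 by (intro mult_left_mono mult_right_mono) auto
      ultimately have "al * s * s + 2 * CA * Etv * (z powr \<gamma> * s) \<le> K * s" by (simp add: K_def algebra_simps)
      then show ?thesis using False by (simp add: power2_eq_square mult.assoc)
    qed
  qed
  have main: "\<forall>f. mixture_flow N m \<gamma> h f \<delta> M E \<longrightarrow> (\<forall>c T. norm c \<le> R \<longrightarrow> 0 \<le> T \<longrightarrow>
     (\<Sum>i\<in>{1..N}. LINT v|lborel. f i 0 v * sat X (m i * (norm (v - c))^2))
     \<le> exp (K / (al * X)) * (\<Sum>i\<in>{1..N}. LINT v|lborel. f i T v * sat X (m i * (norm (v - c))^2)))"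
  proof (intro allI impI)
    fix f :: "nat \<Rightarrow> real \<Rightarrow> vec \<Rightarrow> real" and c :: vec and T :: real
    assume "mixture_flow N m \<gamma> h f \<delta> M E" and cT: "norm c \<le> R" "0 \<le> T"
    then interpret mixture_flow N m \<gamma> h f \<delta> M E by simp
    have Eq: "Ec R = Ecv" "Etot R = Etv" by (simp_all add: Ec_def Etot_def Ecv_def Etv_def)
    show "(\<Sum>i\<in>{1..N}. LINT v|lborel. f i 0 v * sat X (m i * (norm (v - c))^2))
     \<le> exp (K / (al * X)) * (\<Sum>i\<in>{1..N}. LINT v|lborel. f i T v * sat X (m i * (norm (v - c))^2))"
      by (rule saturated_energy_mono[OF _ cT(2) cT(1) th AW, where Z=Z])
         (use X Z1 ZE al K PW in \<open>auto simp: Eq c3_def\<close>)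
  qed
  show ?thesis
    by (rule exI[of _ X], rule conjI, use X in simp, rule exI[of _ "exp (K / (al * X))"], rule conjI, simp, rule main)
qed

text \<open>Initially at least half of the guaranteed mass \<open>\<delta>\<close> of species 1 lies
  outside a small ball about \<open>c\<close>, where \<open>sat\<close> is at least
  \<open>e0\<close>. The saturated energy carries this to all later times, at the cost of the factor
  \<open>C\<close>.\<close>

lemma nonconcentration:
  assumes N: "1 \<le> N" and pos: "0 < \<delta>" "0 < M" "0 < E"
  shows "\<exists>k0>0. \<exists>\<epsilon>>0. \<forall>f. mixture_flow N m \<gamma> h f \<delta> M E \<longrightarrow>
     finite_entropy N f \<longrightarrow>
     entropy N f \<le> Hb \<longrightarrow>
     (\<forall>c T. norm c \<le> R \<longrightarrow> 0 \<le> T \<longrightarrow> \<epsilon> \<le> (\<Sum>i\<in>{1..N}. LINT v|lborel. f i T v * sat k0 (m i * (norm (v - c))^2)))"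
proof -
  obtain k0 C where k0: "0 < k0" and C: "0 < C" and mono: "\<And>f c T. mixture_flow N m \<gamma> h f \<delta> M E \<Longrightarrow> norm c \<le> R \<Longrightarrow> 0 \<le> T \<Longrightarrow>
     (\<Sum>i\<in>{1..N}. LINT v|lborel. f i 0 v * sat k0 (m i * (norm (v - c))^2))
     \<le> C * (\<Sum>i\<in>{1..N}. LINT v|lborel. f i T v * sat k0 (m i * (norm (v - c))^2))"
    using saturated_energy_const[OF pos, of R] by blast
  have one: "1 \<in> {1..N}" using N by simp
  \<comment> \<open>A bound for the positive part of the entropy of species 1: each other species
    may contribute as little as \<open>- (E + gauss)\<close> to the total, and the positive part
    costs another \<open>E + gauss\<close>.\<close>
  define Hx where "Hx = \<bar>Hb\<bar> + real N * (E + gauss) + E + gauss"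
  have Hx: "0 \<le> Hx" using pos gauss_nonneg by (simp add: Hx_def)
  \<comment> \<open>The level above which at most \<open>\<delta> / 4\<close> of the mass can sit;
    the radius \<open>r\<close> below limits the mass under this level to
    \<open>\<delta> / 4\<close> as well.\<close>
  define K where "K = exp (1 + 4 * Hx / \<delta>)"
  have lnK: "ln K = 1 + 4 * Hx / \<delta>" by (simp add: K_def)
  have K1: "1 < K" using Hx pos by (simp add: K_def add_pos_nonneg)
  have HK: "Hx / ln K \<le> \<delta> / 4"
  proof -
    have "Hx \<le> \<delta> / 4 * ln K" using pos by (simp add: lnK field_simps)
    moreover have "0 < ln K" using K1 by simp
    ultimately show ?thesis by (simp add: pos_divide_le_eq)
  qed
  define V where "V = unit_ball_vol (real DIM(vec))"
  have V: "0 < V" by (simp add: V_def)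
  define r where "r = min 1 (\<delta> / (4 * K * V))"
  have r: "0 < r" "r \<le> 1" "r \<le> \<delta> / (4 * K * V)" using pos K1 V by (auto simp: r_def)
  have vol: "K * measure lborel (ball c r) \<le> \<delta> / 4" for c :: vec
  proof -
    have "measure lborel (ball c r) = V * r ^ 3"
      using content_ball[of r c] r by (simp add: V_def)
    also have "\<dots> \<le> V * r" using r V power_decreasing[of 1 3 r] by (intro mult_left_mono) auto
    also have "\<dots> \<le> V * (\<delta> / (4 * K * V))" using r V by (intro mult_left_mono) auto
    also have "\<dots> = \<delta> / (4 * K)" using V by simp
    finally have "K * measure lborel (ball c r) \<le> K * (\<delta> / (4 * K))" using K1 by (intro mult_left_mono) auto
    then show ?thesis using K1 by simp
  qed
  define e0 where "e0 = sat k0 (m 1 * r^2)"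
  have m1: "0 < m 1" by (rule mass_pos[OF one])
  have e0: "0 < e0" using k0 m1 r by (simp add: e0_def sat_def add_pos_pos)
  have main: "\<forall>f. mixture_flow N m \<gamma> h f \<delta> M E \<longrightarrow>
     finite_entropy N f \<longrightarrow>
     entropy N f \<le> Hb \<longrightarrow>
     (\<forall>c T. norm c \<le> R \<longrightarrow> 0 \<le> T \<longrightarrow> e0 * (\<delta> / 2) / C \<le> (\<Sum>i\<in>{1..N}. LINT v|lborel. f i T v * sat k0 (m i * (norm (v - c))^2)))"
  proof (intro allI impI)
    fix f :: "nat \<Rightarrow> real \<Rightarrow> vec \<Rightarrow> real" and c :: vec and T :: real
    assume flow: "mixture_flow N m \<gamma> h f \<delta> M E" and il: "finite_entropy N f"
      and Hb: "entropy N f \<le> Hb" and cT: "norm c \<le> R" "0 \<le> T"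
    interpret mixture_flow N m \<gamma> h f \<delta> M E by (rule flow)
    have g: "0 \<le> f i 0 v" "integrable lborel (f i 0)" "integrable lborel (\<lambda>v. f i 0 v * (norm v)^2)" "integrable lborel (\<lambda>v. f i 0 v * ln (f i 0 v))"
      "(LINT v|lborel. f i 0 v * (norm v)^2) \<le> E" if "i \<in> {1..N}" for i v
      using f_nonneg[OF that] integrable_f[OF that] energy_le[OF that] il that by auto
    note eb = entropy_bounds[OF g]
    have "(\<Sum>i\<in>{1..N} - {1}. - (E + gauss)) \<le> (\<Sum>i\<in>{1..N} - {1}. LINT v|lborel. f i 0 v * ln (f i 0 v))"
      by (intro sum_mono eb(1)) auto
    moreover have "entropy N f = (LINT v|lborel. f 1 0 v * ln (f 1 0 v)) + (\<Sum>i\<in>{1..N} - {1}. LINT v|lborel. f i 0 v * ln (f i 0 v))"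
      by (rule sum.remove[OF _ one]) simp
    moreover have "- (real N * (E + gauss)) \<le> (\<Sum>i\<in>{1..N} - {1}. - (E + gauss))"
    proof -
      have "real (card ({1..N} - {1})) * (E + gauss) \<le> real N * (E + gauss)"
        using pos gauss_nonneg card_mono[of "{1..N}" "{1..N} - {1}"] by (intro mult_right_mono) auto
      then show ?thesis by (simp only: sum_constant mult_minus_right neg_le_iff_le)
    qed
    ultimately have "(LINT v|lborel. f 1 0 v * ln (f 1 0 v)) \<le> \<bar>Hb\<bar> + real N * (E + gauss)" using Hb by linarith
    then have Hm: "(LINT v|lborel. f 1 0 v * max 0 (ln (f 1 0 v))) \<le> Hx"
      using eb(3)[OF one one one one one] by (simp add: Hx_def)
    have "(LINT v|lborel. f 1 0 v * indicator (ball c r) v) \<le> K * measure lborel (ball c r) + (LINT v|lborel. f 1 0 v * max 0 (ln (f 1 0 v))) / ln K"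
      by (rule ball_mass_le[OF g(1)[OF one] g(2)[OF one] eb(2)[OF one one one one one] K1])
    also have "\<dots> \<le> \<delta> / 4 + Hx / ln K"
      using vol Hm K1 by (intro add_mono divide_right_mono) auto
    also have "\<dots> \<le> \<delta> / 2" using HK by linarith
    finally have ball: "(LINT v|lborel. f 1 0 v * indicator (ball c r) v) \<le> \<delta> / 2" .
    note [measurable] = f_measurable[OF one order_refl]
    have ib: "integrable lborel (\<lambda>v. f 1 0 v * indicator (ball c r) v)"
    proof (rule Bochner_Integration.integrable_bound[OF g(2)[OF one]])
      show "(\<lambda>v. f 1 0 v * indicator (ball c r) v) \<in> borel_measurable lborel" by measurable
      show "AE v in lborel. norm (f 1 0 v * indicator (ball c r) v) \<le> norm (f 1 0 v)" by (auto simp: indicator_def)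
    qed
    have isat: "integrable lborel (\<lambda>v. f i 0 v * sat k0 (m i * (norm (v - c))^2))" if i: "i \<in> {1..N}" for i
    proof (rule Bochner_Integration.integrable_bound[where f="\<lambda>v. k0 * f i 0 v"])
      note [measurable] = f_measurable[OF i order_refl]
      show "integrable lborel (\<lambda>v. k0 * f i 0 v)" using g(2)[OF i] by simp
      show "(\<lambda>v. f i 0 v * sat k0 (m i * (norm (v - c))^2)) \<in> borel_measurable lborel" by measurable
      show "AE v in lborel. norm (f i 0 v * sat k0 (m i * (norm (v - c))^2)) \<le> norm (k0 * f i 0 v)"
        using sat_bounds[OF k0, of "m i * (norm (_ - c))^2"] mass_pos[OF i] k0
        by (auto simp: abs_mult mult.commute[of _ "sat _ _"] intro!: mult_right_mono)
    qed
    have "e0 * (\<delta> / 2) \<le> e0 * ((LINT v|lborel. f 1 0 v) - (LINT v|lborel. f 1 0 v * indicator (ball c r) v))"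
      using mass_ge[OF one order_refl] ball e0 by (intro mult_left_mono) auto
    also have "\<dots> = (LINT v|lborel. e0 * (f 1 0 v - f 1 0 v * indicator (ball c r) v))"
      using ib g(2)[OF one] by simp
    also have "\<dots> \<le> (LINT v|lborel. f 1 0 v * sat k0 (m 1 * (norm (v - c))^2))"
    proof (rule integral_mono[OF _ isat[OF one]])
      show "integrable lborel (\<lambda>v. e0 * (f 1 0 v - f 1 0 v * indicator (ball c r) v))" using ib g(2)[OF one] by simp
      fix v
      show "e0 * (f 1 0 v - f 1 0 v * indicator (ball c r) v) \<le> f 1 0 v * sat k0 (m 1 * (norm (v - c))^2)"
      proof (cases "v \<in> ball c r")
        case True
        then show ?thesis using g(1)[OF one, of v] sat_bounds(1)[OF k0, of "m 1 * (norm (v - c))^2"] m1 by simp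
      next
        case False
        then have "r \<le> norm (v - c)" by (simp add: dist_norm norm_minus_commute)
        then have "r^2 \<le> (norm (v - c))^2" using r by (intro power_mono) auto
        then have "e0 \<le> sat k0 (m 1 * (norm (v - c))^2)" unfolding e0_def using m1 k0 by (intro sat_mono mult_left_mono) auto
        then have "f 1 0 v * e0 \<le> f 1 0 v * sat k0 (m 1 * (norm (v - c))^2)" using g(1)[OF one] by (intro mult_left_mono) auto
        then show ?thesis using False by (simp add: mult.commute[of e0])
      qed
    qed
    also have "\<dots> \<le> (\<Sum>i\<in>{1..N}. LINT v|lborel. f i 0 v * sat k0 (m i * (norm (v - c))^2))"
    proof (rule member_le_sum[OF one, where f="\<lambda>i. LINT v|lborel. f i 0 v * sat k0 (m i * (norm (v - c))^2)"])
      fix i assume "i \<in> {1..N} - {1}"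
      then have i: "i \<in> {1..N}" by simp
      show "0 \<le> (LINT v|lborel. f i 0 v * sat k0 (m i * (norm (v - c))^2))"
        using g(1)[OF i] sat_bounds(1)[OF k0] mass_pos[OF i] by (intro Bochner_Integration.integral_nonneg mult_nonneg_nonneg) auto
    qed simp
    also have "\<dots> \<le> C * (\<Sum>i\<in>{1..N}. LINT v|lborel. f i T v * sat k0 (m i * (norm (v - c))^2))"
      by (rule mono[OF flow cT])
    finally show "e0 * (\<delta> / 2) / C \<le> (\<Sum>i\<in>{1..N}. LINT v|lborel. f i T v * sat k0 (m i * (norm (v - c))^2))"
      using C by (simp add: pos_divide_le_eq mult.commute)
  qed
  show ?thesis
    by (rule exI[of _ k0], rule conjI, rule k0, rule exI[of _ "e0 * (\<delta> / 2) / C"], rule conjI, use e0 pos C in simp, rule main)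
qed

end

section \<open>Spreading of a lower bound\<close>

context collision_kernels
begin

text \<open>The upper counterpart of \<open>window_post_vel\<close>: the components of
  \<open>v - w\<close> along and across \<open>n\<close> are shorter than \<open>v - w\<close> by
  the factor \<open>cos \<theta>1\<close>. This contraction is what lets a ball grow.\<close>

lemma window_post_vel_le:
  assumes mi: "0 < mi" and th: "0 < \<theta>1" "\<theta>1 < pi/4" and n: "norm n = 1"
    and k: "ckern \<gamma> (Hw \<theta>1 i) v w n \<noteq> 0"
  shows "norm (post_vel mi mi v w n - c) \<le> norm (w - c) + norm (v - w) * cos \<theta>1"
    "norm (post_vel_star mi mi v w n - c) \<le> norm (w - c) + norm (v - w) * cos \<theta>1"
proof -
  define g where "g = v - w"
  have gn: "0 \<le> g \<bullet> n" and ang: "coll_angle v w n \<in> {\<theta>1..pi/2 - \<theta>1}" and g0: "v \<noteq> w"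
    using k by (auto simp: ckern_def coll_kernel_def Hw_def g_def indicator_def split: if_splits)
  define y where "y = (g /\<^sub>R norm g) \<bullet> n"
  have gy: "g \<bullet> n = norm g * y" using g0 by (simp add: y_def g_def)
  have "y \<le> norm (g /\<^sub>R norm g) * norm n" unfolding y_def by (rule norm_cauchy_schwarz)
  then have y1: "y \<le> 1" using n g0 by (simp add: g_def)
  have y0: "0 \<le> y" using gn by (simp add: y_def)
  have ca: "coll_angle v w n = arccos y" by (simp add: coll_angle_def y_def g_def)
  have cy: "cos (arccos y) = y" using y0 y1 by simp
  have "cos (pi/2 - \<theta>1) \<le> cos (arccos y)"
    using ang th y0 y1 arccos_lbound[of y] by (intro cos_monotone_0_pi_le) (auto simp: ca)
  then have ylo: "sin \<theta>1 \<le> y" unfolding cy by (simp add: cos_diff)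
  have "cos (arccos y) \<le> cos \<theta>1"
    using ang th y0 y1 arccos_ubound[of y] by (intro cos_monotone_0_pi_le) (auto simp: ca)
  then have yhi: "y \<le> cos \<theta>1" unfolding cy .
  have s0: "0 \<le> sin \<theta>1" "0 \<le> cos \<theta>1" using th by (auto intro!: sin_ge_zero cos_ge_zero)
  have "1 - y\<^sup>2 \<le> (cos \<theta>1)^2"
    using power_mono[OF ylo s0(1), of 2] sin_cos_squared_add[of \<theta>1] by linarith
  then have ysq: "sqrt (1 - y\<^sup>2) \<le> cos \<theta>1" using s0 by (intro real_le_lsqrt) auto
  have half: "2 * mi / (mi + mi) = 1" using mi by simp
  have ps: "post_vel_star mi mi v w n - c = (w - c) + (g \<bullet> n) *\<^sub>R n"
    unfolding post_vel_simps half by (simp add: g_def)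
  have pv: "post_vel mi mi v w n - c = (w - c) + (g - (g \<bullet> n) *\<^sub>R n)"
    unfolding post_vel_simps half by (simp add: g_def)
  have a: "norm ((g \<bullet> n) *\<^sub>R n) \<le> norm g * cos \<theta>1" using n y0 yhi by (simp add: gy mult_left_mono)
  have "(norm (g - (g \<bullet> n) *\<^sub>R n))^2 = (norm g)^2 * (1 - y\<^sup>2)"
    unfolding norm_diff_scaleR_sq[OF n] gy by (simp add: power2_eq_square algebra_simps)
  then have "norm (g - (g \<bullet> n) *\<^sub>R n) = norm g * sqrt (1 - y\<^sup>2)"
    by (metis abs_norm_cancel real_sqrt_abs real_sqrt_mult)
  then have b: "norm (g - (g \<bullet> n) *\<^sub>R n) \<le> norm g * cos \<theta>1" using ysq by (simp add: mult_left_mono)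
  show "norm (post_vel mi mi v w n - c) \<le> norm (w - c) + norm (v - w) * cos \<theta>1"
    unfolding pv using norm_triangle_ineq[of "w - c" "g - (g \<bullet> n) *\<^sub>R n"] b by (simp add: g_def)
  show "norm (post_vel_star mi mi v w n - c) \<le> norm (w - c) + norm (v - w) * cos \<theta>1"
    unfolding ps using norm_triangle_ineq[of "w - c" "(g \<bullet> n) *\<^sub>R n"] a by (simp add: g_def)
qed

text \<open>A Maxwellian is reproduced by the gain term outside the ball on which it is already a lower
  bound: the energies of the two pre-collisional velocities add up to \<open>|v - y|\<^sup>2\<close>, apart from
  the small contribution of the slow partner.\<close>

lemma gain_maxwellian:
  fixes y v :: vec
  assumes i: "i \<in> {1..N}" and th: "0 < \<theta>1" "\<theta>1 < pi/4" and AW: "0 < AW" "ennreal AW \<le> angle_mass (\<lambda>\<theta>. ennreal (Hw \<theta>1 i \<theta>))"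
    and l: "0 < \<eta>" "\<eta> \<le> 1/2" "l * cos \<theta>1 + 2 * \<eta> \<le> 1" and \<rho>: "0 < \<rho>" "\<rho> \<le> R" and a: "0 < a" and b: "0 \<le> b"
    and v: "R < norm (v - y)" "norm (v - y) \<le> l * R"
  defines "F \<equiv> \<lambda>v. ennreal (a * exp (- b * (norm (v - y))^2)) * indicator (cball y R) v"
  shows "ennreal (a^2 * exp (- b * ((norm (v - y))^2 + (\<eta> * \<rho>)^2)) * ((\<rho> / 2) powr \<gamma> * AW * measure lborel (ball y (\<eta> * \<rho>))))
    \<le> gain \<gamma> (H i i) (m i) (m i) F F v"
proof -
  let ?K = "a^2 * exp (- b * ((norm (v - y))^2 + (\<eta> * \<rho>)^2))"
  let ?P = "post_vel (m i) (m i)" and ?S = "post_vel_star (m i) (m i)"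
  have mi: "0 < m i" by (rule mass_pos[OF i])
  have c0: "0 \<le> cos \<theta>1" "cos \<theta>1 \<le> 1" using th by (auto intro!: cos_ge_zero)
  have inner: "ennreal ((\<rho> / 2) powr \<gamma> * AW) * ennreal ?K * indicator (ball y (\<eta> * \<rho>)) w
     \<le> (SINT n. ennreal (ckern \<gamma> (H i i) v w n) * (F (?S v w n) * F (?P v w n)))" for w
  proof (cases "w \<in> ball y (\<eta> * \<rho>)")
    case True
    then have wy: "norm (w - y) \<le> \<eta> * \<rho>" by (simp add: dist_norm norm_minus_commute)
    have "\<eta> * \<rho> \<le> 1/2 * \<rho>" using l \<rho> by (intro mult_right_mono) auto
    moreover have "norm (v - y) - norm (w - y) \<le> norm (v - w)"
      using norm_triangle_ineq2[of "v - y" "w - y"] by simp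
    ultimately have vw: "\<rho> / 2 \<le> norm (v - w)" using v wy \<rho> by linarith
    have eR: "\<eta> * \<rho> \<le> \<eta> * R" using l \<rho> by (intro mult_left_mono) auto
    have "norm (v - w) \<le> norm (v - y) + norm (w - y)"
      using norm_triangle_ineq4[of "v - y" "w - y"] by simp
    then have vw2: "norm (v - w) \<le> (l + \<eta>) * R" using v wy eR by (simp add: distrib_right)
    \<comment> \<open>Both velocities at which \<open>F\<close> is evaluated stay in the ball. One
      \<open>\<eta> * R\<close> is the distance of \<open>w\<close>, the other comes from
      \<open>|v - w| \<le> (l + \<eta>) * R\<close>; hence the condition on
      \<open>l * cos \<theta>1 + 2 * \<eta>\<close>.\<close>
    have rad: "norm (w - y) + norm (v - w) * cos \<theta>1 \<le> R"
    proof -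
      have "norm (v - w) * cos \<theta>1 \<le> (l + \<eta>) * R * cos \<theta>1" using vw2 c0 by (intro mult_right_mono) auto
      moreover have "\<eta> * R * cos \<theta>1 \<le> \<eta> * R * 1" using l \<rho> c0 by (intro mult_left_mono) auto
      moreover have "(l * cos \<theta>1 + 2 * \<eta>) * R \<le> 1 * R" using l \<rho> by (intro mult_right_mono) auto
      ultimately show ?thesis using wy eR by (simp add: algebra_simps)
    qed
    have "ennreal ((\<rho> / 2) powr \<gamma> * AW) \<le> ennreal (norm (v - w) powr \<gamma>) * angle_mass (\<lambda>\<theta>. ennreal (Hw \<theta>1 i \<theta>))"
    proof -
      have "(\<rho> / 2) powr \<gamma> \<le> norm (v - w) powr \<gamma>" using vw \<rho> gamma by (intro powr_mono2) auto
      then have "ennreal ((\<rho> / 2) powr \<gamma>) * ennreal AW \<le> ennreal (norm (v - w) powr \<gamma>) * angle_mass (\<lambda>\<theta>. ennreal (Hw \<theta>1 i \<theta>))"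
        using AW by (intro mult_mono ennreal_leI) auto
      then show ?thesis using AW by (simp add: ennreal_mult)
    qed
    also have "\<dots> = (SINT n. ennreal (ckern \<gamma> (Hw \<theta>1 i) v w n))"
      by (rule nn_integral_ckern[symmetric]) (auto simp: Hw_bounds)
    finally have "ennreal ((\<rho> / 2) powr \<gamma> * AW) * ennreal ?K \<le> (SINT n. ennreal (ckern \<gamma> (Hw \<theta>1 i) v w n)) * ennreal ?K"
      by (rule mult_right_mono) simp
    also have "\<dots> = (SINT n. ennreal (ckern \<gamma> (Hw \<theta>1 i) v w n) * ennreal ?K)"
      by (rule nn_integral_sphere_multc[symmetric]) measurable
    also have "\<dots> \<le> (SINT n. ennreal (ckern \<gamma> (H i i) v w n) * (F (?S v w n) * F (?P v w n)))"
    proof (rule nn_integral_mono_AE, use AE_sphere_measure_norm in eventually_elim)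
      fix n :: vec assume n: "norm n = 1"
      show "ennreal (ckern \<gamma> (Hw \<theta>1 i) v w n) * ennreal ?K \<le> ennreal (ckern \<gamma> (H i i) v w n) * (F (?S v w n) * F (?P v w n))"
      proof (cases "ckern \<gamma> (Hw \<theta>1 i) v w n = 0")
        case False
        note pv = window_post_vel_le[OF mi th n False, of y]
        have in1: "?S v w n \<in> cball y R" "?P v w n \<in> cball y R"
          using pv rad by (auto simp: dist_norm norm_minus_commute)
        have "m i * ((norm (?P v w n - y))^2 + (norm (?S v w n - y))^2) = m i * ((norm (v - y))^2 + (norm (w - y))^2)"
          using post_vel_energy[OF mi mi n, of v w y] by (simp add: distrib_left)
        then have en: "(norm (?P v w n - y))^2 + (norm (?S v w n - y))^2 = (norm (v - y))^2 + (norm (w - y))^2" using mi by simp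
        have "(norm (w - y))^2 \<le> (\<eta> * \<rho>)^2" using wy by (intro power_mono) auto
        then have "b * ((norm (?P v w n - y))^2 + (norm (?S v w n - y))^2) \<le> b * ((norm (v - y))^2 + (\<eta> * \<rho>)^2)"
          unfolding en using b by (intro mult_left_mono) auto
        then have "?K \<le> a^2 * exp (- b * (norm (?S v w n - y))^2 + - b * (norm (?P v w n - y))^2)"
          by (intro mult_left_mono) (auto simp: algebra_simps)
        also have "\<dots> = (a * exp (- b * (norm (?S v w n - y))^2)) * (a * exp (- b * (norm (?P v w n - y))^2))"
          unfolding exp_add by (simp only: power2_eq_square mult_ac)
        finally have "ennreal ?K \<le> F (?S v w n) * F (?P v w n)"
          unfolding F_def using in1 a by (simp add: ennreal_mult[symmetric] ennreal_leI)
        then show ?thesis by (intro mult_mono ennreal_leI ckern_mono Hw_bounds) auto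
      qed simp
    qed
    finally show ?thesis using True by simp
  qed simp
  have "ennreal (?K * ((\<rho> / 2) powr \<gamma> * AW * measure lborel (ball y (\<eta> * \<rho>))))
    = ennreal ((\<rho> / 2) powr \<gamma> * AW) * ennreal ?K * emeasure lborel (ball y (\<eta> * \<rho>))"
  proof -
    have "emeasure lborel (ball y (\<eta> * \<rho>)) = ennreal (measure lborel (ball y (\<eta> * \<rho>)))"
      using emeasure_lborel_ball_finite[of y "\<eta> * \<rho>"] by (intro emeasure_eq_ennreal_measure) auto
    then show ?thesis using AW by (simp only: ennreal_mult[symmetric] mult_nonneg_nonneg powr_ge_zero less_imp_le zero_le_power2 exp_ge_zero measure_nonneg) (simp only: mult_ac)
  qed
  also have "\<dots> = (VINT w. ennreal ((\<rho> / 2) powr \<gamma> * AW) * ennreal ?K * indicator (ball y (\<eta> * \<rho>)) w)"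
    by (subst nn_integral_cmult) auto
  also have "\<dots> \<le> gain \<gamma> (H i i) (m i) (m i) F F v"
    unfolding gain_def by (intro nn_integral_mono inner)
  finally show ?thesis .
qed

text \<open>Induction over balls of radius \<open>\<rho> * l ^ k\<close>. The time left at stage
  \<open>k\<close> is proportional to \<open>l ^ (- k)\<close> and offsets the loss frequency of
  order \<open>l ^ k\<close>, so the damping per stage is a constant. The exponents
  \<open>bb k\<close> rise from \<open>b\<close> to \<open>2 * b\<close>; each increment times the
  squared radius is of order \<open>l ^ k\<close>, enough for the constants and for the logarithm of
  the short time step.\<close>

lemma maxwellian_tail:
  assumes pos: "0 < \<delta>" "0 < M" "0 < E" and a: "0 < a" and \<rho>: "0 < \<rho>" and \<tau>: "0 < \<tau>" and Y: "0 \<le> Y"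
  shows "\<exists>b>0. \<forall>f i s y. mixture_flow N m \<gamma> h f \<delta> M E \<longrightarrow> i \<in> {1..N} \<longrightarrow> 0 \<le> s \<longrightarrow> norm y \<le> Y \<longrightarrow>
     (AE v in lborel. \<forall>\<sigma>\<in>{s..s + \<tau>}. ennreal a * indicator (cball y \<rho>) v \<le> ennreal (f i \<sigma> v)) \<longrightarrow>
     (AE v in lborel. a * exp (- b * (norm (v - y))^2) \<le> f i (s + \<tau>) v)"
proof -
  obtain \<theta>1 AW where th: "0 < \<theta>1" "\<theta>1 < pi/4" and AW: "0 < AW" "\<And>i. i \<in> {1..N} \<Longrightarrow> ennreal AW \<le> angle_mass (\<lambda>\<theta>. ennreal (Hw \<theta>1 i \<theta>))"
    using window by metis
  define d where "d = 1 - cos \<theta>1"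
  have "cos \<theta>1 < cos 0" using th by (intro cos_monotone_0_pi) auto
  moreover have "0 < cos \<theta>1" using th by (intro cos_gt_zero_pi) auto
  ultimately have d: "0 < d" "d < 1" by (auto simp: d_def)
  \<comment> \<open>With \<open>cos \<theta>1 = 1 - d\<close> these choices give
    \<open>l * cos \<theta>1 + 2 * \<eta> = 1 - d * d / 2\<close>.\<close>
  define l where "l = 1 + d / 2"
  define \<eta> where "\<eta> = d / 4"
  have l1: "1 < l" using d by (simp add: l_def)
  have \<eta>: "0 < \<eta>" "\<eta> \<le> 1/2" using d by (auto simp: \<eta>_def)
  have leta: "l * cos \<theta>1 + 2 * \<eta> \<le> 1"
  proof -
    have "l * cos \<theta>1 + 2 * \<eta> = 1 - d * d / 2" by (simp add: l_def \<eta>_def d_def field_simps)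
    then show ?thesis by simp
  qed
  define q where "q = 1 - 1 / l"
  have q0: "0 < q" using l1 by (simp add: q_def)
  have qe: "4 * \<eta>^2 \<le> q"
  proof -
    have "q = (d / 2) / l" using l1 by (simp add: q_def l_def field_simps)
    moreover have "(d / 2) / 2 \<le> (d / 2) / l" using d l1 by (intro divide_left_mono) (auto simp: l_def)
    moreover have "4 * \<eta>^2 = d / 4 * d" by (simp add: \<eta>_def power2_eq_square)
    moreover have "d / 4 * d \<le> d / 4 * 1" using d by (intro mult_left_mono) auto
    ultimately show ?thesis by simp
  qed
  define vol where "vol = measure lborel (ball (0::vec) (\<eta> * \<rho>))"
  have vol: "0 < vol" unfolding vol_def using \<eta> \<rho> content_ball_pos[of "\<eta> * \<rho>" "0::vec"] by simp
  have voly: "measure lborel (ball y (\<eta> * \<rho>)) = vol" for y :: vec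
    using content_ball[of "\<eta> * \<rho>" y] content_ball[of "\<eta> * \<rho>" "0::vec"] \<eta> \<rho> by (simp add: vol_def)
  define c1 where "c1 = (\<rho> / 2) powr \<gamma> * AW * vol"
  have c1: "0 < c1" using \<rho> AW vol by (simp add: c1_def)
  define CLv where "CLv = CA * (2 * M + E)"
  have CLv: "0 < CLv" using CA_pos pos by (simp add: CLv_def)
  define C2 where "C2 = real N * CLv * (1 + Y + l * \<rho>) * \<tau>"
  have C2: "0 \<le> C2" using CLv Y l1 \<rho> \<tau> by (simp add: C2_def)
  define C3 where "C3 = C2 + \<bar>ln (\<tau> * q)\<bar> + \<bar>ln (a * c1)\<bar>"
  have C3: "0 \<le> C3" using C2 by (simp add: C3_def)
  \<comment> \<open>One half of \<open>b * (\<rho>^2 * q)\<close> pays for the slow partner, which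
    costs at most \<open>C3 + 1\<close>; the other half pays for \<open>C3 + l ^ k\<close>.\<close>
  define b where "b = 2 * (C3 + 1) / (\<rho>^2 * q)"
  have b: "0 < b" using C3 \<rho> q0 by (simp add: b_def)
  have bq: "b * (\<rho>^2 * q) = 2 * (C3 + 1)" using \<rho> q0 by (simp add: b_def)
  define p where "p k = (1 / l) ^ k" for k :: nat
  have p: "0 < p k" "p k \<le> 1" "p (Suc k) = p k / l" "p k * l ^ k = 1" for k
    using l1 by (auto simp: p_def power_le_one power_one_over)
  define bb where "bb k = b * (2 - p k)" for k
  have bb: "0 \<le> bb k" "bb k \<le> 2 * b" "bb (Suc k) - bb k = b * q * p k" for k
    using b p[of k] l1 by (auto simp: bb_def q_def field_simps)
  define R where "R k = \<rho> * l ^ k" for k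
  have R: "\<rho> \<le> R k" "R (Suc k) = l * R k" for k
    using \<rho> l1 one_le_power[of l k] by (auto simp: R_def)
  text \<open>The exponents grow fast enough to absorb the losses of one step.\<close>
  have step: "a * exp (- bb (Suc k) * x) \<le> exp (- C2) * (\<tau> * q * p k) * (a^2 * exp (- bb k * (x + (\<eta> * \<rho>)^2)) * c1)"
    if x: "(R k)^2 \<le> x" for k x
  proof -
    have lk: "1 \<le> l ^ k" using l1 by (simp add: one_le_power)
    have "real k * ln l \<le> l ^ k"
    proof -
      have "real k * ln l = ln (l ^ k)" using l1 by (simp add: ln_realpow)
      also have "\<dots> \<le> l ^ k - 1" using lk by (intro ln_le_minus_one) auto
      finally show ?thesis by simp
    qed
    moreover have "ln (p k) = - (real k * ln l)" using l1 by (simp add: p_def ln_realpow ln_div)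
    ultimately have lp: "- ln (p k) \<le> l ^ k" by simp
    have "b * q * p k * (R k)^2 \<le> b * q * p k * x" using x b q0 p(1)[of k] by (intro mult_left_mono) auto
    moreover have "b * q * p k * (R k)^2 = b * (\<rho>^2 * q) * l ^ k"
    proof -
      have "b * q * p k * (R k)^2 = b * (\<rho>^2 * q) * (p k * l ^ k) * l ^ k" by (simp add: R_def power2_eq_square mult_ac)
      then show ?thesis by (simp only: p(4) mult_1_right)
    qed
    ultimately have 1: "b * (\<rho>^2 * q) * l ^ k \<le> (bb (Suc k) - bb k) * x" by (simp only: bb(3))
    have "bb k * (\<eta> * \<rho>)^2 \<le> 2 * b * (\<eta> * \<rho>)^2" using bb(2) by (intro mult_right_mono) auto
    also have "\<dots> = b * \<rho>^2 / 2 * (4 * \<eta>^2)" by (simp add: power_mult_distrib)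
    also have "\<dots> \<le> b * \<rho>^2 / 2 * q" using qe b by (intro mult_left_mono) auto
    also have "\<dots> = C3 + 1" using bq by (simp add: mult.assoc)
    also have "\<dots> \<le> (C3 + 1) * l ^ k" using lk C3 by (simp add: mult_le_cancel_left1)
    finally have 2: "bb k * (\<eta> * \<rho>)^2 \<le> (C3 + 1) * l ^ k" .
    have 3: "C3 + l ^ k \<le> (C3 + 1) * l ^ k" using lk C3 by (simp add: distrib_right mult_le_cancel_left1)
    have key: "C2 - ln (\<tau> * q) - ln (p k) - ln (a * c1) + bb k * (\<eta> * \<rho>)^2 \<le> (bb (Suc k) - bb k) * x"
      using 1 2 3 lp unfolding bq C3_def by (simp add: algebra_simps)
    have "exp (C2 - ln (\<tau> * q) - ln (p k) - ln (a * c1) + bb k * (\<eta> * \<rho>)^2) \<le> exp ((bb (Suc k) - bb k) * x)"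
      using key by simp
    then have e: "exp (- bb (Suc k) * x) * exp (C2 - ln (\<tau> * q) - ln (p k) - ln (a * c1) + bb k * (\<eta> * \<rho>)^2) \<le> exp (- bb k * x)"
    proof -
      have "exp (- bb (Suc k) * x) * exp (C2 - ln (\<tau> * q) - ln (p k) - ln (a * c1) + bb k * (\<eta> * \<rho>)^2)
        \<le> exp (- bb (Suc k) * x) * exp ((bb (Suc k) - bb k) * x)" using key by (intro mult_left_mono) auto
      also have "\<dots> = exp (- bb k * x)" unfolding mult_exp_exp by (simp add: algebra_simps)
      finally show ?thesis .
    qed
    have pos': "0 < \<tau> * q" "0 < a * c1" using \<tau> q0 a c1 by auto
    have ex: "exp (C2 - ln (\<tau> * q) - ln (p k) - ln (a * c1) + bb k * (\<eta> * \<rho>)^2)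
      = exp C2 / (\<tau> * q) / p k / (a * c1) * exp (bb k * (\<eta> * \<rho>)^2)"
      using pos' p(1)[of k] by (simp add: exp_add exp_diff)
    define u where "u = exp C2 / (\<tau> * q) / p k / (a * c1) * exp (bb k * (\<eta> * \<rho>)^2)"
    have u: "0 < u" unfolding u_def using pos' p(1)[of k] by simp
    have "a * exp (- bb (Suc k) * x) = a * (exp (- bb (Suc k) * x) * u) / u" using u by simp
    also have "\<dots> \<le> a * exp (- bb k * x) / u"
      using e a u unfolding ex u_def[symmetric] by (intro divide_right_mono mult_left_mono) auto
    also have "\<dots> = exp (- C2) * (\<tau> * q * p k) * (a^2 * (exp (- bb k * x) * exp (- bb k * (\<eta> * \<rho>)^2)) * c1)"
      unfolding u_def using pos' p(1)[of k] by (simp add: exp_minus field_simps power2_eq_square)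
    also have "exp (- bb k * x) * exp (- bb k * (\<eta> * \<rho>)^2) = exp (- bb k * (x + (\<eta> * \<rho>)^2))"
      unfolding mult_exp_exp by (simp add: algebra_simps)
    finally show ?thesis .
  qed
  have main: "AE v in lborel. a * exp (- (2 * b) * (norm (v - y))^2) \<le> f i (s + \<tau>) v"
    if flow: "mixture_flow N m \<gamma> h f \<delta> M E" and i: "i \<in> {1..N}" and s: "0 \<le> s" and y: "norm y \<le> Y"
      and base: "AE v in lborel. \<forall>\<sigma>\<in>{s..s + \<tau>}. ennreal a * indicator (cball y \<rho>) v \<le> ennreal (f i \<sigma> v)" for f i s y
  proof -
    interpret mixture_flow N m \<gamma> h f \<delta> M E by (rule flow)
    have CLeq: "CL = CLv" by (simp add: CL_def CLv_def)
    \<comment> \<open>The stages begin at times increasing to \<open>s + \<tau>\<close> without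
      passing it, so at time \<open>s + \<tau>\<close> all of them hold together.\<close>
    define t where "t k = s + \<tau> * (1 - p k)" for k
    have t: "s \<le> t k" "t k \<le> s + \<tau>" "t (Suc k) - t k = \<tau> * q * p k" "s + \<tau> - t k = \<tau> * p k" for k
      using p[of k] \<tau> l1 by (auto simp: t_def q_def field_simps)
    have tk: "t k \<le> t (Suc k)" for k using t(3)[of k] \<tau> q0 p(1)[of k] by (smt (verit) mult_pos_pos)
    define G where "G k v = ennreal (a * exp (- bb k * (norm (v - y))^2)) * indicator (cball y (R k)) v" for k and v :: vec
    have P: "AE v in lborel. \<forall>\<sigma>\<in>{t k..s + \<tau>}. G k v \<le> ennreal (f i \<sigma> v)" for k
    proof (induction k)
      case 0
      show ?case using base
      proof (eventually_elim, intro ballI)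
        fix v \<sigma> assume *: "\<forall>\<sigma>\<in>{s..s + \<tau>}. ennreal a * indicator (cball y \<rho>) v \<le> ennreal (f i \<sigma> v)" and \<sigma>: "\<sigma> \<in> {t 0..s + \<tau>}"
        have "exp (- bb 0 * (norm (v - y))^2) \<le> 1" using bb(1)[of 0] by simp
        then have "ennreal (a * exp (- bb 0 * (norm (v - y))^2)) \<le> ennreal a"
          using a by (intro ennreal_leI) (simp add: mult_le_cancel_left1)
        then have "G 0 v \<le> ennreal a * indicator (cball y \<rho>) v"
          unfolding G_def by (simp add: R_def mult_right_mono)
        also have "\<dots> \<le> ennreal (f i \<sigma> v)" using * \<sigma> by (simp add: t_def p_def)
        finally show "G 0 v \<le> ennreal (f i \<sigma> v)" .
      qed
    next
      case (Suc k)
      have s': "0 \<le> t k" using t(1)[of k] s by linarith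
      show ?case using Suc duhamel_step[OF i i s' Suc Suc]
      proof (eventually_elim, intro ballI)
        fix v \<sigma>
        assume old: "\<forall>\<sigma>\<in>{t k..s + \<tau>}. G k v \<le> ennreal (f i \<sigma> v)"
          and new: "\<forall>\<sigma>\<in>{t k..s + \<tau>}. ennreal (exp (- L v * (\<sigma> - t k)) * (\<sigma> - t k)) * gain \<gamma> (H i i) (m i) (m i) (G k) (G k) v \<le> ennreal (f i \<sigma> v)"
          and \<sigma>: "\<sigma> \<in> {t (Suc k)..s + \<tau>}"
        have \<sigma>k: "\<sigma> \<in> {t k..s + \<tau>}" using \<sigma> tk[of k] by auto
        show "G (Suc k) v \<le> ennreal (f i \<sigma> v)"
        proof (cases "norm (v - y) \<le> R k")
          case True
          have "bb k \<le> bb (Suc k)" using bb(3)[of k] b q0 p(1)[of k] by (smt (verit) mult_pos_pos)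
          then have "exp (- bb (Suc k) * (norm (v - y))^2) \<le> exp (- bb k * (norm (v - y))^2)"
            by (simp add: mult_right_mono)
          then have "ennreal (a * exp (- bb (Suc k) * (norm (v - y))^2)) \<le> ennreal (a * exp (- bb k * (norm (v - y))^2))"
            using a by (intro ennreal_leI mult_left_mono) auto
          also have "\<dots> = G k v" using True by (simp add: G_def dist_norm norm_minus_commute)
          also have "\<dots> \<le> ennreal (f i \<sigma> v)" using old \<sigma>k by blast
          finally have *: "ennreal (a * exp (- bb (Suc k) * (norm (v - y))^2)) \<le> ennreal (f i \<sigma> v)" .
          then show ?thesis by (simp add: G_def indicator_def)
        next
          case F1: False
          show ?thesis
          proof (cases "norm (v - y) \<le> R (Suc k)")
            case True
            let ?x = "(norm (v - y))^2"
            have Rx: "(R k)^2 \<le> ?x" using F1 R(1)[of k] \<rho> by (intro power_mono) auto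
            have Lb: "L v * (\<sigma> - t k) \<le> C2"
            proof -
              have "norm v \<le> norm (v - y) + norm y" using norm_triangle_ineq[of "v - y" y] by simp
              then have "1 + norm v \<le> 1 + Y + l * R k" using True y R(2)[of k] by simp
              also have "\<dots> \<le> (1 + Y + l * \<rho>) * l ^ k"
              proof -
                have lk: "1 \<le> l ^ k" using l1 by (simp add: one_le_power)
                have "1 + Y \<le> (1 + Y) * l ^ k" using lk Y by (simp add: mult_le_cancel_left1)
                then show ?thesis by (simp add: R_def distrib_right mult.assoc)
              qed
              finally have nv: "1 + norm v \<le> (1 + Y + l * \<rho>) * l ^ k" .
              have "L v * (\<sigma> - t k) \<le> (real N * CLv * ((1 + Y + l * \<rho>) * l ^ k)) * (\<tau> * p k)"
                unfolding L_def CLeq using nv CLv \<sigma>k t(4)[of k] Y l1 \<rho> \<tau> q0 less_imp_le[OF p(1)[of k]] by (intro mult_mono mult_nonneg_nonneg) auto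
              also have "\<dots> = C2 * (p k * l ^ k)" by (simp add: C2_def mult_ac)
              finally show ?thesis by (simp only: p(4) mult_1_right)
            qed
            have dt: "\<tau> * q * p k \<le> \<sigma> - t k" using t(3)[of k] \<sigma> by auto
            have pp: "0 \<le> \<tau> * q * p k" using \<tau> q0 p(1)[of k] by simp
            have "a * exp (- bb (Suc k) * ?x) \<le> exp (- C2) * (\<tau> * q * p k) * (a^2 * exp (- bb k * (?x + (\<eta> * \<rho>)^2)) * c1)"
              by (rule step[OF Rx])
            also have "\<dots> \<le> (exp (- L v * (\<sigma> - t k)) * (\<sigma> - t k)) * (a^2 * exp (- bb k * (?x + (\<eta> * \<rho>)^2)) * c1)"
              using Lb dt pp c1 \<tau> q0 less_imp_le[OF p(1)[of k]] order_trans[OF pp dt] by (intro mult_mono mult_nonneg_nonneg) auto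
            finally have "ennreal (a * exp (- bb (Suc k) * ?x)) \<le> ennreal ((exp (- L v * (\<sigma> - t k)) * (\<sigma> - t k)) * (a^2 * exp (- bb k * (?x + (\<eta> * \<rho>)^2)) * c1))"
              by (rule ennreal_leI)
            also have "\<dots> = ennreal (exp (- L v * (\<sigma> - t k)) * (\<sigma> - t k)) * ennreal (a^2 * exp (- bb k * (?x + (\<eta> * \<rho>)^2)) * c1)"
              using dt pp c1 by (intro ennreal_mult mult_nonneg_nonneg) auto
            also have "\<dots> \<le> ennreal (exp (- L v * (\<sigma> - t k)) * (\<sigma> - t k)) * gain \<gamma> (H i i) (m i) (m i) (G k) (G k) v"
              using gain_maxwellian[OF i th AW(1) AW(2)[OF i] \<eta> leta \<rho> R(1)[of k] a bb(1)[of k], of v y] F1 True R(2)[of k]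
              unfolding c1_def G_def voly by (intro mult_left_mono) auto
            also have "\<dots> \<le> ennreal (f i \<sigma> v)" using new \<sigma>k by blast
            finally show ?thesis by (simp add: G_def indicator_def)
          next
            case False
            then show ?thesis by (simp add: G_def dist_norm norm_minus_commute)
          qed
        qed
      qed
    qed
    have "AE v in lborel. \<forall>k. \<forall>\<sigma>\<in>{t k..s + \<tau>}. G k v \<le> ennreal (f i \<sigma> v)"
      using P by (subst AE_all_countable) blast
    then show ?thesis
    proof eventually_elim
      fix v assume *: "\<forall>k. \<forall>\<sigma>\<in>{t k..s + \<tau>}. G k v \<le> ennreal (f i \<sigma> v)"
      obtain k where k: "norm (v - y) / \<rho> < l ^ k" using real_arch_pow[OF l1] by blast
      then have vk: "norm (v - y) \<le> R k" using \<rho> by (simp add: R_def pos_divide_less_eq mult.commute)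
      have f0: "0 \<le> f i (s + \<tau>) v" using f_nonneg[OF i] s \<tau> by simp
      have "s + \<tau> \<in> {t k..s + \<tau>}" using t(2)[of k] by simp
      then have "G k v \<le> ennreal (f i (s + \<tau>) v)" using * by blast
      then have "ennreal (a * exp (- bb k * (norm (v - y))^2)) \<le> ennreal (f i (s + \<tau>) v)"
        using vk by (simp add: G_def dist_norm norm_minus_commute)
      then have "a * exp (- bb k * (norm (v - y))^2) \<le> f i (s + \<tau>) v" using f0 by (simp add: ennreal_le_iff)
      moreover have "a * exp (- (2 * b) * (norm (v - y))^2) \<le> a * exp (- bb k * (norm (v - y))^2)"
        using a bb(2)[of k] by (intro mult_left_mono) (auto intro: mult_right_mono)
      ultimately show "a * exp (- (2 * b) * (norm (v - y))^2) \<le> f i (s + \<tau>) v" by linarith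
    qed
  qed
  show ?thesis
    by (rule exI[of _ "2 * b"], rule conjI, use b in simp, intro allI impI, rule main)
qed

end

section \<open>Smoothing by three collisions\<close>

text \<open>Strict differentiability: both points of the increment may move. It yields Lipschitz
  bounds and the inverse function theorem at a single point, and it passes through compositions, so
  continuity of derivatives never has to be tracked.\<close>

definition strict_deriv :: "('a::real_normed_vector \<Rightarrow> 'b::real_normed_vector) \<Rightarrow> ('a \<Rightarrow> 'b) \<Rightarrow> 'a \<Rightarrow> bool" where
  "strict_deriv f L x \<longleftrightarrow> bounded_linear L \<and>
     (\<forall>e>0. \<exists>d>0. \<forall>y\<in>ball x d. \<forall>z\<in>ball x d. norm (f y - f z - L (y - z)) \<le> e * norm (y - z))"

lemma strict_derivE:
  assumes "strict_deriv f L x" "0 < e"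
  obtains d where "0 < d" "\<And>y z. y \<in> ball x d \<Longrightarrow> z \<in> ball x d \<Longrightarrow> norm (f y - f z - L (y - z)) \<le> e * norm (y - z)"
  using assms unfolding strict_deriv_def by meson

lemma strict_deriv_linear: "bounded_linear f \<Longrightarrow> strict_deriv f f x"
  unfolding strict_deriv_def by (auto simp: linear_diff[OF bounded_linear.linear] intro!: exI[of _ 1])

lemma strict_deriv_const: "strict_deriv (\<lambda>x. c) (\<lambda>x. 0) x"
  unfolding strict_deriv_def by (auto intro!: exI[of _ 1])

lemma strict_deriv_lipschitz:
  assumes f: "strict_deriv f L x"
  obtains d C where "0 < d" "0 < C" "\<And>y z. y \<in> ball x d \<Longrightarrow> z \<in> ball x d \<Longrightarrow> norm (f y - f z) \<le> C * norm (y - z)"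
proof -
  obtain d where d: "0 < d" "\<And>y z. y \<in> ball x d \<Longrightarrow> z \<in> ball x d \<Longrightarrow> norm (f y - f z - L (y - z)) \<le> 1 * norm (y - z)"
    by (rule strict_derivE[OF f, of 1], simp, rule that)
  have "bounded_linear L" using f by (simp add: strict_deriv_def)
  then obtain K where K: "0 < K" "\<And>x. norm (L x) \<le> norm x * K" using bounded_linear.pos_bounded by blast
  show ?thesis
  proof (rule that[of d "1 + K"])
    fix y z assume yz: "y \<in> ball x d" "z \<in> ball x d"
    have "norm (f y - f z) \<le> norm (f y - f z - L (y - z)) + norm (L (y - z))"
      using norm_triangle_ineq[of "f y - f z - L (y - z)" "L (y - z)"] by simp
    also have "\<dots> \<le> 1 * norm (y - z) + norm (y - z) * K" using d(2)[OF yz] K(2)[of "y - z"] by (rule add_mono)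
    finally show "norm (f y - f z) \<le> (1 + K) * norm (y - z)" by (simp add: algebra_simps)
  qed (use d K in auto)
qed

lemma strict_deriv_has_derivative:
  assumes f: "strict_deriv f L x"
  shows "(f has_derivative L) (at x)"
  unfolding has_derivative_at_alt
proof (intro conjI allI impI)
  show "bounded_linear L" using f by (simp add: strict_deriv_def)
  fix e :: real assume "0 < e"
  obtain d where "0 < d" "\<And>y z. y \<in> ball x d \<Longrightarrow> z \<in> ball x d \<Longrightarrow> norm (f y - f z - L (y - z)) \<le> e * norm (y - z)"
    by (rule strict_derivE[OF f, of e], use \<open>0 < e\<close> in force, rule that)
  then show "\<exists>d>0. \<forall>y. norm (y - x) < d \<longrightarrow> norm (f y - f x - L (y - x)) \<le> e * norm (y - x)"
    by (intro exI[of _ d]) (auto simp: dist_norm norm_minus_commute)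
qed

lemma strict_deriv_continuous: "strict_deriv f L x \<Longrightarrow> isCont f x"
  using strict_deriv_has_derivative has_derivative_continuous by blast

lemma strict_deriv_continuousE:
  assumes "strict_deriv f L x" "0 < r"
  obtains d where "0 < d" "\<And>y. y \<in> ball x d \<Longrightarrow> f y \<in> ball (f x) r"
  using strict_deriv_continuous[OF assms(1)] assms(2) unfolding continuous_at_eps_delta
  by (metis dist_commute mem_ball)

lemma strict_deriv_compose:
  assumes f: "strict_deriv f L x" and g: "strict_deriv g K (f x)"
  shows "strict_deriv (\<lambda>y. g (f y)) (\<lambda>h. K (L h)) x"
  unfolding strict_deriv_def
proof (intro conjI allI impI)
  have bL: "bounded_linear L" and bK: "bounded_linear K" using f g by (auto simp: strict_deriv_def)
  then show "bounded_linear (\<lambda>h. K (L h))" by (rule bounded_linear_compose[rotated])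
  obtain B where B: "0 < B" "\<And>x. norm (K x) \<le> norm x * B" using bounded_linear.pos_bounded[OF bK] by blast
  obtain d1 C where C: "0 < d1" "0 < C" "\<And>y z. y \<in> ball x d1 \<Longrightarrow> z \<in> ball x d1 \<Longrightarrow> norm (f y - f z) \<le> C * norm (y - z)"
    by (rule strict_deriv_lipschitz[OF f]) (rule that)
  fix e :: real assume e: "0 < e"
  obtain d2 where d2: "0 < d2" "\<And>y z. y \<in> ball (f x) d2 \<Longrightarrow> z \<in> ball (f x) d2 \<Longrightarrow> norm (g y - g z - K (y - z)) \<le> e / (2 * C) * norm (y - z)"
    by (rule strict_derivE[OF g, of "e / (2 * C)"], use e C(2) in force, rule that)
  obtain d3 where d3: "0 < d3" "\<And>y z. y \<in> ball x d3 \<Longrightarrow> z \<in> ball x d3 \<Longrightarrow> norm (f y - f z - L (y - z)) \<le> e / (2 * B) * norm (y - z)"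
    by (rule strict_derivE[OF f, of "e / (2 * B)"], use e B(1) in force, rule that)
  obtain d4 where d4: "0 < d4" "\<And>y. y \<in> ball x d4 \<Longrightarrow> f y \<in> ball (f x) d2" by (rule strict_deriv_continuousE[OF f d2(1)]) (rule that)
  show "\<exists>d>0. \<forall>y\<in>ball x d. \<forall>z\<in>ball x d. norm (g (f y) - g (f z) - K (L (y - z))) \<le> e * norm (y - z)"
  proof (intro exI[of _ "min d1 (min d3 d4)"] conjI ballI)
    fix y z assume "y \<in> ball x (min d1 (min d3 d4))" "z \<in> ball x (min d1 (min d3 d4))"
    then have yz: "y \<in> ball x d1" "z \<in> ball x d1" "y \<in> ball x d3" "z \<in> ball x d3" "y \<in> ball x d4" "z \<in> ball x d4" by auto
    have "g (f y) - g (f z) - K (L (y - z)) = (g (f y) - g (f z) - K (f y - f z)) + K (f y - f z - L (y - z))"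
      by (simp add: linear_diff[OF bounded_linear.linear[OF bK]])
    then have "norm (g (f y) - g (f z) - K (L (y - z))) \<le> norm (g (f y) - g (f z) - K (f y - f z)) + norm (K (f y - f z - L (y - z)))"
      by (simp only: norm_triangle_ineq)
    also have "\<dots> \<le> e / (2 * C) * norm (f y - f z) + norm (f y - f z - L (y - z)) * B"
      using d2(2)[OF d4(2)[OF yz(5)] d4(2)[OF yz(6)]] B(2) by (intro add_mono) auto
    also have "\<dots> \<le> e / (2 * C) * (C * norm (y - z)) + (e / (2 * B) * norm (y - z)) * B"
      using C(3)[OF yz(1,2)] d3(2)[OF yz(3,4)] e C B by (intro add_mono mult_left_mono mult_right_mono) auto
    also have "\<dots> = e * norm (y - z)" using B C by (simp add: field_simps)
    finally show "norm (g (f y) - g (f z) - K (L (y - z))) \<le> e * norm (y - z)" .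
  qed (use C d3 d4 in auto)
qed

lemma strict_deriv_Pair:
  assumes f: "strict_deriv f L x" and g: "strict_deriv g K x"
  shows "strict_deriv (\<lambda>y. (f y, g y)) (\<lambda>h. (L h, K h)) x"
  unfolding strict_deriv_def
proof (intro conjI allI impI)
  show "bounded_linear (\<lambda>h. (L h, K h))" using f g by (auto simp: strict_deriv_def intro: bounded_linear_Pair)
  fix e :: real assume e: "0 < e"
  obtain d1 where d1: "0 < d1" "\<And>y z. y \<in> ball x d1 \<Longrightarrow> z \<in> ball x d1 \<Longrightarrow> norm (f y - f z - L (y - z)) \<le> e / 2 * norm (y - z)"
    by (rule strict_derivE[OF f, of "e/2"], use e in force, rule that)
  obtain d2 where d2: "0 < d2" "\<And>y z. y \<in> ball x d2 \<Longrightarrow> z \<in> ball x d2 \<Longrightarrow> norm (g y - g z - K (y - z)) \<le> e / 2 * norm (y - z)"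
    by (rule strict_derivE[OF g, of "e/2"], use e in force, rule that)
  show "\<exists>d>0. \<forall>y\<in>ball x d. \<forall>z\<in>ball x d. norm ((f y, g y) - (f z, g z) - (L (y - z), K (y - z))) \<le> e * norm (y - z)"
  proof (intro exI[of _ "min d1 d2"] conjI ballI)
    fix y z assume "y \<in> ball x (min d1 d2)" "z \<in> ball x (min d1 d2)"
    then have yz: "y \<in> ball x d1" "z \<in> ball x d1" "y \<in> ball x d2" "z \<in> ball x d2" by auto
    have "norm ((f y, g y) - (f z, g z) - (L (y - z), K (y - z))) \<le> norm (f y - f z - L (y - z)) + norm (g y - g z - K (y - z))"
      using norm_Pair_le[of "f y - f z - L (y - z)" "g y - g z - K (y - z)"] by simp
    also have "\<dots> \<le> e / 2 * norm (y - z) + e / 2 * norm (y - z)" by (intro add_mono d1(2) d2(2) yz)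
    finally show "norm ((f y, g y) - (f z, g z) - (L (y - z), K (y - z))) \<le> e * norm (y - z)" by simp
  qed (use d1 d2 in auto)
qed

lemma strict_deriv_bilinear:
  assumes "bounded_bilinear prd"
  shows "strict_deriv (\<lambda>p. prd (fst p) (snd p)) (\<lambda>h. prd a (snd h) + prd (fst h) b) (a, b)"
proof -
  interpret bounded_bilinear prd by fact
  obtain K where K: "0 < K" "\<And>a b. norm (prd a b) \<le> norm a * norm b * K" using pos_bounded by blast
  show ?thesis unfolding strict_deriv_def
  proof (intro conjI allI impI)
    show "bounded_linear (\<lambda>h. prd a (snd h) + prd (fst h) b)"
      by (intro bounded_linear_add bounded_linear_compose[OF bounded_linear_right bounded_linear_snd]
          bounded_linear_compose[OF bounded_linear_left bounded_linear_fst])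
    fix e :: real assume e: "0 < e"
    show "\<exists>d>0. \<forall>y\<in>ball (a, b) d. \<forall>z\<in>ball (a, b) d.
       norm (prd (fst y) (snd y) - prd (fst z) (snd z) - (prd a (snd (y - z)) + prd (fst (y - z)) b)) \<le> e * norm (y - z)"
    proof (intro exI[of _ "e / (2 * K)"] conjI ballI)
      fix y z assume y: "y \<in> ball (a, b) (e / (2 * K))" and z: "z \<in> ball (a, b) (e / (2 * K))"
      have ya: "norm (fst y - a) \<le> e / (2 * K)"
        using y dist_fst_le[of y "(a,b)"] by (simp add: dist_norm norm_minus_commute)
      have zb: "norm (snd z - b) \<le> e / (2 * K)"
        using z dist_snd_le[of z "(a,b)"] by (simp add: dist_norm norm_minus_commute)
      have f: "norm (fst y - fst z) \<le> norm (y - z)" "norm (snd y - snd z) \<le> norm (y - z)"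
        using norm_fst_le[of "fst (y-z)" "snd (y-z)"] norm_snd_le[of "snd (y-z)" "fst (y-z)"]
        by (simp_all del: fst_diff snd_diff) (simp_all add: fst_diff snd_diff)
      have "prd (fst y) (snd y) - prd (fst z) (snd z) - (prd a (snd (y - z)) + prd (fst (y - z)) b)
        = prd (fst y - a) (snd y - snd z) + prd (fst y - fst z) (snd z - b)"
        by (simp add: diff_left diff_right)
      then have "norm (prd (fst y) (snd y) - prd (fst z) (snd z) - (prd a (snd (y - z)) + prd (fst (y - z)) b))
        \<le> norm (fst y - a) * norm (snd y - snd z) * K + norm (fst y - fst z) * norm (snd z - b) * K"
        by (simp only:) (rule order_trans[OF norm_triangle_ineq add_mono[OF K(2) K(2)]])
      also have "\<dots> \<le> (e / (2 * K)) * norm (y - z) * K + norm (y - z) * (e / (2 * K)) * K"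
        using ya zb f K e by (intro add_mono mult_right_mono mult_mono) auto
      also have "\<dots> = e * norm (y - z)" using K by (simp add: field_simps)
      finally show "norm (prd (fst y) (snd y) - prd (fst z) (snd z) - (prd a (snd (y - z)) + prd (fst (y - z)) b)) \<le> e * norm (y - z)" .
    qed (use e K in auto)
  qed
qed

lemma strict_deriv_real:
  fixes f :: "real \<Rightarrow> real"
  assumes d: "\<And>y. y \<in> ball x r \<Longrightarrow> (f has_real_derivative f' y) (at y)" and c: "isCont f' x" and r: "0 < r"
  shows "strict_deriv f (\<lambda>h. f' x * h) x"
  unfolding strict_deriv_def
proof (intro conjI allI impI)
  show "bounded_linear (\<lambda>h. f' x * h)" by (rule bounded_linear_mult_right)
  fix e :: real assume e: "0 < e"
  then obtain s where s: "0 < s" "\<And>y. dist y x < s \<Longrightarrow> dist (f' y) (f' x) < e"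
    using c unfolding continuous_at_eps_delta by meson
  show "\<exists>d>0. \<forall>y\<in>ball x d. \<forall>z\<in>ball x d. norm (f y - f z - f' x * (y - z)) \<le> e * norm (y - z)"
  proof (intro exI[of _ "min r s"] conjI ballI)
    fix y z assume yz: "y \<in> ball x (min r s)" "z \<in> ball x (min r s)"
    have "norm ((\<lambda>y. f y - f' x * y) y - (\<lambda>y. f y - f' x * y) z) \<le> e * norm (y - z)"
    proof (rule field_differentiable_bound[where S="ball x (min r s)" and f'="\<lambda>y. f' y - f' x"])
      fix u assume u: "u \<in> ball x (min r s)"
      then have "(f has_real_derivative f' u) (at u)" using d by auto
      then show "((\<lambda>y. f y - f' x * y) has_field_derivative f' u - f' x) (at u within ball x (min r s))"
        by (rule DERIV_diff[OF has_field_derivative_at_within DERIV_cmult_Id])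
      have "dist u x < s" using u by (simp add: dist_commute)
      from s(2)[OF this] show "norm (f' u - f' x) \<le> e" by (simp add: dist_norm)
    qed (use yz in auto)
    then show "norm (f y - f z - f' x * (y - z)) \<le> e * norm (y - z)" by (simp add: algebra_simps)
  qed (use r s in auto)
qed

text \<open>Only the existence of a derivative is recorded. For the collision maps it is never
  computed; its kernel is found from conserved quantities.\<close>

definition strict_diff :: "('a::real_normed_vector \<Rightarrow> 'b::real_normed_vector) \<Rightarrow> 'a \<Rightarrow> bool" where
  "strict_diff f x \<longleftrightarrow> (\<exists>L. strict_deriv f L x)"

lemma sd_linear: "bounded_linear f \<Longrightarrow> strict_diff f x"
  unfolding strict_diff_def by (blast intro: strict_deriv_linear)

lemma sd_const: "strict_diff (\<lambda>x. c) x"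
  unfolding strict_diff_def by (blast intro: strict_deriv_const)

lemma sd_compose: "strict_diff f x \<Longrightarrow> strict_diff g (f x) \<Longrightarrow> strict_diff (\<lambda>y. g (f y)) x"
  unfolding strict_diff_def by (blast intro: strict_deriv_compose)

lemma sd_Pair: "strict_diff f x \<Longrightarrow> strict_diff g x \<Longrightarrow> strict_diff (\<lambda>y. (f y, g y)) x"
  unfolding strict_diff_def by (blast intro: strict_deriv_Pair)

lemma sd_bilinear:
  assumes "bounded_bilinear prd" "strict_diff f x" "strict_diff g x"
  shows "strict_diff (\<lambda>y. prd (f y) (g y)) x"
  using sd_compose[OF sd_Pair[OF assms(2,3)], of "\<lambda>p. prd (fst p) (snd p)"]
    strict_deriv_bilinear[OF assms(1), of "f x" "g x"]
  unfolding strict_diff_def by auto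

lemma sd_comp_linear: "bounded_linear g \<Longrightarrow> strict_diff f x \<Longrightarrow> strict_diff (\<lambda>y. g (f y)) x"
  by (rule sd_compose[OF _ sd_linear])

lemma sd_add: "strict_diff f x \<Longrightarrow> strict_diff g x \<Longrightarrow> strict_diff (\<lambda>y. f y + g y) x"
  using sd_comp_linear[OF bounded_linear_add[OF bounded_linear_fst bounded_linear_snd] sd_Pair[of f x g]] by simp

lemma sd_diff: "strict_diff f x \<Longrightarrow> strict_diff g x \<Longrightarrow> strict_diff (\<lambda>y. f y - g y) x"
  using sd_comp_linear[OF bounded_linear_sub[OF bounded_linear_fst bounded_linear_snd] sd_Pair[of f x g]] by simp

lemma sd_inverse:
  fixes f :: "'a::real_normed_vector \<Rightarrow> real"
  assumes f: "strict_diff f x" "f x \<noteq> 0"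
  shows "strict_diff (\<lambda>y. inverse (f y)) x"
proof (rule sd_compose[OF f(1)])
  have "strict_deriv inverse (\<lambda>h. - ((inverse (f x))^2) * h) (f x)"
  proof (rule strict_deriv_real[where f'="\<lambda>y. - ((inverse y)^2)" and r="\<bar>f x\<bar>"])
    fix y assume "y \<in> ball (f x) \<bar>f x\<bar>"
    then have "y \<noteq> 0" by (auto simp: dist_real_def)
    then show "(inverse has_real_derivative - ((inverse y)^2)) (at y)"
      by (auto intro!: derivative_eq_intros simp: power2_eq_square)
  qed (use f in \<open>auto intro!: continuous_intros\<close>)
  then show "strict_diff inverse (f x)" unfolding strict_diff_def by blast
qed

lemma sd_sqrt:
  assumes f: "strict_diff f x" "0 < f x"
  shows "strict_diff (\<lambda>y. sqrt (f y)) x"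
proof (rule sd_compose[OF f(1)])
  have "strict_deriv sqrt (\<lambda>h. (inverse (sqrt (f x)) / 2) * h) (f x)"
  proof (rule strict_deriv_real[where f'="\<lambda>y. inverse (sqrt y) / 2" and r="f x"])
    fix y assume "y \<in> ball (f x) (f x)"
    then have "0 < y" by (auto simp: dist_real_def)
    then show "(sqrt has_real_derivative inverse (sqrt y) / 2) (at y)" by (rule DERIV_real_sqrt)
  qed (use f in \<open>auto intro!: continuous_intros\<close>)
  then show "strict_diff sqrt (f x)" unfolding strict_diff_def by blast
qed

lemma sd_norm:
  fixes f :: "'a::real_normed_vector \<Rightarrow> 'b::real_inner"
  assumes f: "strict_diff f x" "f x \<noteq> 0"
  shows "strict_diff (\<lambda>y. norm (f y)) x"
  unfolding norm_eq_sqrt_inner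
  by (rule sd_sqrt[OF sd_bilinear[OF bounded_bilinear_inner f(1) f(1)]]) (use f in auto)

text \<open>A quantitative inverse function theorem, uniform in the parameter.\<close>

lemma strict_deriv_open_map:
  fixes \<Phi> :: "'p::real_normed_vector \<times> 'a::euclidean_space \<Rightarrow> 'a"
  assumes sd: "strict_deriv \<Phi> L (l0, \<phi>0)" and inj: "\<And>h. L (0, h) = 0 \<Longrightarrow> h = 0"
    and r0: "0 < r0"
  obtains \<eta> \<rho> C r where "0 < \<eta>" "\<eta> \<le> r0" "0 < \<rho>" "0 < C" "0 < r" "r \<le> r0"
    "\<And>l a s. l \<in> ball l0 \<eta> \<Longrightarrow> 0 < s \<Longrightarrow> ball a s \<subseteq> ball (\<Phi> (l0, \<phi>0)) \<rho> \<Longrightarrow>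
       \<exists>\<psi>. ball \<psi> (s / C) \<subseteq> ball \<phi>0 r \<and> (\<forall>\<phi>\<in>ball \<psi> (s / C). \<Phi> (l, \<phi>) \<in> ball a s)"
proof -
  define L1 where "L1 = (\<lambda>h. L (0, h))"
  have bL: "bounded_linear L" using sd by (simp add: strict_deriv_def)
  have bL1: "bounded_linear L1" unfolding L1_def
    by (rule bounded_linear_compose[OF bL bounded_linear_Pair[OF bounded_linear_zero bounded_linear_ident]])
  have "inj L1" using inj by (subst linear_inj_iff_eq_0[OF bounded_linear.linear[OF bL1]]) (auto simp: L1_def)
  then obtain G where G: "linear G" "\<And>x. G (L1 x) = x" "\<And>x. L1 (G x) = x"
    using linear_injective_isomorphism[OF bounded_linear.linear[OF bL1]] by blast
  have bG: "bounded_linear G" using G(1) by (rule linear_conv_bounded_linear[THEN iffD1])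
  obtain B where B: "0 < B" "\<And>x. norm (G x) \<le> norm x * B" using bounded_linear.pos_bounded[OF bG] by blast
  obtain d1 where d1: "0 < d1" "\<And>y z. y \<in> ball (l0, \<phi>0) d1 \<Longrightarrow> z \<in> ball (l0, \<phi>0) d1 \<Longrightarrow>
      norm (\<Phi> y - \<Phi> z - L (y - z)) \<le> 1 / (2 * B) * norm (y - z)"
    by (rule strict_derivE[OF sd, of "1 / (2 * B)"], use B(1) in force, rule that)
  obtain d2 C0 where C0: "0 < d2" "0 < C0" "\<And>y z. y \<in> ball (l0, \<phi>0) d2 \<Longrightarrow> z \<in> ball (l0, \<phi>0) d2 \<Longrightarrow> norm (\<Phi> y - \<Phi> z) \<le> C0 * norm (y - z)"
    by (rule strict_deriv_lipschitz[OF sd]) (rule that)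
  define d where "d = min (min d1 d2) r0 / 2"
  have d: "0 < d" "d \<le> r0" using d1 C0 r0 by (auto simp: d_def)
  have inb: "(l, \<phi>) \<in> ball (l0, \<phi>0) (min d1 d2)" if "l \<in> ball l0 d" "\<phi> \<in> ball \<phi>0 d" for l \<phi>
  proof -
    have "dist (l0, \<phi>0) (l, \<phi>) \<le> dist l0 l + dist \<phi>0 \<phi>"
      using norm_Pair_le[of "l0 - l" "\<phi>0 - \<phi>"] by (simp add: dist_norm)
    also have "\<dots> < d + d" using that by auto
    finally show ?thesis by (simp add: d_def)
  qed
  define r where "r = d / 2"
  define \<rho> where "\<rho> = r / (4 * B)"
  define \<eta> where "\<eta> = min d (\<rho> / C0)"
  \<comment> \<open>\<open>C0 \<le> C\<close> keeps the image of the ball of radius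
    \<open>s / C\<close> within \<open>s\<close>; \<open>2 * \<rho> / r \<le> C\<close> keeps that
    radius below \<open>r\<close>.\<close>
  define C where "C = max C0 (2 * \<rho> / r)"
  have r: "0 < r" "r < d" and \<rho>: "0 < \<rho>" using d B by (auto simp: r_def \<rho>_def)
  have \<eta>: "0 < \<eta>" "\<eta> \<le> d" "\<eta> \<le> \<rho> / C0" using d \<rho> C0 by (auto simp: \<eta>_def)
  have C: "0 < C" "C0 \<le> C" "2 * \<rho> / r \<le> C" using C0 by (auto simp: C_def)
  show ?thesis
  proof (rule that[of \<eta> \<rho> C "2 * r"])
    show "0 < \<eta>" "\<eta> \<le> r0" "0 < \<rho>" "0 < C" "0 < 2 * r" "2 * r \<le> r0" using d \<eta> \<rho> C r by (auto simp: r_def)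
    fix l a s assume l: "l \<in> ball l0 \<eta>" and s: "0 < s" and sub: "ball a s \<subseteq> ball (\<Phi> (l0, \<phi>0)) \<rho>"
    have ld: "l \<in> ball l0 d" using l \<eta> by auto
    have a: "norm (\<Phi> (l0, \<phi>0) - a) \<le> \<rho>"
      using subsetD[OF sub, of a] s by (simp add: dist_norm)
    have s\<rho>: "s \<le> \<rho>" using sub s zero_le_dist[of a "\<Phi> (l0, \<phi>0)"] unfolding ball_subset_ball_iff by linarith
    have gd: "cball \<phi>0 r \<subseteq> ball \<phi>0 d" using r by auto
    \<comment> \<open>Newton's iteration for \<open>\<Phi> (l, \<phi>) = a\<close> with the inverse
      derivative \<open>G\<close> frozen at the base point; it is a contraction with factor 1/2,
      uniformly in \<open>l\<close> and \<open>a\<close>.\<close>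
    define T where "T = (\<lambda>\<phi>. \<phi> - G (\<Phi> (l, \<phi>) - a))"
    have con: "dist (T x) (T y) \<le> 1/2 * dist x y" if xy: "x \<in> ball \<phi>0 d" "y \<in> ball \<phi>0 d" for x y
    proof -
      have "T x - T y = - G (\<Phi> (l, x) - \<Phi> (l, y) - L1 (x - y))"
        unfolding T_def linear_diff[OF G(1)] G(2) by simp
      then have "norm (T x - T y) \<le> norm (\<Phi> (l, x) - \<Phi> (l, y) - L1 (x - y)) * B" using B(2) by simp
      also have "\<dots> = norm (\<Phi> (l, x) - \<Phi> (l, y) - L ((l, x) - (l, y))) * B" by (simp add: L1_def)
      also have "\<dots> \<le> (1 / (2 * B) * norm ((l, x) - (l, y))) * B"
        using d1(2)[of "(l, x)" "(l, y)"] inb[OF ld xy(1)] inb[OF ld xy(2)] B by (intro mult_right_mono) auto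
      also have "\<dots> = 1/2 * norm (x - y)" using B by (simp add: norm_Pair)
      finally show ?thesis by (simp add: dist_norm)
    qed
    have c0: "\<phi>0 \<in> ball \<phi>0 d" using d by simp
    have T0: "dist \<phi>0 (T \<phi>0) \<le> r / 2"
    proof -
      have "norm (\<Phi> (l, \<phi>0) - \<Phi> (l0, \<phi>0)) \<le> C0 * norm ((l, \<phi>0) - (l0, \<phi>0))"
        using C0(3)[of "(l, \<phi>0)" "(l0, \<phi>0)"] inb[OF ld c0] inb[OF _ c0, of l0] d by auto
      also have "\<dots> \<le> C0 * (\<rho> / C0)" using l \<eta> C0 by (intro mult_left_mono) (auto simp: norm_Pair dist_norm norm_minus_commute)
      also have "\<dots> = \<rho>" using C0 by simp
      finally have "norm (\<Phi> (l, \<phi>0) - a) \<le> 2 * \<rho>"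
        using a norm_triangle_ineq[of "\<Phi> (l, \<phi>0) - \<Phi> (l0, \<phi>0)" "\<Phi> (l0, \<phi>0) - a"] by simp
      then have "norm (\<Phi> (l, \<phi>0) - a) * B \<le> 2 * \<rho> * B" using B by (intro mult_right_mono) auto
      also have "\<dots> = r / 2" using B by (simp add: \<rho>_def)
      finally show ?thesis using B(2)[of "\<Phi> (l, \<phi>0) - a"] by (simp add: T_def dist_norm)
    qed
    have "\<exists>!x. x \<in> cball \<phi>0 r \<and> T x = x"
    proof (rule Banach_fix[where c="1/2"])
      show "T ` cball \<phi>0 r \<subseteq> cball \<phi>0 r"
      proof
        fix z assume "z \<in> T ` cball \<phi>0 r"
        then obtain x where x: "x \<in> cball \<phi>0 r" "z = T x" by auto
        have "dist \<phi>0 z \<le> dist \<phi>0 (T \<phi>0) + dist (T \<phi>0) (T x)" unfolding x(2) by (rule dist_triangle)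
        also have "\<dots> \<le> r / 2 + 1/2 * dist \<phi>0 x" using T0 con[OF c0] x gd by (intro add_mono) auto
        also have "\<dots> \<le> r" using x by simp
        finally show "z \<in> cball \<phi>0 r" by simp
      qed
    qed (use con gd r in \<open>auto simp: complete_eq_closed\<close>)
    then obtain \<psi> where \<psi>: "\<psi> \<in> cball \<phi>0 r" "T \<psi> = \<psi>" by blast
    have "L1 (G (\<Phi> (l, \<psi>) - a)) = L1 0" using \<psi>(2) by (simp add: T_def)
    then have eq: "\<Phi> (l, \<psi>) = a" unfolding G(3) using linear_0[OF bounded_linear.linear[OF bL1]] by simp
    have sC: "s / C \<le> r"
    proof -
      have "2 * \<rho> \<le> C * r" using C(3) r by (simp add: divide_le_eq)
      then have "s \<le> r * C" using s\<rho> \<rho> by (simp add: mult.commute)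
      then show ?thesis using C by (simp add: divide_le_eq)
    qed
    show "\<exists>\<psi>. ball \<psi> (s / C) \<subseteq> ball \<phi>0 (2 * r) \<and> (\<forall>\<phi>\<in>ball \<psi> (s / C). \<Phi> (l, \<phi>) \<in> ball a s)"
    proof (intro exI[of _ \<psi>] conjI ballI)
      show sub2: "ball \<psi> (s / C) \<subseteq> ball \<phi>0 (2 * r)"
      proof
        fix x assume "x \<in> ball \<psi> (s / C)"
        then show "x \<in> ball \<phi>0 (2 * r)" using \<psi>(1) sC dist_triangle[of \<phi>0 x \<psi>] by auto
      qed
      fix \<phi> assume \<phi>: "\<phi> \<in> ball \<psi> (s / C)"
      have "\<phi> \<in> ball \<phi>0 d" using \<phi> sub2 by (auto simp: r_def)
      moreover have "\<psi> \<in> ball \<phi>0 d" using \<psi>(1) gd by auto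
      ultimately have "norm (\<Phi> (l, \<phi>) - \<Phi> (l, \<psi>)) \<le> C0 * norm ((l, \<phi>) - (l, \<psi>))"
        using C0(3)[of "(l, \<phi>)" "(l, \<psi>)"] inb[OF ld] by auto
      also have "\<dots> = C0 * norm (\<phi> - \<psi>)" by (simp add: norm_Pair)
      also have "\<dots> \<le> C * norm (\<phi> - \<psi>)" using C by (intro mult_right_mono) auto
      also have "\<dots> < C * (s / C)" using \<phi> C by (intro mult_strict_left_mono) (auto simp: dist_norm norm_minus_commute)
      also have "\<dots> = s" using C by simp
      finally show "\<Phi> (l, \<phi>) \<in> ball a s" by (simp add: eq dist_norm norm_minus_commute)
    qed
  qed
qed

text \<open>By Vitali's theorem an open set is, up to a null set, a countable disjoint union of
  balls inside it. Outer regularity of the finite measure then extends the inequality to Borel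
  sets.\<close>

lemma emeasure_ge_of_balls:
  fixes \<mu> :: "'a::euclidean_space measure"
  assumes fin: "emeasure \<mu> UNIV < \<infinity>" and sets: "sets \<mu> = sets borel" and c: "0 \<le> c" and W: "open W"
    and b: "\<And>a s. 0 < s \<Longrightarrow> ball a s \<subseteq> W \<Longrightarrow> ennreal c * emeasure lborel (ball a s) \<le> emeasure \<mu> (ball a s)"
    and A: "A \<in> sets borel" "A \<subseteq> W"
  shows "ennreal c * emeasure lborel A \<le> emeasure \<mu> A"
proof -
  have opn: "ennreal c * emeasure lborel U \<le> emeasure \<mu> U" if U: "open U" "U \<subseteq> W" for U
  proof -
    define K where "K = {(x, r) |x r. 0 < r \<and> ball x r \<subseteq> U}"
    obtain D where D: "countable D" "D \<subseteq> K" "pairwise (\<lambda>i j. disjnt (ball (fst i) (snd i)) (ball (fst j) (snd j))) D"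
      "negligible (U - (\<Union>i\<in>D. ball (fst i) (snd i)))"
    proof (rule Vitali_covering_theorem_balls[of U K fst snd])
      fix x d assume x: "x \<in> U" and d: "(0::real) < d"
      then obtain e where e: "0 < e" "ball x e \<subseteq> U" using U(1) open_contains_ball by blast
      then show "\<exists>i. i \<in> K \<and> x \<in> ball (fst i) (snd i) \<and> snd i < d"
        using d by (intro exI[of _ "(x, min e (d/2))"]) (auto simp: K_def)
    qed (rule that)
    let ?B = "\<lambda>i. ball (fst i) (snd i)"
    have "disjoint_family_on ?B D" using D(3) by (auto simp: disjoint_family_on_def pairwise_def disjnt_def)
    then have dis: "emeasure M (\<Union>i\<in>D. ?B i) = (\<integral>\<^sup>+i. emeasure M (?B i) \<partial>count_space D)" if "sets M = sets borel" for M
      by (intro emeasure_UN_countable) (auto simp: that D(1))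
    have "emeasure lborel U \<le> emeasure lborel ((\<Union>i\<in>D. ?B i) \<union> (U - (\<Union>i\<in>D. ?B i)))"
      using U by (intro emeasure_mono) (auto intro!: borel_open)
    also have "\<dots> \<le> emeasure lborel (\<Union>i\<in>D. ?B i) + emeasure lborel (U - (\<Union>i\<in>D. ?B i))"
      using U by (intro emeasure_subadditive) (simp_all add: borel_open sets.Diff open_UN)
    also have "emeasure lborel (U - (\<Union>i\<in>D. ?B i)) = 0"
    proof -
      have "U - (\<Union>i\<in>D. ?B i) \<in> sets lborel" using U by (simp add: borel_open sets.Diff open_UN)
      moreover have "emeasure lebesgue (U - (\<Union>i\<in>D. ?B i)) = 0" using D(4) by (auto simp: negligible_iff_null_sets)
      ultimately show ?thesis by simp
    qed
    finally have "ennreal c * emeasure lborel U \<le> ennreal c * emeasure lborel (\<Union>i\<in>D. ?B i)"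
      by (intro mult_left_mono) auto
    also have "\<dots> = (\<integral>\<^sup>+i. ennreal c * emeasure lborel (?B i) \<partial>count_space D)"
      by (simp add: dis nn_integral_cmult)
    also have "\<dots> \<le> (\<integral>\<^sup>+i. emeasure \<mu> (?B i) \<partial>count_space D)"
      using D(2) U(2) by (intro nn_integral_mono b) (fastforce simp: K_def)+
    also have "\<dots> = emeasure \<mu> (\<Union>i\<in>D. ?B i)" by (simp add: dis sets)
    also have "\<dots> \<le> emeasure \<mu> U"
      using D(2) U by (intro emeasure_mono) (fastforce simp: K_def sets)+
    finally show ?thesis .
  qed
  have "emeasure \<mu> A = (INF U\<in>{U. A \<subseteq> U \<and> open U}. emeasure \<mu> U)"
    using outer_regular[OF sets, of A] fin A by (simp add: sets_eq_imp_space_eq[OF sets])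
  also have "\<dots> \<ge> ennreal c * emeasure lborel A"
  proof (rule INF_greatest)
    fix U assume "U \<in> {U. A \<subseteq> U \<and> open U}"
    then have U: "A \<subseteq> U" "open U" by auto
    have "ennreal c * emeasure lborel A \<le> ennreal c * emeasure lborel (U \<inter> W)"
      using U W A by (intro mult_left_mono emeasure_mono) (auto intro!: borel_open)
    also have "\<dots> \<le> emeasure \<mu> (U \<inter> W)" using U W by (intro opn) auto
    also have "\<dots> \<le> emeasure \<mu> U" using U by (intro emeasure_mono) (auto simp: sets)
    finally show "ennreal c * emeasure lborel A \<le> emeasure \<mu> U" .
  qed
  finally show ?thesis .
qed

section \<open>Single collisions in coordinates where the polar angle is fixed and the azimuth is
  free\<close>

definition mirror :: "vec \<Rightarrow> vec \<Rightarrow> vec" where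
  "mirror a x = x - (2 * (x \<bullet> a) / (a \<bullet> a)) *\<^sub>R a"

lemma mirror_orthogonal: "orthogonal_transformation (mirror a)"
  unfolding mirror_def[abs_def] by (rule orthogonal_transformation_reflect)

lemma mirror_inner: "mirror a x \<bullet> y = x \<bullet> mirror a y"
  by (simp add: mirror_def inner_diff_left inner_diff_right inner_commute[of a y])

lemma mirror_perp: "x \<bullet> a = 0 \<Longrightarrow> mirror a x = x"
  by (simp add: mirror_def)

lemma mirror_scaleR: "c \<noteq> 0 \<Longrightarrow> mirror (c *\<^sub>R a) x = mirror a x"
  by (simp add: mirror_def)

lemma mirror_swap:
  assumes "norm x = norm y"
  shows "mirror (x - y) x = y"
proof (cases "x = y")
  case False
  have "x \<bullet> x = y \<bullet> y" using assms by (simp add: dot_square_norm)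
  then have "2 * (x \<bullet> (x - y)) = (x - y) \<bullet> (x - y)" by (simp add: inner_diff_left inner_diff_right inner_commute[of y x])
  then show ?thesis using False by (simp add: mirror_def)
qed (simp add: mirror_def)

lemma mirror_measurable [measurable]:
  assumes [measurable]: "f \<in> borel_measurable M" "g \<in> borel_measurable M"
  shows "(\<lambda>x. mirror (f x) (g x)) \<in> borel_measurable M"
  unfolding mirror_def by measurable

text \<open>An isometry carrying the axis \<open>d\<close> to the direction of \<open>g\<close>, smooth in \<open>g\<close> near \<open>d\<close>, and
  rotating around the axis by an azimuth that depends smoothly on \<open>\<phi>\<close>. The angular factor of the
  collision kernel, which is merely integrable, does not see \<open>\<phi>\<close>.\<close>

definition turn :: "vec \<Rightarrow> vec \<Rightarrow> vec \<Rightarrow> vec \<Rightarrow> real \<Rightarrow> vec \<Rightarrow> vec" where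
  "turn d e q g \<phi> x = - mirror (g /\<^sub>R norm g + d) (mirror (e + \<phi> *\<^sub>R q) x)"

definition frame :: "vec \<Rightarrow> vec \<Rightarrow> vec \<Rightarrow> bool" where
  "frame d e q \<longleftrightarrow> norm d = 1 \<and> norm e = 1 \<and> norm q = 1 \<and> d \<bullet> e = 0 \<and> d \<bullet> q = 0 \<and> e \<bullet> q = 0"

lemma frameD:
  assumes "frame d e q"
  shows "norm d = 1" "norm e = 1" "norm q = 1" "d \<bullet> e = 0" "d \<bullet> q = 0" "e \<bullet> q = 0"
    "e \<bullet> d = 0" "q \<bullet> d = 0" "q \<bullet> e = 0" "d \<bullet> d = 1" "e \<bullet> e = 1" "q \<bullet> q = 1"
  using assms by (auto simp: frame_def dot_square_norm inner_commute)

lemma turn_measurable [measurable]: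
  assumes [measurable]: "f \<in> borel_measurable M" "g \<in> borel_measurable M" "k \<in> borel_measurable M"
  shows "(\<lambda>x. turn d e q (f x) (g x) (k x)) \<in> borel_measurable M"
  unfolding turn_def by measurable

lemma turn_orthogonal: "orthogonal_transformation (turn d e q g \<phi>)"
proof -
  have "orthogonal_transformation (\<lambda>x. (uminus \<circ> (mirror (g /\<^sub>R norm g + d) \<circ> mirror (e + \<phi> *\<^sub>R q))) x)"
    unfolding eta_contract_eq
    by (intro orthogonal_transformation_compose mirror_orthogonal)
       (simp add: orthogonal_transformation_def linear_uminus)
  then show ?thesis by (simp add: turn_def[abs_def] o_def)
qed

text \<open>The outer mirror exchanges the direction of \<open>g\<close> with \<open>- d\<close>;
  the inner one has its normal orthogonal to \<open>d\<close> and fixes \<open>d\<close>.\<close>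

lemma turn_axis:
  assumes F: "frame d e q" and g: "0 < g \<bullet> d"
  shows "turn d e q g \<phi> x \<bullet> (g /\<^sub>R norm g) = x \<bullet> d"
proof -
  let ?g = "g /\<^sub>R norm g"
  have g0: "g \<noteq> 0" using g by auto
  then have "norm ?g = norm (- d)" using frameD[OF F] by simp
  from mirror_swap[OF this] have "mirror (?g + d) ?g = - d" by simp
  then have "turn d e q g \<phi> x \<bullet> ?g = - (mirror (e + \<phi> *\<^sub>R q) x \<bullet> (- d))"
    by (simp only: turn_def inner_minus_left mirror_inner[of "?g + d"])
  also have "\<dots> = mirror (e + \<phi> *\<^sub>R q) x \<bullet> d" by simp
  also have "\<dots> = x \<bullet> d" using frameD[OF F] by (simp add: mirror_inner mirror_perp inner_add_right)
  finally show ?thesis .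
qed

text \<open>The components along \<open>e\<close> and \<open>q\<close> are
  \<open>s (1 - \<phi>^2) / (1 + \<phi>^2)\<close> and \<open>2 s \<phi> / (1 + \<phi>^2)\<close>:
  the rational parametrisation of the circle, \<open>\<phi>\<close> being the tangent of half the
  azimuth.\<close>

lemma turn_base:
  assumes F: "frame d e q" and r: "0 < r"
  shows "turn d e q (r *\<^sub>R d) \<phi> (c *\<^sub>R d + s *\<^sub>R e) = c *\<^sub>R d - s *\<^sub>R e + (2 * s / (1 + \<phi>^2)) *\<^sub>R (e + \<phi> *\<^sub>R q)"
proof -
  note D = frameD[OF F]
  have e: "(r *\<^sub>R d) /\<^sub>R norm (r *\<^sub>R d) + d = 2 *\<^sub>R d" using r D(1) by (simp add: scaleR_2)
  have m: "mirror d (c *\<^sub>R d + s *\<^sub>R e + t *\<^sub>R (e + \<phi> *\<^sub>R q)) = - c *\<^sub>R d + s *\<^sub>R e + t *\<^sub>R (e + \<phi> *\<^sub>R q)" for s t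
  proof -
    have i: "(c *\<^sub>R d + s *\<^sub>R e + t *\<^sub>R (e + \<phi> *\<^sub>R q)) \<bullet> d = c" using D by (simp add: inner_add_left)
    have "(2 * c / 1) *\<^sub>R d = c *\<^sub>R d + c *\<^sub>R d" by (simp add: scaleR_left_distrib[symmetric])
    then show ?thesis unfolding mirror_def i D(10) by simp
  qed
  have "mirror (e + \<phi> *\<^sub>R q) (c *\<^sub>R d + s *\<^sub>R e) = c *\<^sub>R d + s *\<^sub>R e + (- (2 * s / (1 + \<phi>^2))) *\<^sub>R (e + \<phi> *\<^sub>R q)"
    using D by (simp add: mirror_def inner_add_left inner_add_right power2_eq_square)
  moreover have "mirror (2 *\<^sub>R d) y = mirror d y" for y by (rule mirror_scaleR) simp
  ultimately show ?thesis unfolding turn_def e by (simp only: m) simp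
qed

lemma sd_mirror:
  assumes "strict_diff f z" "strict_diff g z" "f z \<noteq> 0"
  shows "strict_diff (\<lambda>y. mirror (f y) (g y)) z"
  unfolding mirror_def divide_inverse
  using assms
  by (intro sd_diff sd_bilinear[OF bounded_bilinear_scaleR] sd_bilinear[OF bounded_bilinear_mult]
      sd_bilinear[OF bounded_bilinear_inner] sd_inverse sd_const) auto

lemma sd_turn:
  assumes F: "frame d e q" and f: "strict_diff f z" "strict_diff g z" "strict_diff k z"
    and pos: "0 < f z \<bullet> d"
  shows "strict_diff (\<lambda>y. turn d e q (f y) (g y) (k y)) z"
proof -
  have f0: "f z \<noteq> 0" using pos by auto
  have "(f z /\<^sub>R norm (f z) + d) \<bullet> d = (f z \<bullet> d) / norm (f z) + 1"
    using frameD[OF F] by (simp add: inner_add_left divide_inverse mult.commute)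
  moreover have "0 < (f z \<bullet> d) / norm (f z) + 1" using pos f0 by (intro add_pos_pos divide_pos_pos) auto
  ultimately have "f z /\<^sub>R norm (f z) + d \<noteq> 0" by auto
  moreover have "(e + g z *\<^sub>R q) \<bullet> e = 1" using frameD[OF F] by (simp add: inner_add_left)
  then have "e + g z *\<^sub>R q \<noteq> 0" by auto
  ultimately have "strict_diff (\<lambda>y. (-1) *\<^sub>R mirror (f y /\<^sub>R norm (f y) + d) (mirror (e + g y *\<^sub>R q) (k y))) z"
    using f f0
    by (intro sd_mirror sd_add sd_bilinear[OF bounded_bilinear_scaleR] sd_inverse sd_norm sd_const) auto
  then show ?thesis by (simp add: turn_def[abs_def])
qed

lemma sd_post_vel:
  assumes "strict_diff f z" "strict_diff g z" "strict_diff k z"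
  shows "strict_diff (\<lambda>y. post_vel mi mj (f y) (g y) (k y)) z"
  unfolding post_vel_def using assms
  by (intro sd_diff sd_bilinear[OF bounded_bilinear_scaleR] sd_bilinear[OF bounded_bilinear_mult]
      sd_bilinear[OF bounded_bilinear_inner] sd_const) auto

definition coll_map :: "real \<Rightarrow> real \<Rightarrow> vec \<Rightarrow> vec \<Rightarrow> vec \<Rightarrow> vec \<Rightarrow> vec \<Rightarrow> real \<Rightarrow> vec \<Rightarrow> vec" where
  "coll_map mi mj d e q u w \<phi> x = post_vel mi mj u w (turn d e q (u - w) \<phi> x)"

lemma coll_map_measurable [measurable]:
  assumes [measurable]: "u \<in> borel_measurable M" "w \<in> borel_measurable M" "f \<in> borel_measurable M" "g \<in> borel_measurable M"
  shows "(\<lambda>x. coll_map mi mj d e q (u x) (w x) (f x) (g x)) \<in> borel_measurable M"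
  unfolding coll_map_def by measurable

lemma sd_coll_map:
  assumes "frame d e q" "strict_diff u z" "strict_diff w z"
    "strict_diff g z" "strict_diff k z" "0 < (u z - w z) \<bullet> d"
  shows "strict_diff (\<lambda>y. coll_map mi mj d e q (u y) (w y) (g y) (k y)) z"
  unfolding coll_map_def using assms by (intro sd_post_vel sd_turn sd_diff) auto

text \<open>The direction of impact makes the polar angle with cosine \<open>c\<close> with the
  relative velocity, whatever the azimuth. Differentiating these identities replaces the computation
  of the derivative. The second one also shows that partners of velocity \<open>w\<close> alone
  confine the particle to a sphere about \<open>w\<close> of prescribed radius.\<close>

lemma coll_map_invariants:
  fixes mi mj :: real
  assumes F: "frame d e q" and g: "0 < (u - w) \<bullet> d" and n: "norm x = 1" and c: "x \<bullet> d = c"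
  defines "\<kappa> \<equiv> 2 * mj / (mi + mj)"
  shows "(coll_map mi mj d e q u w \<phi> x - w) \<bullet> (u - w) = (1 - \<kappa> * c^2) * ((u - w) \<bullet> (u - w))"
    "(coll_map mi mj d e q u w \<phi> x - w) \<bullet> (coll_map mi mj d e q u w \<phi> x - w) = (1 - 2 * \<kappa> * c^2 + \<kappa>^2 * c^2) * ((u - w) \<bullet> (u - w))"
proof -
  define g p where "g = u - w" and "p = turn d e q g \<phi> x"
  have g0: "g \<noteq> 0" and gd: "0 < g \<bullet> d" using g by (auto simp: g_def)
  have "inverse (norm g) * (p \<bullet> g) = c"
    using turn_axis[OF F gd, of \<phi> x] c by (simp add: p_def)
  then have gp: "p \<bullet> g = c * norm g" "g \<bullet> p = c * norm g" using g0 by (simp_all add: field_simps inner_commute)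
  have pp: "p \<bullet> p = 1" using turn_orthogonal[of d e q g \<phi>] n by (simp add: p_def dot_square_norm orthogonal_transformation_norm)
  have eq: "coll_map mi mj d e q u w \<phi> x - w = g - (\<kappa> * (c * norm g)) *\<^sub>R p"
    unfolding coll_map_def post_vel_def g_def[symmetric] p_def[symmetric] gp \<kappa>_def by (simp add: g_def)
  have gg: "norm g * norm g = g \<bullet> g" by (simp add: dot_square_norm power2_eq_square)
  have "(g - (\<kappa> * (c * norm g)) *\<^sub>R p) \<bullet> g = g \<bullet> g - \<kappa> * (c * c) * (norm g * norm g)"
    by (simp add: inner_diff_left gp)
  then show "(coll_map mi mj d e q u w \<phi> x - w) \<bullet> (u - w) = (1 - \<kappa> * c^2) * ((u - w) \<bullet> (u - w))"
    unfolding eq gg g_def[symmetric] by (simp add: algebra_simps power2_eq_square)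
  have "(g - (\<kappa> * (c * norm g)) *\<^sub>R p) \<bullet> (g - (\<kappa> * (c * norm g)) *\<^sub>R p)
    = g \<bullet> g - 2 * \<kappa> * (c * c) * (norm g * norm g) + \<kappa> * \<kappa> * (c * c) * (norm g * norm g)"
    by (simp add: inner_diff_left inner_diff_right gp pp algebra_simps)
  then show "(coll_map mi mj d e q u w \<phi> x - w) \<bullet> (coll_map mi mj d e q u w \<phi> x - w) = (1 - 2 * \<kappa> * c^2 + \<kappa>^2 * c^2) * ((u - w) \<bullet> (u - w))"
    unfolding eq gg g_def[symmetric] by (simp add: algebra_simps power2_eq_square)
qed

lemma coll_map_base:
  fixes mi mj :: real
  assumes F: "frame d e q" and r: "0 < r" and g: "u - w = r *\<^sub>R d" and n: "n = c *\<^sub>R d + s *\<^sub>R e"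
  defines "\<kappa> \<equiv> 2 * mj / (mi + mj)"
  shows "coll_map mi mj d e q u w 0 n - w = (r * (1 - \<kappa> * c^2)) *\<^sub>R d - (\<kappa> * c * s * r) *\<^sub>R e"
    "(coll_map mi mj d e q u w \<phi> n - u) \<bullet> q = - \<kappa> * c * r * (2 * s * \<phi> / (1 + \<phi>^2))"
proof -
  note D = frameD[OF F]
  let ?n = "turn d e q (r *\<^sub>R d) \<phi> n"
  have tb: "turn d e q (r *\<^sub>R d) \<phi> n = c *\<^sub>R d - s *\<^sub>R e + (2 * s / (1 + \<phi>^2)) *\<^sub>R (e + \<phi> *\<^sub>R q)" for \<phi>
    unfolding n by (rule turn_base[OF F r])
  have t0: "turn d e q (r *\<^sub>R d) 0 n = c *\<^sub>R d + s *\<^sub>R e"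
  proof -
    have "(2 * s) *\<^sub>R e = s *\<^sub>R e + s *\<^sub>R e" by (simp add: scaleR_left_distrib[symmetric])
    then show ?thesis unfolding tb by simp
  qed
  have u: "u = w + r *\<^sub>R d" using g by (simp add: algebra_simps)
  have "(r *\<^sub>R d) \<bullet> (c *\<^sub>R d + s *\<^sub>R e) = r * c" using D by (simp add: inner_add_right)
  then show "coll_map mi mj d e q u w 0 n - w = (r * (1 - \<kappa> * c^2)) *\<^sub>R d - (\<kappa> * c * s * r) *\<^sub>R e"
    unfolding coll_map_def post_vel_def g t0 \<kappa>_def[symmetric] by (simp only:) (simp add: u scaleR_add_right scaleR_diff_left right_diff_distrib power2_eq_square mult_ac)
  have 1: "(r *\<^sub>R d) \<bullet> ?n = r * c" unfolding tb using D by (simp add: inner_add_right inner_diff_right)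
  have 2: "?n \<bullet> q = 2 * s * \<phi> / (1 + \<phi>^2)" unfolding tb using D by (simp add: inner_add_left inner_diff_left)
  show "(coll_map mi mj d e q u w \<phi> n - u) \<bullet> q = - \<kappa> * c * r * (2 * s * \<phi> / (1 + \<phi>^2))"
    unfolding coll_map_def post_vel_def g 1 \<kappa>_def[symmetric] by (simp add: inner_diff_left 2)
qed

text \<open>The component along \<open>q\<close>, the direction transverse to \<open>d\<close> and
  \<open>e\<close>, has derivative \<open>- 2 \<kappa> c s r h\<close> at azimuth zero, with
  \<open>\<kappa> = 2 mj / (mi + mj)\<close>. It vanishes only for \<open>h = 0\<close> because
  impacts along the axis and grazing ones are excluded.\<close>

lemma coll_map_azimuth:
  assumes F: "frame d e q" and r: "0 < r" and g: "u - w = r *\<^sub>R d" and n: "n = c *\<^sub>R d + s *\<^sub>R e"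
    and m: "0 < mi" "0 < mj" and cs: "0 < c" "0 < s"
    and der: "((\<lambda>t. coll_map mi mj d e q u w (t * h) n) has_vector_derivative 0) (at 0)"
  shows "h = 0"
proof -
  let ?\<kappa> = "2 * mj / (mi + mj)"
  have "((\<lambda>t. (coll_map mi mj d e q u w (t * h) n - u) \<bullet> q) has_vector_derivative 0) (at 0)"
    using bounded_linear.has_vector_derivative[OF bounded_linear_inner_left, OF has_vector_derivative_diff[OF der has_vector_derivative_const[of u]], of q]
    by simp
  then have "((\<lambda>t. - ?\<kappa> * c * r * (2 * s * (t * h) / (1 + (t * h)^2))) has_real_derivative 0) (at 0)"
    unfolding coll_map_base(2)[OF F r g n] has_real_derivative_iff_has_vector_derivative .
  moreover have "((\<lambda>t. 2 * s * (t * h) / (1 + (t * h)^2)) has_real_derivative 2 * s * h) (at 0)"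
    by (auto intro!: derivative_eq_intros)
  then have "((\<lambda>t. - ?\<kappa> * c * r * (2 * s * (t * h) / (1 + (t * h)^2))) has_real_derivative (- ?\<kappa> * c * r * (2 * s * h))) (at 0)"
    by (rule DERIV_cmult)
  ultimately have "- ?\<kappa> * c * r * (2 * s * h) = 0" using DERIV_unique by blast
  then show ?thesis using m cs r by simp
qed

text \<open>Two independent vectors and their cross product span the space; the Lagrange identity
  makes the cross product of \<open>x\<close> with \<open>cross3 a b\<close> vanish while the two
  are orthogonal.\<close>

lemma inner_cross_eq_0:
  fixes x a b :: vec
  assumes "x \<bullet> a = 0" "x \<bullet> b = 0" "x \<bullet> cross3 a b = 0" "cross3 a b \<noteq> 0"
  shows "x = 0"
proof -
  have "cross3 x (cross3 a b) = (x \<bullet> b) *\<^sub>R a - (x \<bullet> a) *\<^sub>R b"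
    by (rule Lagrange)
  then have "cross3 x (cross3 a b) = 0" using assms by simp
  then have "0 = (norm x * norm (cross3 a b))^2" using norm_cross_dot[of x "cross3 a b"] assms(3) by simp
  then show ?thesis using assms(4) by simp
qed

lemma frame_exists:
  fixes a b :: vec
  assumes ab: "cross3 a b \<noteq> 0" and r: "0 < r" and a: "a = r *\<^sub>R d" and d: "norm d = 1"
  obtains q where "frame d (cross3 a b /\<^sub>R norm (cross3 a b)) q"
proof -
  define e where "e = cross3 a b /\<^sub>R norm (cross3 a b)"
  have e: "norm e = 1" using ab by (simp add: e_def)
  have "a \<bullet> cross3 a b = 0" by (simp add: dot_cross_self)
  then have de: "d \<bullet> e = 0" using r unfolding a e_def by simp
  have "(norm (cross3 d e))^2 = 1" using norm_cross_dot[of d e] e d de by simp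
  then have "norm (cross3 d e) = 1" by (simp add: power2_eq_1_iff) (use norm_ge_zero[of "cross3 d e"] in linarith)
  then have "frame d e (cross3 d e)" using d e de unfolding frame_def by (simp add: dot_cross_self)
  then show ?thesis unfolding e_def by (rule that)
qed

lemma strict_deriv_curve:
  assumes "strict_deriv f L (l, 0)"
  shows "((\<lambda>t. f (l, t *\<^sub>R h)) has_vector_derivative L (0, h)) (at 0)"
proof -
  have bl: "bounded_linear L" using assms by (simp add: strict_deriv_def)
  have "((\<lambda>t. (l, t *\<^sub>R h)) has_derivative (\<lambda>t. (0, t *\<^sub>R h))) (at 0)"
    by (auto intro!: derivative_eq_intros)
  moreover have "(f has_derivative L) (at (l, 0 *\<^sub>R h))" using strict_deriv_has_derivative[OF assms] by simp
  ultimately have "((\<lambda>t. f (l, t *\<^sub>R h)) has_derivative (\<lambda>t. L (0, t *\<^sub>R h))) (at 0)"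
    by (rule has_derivative_compose)
  moreover have "L (0, t *\<^sub>R h) = t *\<^sub>R L (0, h)" for t
    using linear_cmul[OF bounded_linear.linear[OF bl], of t "(0, h)"] by simp
  ultimately show ?thesis by (simp add: has_vector_derivative_def)
qed

lemma inner_curve:
  fixes p r s :: "real \<Rightarrow> 'a::real_inner"
  assumes p: "(p has_vector_derivative p') (at 0)" and r: "(r has_vector_derivative r') (at 0)"
    and s: "(s has_vector_derivative s') (at 0)"
    and ev: "\<forall>\<^sub>F t in nhds 0. (p t - a) \<bullet> (r t - b) = K * ((s t - c) \<bullet> (s t - c))"
  shows "(p 0 - a) \<bullet> r' + p' \<bullet> (r 0 - b) = 2 * K * ((s 0 - c) \<bullet> s')"
proof -
  have d: "((\<lambda>t. x t - k) has_vector_derivative x') (at 0)" if "(x has_vector_derivative x') (at 0)" for x x' and k :: 'a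
    using has_vector_derivative_diff[OF that has_vector_derivative_const[of k]] by simp
  have "((\<lambda>t. (p t - a) \<bullet> (r t - b)) has_real_derivative (p 0 - a) \<bullet> r' + p' \<bullet> (r 0 - b)) (at 0)"
    unfolding has_real_derivative_iff_has_vector_derivative
    by (rule bounded_bilinear.has_vector_derivative[OF bounded_bilinear_inner d[OF p] d[OF r]])
  moreover have "((\<lambda>t. (s t - c) \<bullet> (s t - c)) has_real_derivative (s 0 - c) \<bullet> s' + s' \<bullet> (s 0 - c)) (at 0)"
    unfolding has_real_derivative_iff_has_vector_derivative
    by (rule bounded_bilinear.has_vector_derivative[OF bounded_bilinear_inner d[OF s] d[OF s]])
  then have "((\<lambda>t. K * ((s t - c) \<bullet> (s t - c))) has_real_derivative K * ((s 0 - c) \<bullet> s' + s' \<bullet> (s 0 - c))) (at 0)"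
    by (rule DERIV_cmult)
  then have "((\<lambda>t. (p t - a) \<bullet> (r t - b)) has_real_derivative K * ((s 0 - c) \<bullet> s' + s' \<bullet> (s 0 - c))) (at 0)"
    by (subst DERIV_cong_ev[OF refl ev refl])
  ultimately have "(p 0 - a) \<bullet> r' + p' \<bullet> (r 0 - b) = K * ((s 0 - c) \<bullet> s' + s' \<bullet> (s 0 - c))"
    by (rule DERIV_unique)
  then show ?thesis by (simp add: inner_commute[of s'])
qed

section \<open>Chains of three collisions and their nondegeneracy\<close>

type_synonym params = "((vec \<times> vec) \<times> (vec \<times> vec)) \<times> (vec \<times> vec \<times> vec)"

text \<open>A particle of mass \<open>mi\<close> starting from \<open>a\<close> meets two particles of mass \<open>mj\<close> and velocity
  \<open>b\<close> and then one of its own kind and velocity \<open>a\<close>. The transversality assumptions make its final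
  velocity a local diffeomorphism as a function of the three azimuths.\<close>

locale collision_chain =
  fixes mi mj :: real and d1 e1 q1 d2 e2 q2 d3 e3 q3 :: vec and c1 s1 c2 s2 c3 s3 r1 r2 r3 :: real and a b u1 u2 u3 :: vec
  assumes mass: "0 < mi" "0 < mj"
    and frames: "frame d1 e1 q1" "frame d2 e2 q2" "frame d3 e3 q3"
    and cs: "0 < c1" "0 < s1" "0 < c2" "0 < s2" "0 < c3" "0 < s3"
    and cs1: "c1^2 + s1^2 = 1" "c2^2 + s2^2 = 1" "c3^2 + s3^2 = 1"
    and r: "0 < r1" "0 < r2" "0 < r3"
    and u1: "u1 = coll_map mi mj d1 e1 q1 a b 0 (c1 *\<^sub>R d1 + s1 *\<^sub>R e1)"
    and u2: "u2 = coll_map mi mj d2 e2 q2 u1 b 0 (c2 *\<^sub>R d2 + s2 *\<^sub>R e2)"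
    and u3: "u3 = coll_map mi mi d3 e3 q3 u2 a 0 (c3 *\<^sub>R d3 + s3 *\<^sub>R e3)"
    and g: "a - b = r1 *\<^sub>R d1" "u1 - b = r2 *\<^sub>R d2" "u2 - a = r3 *\<^sub>R d3"
    and transversal: "\<And>x. x \<bullet> (a - b) = 0 \<Longrightarrow> x \<bullet> (u1 - b) = 0 \<Longrightarrow> x \<bullet> (u2 - b) = 0 \<Longrightarrow> x = 0"
      "\<And>x. x \<bullet> (u2 - a) = 0 \<Longrightarrow> x \<bullet> (u3 - a) = 0 \<Longrightarrow> x \<bullet> (u2 - b) = 0 \<Longrightarrow> x = 0"
begin

abbreviation "n1 \<equiv> c1 *\<^sub>R d1 + s1 *\<^sub>R e1"
abbreviation "n2 \<equiv> c2 *\<^sub>R d2 + s2 *\<^sub>R e2"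
abbreviation "n3 \<equiv> c3 *\<^sub>R d3 + s3 *\<^sub>R e3"

text \<open>The parameters hold the starting velocity, the three partners and the three reference
  directions, which carry the polar angles. The azimuths form the \<open>vec\<close> component, the
  only one in which the map is inverted.\<close>

definition V1 :: "params \<times> vec \<Rightarrow> vec" where
  "V1 z = coll_map mi mj d1 e1 q1 (fst (fst (fst (fst z)))) (snd (fst (fst (fst z)))) (snd z $ 1) (fst (snd (fst z)))"

definition V2 :: "params \<times> vec \<Rightarrow> vec" where
  "V2 z = coll_map mi mj d2 e2 q2 (V1 z) (fst (snd (fst (fst z)))) (snd z $ 2) (fst (snd (snd (fst z))))"

definition V3 :: "params \<times> vec \<Rightarrow> vec" where
  "V3 z = coll_map mi mi d3 e3 q3 (V2 z) (snd (snd (fst (fst z)))) (snd z $ 3) (snd (snd (snd (fst z))))"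

definition l0 :: params where "l0 = (((a, b), (b, a)), (n1, n2, n3))"

lemma base: "V1 (l0, 0) = u1" "V2 (l0, 0) = u2" "V3 (l0, 0) = u3"
  by (simp_all add: V1_def V2_def V3_def l0_def u1[symmetric] u2[symmetric] u3[symmetric])

lemma pos: "0 < (a - b) \<bullet> d1" "0 < (u1 - b) \<bullet> d2" "0 < (u2 - a) \<bullet> d3"
  using r frameD[OF frames(1)] frameD[OF frames(2)] frameD[OF frames(3)] unfolding g by simp_all

lemma unit: "norm n1 = 1" "n1 \<bullet> d1 = c1" "norm n2 = 1" "n2 \<bullet> d2 = c2" "norm n3 = 1" "n3 \<bullet> d3 = c3"
proof -
  have *: "norm (c *\<^sub>R d + s *\<^sub>R e) = 1" if "frame d e q" "c^2 + s^2 = 1" for c d s e q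
    using frameD[OF that(1)] that(2) unfolding norm_eq_1 by (simp add: inner_add_left inner_add_right power2_eq_square)
  show "norm n1 = 1" "norm n2 = 1" "norm n3 = 1" using * frames cs1 by blast+
  show "n1 \<bullet> d1 = c1" "n2 \<bullet> d2 = c2" "n3 \<bullet> d3 = c3"
    using frameD[OF frames(1)] frameD[OF frames(2)] frameD[OF frames(3)] by (simp_all add: inner_add_left)
qed

lemma sd_components:
  "strict_diff (\<lambda>z::params \<times> vec. fst (fst (fst (fst z)))) z"
  "strict_diff (\<lambda>z::params \<times> vec. snd (fst (fst (fst z)))) z"
  "strict_diff (\<lambda>z::params \<times> vec. fst (snd (fst (fst z)))) z"
  "strict_diff (\<lambda>z::params \<times> vec. snd (snd (fst (fst z)))) z"
  "strict_diff (\<lambda>z::params \<times> vec. fst (snd (fst z))) z"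
  "strict_diff (\<lambda>z::params \<times> vec. fst (snd (snd (fst z)))) z"
  "strict_diff (\<lambda>z::params \<times> vec. snd (snd (snd (fst z)))) z"
  "strict_diff (\<lambda>z::params \<times> vec. snd z $ k) z"
  by (intro sd_comp_linear[OF bounded_linear_fst] sd_comp_linear[OF bounded_linear_snd]
      sd_comp_linear[OF bounded_linear_vec_nth] sd_linear[OF bounded_linear_ident])+

lemma sd_V: "strict_diff V1 (l0, 0)" "strict_diff V2 (l0, 0)" "strict_diff V3 (l0, 0)"
proof -
  show 1: "strict_diff V1 (l0, 0)" unfolding V1_def[abs_def]
    using pos by (intro sd_coll_map frames sd_components) (simp add: l0_def)
  show 2: "strict_diff V2 (l0, 0)" unfolding V2_def[abs_def]
    using pos by (intro sd_coll_map frames sd_components 1) (simp add: base, simp add: l0_def)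
  show "strict_diff V3 (l0, 0)" unfolding V3_def[abs_def]
    using pos by (intro sd_coll_map frames sd_components 2) (simp add: base, simp add: l0_def)
qed

text \<open>Along a line of azimuths that leaves the final velocity stationary, the derivative
  \<open>x2\<close> of the second velocity is orthogonal to \<open>u2 - b\<close>,
  \<open>u2 - a\<close> and \<open>u3 - a\<close>, by the invariants of the last two collisions, so
  it vanishes. Then \<open>x1\<close> is orthogonal to \<open>a - b\<close>, \<open>u1 - b\<close>
  and \<open>u2 - b\<close> and vanishes as well. With every intermediate velocity stationary, the
  azimuths drop out one after the other.\<close>

lemma deriv_injective:
  assumes L: "strict_deriv V3 L (l0, 0)" and h: "L (0, h) = 0"
  shows "h = 0"
proof -
  obtain L1 L2 where L1: "strict_deriv V1 L1 (l0, 0)" and L2: "strict_deriv V2 L2 (l0, 0)"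
    using sd_V unfolding strict_diff_def by blast
  define p1 p2 p3 where "p1 = (\<lambda>t. V1 (l0, t *\<^sub>R h))" and "p2 = (\<lambda>t. V2 (l0, t *\<^sub>R h))" and "p3 = (\<lambda>t. V3 (l0, t *\<^sub>R h))"
  define x1 x2 where "x1 = L1 (0, h)" and "x2 = L2 (0, h)"
  have d1: "(p1 has_vector_derivative x1) (at 0)" and d2: "(p2 has_vector_derivative x2) (at 0)"
    and d3: "(p3 has_vector_derivative 0) (at 0)"
    unfolding p1_def p2_def p3_def x1_def x2_def h[symmetric] by (intro strict_deriv_curve L1 L2 L)+
  have p1: "p1 t = coll_map mi mj d1 e1 q1 a b (t * h $ 1) n1"
    and p2: "p2 t = coll_map mi mj d2 e2 q2 (p1 t) b (t * h $ 2) n2"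
    and p3: "p3 t = coll_map mi mi d3 e3 q3 (p2 t) a (t * h $ 3) n3" for t
    by (simp_all add: p1_def p2_def p3_def V1_def V2_def V3_def l0_def)
  have p0: "p1 0 = u1" "p2 0 = u2" "p3 0 = u3" using base by (simp_all add: p1_def p2_def p3_def)
  have a': "((\<lambda>_. a) has_vector_derivative 0) (at (0::real))" by (rule has_vector_derivative_const)
  have ev: "\<forall>\<^sub>F t in nhds 0. 0 < (p t - w) \<bullet> d"
    if "(p has_vector_derivative x) (at 0)" "0 < (p 0 - w) \<bullet> d" for p :: "real \<Rightarrow> vec" and x w d
  proof -
    have "isCont (\<lambda>t. (p t - w) \<bullet> d) 0" using has_vector_derivative_continuous[OF that(1)] by (intro continuous_intros)
    then have "((\<lambda>t. (p t - w) \<bullet> d) \<longlongrightarrow> (p 0 - w) \<bullet> d) (nhds 0)" by (simp add: continuous_at isCont_def tendsto_nhds_iff)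
    then show ?thesis using that(2) by (rule order_tendstoD)
  qed
  let ?k = "2 * mj / (mi + mj)"
  have inv1: "(p1 t - b) \<bullet> (a - b) = (1 - ?k * c1^2) * ((a - b) \<bullet> (a - b))"
    "(p1 t - b) \<bullet> (p1 t - b) = (1 - 2 * ?k * c1^2 + ?k\<^sup>2 * c1^2) * ((a - b) \<bullet> (a - b))" for t
    unfolding p1 by (intro coll_map_invariants frames pos unit)+
  have A1: "x1 \<bullet> (a - b) = 0" using inner_curve[OF d1 a' a', of b b, OF always_eventually, OF allI, OF inv1(1)] by simp
  have A2: "x1 \<bullet> (u1 - b) = 0"
    using inner_curve[OF d1 d1 a', of b b, OF always_eventually, OF allI, OF inv1(2)] by (simp add: p0 inner_commute)
  have inv2: "\<forall>\<^sub>F t in nhds 0. (p2 t - b) \<bullet> (p1 t - b) = (1 - ?k * c2^2) * ((p1 t - b) \<bullet> (p1 t - b))"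
    "\<forall>\<^sub>F t in nhds 0. (p2 t - b) \<bullet> (p2 t - b) = (1 - 2 * ?k * c2^2 + ?k\<^sup>2 * c2^2) * ((p1 t - b) \<bullet> (p1 t - b))"
    using ev[OF d1, of b d2] pos(2) unfolding p0
    by (auto elim!: eventually_mono simp: p2 coll_map_invariants[OF frames(2) _ unit(3,4)])
  have B1: "(u2 - b) \<bullet> x1 + x2 \<bullet> (u1 - b) = 0" using inner_curve[OF d2 d1 d1 inv2(1)] A2 by (simp add: p0 inner_commute)
  have B2: "x2 \<bullet> (u2 - b) = 0" using inner_curve[OF d2 d2 d1 inv2(2)] A2 by (simp add: p0 inner_commute)
  have k1: "2 * mi / (mi + mi) = 1" using mass by simp
  have inv3: "\<forall>\<^sub>F t in nhds 0. (p3 t - a) \<bullet> (p2 t - a) = (1 - c3\<^sup>2) * ((p2 t - a) \<bullet> (p2 t - a))"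
    "\<forall>\<^sub>F t in nhds 0. (p3 t - a) \<bullet> (p3 t - a) = (1 - c3\<^sup>2) * ((p2 t - a) \<bullet> (p2 t - a))"
  proof -
    have k2: "1 - 2 * 1 * c3^2 + 1\<^sup>2 * c3^2 = 1 - c3\<^sup>2" by simp
    have "(p3 t - a) \<bullet> (p2 t - a) = (1 - c3\<^sup>2) * ((p2 t - a) \<bullet> (p2 t - a))"
      "(p3 t - a) \<bullet> (p3 t - a) = (1 - c3\<^sup>2) * ((p2 t - a) \<bullet> (p2 t - a))" if t: "0 < (p2 t - a) \<bullet> d3" for t
      using coll_map_invariants[OF frames(3) t unit(5,6), of mi mi "t * h $ 3"]
      unfolding p3[symmetric] k1 k2 mult_1 by blast+
    then show "\<forall>\<^sub>F t in nhds 0. (p3 t - a) \<bullet> (p2 t - a) = (1 - c3\<^sup>2) * ((p2 t - a) \<bullet> (p2 t - a))"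
      "\<forall>\<^sub>F t in nhds 0. (p3 t - a) \<bullet> (p3 t - a) = (1 - c3\<^sup>2) * ((p2 t - a) \<bullet> (p2 t - a))"
      using ev[OF d2, of a d3] pos(3) unfolding p0 by (blast intro: eventually_mono)+
  qed
  have s3: "1 - c3\<^sup>2 = s3^2" using cs1(3) by simp
  have C2: "x2 \<bullet> (u2 - a) = 0" using inner_curve[OF d3 d3 d2 inv3(2)] cs by (simp add: p0 s3 inner_commute)
  have C1: "x2 \<bullet> (u3 - a) = 0" using inner_curve[OF d3 d2 d2 inv3(1)] C2 by (simp add: p0 inner_commute)
  have x2: "x2 = 0" by (rule transversal(2)[OF C2 C1 B2])
  then have "x1 \<bullet> (u2 - b) = 0" using B1 by (simp add: inner_commute)
  then have x1: "x1 = 0" by (rule transversal(1)[OF A1 A2])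
  have "((\<lambda>t. coll_map mi mj d1 e1 q1 a b (t * h $ 1) n1) has_vector_derivative 0) (at 0)"
    using d1 unfolding x1 by (simp add: p1[abs_def])
  then have h1: "h $ 1 = 0" by (rule coll_map_azimuth[OF frames(1) r(1) g(1) refl mass cs(1,2)])
  have "p1 t = u1" for t unfolding p1 h1 u1 by simp
  then have "((\<lambda>t. coll_map mi mj d2 e2 q2 u1 b (t * h $ 2) n2) has_vector_derivative 0) (at 0)"
    using d2 unfolding x2 by (simp add: p2[abs_def])
  then have h2: "h $ 2 = 0" by (rule coll_map_azimuth[OF frames(2) r(2) g(2) refl mass cs(3,4)])
  have "p2 t = u2" for t using \<open>\<And>t. p1 t = u1\<close> unfolding p2 h2 u2 by simp
  then have "((\<lambda>t. coll_map mi mi d3 e3 q3 u2 a (t * h $ 3) n3) has_vector_derivative 0) (at 0)"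
    using d3 by (simp add: p3[abs_def])
  then have h3: "h $ 3 = 0" by (rule coll_map_azimuth[OF frames(3) r(3) g(3) refl mass(1) mass(1) cs(5,6)])
  show ?thesis using h1 h2 h3 by (simp add: vec_eq_iff forall_3)
qed

end

text \<open>From the second collision on, the vector \<open>e\<close> of the frame is normal to the
  plane spanned by the current relative velocity and \<open>a - b\<close>. The collision therefore
  leaves this plane, which yields both transversality conditions. For the first collision any
  \<open>e\<close> orthogonal to \<open>a - b\<close> makes \<open>u1 - b\<close> leave the line of
  \<open>a - b\<close>.\<close>

lemma collision_chain_exists:
  fixes a b :: vec
  assumes ab: "a \<noteq> b" and m: "0 < mi" "0 < mj"
    and cs: "0 < c1" "0 < s1" "0 < c2" "0 < s2" "0 < c3" "0 < s3" "c1^2 + s1^2 = 1" "c2^2 + s2^2 = 1" "c3^2 + s3^2 = 1"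
  obtains d1 e1 q1 d2 e2 q2 d3 e3 q3 r1 r2 r3 u1 u2 u3
  where "collision_chain mi mj d1 e1 q1 d2 e2 q2 d3 e3 q3 c1 s1 c2 s2 c3 s3 r1 r2 r3 a b u1 u2 u3"
proof -
  let ?k = "2 * mj / (mi + mj)"
  have k0: "?k \<noteq> 0" using m by simp
  have nz: "x \<noteq> 0 \<Longrightarrow> 0 < norm x \<and> x = norm x *\<^sub>R (x /\<^sub>R norm x) \<and> norm (x /\<^sub>R norm x) = 1" for x :: vec by simp
  have crs: "cross3 x y \<noteq> 0" if "x \<bullet> e \<noteq> 0" "y \<bullet> e = 0" "y \<noteq> 0" for x y e :: vec
  proof
    assume "cross3 x y = 0"
    moreover have "cross3 e (cross3 x y) = (e \<bullet> y) *\<^sub>R x - (e \<bullet> x) *\<^sub>R y" by (rule Lagrange)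
    ultimately have "(e \<bullet> x) *\<^sub>R y = 0" using that(2) by (simp add: inner_commute)
    then show False using that by (simp add: inner_commute)
  qed
  define g1 where "g1 = a - b"
  have g1: "g1 \<noteq> 0" using ab by (simp add: g1_def)
  obtain y where y: "y \<noteq> 0" "orthogonal g1 y" using orthogonal_to_vector_exists[of g1] by (auto simp: orthogonal_commute)
  have "cross3 g1 y \<noteq> 0" by (rule crs[of _ g1]) (use g1 y in \<open>auto simp: orthogonal_def inner_commute\<close>)
  then obtain q1 where F1: "frame (g1 /\<^sub>R norm g1) (cross3 g1 y /\<^sub>R norm (cross3 g1 y)) q1"
    using frame_exists[of g1 y "norm g1" "g1 /\<^sub>R norm g1"] nz[OF g1] by metis
  define d1 e1 r1 where "d1 = g1 /\<^sub>R norm g1" and "e1 = cross3 g1 y /\<^sub>R norm (cross3 g1 y)" and "r1 = norm g1"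
  have F1: "frame d1 e1 q1" using F1 by (simp add: d1_def e1_def)
  have r1: "0 < r1" and G1: "a - b = r1 *\<^sub>R d1" using nz[OF g1] by (simp_all add: r1_def d1_def g1_def)
  define u1 where "u1 = coll_map mi mj d1 e1 q1 a b 0 (c1 *\<^sub>R d1 + s1 *\<^sub>R e1)"
  define g2 where "g2 = u1 - b"
  have g2eq: "g2 = (r1 * (1 - ?k * c1^2)) *\<^sub>R d1 - (?k * c1 * s1 * r1) *\<^sub>R e1"
    unfolding g2_def u1_def by (rule coll_map_base[OF F1 r1 G1 refl])
  have "g2 \<bullet> e1 = - (?k * c1 * s1 * r1)" unfolding g2eq using frameD[OF F1] by (simp add: inner_diff_left)
  moreover have "g1 \<bullet> e1 = 0" using frameD[OF F1] by (simp add: g1_def G1)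
  ultimately have c2: "cross3 g2 g1 \<noteq> 0" using k0 cs r1 g1 by (intro crs[of _ e1]) auto
  then have g2: "g2 \<noteq> 0" by auto
  obtain q2 where F2: "frame (g2 /\<^sub>R norm g2) (cross3 g2 g1 /\<^sub>R norm (cross3 g2 g1)) q2"
    using frame_exists[OF c2, of "norm g2" "g2 /\<^sub>R norm g2"] nz[OF g2] by metis
  define d2 e2 r2 where "d2 = g2 /\<^sub>R norm g2" and "e2 = cross3 g2 g1 /\<^sub>R norm (cross3 g2 g1)" and "r2 = norm g2"
  have F2: "frame d2 e2 q2" using F2 by (simp add: d2_def e2_def)
  have r2: "0 < r2" and G2: "u1 - b = r2 *\<^sub>R d2" using nz[OF g2] by (simp_all add: r2_def d2_def g2_def)
  define u2 where "u2 = coll_map mi mj d2 e2 q2 u1 b 0 (c2 *\<^sub>R d2 + s2 *\<^sub>R e2)"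
  have u2eq: "u2 - b = (r2 * (1 - ?k * c2^2)) *\<^sub>R d2 - (?k * c2 * s2 * r2) *\<^sub>R e2"
    unfolding u2_def by (rule coll_map_base[OF F2 r2 G2 refl])
  define g3 where "g3 = u2 - a"
  have g1e2: "g1 \<bullet> e2 = 0" by (simp add: e2_def dot_cross_self)
  have g3b: "g3 = (u2 - b) - g1" by (simp add: g3_def g1_def)
  have "g3 \<bullet> e2 = - (?k * c2 * s2 * r2)" unfolding g3b u2eq using frameD[OF F2] g1e2 by (simp add: inner_diff_left)
  then have c3: "cross3 g3 g1 \<noteq> 0" using k0 cs r2 g1 g1e2 by (intro crs[of _ e2]) auto
  then have g3: "g3 \<noteq> 0" by auto
  obtain q3 where F3: "frame (g3 /\<^sub>R norm g3) (cross3 g3 g1 /\<^sub>R norm (cross3 g3 g1)) q3"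
    using frame_exists[OF c3, of "norm g3" "g3 /\<^sub>R norm g3"] nz[OF g3] by metis
  define d3 e3 r3 where "d3 = g3 /\<^sub>R norm g3" and "e3 = cross3 g3 g1 /\<^sub>R norm (cross3 g3 g1)" and "r3 = norm g3"
  have F3: "frame d3 e3 q3" using F3 by (simp add: d3_def e3_def)
  have r3: "0 < r3" and G3: "u2 - a = r3 *\<^sub>R d3" using nz[OF g3] by (simp_all add: r3_def d3_def g3_def)
  define u3 where "u3 = coll_map mi mi d3 e3 q3 u2 a 0 (c3 *\<^sub>R d3 + s3 *\<^sub>R e3)"
  have "u3 - a = (r3 * (1 - 2 * mi / (mi + mi) * c3^2)) *\<^sub>R d3 - (2 * mi / (mi + mi) * c3 * s3 * r3) *\<^sub>R e3"
    unfolding u3_def by (rule coll_map_base[OF F3 r3 G3 refl])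
  then have u3eq: "u3 - a = (r3 * (1 - c3\<^sup>2)) *\<^sub>R d3 - (c3 * s3 * r3) *\<^sub>R e3" using m by simp
  have ce: "x \<bullet> cross3 y z = 0" if "x \<bullet> (cross3 y z /\<^sub>R norm (cross3 y z)) = 0" "cross3 y z \<noteq> 0" for x y z
    using that by simp
  have T1: "x = 0" if x: "x \<bullet> (a - b) = 0" "x \<bullet> (u1 - b) = 0" "x \<bullet> (u2 - b) = 0" for x
  proof -
    have "x \<bullet> d2 = 0" using x(2) r2 unfolding G2 by simp
    then have "x \<bullet> e2 = 0" using x(3) k0 cs r2 unfolding u2eq by (simp add: inner_diff_right)
    then have "x \<bullet> cross3 g2 g1 = 0" unfolding e2_def by (rule ce[OF _ c2])
    then show ?thesis using inner_cross_eq_0[of x g2 g1] x c2 by (simp add: g1_def g2_def)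
  qed
  have T2: "x = 0" if x: "x \<bullet> (u2 - a) = 0" "x \<bullet> (u3 - a) = 0" "x \<bullet> (u2 - b) = 0" for x
  proof -
    have "x \<bullet> d3 = 0" using x(1) r3 unfolding G3 by simp
    then have "x \<bullet> e3 = 0" using x(2) cs r3 unfolding u3eq by (simp add: inner_diff_right)
    then have "x \<bullet> cross3 g3 g1 = 0" unfolding e3_def by (rule ce[OF _ c3])
    moreover have "x \<bullet> g3 = 0" using x(1) by (simp add: g3_def)
    moreover have "x \<bullet> g1 = 0" using \<open>x \<bullet> g3 = 0\<close> x(3) unfolding g3b by (simp add: inner_diff_right)
    ultimately show ?thesis using inner_cross_eq_0 c3 by blast
  qed
  show ?thesis
    by (rule that, unfold_locales) (fact m F1 F2 F3 cs r1 r2 r3 u1_def u2_def u3_def G1 G2 G3 T1 T2)+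
qed

definition ang :: "(real \<Rightarrow> real) \<Rightarrow> vec \<Rightarrow> vec \<Rightarrow> real" where
  "ang H d x = indicator {0..} (x \<bullet> d) * H (arccos (x \<bullet> d))"

lemma ang_measurable [measurable]:
  assumes [measurable]: "H \<in> borel_measurable borel"
  shows "ang H d \<in> borel_measurable borel"
  unfolding ang_def[abs_def] by measurable

text \<open>The isometry \<open>turn\<close> is substituted for the direction of impact. Afterwards
  the angular factor depends on \<open>x\<close> alone, no longer on the velocities or the azimuth,
  which have moved into the smooth argument of \<open>K\<close>. The relative speed is at least its
  component along \<open>d\<close>, hence at least \<open>\<beta>\<close>.\<close>

lemma nn_integral_ckern_turn:
  assumes F: "frame d e q" and \<beta>: "0 < \<beta>" "\<beta> \<le> (u - w) \<bullet> d" and \<gamma>: "0 \<le> \<gamma>" and H: "\<And>x. 0 \<le> H x"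
    and [measurable]: "H \<in> borel_measurable borel" "K \<in> borel_measurable borel"
  shows "(SINT x. ennreal (\<beta> powr \<gamma> * ang H d x) * K (turn d e q (u - w) \<phi> x))
    \<le> (SINT n. ennreal (ckern \<gamma> H u w n) * K n)"
proof -
  let ?g = "u - w" and ?T = "turn d e q (u - w) \<phi>"
  have gd: "0 < ?g \<bullet> d" using \<beta> by linarith
  then have g0: "0 < norm ?g" by auto
  have "?g \<bullet> d \<le> norm ?g" using norm_cauchy_schwarz[of ?g d] frameD[OF F] by simp
  then have pw: "\<beta> powr \<gamma> \<le> norm ?g powr \<gamma>" using \<beta> \<gamma> by (intro powr_mono2) auto
  have "(SINT x. ennreal (\<beta> powr \<gamma> * ang H d x) * K (?T x))
    \<le> (SINT x. ennreal (ckern \<gamma> H u w (?T x)) * K (?T x))"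
  proof (intro nn_integral_mono mult_right_mono ennreal_leI)
    fix x
    have t: "(?g /\<^sub>R norm ?g) \<bullet> ?T x = x \<bullet> d" using turn_axis[OF F gd, of \<phi> x] by (simp only: inner_commute)
    have "?g \<bullet> ?T x = norm ?g * ((?g /\<^sub>R norm ?g) \<bullet> ?T x)" using g0 by simp
    then have "?g \<bullet> ?T x = norm ?g * (x \<bullet> d)" by (simp only: t)
    then have "(?g \<bullet> ?T x \<in> {0..}) = (x \<bullet> d \<in> {0..})" using g0 by (simp add: zero_le_mult_iff)
    then have i: "indicator {0..} (?g \<bullet> ?T x) = (indicator {0..} (x \<bullet> d) :: real)" by (simp only: indicator_def)
    have "ckern \<gamma> H u w (?T x) = ang H d x * norm ?g powr \<gamma>"
      unfolding ckern_def coll_kernel_def coll_angle_def ang_def t i by (simp only: mult.assoc)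
    also have "\<dots> \<ge> ang H d x * \<beta> powr \<gamma>" using pw H by (intro mult_left_mono) (auto simp: ang_def)
    finally show "\<beta> powr \<gamma> * ang H d x \<le> ckern \<gamma> H u w (?T x)" by (simp add: mult.commute)
  qed auto
  also have "\<dots> = (SINT n. ennreal (ckern \<gamma> H u w n) * K n)"
    by (rule nn_integral_sphere_orthogonal[OF turn_orthogonal, where F="\<lambda>n. ennreal (ckern \<gamma> H u w n) * K n"]) measurable
  finally show ?thesis .
qed

lemma swap_azimuths:
  fixes G :: "vec \<Rightarrow> vec \<Rightarrow> vec \<Rightarrow> vec \<Rightarrow> ennreal"
  assumes G: "(\<lambda>(\<phi>, x, y, z). G \<phi> x y z) \<in> borel_measurable (borel \<Otimes>\<^sub>M borel \<Otimes>\<^sub>M borel \<Otimes>\<^sub>M borel)"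
  shows "(VINT \<phi>. SINT x. SINT y. SINT z. G \<phi> x y z)
    = (SINT x. SINT y. SINT z. VINT \<phi>. G \<phi> x y z)"
proof -
  note [measurable] = measurable_case_prod4[OF G]
  have "(VINT \<phi>. SINT x. SINT y. SINT z. G \<phi> x y z)
    = (SINT x. VINT \<phi>. SINT y. SINT z. G \<phi> x y z)"
    by (rule lborel_sphere.Fubini'[symmetric]) measurable
  also have "\<dots> = (SINT x. SINT y. VINT \<phi>. SINT z. G \<phi> x y z)"
    by (intro nn_integral_cong lborel_sphere.Fubini'[symmetric]) measurable
  also have "\<dots> = (SINT x. SINT y. SINT z. VINT \<phi>. G \<phi> x y z)"
    by (intro nn_integral_cong lborel_sphere.Fubini'[symmetric]) measurable
  finally show ?thesis .
qed

lemma strict_diff_isCont: "strict_diff f x \<Longrightarrow> isCont f x"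
  unfolding strict_diff_def using strict_deriv_continuous by blast

lemma isCont_tendsto_nhds: "isCont f x \<Longrightarrow> (f \<longlongrightarrow> f x) (nhds x)"
  by (simp add: isCont_def tendsto_at_iff_tendsto_nhds)

context collision_kernels
begin

text \<open>This finds a support point of the angular factor strictly between axis and equator. If
  there were none, countably many balls of zero weight would cover this part of the sphere, by
  Lindelof, and the angular factor would vanish almost everywhere. Isometries carry the point to
  every frame with the same \<open>c\<close> and \<open>s\<close>.\<close>

lemma angular_support:
  assumes ij: "j \<in> {1..N}" "i \<in> {1..N}"
  obtains c s where "0 < c" "0 < s" "c^2 + s^2 = 1"
    "\<And>d e q \<eta>. frame d e q \<Longrightarrow> 0 < \<eta> \<Longrightarrow>
       0 < (SINT x. ennreal (ang (H j i) d x) * indicator (ball (c *\<^sub>R d + s *\<^sub>R e) \<eta>) x)"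
proof -
  define d0 :: vec where "d0 = axis 1 1"
  have d0: "norm d0 = 1" by (simp add: d0_def norm_axis_1)
  define W where "W = {x. norm x = 1 \<and> 0 < x \<bullet> d0 \<and> x \<bullet> d0 < 1}"
  let ?I = "\<lambda>B. (SINT x. ennreal (ang (H j i) d0 x) * indicator B x)"
  have "\<exists>n0\<in>W. \<forall>\<eta>>0. 0 < ?I (ball n0 \<eta>)"
  proof (rule ccontr)
    assume "\<not> ?thesis"
    then have "\<forall>x\<in>W. \<exists>\<eta>>0. ?I (ball x \<eta>) = 0" by (auto simp: not_less)
    then obtain \<eta> where \<eta>: "\<And>x. x \<in> W \<Longrightarrow> 0 < \<eta> x" "\<And>x. x \<in> W \<Longrightarrow> ?I (ball x (\<eta> x)) = 0" by metis
    define \<F> where "\<F> = (\<lambda>x. ball x (\<eta> x)) ` W"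
    obtain \<F>' where F': "\<F>' \<subseteq> \<F>" "countable \<F>'" "\<Union>\<F>' = \<Union>\<F>"
      using Lindelof[of \<F>] by (auto simp: \<F>_def)
    have "AE x in sphere_measure. \<forall>S\<in>\<F>'. ennreal (ang (H j i) d0 x) * indicator S x = 0"
      unfolding AE_ball_countable[OF F'(2)]
    proof
      fix S assume "S \<in> \<F>'"
      then obtain y where y: "y \<in> W" "S = ball y (\<eta> y)" using F'(1) by (auto simp: \<F>_def)
      show "AE x in sphere_measure. ennreal (ang (H j i) d0 x) * indicator S x = 0"
        using \<eta>(2)[OF y(1)] unfolding y(2) by (subst (asm) nn_integral_0_iff_AE) auto
    qed
    then have z: "AE x in sphere_measure. x \<in> W \<longrightarrow> ang (H j i) d0 x = 0"
    proof eventually_elim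
      fix x assume *: "\<forall>S\<in>\<F>'. ennreal (ang (H j i) d0 x) * indicator S x = 0"
      show "x \<in> W \<longrightarrow> ang (H j i) d0 x = 0"
      proof
        assume x: "x \<in> W"
        then have "x \<in> \<Union>\<F>'" unfolding F'(3) \<F>_def using \<eta>(1)[OF x] by (intro UnionI[OF imageI[OF x]]) simp
        then obtain S where "S \<in> \<F>'" "x \<in> S" by blast
        with * have "ennreal (ang (H j i) d0 x) = 0" by fastforce
        moreover have "0 \<le> ang (H j i) d0 x" using H_nonneg[of j i] by (simp add: ang_def)
        ultimately show "ang (H j i) d0 x = 0" by (simp add: ennreal_eq_0_iff)
      qed
    qed
    let ?H = "\<lambda>\<theta>. ennreal (H j i \<theta>) * indicator {0<..<pi/2} \<theta>"
    have "(SINT n. indicator {0..} (d0 \<bullet> n) * ?H (arccos (d0 \<bullet> n))) = (\<integral>\<^sup>+n. 0 \<partial>(sphere_measure :: vec measure))"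
    proof (rule nn_integral_cong_AE, use z AE_sphere_measure_norm in eventually_elim)
      fix n :: vec assume z: "n \<in> W \<longrightarrow> ang (H j i) d0 n = 0" and n: "norm n = 1"
      show "indicator {0..} (d0 \<bullet> n) * ?H (arccos (d0 \<bullet> n)) = 0"
      proof (rule ccontr)
        assume "\<not> ?thesis"
        then have d: "0 \<le> d0 \<bullet> n" and a: "0 < arccos (d0 \<bullet> n)" "arccos (d0 \<bullet> n) < pi/2" and h: "H j i (arccos (d0 \<bullet> n)) \<noteq> 0"
          by (auto simp: indicator_def split: if_splits)
        have "\<bar>d0 \<bullet> n\<bar> \<le> 1" using Cauchy_Schwarz_ineq2[of d0 n] d0 n by simp
        moreover have "d0 \<bullet> n \<noteq> 0" "d0 \<bullet> n \<noteq> 1" using a by auto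
        ultimately have "n \<in> W" using d n by (auto simp: W_def inner_commute)
        then show False using z d h by (simp add: ang_def inner_commute)
      qed
    qed
    then have a0: "angle_mass ?H = 0" by (simp add: angle_mass_def d0_def)
    obtain Y where Y: "0 < Y" and eq: "\<And>H. H \<in> borel_measurable borel \<Longrightarrow>
         angle_mass H = Y * (VINT t. H t * ennreal (sin t) * indicator {0..pi/2} t)"
      using angle_mass_eq by metis
    have "angle_mass ?H = Y * (VINT t. ?H t * ennreal (sin t) * indicator {0..pi/2} t)" by (rule eq) measurable
    then have "(VINT t. ?H t * ennreal (sin t) * indicator {0..pi/2} t) = 0" using Y a0 by auto
    then have "AE t in lborel. ?H t * ennreal (sin t) * indicator {0..pi/2} t = 0"
      by (subst (asm) nn_integral_0_iff_AE) auto
    then have "AE t in lborel. H j i t = 0"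
      using AE_lborel_singleton[of "0::real"] AE_lborel_singleton[of "pi/2"]
    proof eventually_elim
      fix t assume *: "?H t * ennreal (sin t) * indicator {0..pi/2} t = 0" and t: "t \<noteq> 0" "t \<noteq> pi/2"
      show "H j i t = 0"
      proof (cases "t \<in> {0..pi/2}")
        case False
        then show ?thesis by (auto simp: H_def)
      next
        case True
        then have t': "0 < t" "t < pi/2" using t by auto
        then have "0 < sin t" by (intro sin_gt_zero) auto
        then have "ennreal (H j i t) = 0" using * t' True by auto
        then show ?thesis using H_nonneg[of j i t] by (simp add: ennreal_eq_0_iff)
      qed
    qed
    then have "(\<integral>t. H j i t \<partial>lborel) = 0" by (simp cong: integral_cong_AE add: integral_eq_zero_AE)
    then show False using integral_H_pos[OF ij] by simp
  qed
  then obtain n0 where n0: "norm n0 = 1" "0 < n0 \<bullet> d0" "n0 \<bullet> d0 < 1" and supp: "\<And>\<eta>. 0 < \<eta> \<Longrightarrow> 0 < ?I (ball n0 \<eta>)"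
    by (auto simp: W_def)
  define c v s where "c = n0 \<bullet> d0" and "v = n0 - (n0 \<bullet> d0) *\<^sub>R d0" and "s = norm v"
  have dd: "d0 \<bullet> d0 = 1" "n0 \<bullet> n0 = 1" using d0 n0 by (simp_all add: dot_square_norm)
  have s2: "s^2 = 1 - c\<^sup>2"
    unfolding s_def power2_norm_eq_inner v_def c_def
    using dd by (simp add: inner_diff_left inner_diff_right inner_commute[of d0 n0] power2_eq_square)
  have "c^2 < 1" using n0 by (simp add: c_def power_less_one_iff)
  then have "s \<noteq> 0" using s2 by auto
  then have s: "0 < s" by (simp add: s_def)
  show ?thesis
  proof (rule that[of c s])
    show "0 < c" "0 < s" "c^2 + s^2 = 1" using n0 s s2 by (simp_all add: c_def)
    fix d e q :: vec and \<eta> :: real assume F: "frame d e q" and \<eta>: "0 < \<eta>"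
    note D = frameD[OF F]
    define e0 where "e0 = v /\<^sub>R s"
    have "norm e0 = 1" using s unfolding e0_def by (simp add: s_def)
    then have e0: "norm e0 = 1" "d0 \<bullet> e0 = 0" "n0 = c *\<^sub>R d0 + s *\<^sub>R e0"
      using s dd by (simp, simp_all add: e0_def c_def v_def inner_diff_right inner_commute[of d0 n0])
    \<comment> \<open>The first mirror takes \<open>d0\<close> to \<open>d\<close>; the second fixes
      \<open>d\<close> and takes the image of \<open>e0\<close> to \<open>e\<close>.\<close>
    define f where "f = mirror (mirror (d0 - d) e0 - e) \<circ> mirror (d0 - d)"
    have f: "orthogonal_transformation f" unfolding f_def by (intro orthogonal_transformation_compose mirror_orthogonal)
    have md: "mirror (d0 - d) d0 = d" using d0 D by (intro mirror_swap) simp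
    have ne: "norm (mirror (d0 - d) e0) = norm e" using orthogonal_transformation_norm[OF mirror_orthogonal] e0 D by simp
    have "mirror (d0 - d) d0 \<bullet> mirror (d0 - d) e0 = d0 \<bullet> e0"
      using mirror_orthogonal[of "d0 - d"] unfolding orthogonal_transformation_def by blast
    then have "d \<bullet> mirror (d0 - d) e0 = d0 \<bullet> e0" unfolding md .
    then have fd: "f d0 = d" unfolding f_def o_def md using e0 D by (intro mirror_perp) (simp add: inner_diff_right)
    have fe: "f e0 = e" unfolding f_def o_def by (rule mirror_swap[OF ne])
    have fn: "f n0 = c *\<^sub>R d + s *\<^sub>R e"
      unfolding e0(3) by (simp add: linear_add[OF orthogonal_transformation_linear[OF f]] linear_cmul[OF orthogonal_transformation_linear[OF f]] fd fe)
    have fi: "f x \<bullet> d = x \<bullet> d0" for x unfolding fd[symmetric] using f by (simp add: orthogonal_transformation_def)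
    have fb: "(f x \<in> ball (f n0) \<eta>) = (x \<in> ball n0 \<eta>)" for x
      using orthogonal_transformation_norm[OF f, of "n0 - x"]
      by (simp add: dist_norm linear_diff[OF orthogonal_transformation_linear[OF f]])
    have "(SINT x. ennreal (ang (H j i) d x) * indicator (ball (f n0) \<eta>) x)
      = (SINT x. ennreal (ang (H j i) d (f x)) * indicator (ball (f n0) \<eta>) (f x))"
      by (rule nn_integral_sphere_orthogonal[OF f, symmetric]) measurable
    also have "\<dots> = ?I (ball n0 \<eta>)" unfolding ang_def fi indicator_def[of "ball (f n0) \<eta>"] indicator_def[of "ball n0 \<eta>"] fb ..
    finally show "0 < (SINT x. ennreal (ang (H j i) d x) * indicator (ball (c *\<^sub>R d + s *\<^sub>R e) \<eta>) x)"
      using supp[OF \<eta>] unfolding fn by simp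
  qed
qed

text \<open>The kernel of the threefold gain: the weight with which a particle of velocity
  \<open>u\<close> ends in \<open>B\<close> after meeting \<open>w1\<close> and \<open>w2\<close> of
  species \<open>j\<close> and \<open>w3\<close> of its own.\<close>

definition chain :: "nat \<Rightarrow> nat \<Rightarrow> vec \<Rightarrow> vec \<Rightarrow> vec \<Rightarrow> vec \<Rightarrow> vec set \<Rightarrow> ennreal" where
  "chain i j u w1 w2 w3 B = (SINT n1. ennreal (ckern \<gamma> (H j i) u w1 n1) *
     (SINT n2. ennreal (ckern \<gamma> (H j i) (post_vel (m i) (m j) u w1 n1) w2 n2) *
       (SINT n3. ennreal (ckern \<gamma> (H i i) (post_vel (m i) (m j) (post_vel (m i) (m j) u w1 n1) w2 n2) w3 n3) *
          indicator B (post_vel (m i) (m i) (post_vel (m i) (m j) (post_vel (m i) (m j) u w1 n1) w2 n2) w3 n3))))"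

text \<open>For every fixed azimuth vector \<open>\<phi>\<close> the chain dominates an integral
  over the reference directions alone, so it also dominates the average over \<open>\<phi>\<close>.
  For fixed reference directions near the base ones, \<open>strict_deriv_open_map\<close> finds a
  ball of azimuths, of comparable radius, that is sent into the target ball. Fubini combines the
  two.\<close>

lemma smoothing:
  assumes ij: "i \<in> {1..N}" "j \<in> {1..N}" and ab: "a \<noteq> b"
  shows "\<exists>\<eta> \<rho> c y. 0 < \<eta> \<and> 0 < \<rho> \<and> 0 < c \<and>
    (\<forall>u w1 w2 w3 z s. u \<in> ball a \<eta> \<longrightarrow> w1 \<in> ball b \<eta> \<longrightarrow> w2 \<in> ball b \<eta> \<longrightarrow> w3 \<in> ball a \<eta> \<longrightarrow> 0 < s \<longrightarrow> ball z s \<subseteq> ball y \<rho> \<longrightarrow>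
       ennreal c * emeasure lborel (ball z s) \<le> chain i j u w1 w2 w3 (ball z s))"
proof -
  have mi: "0 < m i" and mj: "0 < m j" using mass_pos ij by auto
  obtain c1 s1 where S1: "0 < c1" "0 < s1" "c1^2 + s1^2 = 1"
    "\<And>d e q \<eta>. frame d e q \<Longrightarrow> 0 < \<eta> \<Longrightarrow>
       0 < (SINT x. ennreal (ang (H j i) d x) * indicator (ball (c1 *\<^sub>R d + s1 *\<^sub>R e) \<eta>) x)"
    by (rule angular_support[OF ij(2,1)]) (rule that)
  obtain c3 s3 where S3: "0 < c3" "0 < s3" "c3^2 + s3^2 = 1"
    "\<And>d e q \<eta>. frame d e q \<Longrightarrow> 0 < \<eta> \<Longrightarrow>
       0 < (SINT x. ennreal (ang (H i i) d x) * indicator (ball (c3 *\<^sub>R d + s3 *\<^sub>R e) \<eta>) x)"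
    by (rule angular_support[OF ij(1,1)]) (rule that)
  obtain d1 e1 q1 d2 e2 q2 d3 e3 q3 r1 r2 r3 u1 u2 u3 where
    C: "collision_chain (m i) (m j) d1 e1 q1 d2 e2 q2 d3 e3 q3 c1 s1 c1 s1 c3 s3 r1 r2 r3 a b u1 u2 u3"
    by (rule collision_chain_exists[OF ab mi mj S1(1,2) S1(1,2) S3(1,2) S1(3) S1(3) S3(3)]) (rule that)
  interpret C: collision_chain "m i" "m j" d1 e1 q1 d2 e2 q2 d3 e3 q3 c1 s1 c1 s1 c3 s3 r1 r2 r3 a b u1 u2 u3
    by (rule C)
  \<comment> \<open>Half of the axial relative speeds of the base chain, a margin that survives
    small perturbations of all parameters.\<close>
  define \<beta>1 \<beta>2 \<beta>3 where "\<beta>1 = r1 / 2" and "\<beta>2 = r2 / 2" and "\<beta>3 = r3 / 2"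
  have \<beta>: "0 < \<beta>1" "0 < \<beta>2" "0 < \<beta>3" using C.r by (simp_all add: \<beta>1_def \<beta>2_def \<beta>3_def)
  have dd: "d1 \<bullet> d1 = 1" "d2 \<bullet> d2 = 1" "d3 \<bullet> d3 = 1"
    using frameD(10)[OF C.frames(1)] frameD(10)[OF C.frames(2)] frameD(10)[OF C.frames(3)] .
  let ?D1 = "\<lambda>z::params \<times> vec. (fst (fst (fst (fst z))) - snd (fst (fst (fst z)))) \<bullet> d1"
  let ?D2 = "\<lambda>z. (C.V1 z - fst (snd (fst (fst z)))) \<bullet> d2"
  let ?D3 = "\<lambda>z. (C.V2 z - snd (snd (fst (fst z)))) \<bullet> d3"
  have ct: "isCont ?D1 (C.l0, 0)" "isCont ?D2 (C.l0, 0)" "isCont ?D3 (C.l0, 0)"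
    by (intro continuous_intros strict_diff_isCont C.sd_components C.sd_V)+
  have gt: "\<beta>1 < ?D1 (C.l0, 0)" "\<beta>2 < ?D2 (C.l0, 0)" "\<beta>3 < ?D3 (C.l0, 0)"
    unfolding C.base using C.r by (simp_all add: C.l0_def \<beta>1_def \<beta>2_def \<beta>3_def C.g dd)
  have "\<forall>\<^sub>F z in nhds (C.l0, 0). \<beta>1 < ?D1 z \<and> \<beta>2 < ?D2 z \<and> \<beta>3 < ?D3 z"
    by (intro eventually_conj order_tendstoD(1)[OF isCont_tendsto_nhds[OF ct(1)] gt(1)]
        order_tendstoD(1)[OF isCont_tendsto_nhds[OF ct(2)] gt(2)] order_tendstoD(1)[OF isCont_tendsto_nhds[OF ct(3)] gt(3)])
  then obtain \<epsilon> where \<epsilon>: "0 < \<epsilon>" "\<And>z. z \<in> ball (C.l0, 0) \<epsilon> \<Longrightarrow> \<beta>1 < ?D1 z \<and> \<beta>2 < ?D2 z \<and> \<beta>3 < ?D3 z"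
    unfolding eventually_nhds_metric by (auto simp: dist_commute)
  obtain L where L: "strict_deriv C.V3 L (C.l0, 0)" using C.sd_V(3) unfolding strict_diff_def by blast
  obtain \<eta>1 \<rho> K r where O: "0 < \<eta>1" "\<eta>1 \<le> \<epsilon> / 2" "0 < \<rho>" "0 < K" "0 < r" "r \<le> \<epsilon> / 2"
    "\<And>l z s. l \<in> ball C.l0 \<eta>1 \<Longrightarrow> 0 < s \<Longrightarrow> ball z s \<subseteq> ball (C.V3 (C.l0, 0)) \<rho> \<Longrightarrow>
       \<exists>\<psi>. ball \<psi> (s / K) \<subseteq> ball 0 r \<and> (\<forall>\<phi>\<in>ball \<psi> (s / K). C.V3 (l, \<phi>) \<in> ball z s)"
    by (rule strict_deriv_open_map[OF L, of "\<epsilon> / 2"], erule C.deriv_injective[OF L], use \<epsilon>(1) in simp, rule that)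
  \<comment> \<open>The parameters have seven components; if each is within \<open>\<eta>\<close>,
    the whole is within \<open>\<eta>1\<close>.\<close>
  define \<eta> where "\<eta> = \<eta>1 / 8"
  have \<eta>: "0 < \<eta>" using O by (simp add: \<eta>_def)
  define k1 k2 k3 where "k1 = (\<lambda>x. ennreal (\<beta>1 powr \<gamma> * ang (H j i) d1 x) * indicator (ball C.n1 \<eta>) x)"
    and "k2 = (\<lambda>x. ennreal (\<beta>2 powr \<gamma> * ang (H j i) d2 x) * indicator (ball C.n2 \<eta>) x)"
    and "k3 = (\<lambda>x. ennreal (\<beta>3 powr \<gamma> * ang (H i i) d3 x) * indicator (ball C.n3 \<eta>) x)"
  have km [measurable]: "k1 \<in> borel_measurable borel" "k2 \<in> borel_measurable borel" "k3 \<in> borel_measurable borel"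
    unfolding k1_def k2_def k3_def by measurable
  define A where "A = (SINT x. k1 x) * ((SINT x. k2 x) * (SINT x. k3 x))"
  have kpos: "0 < (SINT x. ennreal (\<beta> powr \<gamma> * ang (H j' i) d x) * indicator (ball n \<eta>) x)"
    if "0 < \<beta>" "0 < (SINT x. ennreal (ang (H j' i) d x) * indicator (ball n \<eta>) x)" for \<beta> j' d n
  proof -
    have "ennreal (\<beta> powr \<gamma> * ang (H j' i) d x) = ennreal (\<beta> powr \<gamma>) * ennreal (ang (H j' i) d x)" for x
      using H_nonneg[of j' i] by (intro ennreal_mult) (auto simp: ang_def)
    then have "(SINT x. ennreal (\<beta> powr \<gamma> * ang (H j' i) d x) * indicator (ball n \<eta>) x)
      = ennreal (\<beta> powr \<gamma>) * (SINT x. ennreal (ang (H j' i) d x) * indicator (ball n \<eta>) x)"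
      by (simp add: mult.assoc nn_integral_cmult)
    then show ?thesis using that by (simp add: ennreal_zero_less_mult_iff)
  qed
  have A0: "0 < A"
    unfolding A_def ennreal_zero_less_mult_iff k1_def k2_def k3_def
    by (intro conjI kpos \<beta> S1(4)[OF C.frames(1) \<eta>] S1(4)[OF C.frames(2) \<eta>] S3(4)[OF C.frames(3) \<eta>])
  define br where "br = emeasure lborel (ball (0::vec) r)"
  \<comment> \<open>Chosen to satisfy \<open>c * br \<le> A / K^3\<close>: \<open>A\<close> is the
    weight of the reference directions, \<open>K^3\<close> the volume distortion and
    \<open>br\<close> the volume of azimuths averaged over. The minimum with 1 makes
    \<open>c\<close> finite.\<close>
  define c where "c = enn2real (min 1 (A * ennreal ((1 / K) ^ 3) / br))"
  have br: "0 < br" "br < \<infinity>" using O(5) by (simp_all add: br_def emeasure_ball emeasure_lborel_ball_finite)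
  have "0 < A * ennreal ((1 / K) ^ 3) / br"
    using A0 br O(4) by (simp add: ennreal_zero_less_mult_iff ennreal_zero_less_divide)
  then have c0: "0 < c" by (auto simp: c_def enn2real_positive_iff min_less_iff_disj)
  have cle: "ennreal c * br \<le> A * ennreal ((1 / K) ^ 3)"
  proof -
    have "ennreal c = min 1 (A * ennreal ((1 / K) ^ 3) / br)"
      unfolding c_def by (intro ennreal_enn2real) (simp add: min_less_iff_disj)
    then have "ennreal c * br \<le> (A * ennreal ((1 / K) ^ 3) / br) * br" by (intro mult_right_mono) auto
    also have "\<dots> = A * ennreal ((1 / K) ^ 3)" using br by (simp add: ennreal_divide_times ennreal_mult_divide_eq)
    finally show ?thesis .
  qed
  have main: "ennreal c * emeasure lborel (ball z s) \<le> chain i j u w1 w2 w3 (ball z s)"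
    if u: "u \<in> ball a \<eta>" and w1: "w1 \<in> ball b \<eta>" and w2: "w2 \<in> ball b \<eta>" and w3: "w3 \<in> ball a \<eta>" and s: "0 < s"
      and zs: "ball z s \<subseteq> ball (C.V3 (C.l0, 0)) \<rho>" for u w1 w2 w3 z s
  proof -
    let ?P = "post_vel (m i) (m j)" and ?Q = "post_vel (m i) (m i)"
    define l where "l = (\<lambda>x1 x2 x3. (((u, w1), (w2, w3)), (x1, x2, x3)) :: params)"
    define v1 where "v1 = (\<lambda>(\<phi> :: vec) x1. coll_map (m i) (m j) d1 e1 q1 u w1 (\<phi> $ 1) x1)"
    define v2 where "v2 = (\<lambda>(\<phi> :: vec) x1 x2. coll_map (m i) (m j) d2 e2 q2 (v1 \<phi> x1) w2 (\<phi> $ 2) x2)"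
    define v3 where "v3 = (\<lambda>(\<phi> :: vec) x1 x2 x3. coll_map (m i) (m i) d3 e3 q3 (v2 \<phi> x1 x2) w3 (\<phi> $ 3) x3)"
    have V: "C.V1 (l x1 x2 x3, \<phi>) = v1 \<phi> x1" "C.V2 (l x1 x2 x3, \<phi>) = v2 \<phi> x1 x2" "C.V3 (l x1 x2 x3, \<phi>) = v3 \<phi> x1 x2 x3" for x1 x2 x3 \<phi>
      by (simp_all add: l_def v1_def v2_def v3_def C.V1_def C.V2_def C.V3_def)
    have lb: "l x1 x2 x3 \<in> ball C.l0 \<eta>1" if "x1 \<in> ball C.n1 \<eta>" "x2 \<in> ball C.n2 \<eta>" "x3 \<in> ball C.n3 \<eta>" for x1 x2 x3
    proof -
      have P: "dist (x, y) (x', y') \<le> dist x x' + dist y y'" for x x' :: "'x::real_normed_vector" and y y' :: "'y::real_normed_vector"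
        using norm_Pair_le[of "x - x'" "y - y'"] by (simp add: dist_norm)
      have "dist C.l0 (l x1 x2 x3) \<le> ((dist a u + dist b w1) + (dist b w2 + dist a w3)) + (dist C.n1 x1 + (dist C.n2 x2 + dist C.n3 x3))"
        unfolding C.l0_def l_def by (intro order_trans[OF P] add_mono P order_refl)
      also have "\<dots> < 8 * \<eta>" using u w1 w2 w3 that \<eta> unfolding mem_ball by linarith
      finally show ?thesis by (simp add: \<eta>_def)
    qed
    have zb: "(l x1 x2 x3, \<phi>) \<in> ball (C.l0, 0) \<epsilon>"
      if "x1 \<in> ball C.n1 \<eta>" "x2 \<in> ball C.n2 \<eta>" "x3 \<in> ball C.n3 \<eta>" "\<phi> \<in> ball 0 r" for x1 x2 x3 and \<phi> :: vec
    proof -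
      have "dist (C.l0, 0) (l x1 x2 x3, \<phi>) \<le> dist C.l0 (l x1 x2 x3) + dist 0 \<phi>"
        using norm_Pair_le[of "C.l0 - l x1 x2 x3" "0 - \<phi>"] by (simp add: dist_norm)
      also have "\<dots> < \<epsilon> / 2 + \<epsilon> / 2" using lb[OF that(1-3)] that(4) O(2,6) by (intro add_strict_mono) auto
      finally show ?thesis by simp
    qed
    have cn: "C.n1 \<in> ball C.n1 \<eta>" "C.n2 \<in> ball C.n2 \<eta>" "C.n3 \<in> ball C.n3 \<eta>" using \<eta> by auto
    have D1: "\<beta>1 \<le> (u - w1) \<bullet> d1"
      using \<epsilon>(2)[OF zb[OF cn, of 0]] O(5) by (simp add: l_def)
    have D2: "\<beta>2 \<le> (v1 \<phi> x1 - w2) \<bullet> d2" if "x1 \<in> ball C.n1 \<eta>" "\<phi> \<in> ball 0 r" for x1 \<phi>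
      using \<epsilon>(2)[OF zb[OF that(1) cn(2,3) that(2)]] unfolding V by (simp add: l_def)
    have D3: "\<beta>3 \<le> (v2 \<phi> x1 x2 - w3) \<bullet> d3" if "x1 \<in> ball C.n1 \<eta>" "x2 \<in> ball C.n2 \<eta>" "\<phi> \<in> ball 0 r" for x1 x2 \<phi>
      using \<epsilon>(2)[OF zb[OF that(1,2) cn(3) that(3)]] unfolding V by (simp add: l_def)
    define B where "B = ball z s"
    have [measurable]: "B \<in> sets borel" by (simp add: B_def)
    define I3 where "I3 = (\<lambda>v. (SINT n. ennreal (ckern \<gamma> (H i i) v w3 n) * indicator B (?Q v w3 n)))"
    define I2 where "I2 = (\<lambda>v. (SINT n. ennreal (ckern \<gamma> (H j i) v w2 n) * I3 (?P v w2 n)))"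
    have [measurable]: "I3 \<in> borel_measurable borel" unfolding I3_def by measurable
    have [measurable]: "I2 \<in> borel_measurable borel" unfolding I2_def by measurable
    have ch: "chain i j u w1 w2 w3 B = (SINT n. ennreal (ckern \<gamma> (H j i) u w1 n) * I2 (?P u w1 n))"
      by (simp add: chain_def I2_def I3_def)
    have st3: "(SINT x3. k3 x3 * indicator B (v3 \<phi> x1 x2 x3)) \<le> I3 (v2 \<phi> x1 x2)"
      if "x1 \<in> ball C.n1 \<eta>" "x2 \<in> ball C.n2 \<eta>" "\<phi> \<in> ball 0 r" for \<phi> x1 x2
    proof -
      have "(SINT x3. k3 x3 * indicator B (v3 \<phi> x1 x2 x3))
        \<le> (SINT x3. ennreal (\<beta>3 powr \<gamma> * ang (H i i) d3 x3) * indicator B (?Q (v2 \<phi> x1 x2) w3 (turn d3 e3 q3 (v2 \<phi> x1 x2 - w3) (\<phi> $ 3) x3)))"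
        unfolding k3_def v3_def coll_map_def by (intro nn_integral_mono) (auto simp: indicator_def)
      also have "\<dots> \<le> I3 (v2 \<phi> x1 x2)"
        unfolding I3_def by (rule nn_integral_ckern_turn[OF C.frames(3) \<beta>(3) D3[OF that] gamma(1) H_nonneg]) measurable
      finally show ?thesis .
    qed
    have st2: "(SINT x2. k2 x2 * (SINT x3. k3 x3 * indicator B (v3 \<phi> x1 x2 x3))) \<le> I2 (v1 \<phi> x1)"
      if "x1 \<in> ball C.n1 \<eta>" "\<phi> \<in> ball 0 r" for \<phi> x1
    proof -
      have "(SINT x2. k2 x2 * (SINT x3. k3 x3 * indicator B (v3 \<phi> x1 x2 x3)))
        \<le> (SINT x2. ennreal (\<beta>2 powr \<gamma> * ang (H j i) d2 x2) * I3 (?P (v1 \<phi> x1) w2 (turn d2 e2 q2 (v1 \<phi> x1 - w2) (\<phi> $ 2) x2)))"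
      proof (rule nn_integral_mono)
        fix x2
        show "k2 x2 * (SINT x3. k3 x3 * indicator B (v3 \<phi> x1 x2 x3))
          \<le> ennreal (\<beta>2 powr \<gamma> * ang (H j i) d2 x2) * I3 (?P (v1 \<phi> x1) w2 (turn d2 e2 q2 (v1 \<phi> x1 - w2) (\<phi> $ 2) x2))"
        proof (cases "x2 \<in> ball C.n2 \<eta>")
          case True
          then show ?thesis using st3[OF that(1) True that(2)]
            by (simp only: k2_def v2_def coll_map_def indicator_simps mult_1_right) (rule mult_left_mono, auto)
        qed (simp add: k2_def)
      qed
      also have "\<dots> \<le> I2 (v1 \<phi> x1)"
        unfolding I2_def by (rule nn_integral_ckern_turn[OF C.frames(2) \<beta>(2) D2[OF that] gamma(1) H_nonneg]) measurable
      finally show ?thesis .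
    qed
    have st1: "(SINT x1. k1 x1 * (SINT x2. k2 x2 * (SINT x3. k3 x3 * indicator B (v3 \<phi> x1 x2 x3)))) \<le> chain i j u w1 w2 w3 B"
      if "\<phi> \<in> ball 0 r" for \<phi>
    proof -
      have "(SINT x1. k1 x1 * (SINT x2. k2 x2 * (SINT x3. k3 x3 * indicator B (v3 \<phi> x1 x2 x3))))
        \<le> (SINT x1. ennreal (\<beta>1 powr \<gamma> * ang (H j i) d1 x1) * I2 (?P u w1 (turn d1 e1 q1 (u - w1) (\<phi> $ 1) x1)))"
      proof (rule nn_integral_mono)
        fix x1
        show "k1 x1 * (SINT x2. k2 x2 * (SINT x3. k3 x3 * indicator B (v3 \<phi> x1 x2 x3)))
          \<le> ennreal (\<beta>1 powr \<gamma> * ang (H j i) d1 x1) * I2 (?P u w1 (turn d1 e1 q1 (u - w1) (\<phi> $ 1) x1))"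
        proof (cases "x1 \<in> ball C.n1 \<eta>")
          case True
          then show ?thesis using st2[OF True that]
            by (simp only: k1_def v1_def coll_map_def indicator_simps mult_1_right) (rule mult_left_mono, auto)
        qed (simp add: k1_def)
      qed
      also have "\<dots> \<le> chain i j u w1 w2 w3 B"
        unfolding ch by (rule nn_integral_ckern_turn[OF C.frames(1) \<beta>(1) D1 gamma(1) H_nonneg]) measurable
      finally show ?thesis .
    qed
    have [measurable]: "(\<lambda>v :: vec. v $ k) \<in> borel_measurable borel" for k
      by (intro borel_measurable_continuous_onI continuous_intros)
    have v3m: "(\<lambda>(\<phi>, x1, x2, x3). v3 \<phi> x1 x2 x3) \<in> borel_measurable (borel \<Otimes>\<^sub>M borel \<Otimes>\<^sub>M borel \<Otimes>\<^sub>M borel)"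
      unfolding v3_def v2_def v1_def by measurable
    note [measurable] = measurable_case_prod4[OF v3m]
    define G where "G = (\<lambda>\<phi> x1 x2 x3. k1 x1 * (k2 x2 * (k3 x3 * (indicator B (v3 \<phi> x1 x2 x3) * indicator (ball 0 r) \<phi>))))"
    have Gm: "(\<lambda>(\<phi>, x1, x2, x3). G \<phi> x1 x2 x3) \<in> borel_measurable (borel \<Otimes>\<^sub>M borel \<Otimes>\<^sub>M borel \<Otimes>\<^sub>M borel)"
      unfolding G_def by measurable
    \<comment> \<open>For fixed reference directions the azimuths that hit the target fill a ball of
      radius \<open>s / K\<close>; away from the base directions the weights vanish.\<close>
    have low: "k1 x1 * (k2 x2 * (k3 x3 * emeasure lborel (ball (0::vec) (s / K)))) \<le> (VINT \<phi>. G \<phi> x1 x2 x3)" for x1 x2 x3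
    proof (cases "x1 \<in> ball C.n1 \<eta> \<and> x2 \<in> ball C.n2 \<eta> \<and> x3 \<in> ball C.n3 \<eta>")
      case True
      then obtain \<psi> where \<psi>: "ball \<psi> (s / K) \<subseteq> ball 0 r" "\<And>\<phi>. \<phi> \<in> ball \<psi> (s / K) \<Longrightarrow> v3 \<phi> x1 x2 x3 \<in> B"
        using O(7)[OF lb s zs, of x1 x2 x3] unfolding V B_def by blast
      have "emeasure lborel (ball (0::vec) (s / K)) = emeasure lborel (ball \<psi> (s / K))"
        using s O(4) by (simp add: emeasure_ball)
      also have "\<dots> = (VINT \<phi>. indicator (ball \<psi> (s / K)) \<phi>)" by simp
      also have "\<dots> \<le> (VINT \<phi>. indicator B (v3 \<phi> x1 x2 x3) * indicator (ball 0 r) \<phi>)"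
        using \<psi> by (intro nn_integral_mono) (auto simp: indicator_def)
      finally have "k1 x1 * (k2 x2 * (k3 x3 * emeasure lborel (ball (0::vec) (s / K))))
        \<le> k1 x1 * (k2 x2 * (k3 x3 * (VINT \<phi>. indicator B (v3 \<phi> x1 x2 x3) * indicator (ball 0 r) \<phi>)))"
        by (intro mult_left_mono) auto
      also have "\<dots> = (VINT \<phi>. G \<phi> x1 x2 x3)" unfolding G_def by (simp add: nn_integral_cmult)
      finally show ?thesis .
    qed (auto simp: k1_def k2_def k3_def)
    have "A * emeasure lborel (ball (0::vec) (s / K))
      = (SINT x1. SINT x2. SINT x3. k1 x1 * (k2 x2 * (k3 x3 * emeasure lborel (ball (0::vec) (s / K)))))"
      unfolding A_def by (simp add: nn_integral_cmult nn_integral_multc mult.assoc)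
    also have "\<dots> \<le> (SINT x1. SINT x2. SINT x3. VINT \<phi>. G \<phi> x1 x2 x3)"
      by (intro nn_integral_mono low)
    also have "\<dots> = (VINT \<phi>. SINT x1. SINT x2. SINT x3. G \<phi> x1 x2 x3)"
      by (rule swap_azimuths[OF Gm, symmetric])
    also have "\<dots> \<le> (\<integral>\<^sup>+\<phi>. chain i j u w1 w2 w3 B * indicator (ball 0 r) \<phi> \<partial>(lborel :: vec measure))"
    proof (rule nn_integral_mono)
      fix \<phi> :: vec
      show "(SINT x1. SINT x2. SINT x3. G \<phi> x1 x2 x3) \<le> chain i j u w1 w2 w3 B * indicator (ball 0 r) \<phi>"
      proof (cases "\<phi> \<in> ball 0 r")
        case True
        have "(SINT x1. SINT x2. SINT x3. G \<phi> x1 x2 x3)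
          = (SINT x1. k1 x1 * (SINT x2. k2 x2 * (SINT x3. k3 x3 * indicator B (v3 \<phi> x1 x2 x3))))"
          unfolding G_def indicator_simps(1)[OF True] mult_1_right by (simp add: nn_integral_cmult)
        then show ?thesis using st1[OF True] True by simp
      qed (simp add: G_def)
    qed
    also have "\<dots> = chain i j u w1 w2 w3 B * br" unfolding br_def by (simp add: nn_integral_cmult)
    finally have fin: "A * emeasure lborel (ball (0::vec) (s / K)) \<le> chain i j u w1 w2 w3 B * br" .
    have "emeasure lborel (ball (0::vec) (s / K)) = ennreal ((1 / K) ^ 3) * emeasure lborel B"
      using s O(4) by (simp add: B_def emeasure_ball ennreal_mult[symmetric] power_divide mult_ac)
    then have "(ennreal c * br) * emeasure lborel B \<le> chain i j u w1 w2 w3 B * br"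
      using mult_right_mono[OF cle, of "emeasure lborel B"] fin by (simp add: mult.assoc)
    then have "br * (ennreal c * emeasure lborel B) \<le> br * chain i j u w1 w2 w3 B"
      by (simp add: mult_ac)
    then show ?thesis using br unfolding B_def by (simp add: ennreal_mult_le_mult_iff)
  qed
  show ?thesis
    by (rule exI[of _ \<eta>], rule exI[of _ \<rho>], rule exI[of _ c], rule exI[of _ "C.V3 (C.l0, 0)"])
       (use \<eta> O(3) c0 main in blast)
qed

end

section \<open>The lower bound\<close>

lemma cball_pred_measurable [measurable]: "Measurable.pred borel (\<lambda>x::vec. x \<in> cball c r)"
  unfolding mem_cball by measurable

text \<open>A collision moves a velocity by at most twice the relative speed, so cutting the gain to
  the ball of radius \<open>R'\<close> loses nothing. The cut is made because the damping in the
  Duhamel formula is uniform only on bounded sets.\<close>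

lemma nn_integral_gain_cball:
  assumes m: "0 < mi" "0 < mj" and H: "\<And>x. 0 \<le> H x" and [measurable]: "H \<in> borel_measurable borel"
    and [measurable]: "fi \<in> borel_measurable borel" "fj \<in> borel_measurable borel" "X \<in> borel_measurable borel"
    and s: "\<And>v. R < norm v \<Longrightarrow> fi v = 0" "\<And>v. R1 < norm v \<Longrightarrow> fj v = 0" and R: "R + 2 * (R + R1) \<le> R'"
  shows "(VINT v. X v * (indicator (cball 0 R') v * gain \<gamma> H mj mi fj fi v))
    = (VINT v. fi v * (VINT w. fj w * (SINT n. ennreal (ckern \<gamma> H v w n) * X (post_vel mi mj v w n))))"
proof -
  let ?P = "post_vel mi mj"
  have "(VINT v. X v * (indicator (cball 0 R') v * gain \<gamma> H mj mi fj fi v))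
    = (VINT v. (X v * indicator (cball 0 R') v) * gain \<gamma> H mj mi fj fi v)" by (simp only: mult.assoc)
  also have "\<dots> = (VINT v. VINT w. SINT n. ennreal (ckern \<gamma> H v w n) * (fi v * fj w * (X (?P v w n) * indicator (cball 0 R') (?P v w n))))"
    by (rule nn_integral_gain[OF m H]) measurable
  also have "\<dots> = (VINT v. VINT w. SINT n. fi v * (fj w * (ennreal (ckern \<gamma> H v w n) * X (?P v w n))))"
  proof (rule nn_integral_cong, rule nn_integral_cong, rule nn_integral_cong_AE, use AE_sphere_measure_norm in eventually_elim)
    fix v w n :: vec assume n: "norm n = 1"
    show "ennreal (ckern \<gamma> H v w n) * (fi v * fj w * (X (?P v w n) * indicator (cball 0 R') (?P v w n))) = fi v * (fj w * (ennreal (ckern \<gamma> H v w n) * X (?P v w n)))"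
    proof (cases "norm v \<le> R \<and> norm w \<le> R1")
      case True
      have "norm (?P v w n) \<le> norm v + norm (?P v w n - v)" using norm_triangle_ineq[of v "?P v w n - v"] by simp
      also have "\<dots> \<le> norm v + 2 * (norm v + norm w)"
        using norm_post_vel_le(1)[OF m n, of v w] norm_triangle_ineq4[of v w] by simp
      also have "\<dots> \<le> R'" using True R by simp
      finally have "?P v w n \<in> cball 0 R'" by simp
      then show ?thesis by (simp only: indicator_simps mult_1_right) (simp only: mult_ac)
    next
      case False
      then have "fi v = 0 \<or> fj w = 0" using s[of v] s[of w] by force
      then show ?thesis by auto
    qed
  qed
  also have "\<dots> = (VINT v. fi v * (VINT w. fj w * (SINT n. ennreal (ckern \<gamma> H v w n) * X (post_vel mi mj v w n))))"
    by (simp add: nn_integral_cmult)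
  finally show ?thesis .
qed

lemma nn_integral_pull:
  fixes I :: "vec \<Rightarrow> vec \<Rightarrow> ennreal"
  assumes [measurable]: "k \<in> borel_measurable borel" "G \<in> borel_measurable borel"
    and I: "(\<lambda>(n, w). I n w) \<in> borel_measurable (borel \<Otimes>\<^sub>M borel)"
  shows "(SINT n. k n * (VINT w. G w * I n w)) = (VINT w. G w * (SINT n. k n * I n w))"
proof -
  have [measurable]: "(\<lambda>x. I (f x) (g x)) \<in> borel_measurable M" if [measurable]: "f \<in> borel_measurable M" "g \<in> borel_measurable M" for f g M
    using measurable_compose[OF _ I, of "\<lambda>x. (f x, g x)" M] by simp
  have "(SINT n. k n * (VINT w. G w * I n w)) = (SINT n. VINT w. G w * (k n * I n w))"
    by (simp add: nn_integral_cmult[symmetric] mult.left_commute)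
  also have "\<dots> = (VINT w. SINT n. G w * (k n * I n w))"
    by (rule lborel_sphere.Fubini') measurable
  also have "\<dots> = (VINT w. G w * (SINT n. k n * I n w))"
    by (simp add: nn_integral_cmult)
  finally show ?thesis .
qed

lemma nn_integral_support_lower:
  fixes G :: "vec \<Rightarrow> ennreal"
  assumes [measurable]: "G \<in> borel_measurable borel" and G: "\<And>w. w \<notin> V \<Longrightarrow> G w = 0" and X: "\<And>w. w \<in> V \<Longrightarrow> C \<le> X w"
    and K: "K \<le> (VINT w. G w)"
  shows "K * C \<le> (VINT w. G w * X w)"
proof -
  have "K * C \<le> (VINT w. G w) * C" using K by (rule mult_right_mono) simp
  also have "\<dots> = (VINT w. G w * C)" by (simp add: nn_integral_multc)
  also have "\<dots> \<le> (VINT w. G w * X w)"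
  proof (rule nn_integral_mono)
    show "G w * C \<le> G w * X w" for w using G X by (cases "w \<in> V") (auto intro: mult_left_mono)
  qed
  finally show ?thesis .
qed

text \<open>Comparison of measures on balls passes to the Borel set where \<open>F\<close> is too
  small, through the finite measure with density \<open>F\<close>; there it forces the nonnegative
  difference to integrate to zero.\<close>

lemma AE_ge_of_balls:
  fixes F :: "vec \<Rightarrow> ennreal"
  assumes F[measurable]: "F \<in> borel_measurable borel" and fin: "(VINT v. F v) < \<infinity>" and a: "0 \<le> a"
    and b: "\<And>z r. 0 < r \<Longrightarrow> ball z r \<subseteq> ball y \<rho> \<Longrightarrow> ennreal a * emeasure lborel (ball z r) \<le> (VINT v. indicator (ball z r) v * F v)"
  shows "AE v in lborel. ennreal a * indicator (ball y \<rho>) v \<le> F v"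
proof -
  let ?A = "{v. F v < ennreal a} \<inter> ball y \<rho>"
  have A[measurable]: "?A \<in> sets borel" by measurable
  have eA: "emeasure (density lborel F) B = (VINT v. indicator B v * F v)" if "B \<in> sets borel" for B
    using that by (simp add: emeasure_density mult.commute)
  have le: "ennreal a * emeasure lborel ?A \<le> emeasure (density lborel F) ?A"
  proof (rule emeasure_ge_of_balls[OF _ _ a open_ball[of y \<rho>]])
    show "emeasure (density lborel F) UNIV < \<infinity>" using fin by (simp add: emeasure_density)
    show "ennreal a * emeasure lborel (ball z r) \<le> emeasure (density lborel F) (ball z r)" if "0 < r" "ball z r \<subseteq> ball y \<rho>" for z r
      using b[OF that] by (simp add: eA)
  qed (use A in auto)
  have finA: "(VINT v. indicator ?A v * F v) < \<infinity>"
    by (rule le_less_trans[OF nn_integral_mono fin]) (auto simp: indicator_def)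
  have "(VINT v. indicator ?A v * F v) + (VINT v. indicator ?A v * (ennreal a - F v))
    = (VINT v. indicator ?A v * F v + indicator ?A v * (ennreal a - F v))"
    by (rule nn_integral_add[symmetric]) measurable
  also have "\<dots> = (VINT v. ennreal a * indicator ?A v)"
    by (intro nn_integral_cong) (auto simp: indicator_def diff_add_cancel_ennreal add.commute less_imp_le)
  also have "\<dots> = ennreal a * emeasure lborel ?A" by (rule nn_integral_cmult_indicator) simp
  also have "\<dots> \<le> (VINT v. indicator ?A v * F v) + 0" using le by (simp add: eA)
  finally have "(VINT v. indicator ?A v * (ennreal a - F v)) \<le> 0"
    using finA by (subst (asm) ennreal_add_left_cancel_le) auto
  then have "AE v in lborel. indicator ?A v * (ennreal a - F v) = 0"
    by (subst nn_integral_0_iff_AE[symmetric]) auto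
  then show ?thesis
  proof eventually_elim
    fix v assume "indicator ?A v * (ennreal a - F v) = 0"
    then have "v \<notin> ?A" by (auto simp: indicator_def dest!: ennreal_minus_eq_0)
    then show "ennreal a * indicator (ball y \<rho>) v \<le> F v" by (auto simp: indicator_def)
  qed
qed

context mixture_flow
begin

text \<open>After the waiting time \<open>T\<close> the gain has accumulated for at least that long,
  while on the ball the damping over a window of length \<open>4 * T\<close> is a fixed
  factor.\<close>

lemma duhamel_window:
  assumes ij: "j \<in> {1..N}" "i \<in> {1..N}" and s: "0 \<le> s" and T: "0 < T" "t \<le> s + 4 * T" and R: "R \<le> R0"
    and Fi: "AE v in lborel. \<forall>\<sigma>\<in>{s..t}. Fi v \<le> ennreal (f i \<sigma> v)"
    and Fj: "AE v in lborel. \<forall>\<sigma>\<in>{s..t}. Fj v \<le> ennreal (f j \<sigma> v)"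
  shows "AE v in lborel. \<forall>\<sigma>\<in>{s + T..t}. ennreal (exp (- (real N * CL * (1 + R0)) * (4 * T)) * T) *
      (indicator (cball 0 R) v * gain \<gamma> (H j i) (m j) (m i) Fj Fi v) \<le> ennreal (f i \<sigma> v)"
  using duhamel_step[OF ij s Fi Fj]
proof eventually_elim
  fix v assume *: "\<forall>\<sigma>\<in>{s..t}. ennreal (exp (- L v * (\<sigma> - s)) * (\<sigma> - s)) * gain \<gamma> (H j i) (m j) (m i) Fj Fi v \<le> ennreal (f i \<sigma> v)"
  show "\<forall>\<sigma>\<in>{s + T..t}. ennreal (exp (- (real N * CL * (1 + R0)) * (4 * T)) * T) *
      (indicator (cball 0 R) v * gain \<gamma> (H j i) (m j) (m i) Fj Fi v) \<le> ennreal (f i \<sigma> v)"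
  proof
    fix \<sigma> assume \<sigma>: "\<sigma> \<in> {s + T..t}"
    show "ennreal (exp (- (real N * CL * (1 + R0)) * (4 * T)) * T) *
      (indicator (cball 0 R) v * gain \<gamma> (H j i) (m j) (m i) Fj Fi v) \<le> ennreal (f i \<sigma> v)"
    proof (cases "v \<in> cball 0 R")
      case True
      then have "L v \<le> real N * CL * (1 + R0)" using R CL_pos unfolding L_def by (intro mult_left_mono) auto
      then have "L v * (\<sigma> - s) \<le> (real N * CL * (1 + R0)) * (4 * T)"
        using \<sigma> T L_nonneg[of v] by (intro mult_mono) auto
      then have "exp (- (real N * CL * (1 + R0)) * (4 * T)) * T \<le> exp (- L v * (\<sigma> - s)) * (\<sigma> - s)"
        using \<sigma> T by (intro mult_mono) auto
      then have "ennreal (exp (- (real N * CL * (1 + R0)) * (4 * T)) * T) * gain \<gamma> (H j i) (m j) (m i) Fj Fi v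
        \<le> ennreal (exp (- L v * (\<sigma> - s)) * (\<sigma> - s)) * gain \<gamma> (H j i) (m j) (m i) Fj Fi v"
        by (intro mult_right_mono ennreal_leI) auto
      also have "\<dots> \<le> ennreal (f i \<sigma> v)" using * \<sigma> T by auto
      finally show ?thesis using True by simp
    qed simp
  qed
qed

text \<open>Three Duhamel steps of duration \<open>T\<close>, leaving the last quarter of the
  window. Each step contributes \<open>e * T\<close>, and each of the four participating particles a
  mass \<open>e * \<kappa>\<close>. The resulting profile is tested against balls, the form in which
  the chain is bounded below.\<close>

lemma chain_lower_bound:
  fixes U V :: "vec set"
  assumes ij: "i \<in> {1..N}" "j \<in> {1..N}" and s: "0 \<le> s" and T: "0 < T" and R1: "0 \<le> R1"
    and [measurable]: "U \<in> sets borel" "V \<in> sets borel" and UV: "U \<subseteq> cball 0 R1" "V \<subseteq> cball 0 R1"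
    and \<kappa>: "0 \<le> \<kappa>" "ennreal \<kappa> \<le> (VINT v. ennreal (ff i s v) * indicator U v)"
      "ennreal \<kappa> \<le> (VINT v. ennreal (ff j s v) * indicator V v)" and c: "0 \<le> c"
    and ch: "\<And>u w1 w2 w3 z r. u \<in> U \<Longrightarrow> w1 \<in> V \<Longrightarrow> w2 \<in> V \<Longrightarrow> w3 \<in> U \<Longrightarrow> 0 < r \<Longrightarrow> ball z r \<subseteq> ball y \<rho> \<Longrightarrow>
       ennreal c * emeasure lborel (ball z r) \<le> chain i j u w1 w2 w3 (ball z r)"
  defines "e \<equiv> exp (- (real N * CL * (1 + 53 * R1)) * (4 * T))"
  shows "AE v in lborel. \<forall>\<sigma>\<in>{s + 3 * T..s + 4 * T}.
    ennreal ((e * T) ^ 3 * (e * \<kappa>) ^ 4 * c) * indicator (ball y \<rho>) v \<le> ennreal (f i \<sigma> v)"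
proof -
  let ?t = "s + 4 * T"
  have e: "0 < e" by (simp add: e_def)
  note [measurable] = ff_measurable[OF ij(1)] ff_measurable[OF ij(2)]
  have mi: "0 < m i" and mj: "0 < m j" using mass_pos ij by auto
  \<comment> \<open>The damped values at time \<open>s\<close> bound the solution from below
    throughout the window, by persistence. They do not depend on time, so the iterated gains are
    formed from fixed profiles.\<close>
  define F0 where "F0 = (\<lambda>v. ennreal e * (ennreal (ff i s v) * indicator U v))"
  define G where "G = (\<lambda>v. ennreal e * (ennreal (ff j s v) * indicator V v))"
  have FM [measurable]: "F0 \<in> borel_measurable borel" "G \<in> borel_measurable borel" unfolding F0_def G_def by measurable
  have pers: "AE v in lborel. \<forall>\<sigma>\<in>{s..?t}. ennreal e * (ennreal (ff k s v) * indicator W v) \<le> ennreal (f k \<sigma> v)"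
    if k: "k \<in> {1..N}" and W: "W \<subseteq> cball 0 R1" for k W
    using persistence[OF k]
  proof eventually_elim
    fix v assume *: "\<forall>s t. 0 \<le> s \<longrightarrow> s \<le> t \<longrightarrow> exp (- L v * (t - s)) * f k s v \<le> f k t v"
    show "\<forall>\<sigma>\<in>{s..?t}. ennreal e * (ennreal (ff k s v) * indicator W v) \<le> ennreal (f k \<sigma> v)"
    proof
      fix \<sigma> assume \<sigma>: "\<sigma> \<in> {s..?t}"
      show "ennreal e * (ennreal (ff k s v) * indicator W v) \<le> ennreal (f k \<sigma> v)"
      proof (cases "v \<in> W")
        case True
        then have "norm v \<le> 53 * R1" using W R1 by fastforce
        then have "L v \<le> real N * CL * (1 + 53 * R1)" using CL_pos unfolding L_def by (intro mult_left_mono) auto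
        then have "L v * (\<sigma> - s) \<le> (real N * CL * (1 + 53 * R1)) * (4 * T)"
          using \<sigma> T L_nonneg[of v] by (intro mult_mono) auto
        then have "e * ff k s v \<le> exp (- L v * (\<sigma> - s)) * f k s v"
          using f_nonneg[OF k s] s unfolding e_def by (intro mult_mono) (auto simp: ff_eq)
        also have "\<dots> \<le> f k \<sigma> v" using * s \<sigma> by auto
        finally show ?thesis using True e ff_nonneg[OF k] by (simp add: ennreal_mult[symmetric] ennreal_leI)
      qed simp
    qed
  qed
  have aF0: "AE v in lborel. \<forall>\<sigma>\<in>{s..?t}. F0 v \<le> ennreal (f i \<sigma> v)" unfolding F0_def by (rule pers[OF ij(1) UV(1)])
  have aG: "AE v in lborel. \<forall>\<sigma>\<in>{s..?t}. G v \<le> ennreal (f j \<sigma> v)" unfolding G_def by (rule pers[OF ij(2) UV(2)])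
  have sub: "AE v in lborel. \<forall>\<sigma>\<in>{s'..?t}. F v \<le> ennreal (f k \<sigma> v)"
    if "AE v in lborel. \<forall>\<sigma>\<in>{s..?t}. F v \<le> ennreal (f k \<sigma> v)" "s \<le> s'" for F k s'
    using that(1) by eventually_elim (use that(2) in auto)
  define gF where "gF = (\<lambda>k Fj Fi R v. indicator (cball 0 R) v * gain \<gamma> (H k i) (m k) (m i) Fj Fi v)"
  have gm [measurable]: "gF k Fj Fi R \<in> borel_measurable borel"
    if [measurable]: "Fj \<in> borel_measurable borel" "Fi \<in> borel_measurable borel" for k Fj Fi R
  proof -
    have [measurable]: "gain \<gamma> (H k i) (m k) (m i) Fj Fi \<in> borel_measurable borel"
      unfolding gain_def[abs_def] by measurable
    show ?thesis unfolding gF_def by measurable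
  qed
  \<comment> \<open>The radii follow \<open>R + 2 * (R + R1)\<close>: from \<open>R1\<close> to
    \<open>5 * R1\<close>, then \<open>17 * R1\<close>, then \<open>53 * R1\<close>.\<close>
  define F1 where "F1 = (\<lambda>v. ennreal (e * T) * gF j G F0 (5 * R1) v)"
  define F2 where "F2 = (\<lambda>v. ennreal (e * T) * gF j G F1 (17 * R1) v)"
  define F3 where "F3 = (\<lambda>v. ennreal (e * T) * gF i F0 F2 (53 * R1) v)"
  have FM1 [measurable]: "F1 \<in> borel_measurable borel" unfolding F1_def by measurable
  have FM2 [measurable]: "F2 \<in> borel_measurable borel" unfolding F2_def by measurable
  have [measurable]: "F3 \<in> borel_measurable borel" unfolding F3_def by measurable
  have aF1: "AE v in lborel. \<forall>\<sigma>\<in>{s + T..?t}. F1 v \<le> ennreal (f i \<sigma> v)"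
    unfolding F1_def gF_def e_def by (rule duhamel_window[OF ij(2,1) s T order_refl _ aF0 aG]) (use R1 in simp)
  have aF2: "AE v in lborel. \<forall>\<sigma>\<in>{s + T + T..?t}. F2 v \<le> ennreal (f i \<sigma> v)"
    unfolding F2_def gF_def e_def by (rule duhamel_window[OF ij(2,1) _ T _ _ aF1 sub[OF aG]]) (use s T R1 in simp_all)
  have aF3: "AE v in lborel. \<forall>\<sigma>\<in>{s + T + T + T..?t}. F3 v \<le> ennreal (f i \<sigma> v)"
    unfolding F3_def gF_def e_def by (rule duhamel_window[OF ij(1,1) _ T _ _ aF2 sub[OF aF0]]) (use s T R1 in simp_all)
  have fin: "(VINT v. F3 v) < \<infinity>"
  proof -
    have "(VINT v. F3 v) \<le> (VINT v. ennreal (f i ?t v))"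
      by (intro nn_integral_mono_AE, use aF3 in eventually_elim) (use T in auto)
    also have "\<dots> \<le> ennreal M" using s T by (intro nn_integral_f_le ij) auto
    finally show ?thesis by (simp add: le_less_trans)
  qed
  have s0: "R1 < norm v \<Longrightarrow> F0 v = 0" "R1 < norm v \<Longrightarrow> G v = 0" for v
    using UV by (auto simp: F0_def G_def indicator_def)
  have s1: "5 * R1 < norm v \<Longrightarrow> F1 v = 0" "17 * R1 < norm v \<Longrightarrow> F2 v = 0" for v
    by (auto simp: F1_def F2_def gF_def)
  let ?P = "post_vel (m i) (m j)" and ?Q = "post_vel (m i) (m i)"
  have low: "ennreal ((e * T) ^ 3 * (e * \<kappa>) ^ 4 * c) * emeasure lborel (ball z r) \<le> (VINT v. indicator (ball z r) v * F3 v)"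
    if zr: "0 < r" "ball z r \<subseteq> ball y \<rho>" for z r
  proof -
    let ?B = "ball z r"
    define I3 where "I3 = (\<lambda>v w3. (SINT n. ennreal (ckern \<gamma> (H i i) v w3 n) * indicator ?B (?Q v w3 n)))"
    have I3m: "(\<lambda>(v, w). I3 v w) \<in> borel_measurable (borel \<Otimes>\<^sub>M borel)" unfolding I3_def by measurable
    have [measurable]: "(\<lambda>x. I3 (a x) (b x)) \<in> borel_measurable K" if [measurable]: "a \<in> borel_measurable K" "b \<in> borel_measurable K" for a b K
      unfolding I3_def by measurable
    define I2 where "I2 = (\<lambda>v w2 w3. (SINT n. ennreal (ckern \<gamma> (H j i) v w2 n) * I3 (?P v w2 n) w3))"
    have [measurable]: "(\<lambda>x. I2 (a x) (b x) (d x)) \<in> borel_measurable K"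
      if [measurable]: "a \<in> borel_measurable K" "b \<in> borel_measurable K" "d \<in> borel_measurable K" for a b d K
      unfolding I2_def by measurable
    define X3 where "X3 = (\<lambda>v. (VINT w3. F0 w3 * I3 v w3))"
    have XM3 [measurable]: "X3 \<in> borel_measurable borel" unfolding X3_def by measurable
    define X2 where "X2 = (\<lambda>v. (VINT w2. G w2 * (SINT n. ennreal (ckern \<gamma> (H j i) v w2 n) * X3 (?P v w2 n))))"
    have XM2 [measurable]: "X2 \<in> borel_measurable borel" unfolding X2_def by measurable
    define X1 where "X1 = (\<lambda>v. (VINT w1. G w1 * (SINT n. ennreal (ckern \<gamma> (H j i) v w1 n) * X2 (?P v w1 n))))"
    have X2eq: "X2 v = (VINT w2. G w2 * (VINT w3. F0 w3 * I2 v w2 w3))" for v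
    proof -
      have "(SINT n. ennreal (ckern \<gamma> (H j i) v w2 n) * X3 (?P v w2 n)) = (VINT w3. F0 w3 * I2 v w2 w3)" for w2
        unfolding X3_def I2_def by (rule nn_integral_pull) measurable
      then show ?thesis by (simp add: X2_def)
    qed
    have X1eq: "X1 u = (VINT w1. G w1 * (VINT w2. G w2 * (VINT w3. F0 w3 * chain i j u w1 w2 w3 ?B)))" for u
    proof -
      have "(SINT n. ennreal (ckern \<gamma> (H j i) u w1 n) * X2 (?P u w1 n))
        = (VINT w2. G w2 * (SINT n. ennreal (ckern \<gamma> (H j i) u w1 n) * (VINT w3. F0 w3 * I2 (?P u w1 n) w2 w3)))" for w1
        unfolding X2eq by (rule nn_integral_pull) measurable
      moreover have "(SINT n. ennreal (ckern \<gamma> (H j i) u w1 n) * (VINT w3. F0 w3 * I2 (?P u w1 n) w2 w3))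
        = (VINT w3. F0 w3 * (SINT n. ennreal (ckern \<gamma> (H j i) u w1 n) * I2 (?P u w1 n) w2 w3))" for w1 w2
        by (rule nn_integral_pull) measurable
      moreover have "(SINT n. ennreal (ckern \<gamma> (H j i) u w1 n) * I2 (?P u w1 n) w2 w3) = chain i j u w1 w2 w3 ?B" for w1 w2 w3
        by (simp add: chain_def I2_def I3_def)
      ultimately show ?thesis unfolding X1_def by simp
    qed
    \<comment> \<open>Moves the test function through one collision. Applied to the last collision,
      then to the second and the first, it reassembles the integral of \<open>chain\<close>.\<close>
    have peel: "(VINT v. X v * (ennreal (e * T) * gF k Fj Fi R' v))
      = ennreal (e * T) * (VINT v. Fi v * (VINT w. Fj w * (SINT n. ennreal (ckern \<gamma> (H k i) v w n) * X (post_vel (m i) (m k) v w n))))"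
      if k: "k \<in> {1..N}" and [measurable]: "X \<in> borel_measurable borel" "Fi \<in> borel_measurable borel" "Fj \<in> borel_measurable borel"
        and sp: "\<And>v. S < norm v \<Longrightarrow> Fi v = 0" "\<And>v. R1 < norm v \<Longrightarrow> Fj v = 0" and S: "S + 2 * (S + R1) \<le> R'" for X Fj Fi :: "vec \<Rightarrow> ennreal" and k S R'
    proof -
      have "(VINT v. X v * (ennreal (e * T) * gF k Fj Fi R' v)) = ennreal (e * T) * (VINT v. X v * gF k Fj Fi R' v)"
        by (subst nn_integral_cmult[symmetric]) (measurable, simp add: mult.left_commute)
      also have "(VINT v. X v * gF k Fj Fi R' v)
        = (VINT v. Fi v * (VINT w. Fj w * (SINT n. ennreal (ckern \<gamma> (H k i) v w n) * X (post_vel (m i) (m k) v w n))))"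
        unfolding gF_def
        by (rule nn_integral_gain_cball[OF mi mass_pos[OF k] H_nonneg H_measurable _ _ _ sp S]) measurable
      finally show ?thesis .
    qed
    have "(VINT v. indicator ?B v * F3 v) = ennreal (e * T) * (VINT v. F2 v * X3 v)"
      unfolding F3_def X3_def I3_def by (rule peel[OF ij(1), of _ _ _ "17 * R1"]) (auto intro!: FM FM2 ij s0 s1)
    also have "(VINT v. F2 v * X3 v) = ennreal (e * T) * (VINT v. F1 v * X2 v)"
    proof -
      have "(VINT v. F2 v * X3 v) = (VINT v. X3 v * F2 v)" by (simp only: mult.commute)
      also have "\<dots> = ennreal (e * T) * (VINT v. F1 v * X2 v)"
        unfolding X2_def F2_def by (rule peel[OF ij(2), of _ _ _ "5 * R1"]) (auto intro!: FM FM1 XM3 ij s0 s1)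
      finally show ?thesis .
    qed
    also have "(VINT v. F1 v * X2 v) = ennreal (e * T) * (VINT v. F0 v * X1 v)"
    proof -
      have "(VINT v. F1 v * X2 v) = (VINT v. X2 v * F1 v)" by (simp only: mult.commute)
      also have "\<dots> = ennreal (e * T) * (VINT v. F0 v * X1 v)"
        unfolding X1_def F1_def by (rule peel[OF ij(2), of _ _ _ R1]) (auto intro!: FM XM2 ij s0)
      finally show ?thesis .
    qed
    finally have F3eq: "(VINT v. indicator ?B v * F3 v) = ennreal (e * T) * (ennreal (e * T) * (ennreal (e * T) * (VINT v. F0 v * X1 v)))" .
    have K0: "ennreal (e * \<kappa>) \<le> (VINT v. F0 v)" "ennreal (e * \<kappa>) \<le> (VINT v. G v)"
      unfolding F0_def G_def using e \<kappa> by (simp_all add: nn_integral_cmult ennreal_mult mult_left_mono)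
    have z: "v \<notin> U \<Longrightarrow> F0 v = 0" "v \<notin> V \<Longrightarrow> G v = 0" for v by (simp_all add: F0_def G_def)
    let ?k = "ennreal (e * \<kappa>)"
    have "?k * (?k * (?k * (?k * (ennreal c * emeasure lborel ?B)))) \<le> (VINT v. F0 v * X1 v)"
    proof (rule nn_integral_support_lower[OF _ z(1) _ K0(1)])
      fix u assume u: "u \<in> U"
      show "?k * (?k * (?k * (ennreal c * emeasure lborel ?B))) \<le> X1 u" unfolding X1eq
      proof (rule nn_integral_support_lower[OF _ z(2) _ K0(2)])
        fix w1 assume w1: "w1 \<in> V"
        show "?k * (?k * (ennreal c * emeasure lborel ?B)) \<le> (VINT w2. G w2 * (VINT w3. F0 w3 * chain i j u w1 w2 w3 ?B))"
        proof (rule nn_integral_support_lower[OF _ z(2) _ K0(2)])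
          fix w2 assume w2: "w2 \<in> V"
          show "?k * (ennreal c * emeasure lborel ?B) \<le> (VINT w3. F0 w3 * chain i j u w1 w2 w3 ?B)"
            by (rule nn_integral_support_lower[OF _ z(1) ch[OF u w1 w2 _ zr] K0(1)]) simp_all
        qed simp_all
      qed simp_all
    qed simp_all
    then have "ennreal (e * T) * (ennreal (e * T) * (ennreal (e * T) * (?k * (?k * (?k * (?k * (ennreal c * emeasure lborel ?B)))))))
      \<le> (VINT v. indicator ?B v * F3 v)"
      unfolding F3eq by (intro mult_left_mono) auto
    moreover have "ennreal ((e * T) ^ 3 * (e * \<kappa>) ^ 4 * c) = ennreal (e * T) ^ 3 * ?k ^ 4 * ennreal c"
    proof -
      have "ennreal (x * y * c) = ennreal x * ennreal y * ennreal c" if "0 \<le> x" "0 \<le> y" for x y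
        using that c by (simp add: ennreal_mult)
      moreover have "ennreal (e * T) ^ 3 = ennreal ((e * T) ^ 3)" using e T by (intro ennreal_power) simp
      moreover have "?k ^ 4 = ennreal ((e * \<kappa>) ^ 4)" using e \<kappa>(1) by (intro ennreal_power) simp
      ultimately show ?thesis using e T \<kappa>(1) by simp
    qed
    ultimately show ?thesis by (simp add: power3_eq_cube power4_eq_xxxx mult_ac)
  qed
  have "AE v in lborel. ennreal ((e * T) ^ 3 * (e * \<kappa>) ^ 4 * c) * indicator (ball y \<rho>) v \<le> F3 v"
    by (rule AE_ge_of_balls[OF _ fin _ low]) (use e T \<kappa> c in auto)
  with aF3 show ?thesis
  proof eventually_elim
    fix v assume 1: "\<forall>\<sigma>\<in>{s + T + T + T..?t}. F3 v \<le> ennreal (f i \<sigma> v)"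
      and 2: "ennreal ((e * T) ^ 3 * (e * \<kappa>) ^ 4 * c) * indicator (ball y \<rho>) v \<le> F3 v"
    show "\<forall>\<sigma>\<in>{s + 3 * T..s + 4 * T}. ennreal ((e * T) ^ 3 * (e * \<kappa>) ^ 4 * c) * indicator (ball y \<rho>) v \<le> ennreal (f i \<sigma> v)"
      using order_trans[OF 2] 1 by auto
  qed
qed

end

context mixture_flow
begin

text \<open>The saturated energy is at most \<open>m i * r^2\<close> within \<open>r\<close> of
  \<open>c\<close>, and at most \<open>k0\<close>, hence at most \<open>k0 * |v|^2 / R^2\<close>,
  beyond radius \<open>R\<close>. Each of these regions accounts for \<open>\<epsilon> / 4\<close>,
  so the remaining one carries \<open>\<epsilon> / 2\<close>, with \<open>sat\<close> at most
  \<open>k0\<close>.\<close>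

lemma far_mass:
  assumes t: "0 \<le> t" and k0: "0 < k0" and r: "0 < r" and R: "0 < R"
    and sat: "\<epsilon> \<le> (\<Sum>i\<in>{1..N}. LINT v|lborel. f i t v * sat k0 (m i * (norm (v - c))^2))"
    and rs: "(\<Sum>i\<in>{1..N}. m i) * M * r^2 \<le> \<epsilon> / 4" and Rs: "real N * k0 * E \<le> \<epsilon> / 4 * R^2"
  shows "ennreal (\<epsilon> / (2 * k0)) \<le> (\<Sum>i\<in>{1..N}. (VINT v. ennreal (ff i t v) * indicator {v. r \<le> norm (c - v) \<and> norm v \<le> R} v))"
proof -
  let ?A = "{v. r \<le> norm (c - v) \<and> norm v \<le> R}"
  have [measurable]: "?A \<in> sets borel" by measurable
  let ?X = "\<lambda>i. LINT v|lborel. f i t v * indicator ?A v"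
  have iA: "integrable lborel (\<lambda>v. f i t v * indicator ?A v)" if i: "i \<in> {1..N}" for i
  proof (rule Bochner_Integration.integrable_bound[OF integrable_f(1)[OF i t]])
    note [measurable] = f_measurable[OF i t]
    show "(\<lambda>v. f i t v * indicator ?A v) \<in> borel_measurable lborel" by measurable
  qed (auto simp: indicator_def)
  have each: "(LINT v|lborel. f i t v * sat k0 (m i * (norm (v - c))^2)) \<le> m i * M * r^2 + k0 * ?X i + k0 * E / R^2"
    if i: "i \<in> {1..N}" for i
  proof -
    note [measurable] = f_measurable[OF i t]
    have mi: "0 < m i" by (rule mass_pos[OF i])
    have sb: "0 \<le> sat k0 (m i * (norm (v - c))^2)" "sat k0 (m i * (norm (v - c))^2) \<le> m i * (norm (v - c))^2"
      "sat k0 (m i * (norm (v - c))^2) \<le> k0" for v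
      using sat_bounds[OF k0, of "m i * (norm (v - c))^2"] mi by auto
    have "(LINT v|lborel. f i t v * sat k0 (m i * (norm (v - c))^2))
      \<le> (LINT v|lborel. (m i * r^2) * f i t v + k0 * (f i t v * indicator ?A v) + k0 / R^2 * (f i t v * (norm v)^2))"
    proof (rule integral_mono)
      show "integrable lborel (\<lambda>v. (m i * r^2) * f i t v + k0 * (f i t v * indicator ?A v) + k0 / R^2 * (f i t v * (norm v)^2))"
        using integrable_f[OF i t] iA[OF i] by (intro Bochner_Integration.integrable_add integrable_mult_right)
      show "integrable lborel (\<lambda>v. f i t v * sat k0 (m i * (norm (v - c))^2))"
      proof (rule Bochner_Integration.integrable_bound[OF integrable_mult_right[OF integrable_f(1)[OF i t], of k0]])
        show "AE v in lborel. norm (f i t v * sat k0 (m i * (norm (v - c))^2)) \<le> norm (k0 * f i t v)"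
          using sb(1) k0 f_nonneg[OF i t] mult_left_mono[OF sb(3) f_nonneg[OF i t]]
          by (intro AE_I2) (simp add: abs_mult mult.commute[of k0])
      qed measurable
      fix v
      have f0: "0 \<le> f i t v" by (rule f_nonneg[OF i t])
      have "sat k0 (m i * (norm (v - c))^2) \<le> m i * r^2 + k0 * indicator ?A v + k0 / R^2 * (norm v)^2"
      proof -
        consider "v \<in> ?A" | "norm (v - c) < r" | "v \<notin> ?A" "R < norm v"
          by (cases "norm (v - c) < r"; cases "R < norm v") (auto simp: norm_minus_commute[of c v])
        then show ?thesis
        proof cases
          case 1
          then have "sat k0 (m i * (norm (v - c))^2) \<le> k0 * indicator ?A v" using sb(3)[of v] by (simp only: indicator_simps mult_1_right)
          moreover have "0 \<le> m i * r^2" "0 \<le> k0 / R^2 * (norm v)^2" using mi k0 by auto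
          ultimately show ?thesis by linarith
        next
          case 2
          then have "(norm (v - c))^2 \<le> r^2" by (intro power_mono) auto
          then have "m i * (norm (v - c))^2 \<le> m i * r^2" using mi by simp
          moreover have "0 \<le> k0 * indicator ?A v" "0 \<le> k0 / R^2 * (norm v)^2" using k0 by auto
          ultimately show ?thesis using sb(2)[of v] by linarith
        next
          case 3
          then have "R^2 \<le> (norm v)^2" using R by (intro power_mono) auto
          then have "k0 / R^2 * R^2 \<le> k0 / R^2 * (norm v)^2" using k0 by (intro mult_left_mono) auto
          then have "k0 \<le> k0 / R^2 * (norm v)^2" using R by simp
          moreover have "0 \<le> k0 * indicator ?A v" "0 \<le> m i * r^2" using k0 mi by auto
          ultimately show ?thesis using sb(3)[of v] by linarith
        qed
      qed
      from mult_left_mono[OF this f0]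
      show "f i t v * sat k0 (m i * (norm (v - c))^2) \<le> (m i * r^2) * f i t v + k0 * (f i t v * indicator ?A v) + k0 / R^2 * (f i t v * (norm v)^2)"
        by (simp add: distrib_left mult_ac)
    qed
    also have "\<dots> = m i * r^2 * (LINT v|lborel. f i t v) + k0 * ?X i + k0 / R^2 * (LINT v|lborel. f i t v * (norm v)^2)"
      using integrable_f[OF i t] iA[OF i] by simp
    also have "\<dots> \<le> m i * r^2 * M + k0 * ?X i + k0 / R^2 * E"
      using mass_le[OF i t] energy_le[OF i t] mi k0 by (intro add_mono mult_left_mono) auto
    finally show ?thesis by (simp add: mult_ac)
  qed
  have "\<epsilon> \<le> (\<Sum>i\<in>{1..N}. m i * M * r^2 + k0 * ?X i + k0 * E / R^2)"
    using sat sum_mono[OF each] by (rule order_trans)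
  also have "\<dots> = (\<Sum>i\<in>{1..N}. m i) * M * r^2 + k0 * (\<Sum>i\<in>{1..N}. ?X i) + real N * k0 * E / R^2"
    by (simp add: sum.distrib sum_distrib_left sum_distrib_right)
  also have "real N * k0 * E / R^2 \<le> \<epsilon> / 4" using Rs R by (simp add: pos_divide_le_eq)
  finally have "\<epsilon> \<le> \<epsilon> / 4 + k0 * (\<Sum>i\<in>{1..N}. ?X i) + \<epsilon> / 4" using rs by linarith
  then have "\<epsilon> / (2 * k0) \<le> (\<Sum>i\<in>{1..N}. ?X i)" using k0 by (simp add: field_simps)
  then have "ennreal (\<epsilon> / (2 * k0)) \<le> ennreal (\<Sum>i\<in>{1..N}. ?X i)" by (rule ennreal_leI)
  also have "\<dots> = (\<Sum>i\<in>{1..N}. ennreal (?X i))"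
    by (rule sum_ennreal[symmetric]) (use f_nonneg t in \<open>auto intro!: Bochner_Integration.integral_nonneg\<close>)
  also have "\<dots> = (\<Sum>i\<in>{1..N}. (VINT v. ennreal (ff i t v) * indicator ?A v))"
  proof (rule sum.cong[OF refl])
    fix i assume i: "i \<in> {1..N}"
    have "ennreal (?X i) = (VINT v. ennreal (f i t v * indicator ?A v))"
      using f_nonneg[OF i t] by (intro nn_integral_eq_integral[symmetric] iA i) auto
    also have "\<dots> = (VINT v. ennreal (ff i t v) * indicator ?A v)"
      by (intro nn_integral_cong) (auto simp: indicator_def ff_eq[OF t])
    finally show "ennreal (?X i) = (VINT v. ennreal (ff i t v) * indicator ?A v)" .
  qed
  finally show ?thesis .
qed

end

context collision_kernels
begin

text \<open>Pairs of velocities in bounded balls and at distance at least \<open>r\<close> form a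
  compact set, so finitely many cells of \<open>smoothing\<close> suffice. The product mass is
  spread over these cells and one of them carries a fixed share. The flow selects the cell, and with
  it the partner species and the centre \<open>y\<close>, but the constants are extrema over all
  cells.\<close>

lemma first_ball:
  assumes N: "1 \<le> N" and p: "0 < \<delta>" "0 < M" "0 < E" and T: "0 < T"
  shows "\<exists>a \<rho> Y. 0 < a \<and> 0 < \<rho> \<and> 0 \<le> Y \<and> (\<forall>f i s. mixture_flow N m \<gamma> h f \<delta> M E \<longrightarrow>
     finite_entropy N f \<longrightarrow>
     entropy N f \<le> Hb \<longrightarrow> i \<in> {1..N} \<longrightarrow> 0 \<le> s \<longrightarrow>
     (\<exists>y. norm y \<le> Y \<and> (AE v in lborel. \<forall>\<sigma>\<in>{s + 3 * T..s + 4 * T}. ennreal a * indicator (cball y \<rho>) v \<le> ennreal (f i \<sigma> v))))"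
proof -
  \<comment> \<open>The Chebyshev radius about the origin: \<open>2 * Ec 0 = 4 * E\<close>, as
    \<open>near_mass\<close> requires.\<close>
  define R0 where "R0 = sqrt (4 * E / \<delta>)"
  have R0: "0 < R0" "\<delta> * R0^2 = 4 * E" using p by (simp_all add: R0_def)
  obtain k0 \<epsilon> where k0: "0 < k0" and \<epsilon>: "0 < \<epsilon>" and nc: "\<And>f c t. mixture_flow N m \<gamma> h f \<delta> M E \<Longrightarrow>
     finite_entropy N f \<Longrightarrow>
     entropy N f \<le> Hb \<Longrightarrow> norm c \<le> R0 \<Longrightarrow> 0 \<le> t \<Longrightarrow>
     \<epsilon> \<le> (\<Sum>i\<in>{1..N}. LINT v|lborel. f i t v * sat k0 (m i * (norm (v - c))^2))"
    using nonconcentration[OF N p, of Hb R0] by blast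
  define mm where "mm = (\<Sum>i\<in>{1..N}. m i)"
  have mm: "0 < mm" unfolding mm_def using N mass_pos by (intro sum_pos) auto
  define r where "r = sqrt (\<epsilon> / (4 * (mm * M)))"
  have r: "0 < r" "mm * M * r^2 \<le> \<epsilon> / 4" using mm p \<epsilon> by (simp_all add: r_def field_simps)
  define R2 where "R2 = max R0 (sqrt (4 * (real N * k0 * E) / \<epsilon>))"
  have R2: "0 < R2" "R0 \<le> R2" using R0 by (auto simp: R2_def)
  have R2s: "real N * k0 * E \<le> \<epsilon> / 4 * R2^2"
  proof -
    have "(sqrt (4 * (real N * k0 * E) / \<epsilon>))^2 \<le> R2^2" using k0 p \<epsilon> by (intro power_mono) (auto simp: R2_def)
    then have "4 * (real N * k0 * E) / \<epsilon> \<le> R2^2" using k0 p \<epsilon> by simp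
    then show ?thesis using \<epsilon> by (simp add: field_simps)
  qed
  define R1 where "R1 = R2 + 1"
  \<comment> \<open>The pairs that can arise: a velocity near the origin and a partner that is
    bounded and not too close to it.\<close>
  define K where "K = {x :: vec \<times> vec. norm (fst x) \<le> R0 \<and> norm (snd x) \<le> R2 \<and> r \<le> norm (fst x - snd x)}"
  have K: "compact K"
  proof -
    have "closed {x :: vec \<times> vec. r \<le> norm (fst x - snd x)}" by (intro closed_Collect_le continuous_intros)
    moreover have "compact (cball (0::vec) R0 \<times> cball (0::vec) R2)" by (intro compact_Times compact_cball)
    moreover have "K = (cball 0 R0 \<times> cball 0 R2) \<inter> {x. r \<le> norm (fst x - snd x)}" by (auto simp: K_def)
    ultimately show ?thesis by (simp add: compact_Int_closed)
  qed
  define Q where "Q = (\<lambda>(i, j, x :: vec \<times> vec) (\<eta>, \<rho>, c, y). 0 < \<eta> \<and> \<eta> \<le> 1 \<and> 0 < \<rho> \<and> 0 < c \<and>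
    (\<forall>u w1 w2 w3 z s. u \<in> ball (fst x) \<eta> \<longrightarrow> w1 \<in> ball (snd x) \<eta> \<longrightarrow> w2 \<in> ball (snd x) \<eta> \<longrightarrow> w3 \<in> ball (fst x) \<eta> \<longrightarrow> 0 < s \<longrightarrow> ball z s \<subseteq> ball y \<rho> \<longrightarrow>
       ennreal c * emeasure lborel (ball z s) \<le> chain i j u w1 w2 w3 (ball z s)))"
  have "\<exists>q. Q (i, j, x) q" if ij: "i \<in> {1..N}" "j \<in> {1..N}" and x: "x \<in> K" for i j x
  proof -
    have ne: "fst x \<noteq> snd x" using x r by (auto simp: K_def)
    from smoothing[OF ij ne] obtain \<eta> \<rho> c y where *: "0 < \<eta>" "0 < \<rho>" "0 < c"
      "\<forall>u w1 w2 w3 z s. u \<in> ball (fst x) \<eta> \<longrightarrow> w1 \<in> ball (snd x) \<eta> \<longrightarrow> w2 \<in> ball (snd x) \<eta> \<longrightarrow> w3 \<in> ball (fst x) \<eta> \<longrightarrow> 0 < s \<longrightarrow> ball z s \<subseteq> ball y \<rho> \<longrightarrow>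
       ennreal c * emeasure lborel (ball z s) \<le> chain i j u w1 w2 w3 (ball z s)"
      by (elim exE conjE) (rule that)
    have "Q (i, j, x) (min \<eta> 1, \<rho>, c, y)" unfolding Q_def prod.case
    proof (intro conjI allI impI)
      fix u w1 w2 w3 z :: vec and s :: real
      assume "u \<in> ball (fst x) (min \<eta> 1)" "w1 \<in> ball (snd x) (min \<eta> 1)" "w2 \<in> ball (snd x) (min \<eta> 1)"
        "w3 \<in> ball (fst x) (min \<eta> 1)" "0 < s" "ball z s \<subseteq> ball y \<rho>"
      then show "ennreal c * emeasure lborel (ball z s) \<le> chain i j u w1 w2 w3 (ball z s)"
        by (intro *(4)[rule_format]) simp_all
    qed (use *(1-3) in simp_all)
    then show ?thesis by blast
  qed
  then have q: "Q (i, j, x) (SOME w. Q (i, j, x) w)" if "i \<in> {1..N}" "j \<in> {1..N}" "x \<in> K" for i j x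
    using someI_ex[of "Q (i, j, x)"] that by blast
  define q where "q = (\<lambda>z. SOME w. Q z w)"
  define \<eta> \<rho> c y where "\<eta> = (\<lambda>x. fst (q x))" and "\<rho> = (\<lambda>x. fst (snd (q x)))" and "c = (\<lambda>x. fst (snd (snd (q x))))" and "y = (\<lambda>x. snd (snd (snd (q x))))"
  have Qd: "Q z (\<eta> z, \<rho> z, c z, y z)" if "fst z \<in> {1..N}" "fst (snd z) \<in> {1..N}" "snd (snd z) \<in> K" for z
    using q[of "fst z" "fst (snd z)" "snd (snd z)"] that by (simp add: q_def \<eta>_def \<rho>_def c_def y_def)
  let ?U = "\<lambda>z. ball (fst (snd (snd z))) (\<eta> z)" and ?V = "\<lambda>z. ball (snd (snd (snd z))) (\<eta> z)"
  have "\<exists>P. finite P \<and> P \<subseteq> K \<and> K \<subseteq> (\<Union>x\<in>P. ?U (i, j, x) \<times> ?V (i, j, x))" if ij: "i \<in> {1..N}" "j \<in> {1..N}" for i j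
  proof -
    have "K \<subseteq> (\<Union>x\<in>K. ?U (i, j, x) \<times> ?V (i, j, x))"
    proof
      fix x assume x: "x \<in> K"
      have "0 < \<eta> (i, j, x)" using Qd[of "(i, j, x)"] ij x by (simp add: Q_def)
      then have "x \<in> ?U (i, j, x) \<times> ?V (i, j, x)" by (cases x) auto
      then show "x \<in> (\<Union>x\<in>K. ?U (i, j, x) \<times> ?V (i, j, x))" using x by blast
    qed
    then obtain P where "P \<subseteq> K" "finite P" "K \<subseteq> (\<Union>x\<in>P. ?U (i, j, x) \<times> ?V (i, j, x))"
      by (rule compactE_image[OF K, rotated]) (auto intro: open_Times)
    then show ?thesis by blast
  qed
  note ex = this
  define P where "P = (\<lambda>i j. SOME P. finite P \<and> P \<subseteq> K \<and> K \<subseteq> (\<Union>x\<in>P. ?U (i, j, x) \<times> ?V (i, j, x)))"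
  have Pall: "finite (P i j) \<and> P i j \<subseteq> K \<and> K \<subseteq> (\<Union>x\<in>P i j. ?U (i, j, x) \<times> ?V (i, j, x))" if "i \<in> {1..N}" "j \<in> {1..N}" for i j
    unfolding P_def by (rule someI_ex[OF ex[OF that]])
  have P: "finite (P i j)" "P i j \<subseteq> K" "K \<subseteq> (\<Union>x\<in>P i j. ?U (i, j, x) \<times> ?V (i, j, x))" if "i \<in> {1..N}" "j \<in> {1..N}" for i j
    using Pall[OF that] by blast+
  define J where "J = (SIGMA i:{1..N}. SIGMA j:{1..N}. P i j)"
  have fJ: "finite J" unfolding J_def using P(1) by (intro finite_SigmaI) auto
  have JQ: "Q z (\<eta> z, \<rho> z, c z, y z)" "snd (snd z) \<in> K" if "z \<in> J" for z
  proof -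
    obtain i j x where ij: "z = (i, j, x)" "i \<in> {1..N}" "j \<in> {1..N}" "x \<in> P i j" using \<open>z \<in> J\<close> by (auto simp: J_def)
    then have "x \<in> K" using P(2)[OF ij(2,3)] by blast
    then show "Q z (\<eta> z, \<rho> z, c z, y z)" "snd (snd z) \<in> K" using ij by (simp_all add: Qd)
  qed
  \<comment> \<open>The total number of cells, plus one so that the pigeonhole inequality below is
    strict.\<close>
  define n where "n = real (\<Sum>i\<in>{1..N}. \<Sum>j\<in>{1..N}. card (P i j)) + 1"
  have n: "0 < n" unfolding n_def by (rule add_nonneg_pos[OF of_nat_0_le_iff zero_less_one])
  \<comment> \<open>The mass of species \<open>i\<close> near the origin times the mass of all
    species at distance at least \<open>r\<close> from such a velocity.\<close>
  define q2 where "q2 = \<delta> / 2 * (\<epsilon> / (2 * k0))"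
  have q2: "0 < q2" using p \<epsilon> k0 by (simp add: q2_def)
  define \<kappa> where "\<kappa> = q2 / n / M"
  have \<kappa>: "0 < \<kappa>" using q2 n p by (simp add: \<kappa>_def)
  define e where "e = exp (- (real N * (CA * (2 * M + E)) * (1 + 53 * R1)) * (4 * T))"
  define a where "a = Min (insert 1 ((\<lambda>z. (e * T) ^ 3 * (e * \<kappa>) ^ 4 * c z) ` J))"
  define \<rho>0 where "\<rho>0 = Min (insert 1 ((\<lambda>z. \<rho> z / 2) ` J))"
  define Y where "Y = Max (insert 0 ((\<lambda>z. norm (y z)) ` J))"
  have J0: "0 < c z" "0 < \<rho> z" if "z \<in> J" for z using JQ(1)[OF that] by (auto simp: Q_def split: prod.splits)
  have e: "0 < e" by (simp add: e_def)
  have a0: "0 < a" unfolding a_def using fJ J0 e T \<kappa> by (subst Min_gr_iff) auto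
  have \<rho>00: "0 < \<rho>0" unfolding \<rho>0_def using fJ J0 by (subst Min_gr_iff) auto
  have Y0: "0 \<le> Y" unfolding Y_def using fJ by (intro Max_ge) auto
  have main: "\<exists>y. norm y \<le> Y \<and> (AE v in lborel. \<forall>\<sigma>\<in>{s + 3 * T..s + 4 * T}. ennreal a * indicator (cball y \<rho>0) v \<le> ennreal (f i \<sigma> v))"
    if flow: "mixture_flow N m \<gamma> h f \<delta> M E" and en: "finite_entropy N f"
      "entropy N f \<le> Hb" and i: "i \<in> {1..N}" and s: "0 \<le> s" for f i s
  proof -
    interpret F: mixture_flow N m \<gamma> h f \<delta> M E by (rule flow)
    note [measurable] = F.ff_measurable
    let ?F = "\<lambda>k v. ennreal (F.ff k s v)"
    let ?A = "\<lambda>v::vec. {w. r \<le> norm (v - w) \<and> norm w \<le> R2}"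
    have [measurable]: "Measurable.pred (borel \<Otimes>\<^sub>M borel) (\<lambda>x :: vec \<times> vec. snd x \<in> ?A (fst x))" by measurable
    have Am [measurable]: "?A v \<in> sets borel" for v by measurable
    have near: "ennreal (\<delta> / 2) \<le> (VINT v. ?F i v * indicator {v. norm (v - 0) \<le> R0} v)"
      by (rule F.near_mass[OF i s, of 0 0]) (use R0 in \<open>auto simp: F.Ec_def\<close>)
    have far: "ennreal (\<epsilon> / (2 * k0)) \<le> (\<Sum>j\<in>{1..N}. (VINT w. ?F j w * indicator (?A v) w))" if "norm v \<le> R0" for v
      by (rule F.far_mass[OF s k0 r(1) R2(1) nc[OF flow en that s]]) (use r(2) R2s in \<open>simp_all add: mm_def\<close>)
    let ?u = "\<lambda>j x. (VINT v. ?F i v * indicator (?U (i, j, x)) v)" and ?v = "\<lambda>j x. (VINT w. ?F j w * indicator (?V (i, j, x)) w)"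
    have "ennreal q2 = ennreal (\<delta> / 2) * ennreal (\<epsilon> / (2 * k0))"
      unfolding q2_def using p \<epsilon> k0 by (intro ennreal_mult) auto
    also have "\<dots> \<le> (VINT v. (?F i v * indicator {v. norm (v - 0) \<le> R0} v) * (\<Sum>j\<in>{1..N}. (VINT w. ?F j w * indicator (?A v) w)))"
    proof (rule nn_integral_support_lower[where V="{v. norm (v - 0) \<le> R0}", OF _ _ _ near])
      show "(\<lambda>v. ?F i v * indicator {v. norm (v - 0) \<le> R0} v) \<in> borel_measurable borel" using i by measurable
      show "ennreal (\<epsilon> / (2 * k0)) \<le> (\<Sum>j\<in>{1..N}. (VINT w. ?F j w * indicator (?A v) w))"
        if "v \<in> {v. norm (v - 0) \<le> R0}" for v using that by (intro far) simp
    qed simp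
    also have "\<dots> \<le> (VINT v. (\<Sum>j\<in>{1..N}. \<Sum>x\<in>P i j. (?F i v * indicator (?U (i, j, x)) v) * ?v j x))"
    proof (rule nn_integral_mono)
      fix v
      show "(?F i v * indicator {v. norm (v - 0) \<le> R0} v) * (\<Sum>j\<in>{1..N}. (VINT w. ?F j w * indicator (?A v) w))
        \<le> (\<Sum>j\<in>{1..N}. \<Sum>x\<in>P i j. (?F i v * indicator (?U (i, j, x)) v) * ?v j x)"
      proof (cases "norm v \<le> R0")
        case True
        have "(VINT w. ?F j w * indicator (?A v) w) \<le> (\<Sum>x\<in>P i j. indicator (?U (i, j, x)) v * ?v j x)" if j: "j \<in> {1..N}" for j
        proof -
          have "(VINT w. ?F j w * indicator (?A v) w) \<le> (VINT w. (\<Sum>x\<in>P i j. indicator (?U (i, j, x)) v * (?F j w * indicator (?V (i, j, x)) w)))"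
          proof (rule nn_integral_mono)
            fix w
            show "?F j w * indicator (?A v) w \<le> (\<Sum>x\<in>P i j. indicator (?U (i, j, x)) v * (?F j w * indicator (?V (i, j, x)) w))"
            proof (cases "w \<in> ?A v")
              case wA: True
              then have "(v, w) \<in> K" using True by (simp add: K_def)
              then obtain x where x: "x \<in> P i j" "v \<in> ?U (i, j, x)" "w \<in> ?V (i, j, x)" using P(3)[OF i j] by blast
              have "?F j w * indicator (?A v) w = indicator (?U (i, j, x)) v * (?F j w * indicator (?V (i, j, x)) w)"
                using wA x(2,3) by (simp only: indicator_simps mult_1_left mult_1_right)
              also have "\<dots> \<le> (\<Sum>x\<in>P i j. indicator (?U (i, j, x)) v * (?F j w * indicator (?V (i, j, x)) w))"
                using P(1)[OF i j] x(1) by (intro member_le_sum) auto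
              finally show ?thesis .
            qed simp
          qed
          also have "\<dots> = (\<Sum>x\<in>P i j. indicator (?U (i, j, x)) v * ?v j x)"
            using j by (subst nn_integral_sum) (auto simp: nn_integral_cmult)
          finally show ?thesis .
        qed
        then have "(\<Sum>j\<in>{1..N}. (VINT w. ?F j w * indicator (?A v) w)) \<le> (\<Sum>j\<in>{1..N}. \<Sum>x\<in>P i j. indicator (?U (i, j, x)) v * ?v j x)"
          by (rule sum_mono)
        then have "?F i v * (\<Sum>j\<in>{1..N}. (VINT w. ?F j w * indicator (?A v) w)) \<le> ?F i v * (\<Sum>j\<in>{1..N}. \<Sum>x\<in>P i j. indicator (?U (i, j, x)) v * ?v j x)"
          by (rule mult_left_mono) simp
        then show ?thesis using True by (simp add: sum_distrib_left mult.assoc)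
      qed simp
    qed
    also have "\<dots> = (\<Sum>j\<in>{1..N}. \<Sum>x\<in>P i j. ?u j x * ?v j x)"
      using i by (simp add: nn_integral_sum nn_integral_multc)
    finally have tot: "ennreal q2 \<le> (\<Sum>j\<in>{1..N}. \<Sum>x\<in>P i j. ?u j x * ?v j x)" .
    \<comment> \<open>Pigeonhole. The bound on the far mass concerns the sum over species, so the
      partner species is only found here.\<close>
    have "\<exists>j\<in>{1..N}. \<exists>x\<in>P i j. ennreal (q2 / n) \<le> ?u j x * ?v j x"
    proof (rule ccontr)
      assume "\<not> ?thesis"
      then have lt: "?u j x * ?v j x < ennreal (q2 / n)" if "j \<in> {1..N}" "x \<in> P i j" for j x
        using that by (meson not_le)
      have "(\<Sum>j\<in>{1..N}. \<Sum>x\<in>P i j. ?u j x * ?v j x) \<le> (\<Sum>j\<in>{1..N}. \<Sum>x\<in>P i j. ennreal (q2 / n))"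
        by (intro sum_mono less_imp_le lt)
      also have "\<dots> = (\<Sum>j\<in>{1..N}. ennreal (real (card (P i j)) * (q2 / n)))"
      proof (rule sum.cong[OF refl])
        show "(\<Sum>x\<in>P i j. ennreal (q2 / n)) = ennreal (real (card (P i j)) * (q2 / n))" for j
          using q2 n by (subst ennreal_mult) (auto simp: ennreal_of_nat_eq_real_of_nat)
      qed
      also have "\<dots> = ennreal (\<Sum>j\<in>{1..N}. real (card (P i j)) * (q2 / n))"
        using q2 n by (intro sum_ennreal) simp
      also have "\<dots> = ennreal (real (\<Sum>j\<in>{1..N}. card (P i j)) * (q2 / n))"
        by (simp only: of_nat_sum sum_distrib_right)
      also have "\<dots> < ennreal q2"
      proof (rule ennreal_lessI[OF q2])
        have "(\<Sum>j\<in>{1..N}. card (P i j)) \<le> (\<Sum>i\<in>{1..N}. \<Sum>j\<in>{1..N}. card (P i j))"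
          using i by (intro member_le_sum[where f="\<lambda>i. \<Sum>j\<in>{1..N}. card (P i j)"]) auto
        then have "real (\<Sum>j\<in>{1..N}. card (P i j)) < n" unfolding n_def by linarith
        then have "real (\<Sum>j\<in>{1..N}. card (P i j)) * (q2 / n) < n * (q2 / n)"
          using q2 n by (intro mult_strict_right_mono) auto
        then show "real (\<Sum>j\<in>{1..N}. card (P i j)) * (q2 / n) < q2" using n by simp
      qed
      finally show False using tot by simp
    qed
    then obtain j x where j: "j \<in> {1..N}" and x: "x \<in> P i j" and uv: "ennreal (q2 / n) \<le> ?u j x * ?v j x" by blast
    define z where "z = (i, j, x)"
    have zJ: "z \<in> J" using i j x by (simp add: z_def J_def)
    note Qz = JQ(1)[OF zJ, unfolded z_def Q_def prod.case]
    have xK: "x \<in> K" using P(2)[OF i j] x by blast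
    have mass: "(VINT v. ?F k v * indicator B v) \<le> ennreal M" if "k \<in> {1..N}" for k B
    proof -
      have "(VINT v. ?F k v * indicator B v) \<le> (VINT v. ennreal (f k s v))"
        by (intro nn_integral_mono) (auto simp: indicator_def F.ff_eq[OF s])
      then show ?thesis using F.nn_integral_f_le(1)[OF that s] by (rule order_trans)
    qed
    \<comment> \<open>A lower bound for the product becomes one for each factor, since the other
      factor is at most \<open>M\<close>.\<close>
    have dv: "ennreal \<kappa> \<le> A" if "ennreal (q2 / n) \<le> A * B" "B \<le> ennreal M" for A B
    proof -
      have "ennreal \<kappa> = ennreal (q2 / n) * ennreal (1 / M)"
        unfolding \<kappa>_def using q2 n p by (subst ennreal_mult[symmetric]) auto
      also have "\<dots> \<le> (A * ennreal M) * ennreal (1 / M)"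
        by (intro mult_right_mono order_trans[OF that(1)] mult_left_mono that(2)) auto
      also have "\<dots> = A" using p by (simp add: mult.assoc ennreal_mult[symmetric])
      finally show ?thesis .
    qed
    have k1: "ennreal \<kappa> \<le> ?u j x" by (rule dv[OF uv mass[OF j]])
    have "ennreal (q2 / n) \<le> ?v j x * ?u j x" using uv by (simp only: mult.commute)
    then have k2: "ennreal \<kappa> \<le> ?v j x" by (rule dv[OF _ mass[OF i]])
    have sub: "?U (i, j, x) \<subseteq> cball 0 R1" "?V (i, j, x) \<subseteq> cball 0 R1"
    proof -
      have *: "ball (p :: vec) (\<eta> (i, j, x)) \<subseteq> cball 0 R1" if "norm p \<le> R2" for p
      proof
        fix w assume "w \<in> ball p (\<eta> (i, j, x))"
        then have "norm (w - p) \<le> 1" using Qz by (simp add: dist_norm norm_minus_commute)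
        then show "w \<in> cball 0 R1" using that norm_triangle_ineq[of p "w - p"] by (simp add: R1_def)
      qed
      show "?U (i, j, x) \<subseteq> cball 0 R1" "?V (i, j, x) \<subseteq> cball 0 R1"
        using xK R2 by (auto intro!: * simp del: subset_iff simp: K_def)
    qed
    have "AE v in lborel. \<forall>\<sigma>\<in>{s + 3 * T..s + 4 * T}.
      ennreal ((exp (- (real N * F.CL * (1 + 53 * R1)) * (4 * T)) * T) ^ 3 * (exp (- (real N * F.CL * (1 + 53 * R1)) * (4 * T)) * \<kappa>) ^ 4 * c (i, j, x)) *
        indicator (ball (y (i, j, x)) (\<rho> (i, j, x))) v \<le> ennreal (f i \<sigma> v)"
    proof (rule F.chain_lower_bound[OF i j s T _ _ _ sub _ k1 k2])
      show "0 \<le> R1" using R2 by (simp add: R1_def)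
      show "0 \<le> \<kappa>" using \<kappa> by simp
      show "0 \<le> c (i, j, x)" using Qz by simp
      fix u w1 w2 w3 z r
      assume "u \<in> ?U (i, j, x)" "w1 \<in> ?V (i, j, x)" "w2 \<in> ?V (i, j, x)" "w3 \<in> ?U (i, j, x)" "0 < r" "ball z r \<subseteq> ball (y (i, j, x)) (\<rho> (i, j, x))"
      then show "ennreal (c (i, j, x)) * emeasure lborel (ball z r) \<le> chain i j u w1 w2 w3 (ball z r)"
        using Qz unfolding fst_conv snd_conv by blast
    qed auto
    then have bnd: "AE v in lborel. \<forall>\<sigma>\<in>{s + 3 * T..s + 4 * T}. ennreal ((e * T) ^ 3 * (e * \<kappa>) ^ 4 * c z) * indicator (ball (y z) (\<rho> z)) v \<le> ennreal (f i \<sigma> v)"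
      unfolding F.CL_def e_def[symmetric] z_def[symmetric] .
    have az: "a \<le> (e * T) ^ 3 * (e * \<kappa>) ^ 4 * c z" unfolding a_def using fJ zJ by (intro Min_le) auto
    have "\<rho>0 \<le> \<rho> z / 2" unfolding \<rho>0_def using fJ zJ by (intro Min_le) auto
    then have \<rho>z: "\<rho>0 < \<rho> z" using J0(2)[OF zJ] by linarith
    show ?thesis
    proof (intro exI[of _ "y z"] conjI)
      show "norm (y z) \<le> Y" unfolding Y_def using fJ zJ by (intro Max_ge) auto
      show "AE v in lborel. \<forall>\<sigma>\<in>{s + 3 * T..s + 4 * T}. ennreal a * indicator (cball (y z) \<rho>0) v \<le> ennreal (f i \<sigma> v)"
        using bnd
      proof eventually_elim
        fix v assume *: "\<forall>\<sigma>\<in>{s + 3 * T..s + 4 * T}. ennreal ((e * T) ^ 3 * (e * \<kappa>) ^ 4 * c z) * indicator (ball (y z) (\<rho> z)) v \<le> ennreal (f i \<sigma> v)"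
        have "ennreal a * indicator (cball (y z) \<rho>0) v \<le> ennreal ((e * T) ^ 3 * (e * \<kappa>) ^ 4 * c z) * indicator (ball (y z) (\<rho> z)) v"
          using \<rho>z az by (intro mult_mono ennreal_leI) (auto simp: indicator_def)
        then show "\<forall>\<sigma>\<in>{s + 3 * T..s + 4 * T}. ennreal a * indicator (cball (y z) \<rho>0) v \<le> ennreal (f i \<sigma> v)"
          using * order_trans by blast
      qed
    qed
  qed
  show ?thesis
    by (rule exI[of _ a], rule exI[of _ \<rho>0], rule exI[of _ Y]) (use a0 \<rho>00 Y0 main in blast)
qed

text \<open>The construction restarts at time \<open>t - \<tau>\<close>, which is possible because
  non-concentration holds at all times: three quarters of the delay yield the first ball, and the
  last quarter the tail. The unknown centre is moved to the origin by
  \<open>|v - y|^2 \<le> 2 |v|^2 + 2 Y^2\<close>.\<close>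

lemma maxwellian_lower_bound:
  assumes N: "1 \<le> N" and p: "0 < \<delta>" "0 < M" "0 < E" and \<tau>: "0 < \<tau>"
  shows "\<exists>A B. 0 < A \<and> 0 < B \<and> (\<forall>f i t. mixture_flow N m \<gamma> h f \<delta> M E \<longrightarrow>
     finite_entropy N f \<longrightarrow>
     entropy N f \<le> Hb \<longrightarrow> i \<in> {1..N} \<longrightarrow> \<tau> \<le> t \<longrightarrow>
     (AE v in lborel. A * exp (- (B * (norm v)^2)) \<le> f i t v))"
proof -
  define T where "T = \<tau> / 4"
  have T: "0 < T" using \<tau> by (simp add: T_def)
  obtain a \<rho> Y where fb: "0 < a" "0 < \<rho>" "0 \<le> Y" "\<And>f i s. mixture_flow N m \<gamma> h f \<delta> M E \<Longrightarrow>
     finite_entropy N f \<Longrightarrow>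
     entropy N f \<le> Hb \<Longrightarrow> i \<in> {1..N} \<Longrightarrow> 0 \<le> s \<Longrightarrow>
     (\<exists>y. norm y \<le> Y \<and> (AE v in lborel. \<forall>\<sigma>\<in>{s + 3 * T..s + 4 * T}. ennreal a * indicator (cball y \<rho>) v \<le> ennreal (f i \<sigma> v)))"
    using first_ball[OF N p T, of Hb] by blast
  obtain b where b: "0 < b" "\<And>f i s y. mixture_flow N m \<gamma> h f \<delta> M E \<Longrightarrow> i \<in> {1..N} \<Longrightarrow> 0 \<le> s \<Longrightarrow> norm y \<le> Y \<Longrightarrow>
     (AE v in lborel. \<forall>\<sigma>\<in>{s..s + T}. ennreal a * indicator (cball y \<rho>) v \<le> ennreal (f i \<sigma> v)) \<Longrightarrow>
     (AE v in lborel. a * exp (- b * (norm (v - y))^2) \<le> f i (s + T) v)"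
    using maxwellian_tail[OF p fb(1,2) T fb(3)] by blast
  have main: "AE v in lborel. a * exp (- (2 * b * Y^2)) * exp (- (2 * b * (norm v)^2)) \<le> f i t v"
    if flow: "mixture_flow N m \<gamma> h f \<delta> M E" and en: "finite_entropy N f"
      "entropy N f \<le> Hb" and i: "i \<in> {1..N}" and t: "\<tau> \<le> t" for f i t
  proof -
    have s: "0 \<le> t - 4 * T" using t by (simp add: T_def)
    have eq: "t - 4 * T + 3 * T = t - T" "t - 4 * T + 4 * T = t - T + T" by simp_all
    obtain y where y: "norm y \<le> Y" "AE v in lborel. \<forall>\<sigma>\<in>{t - T..t - T + T}. ennreal a * indicator (cball y \<rho>) v \<le> ennreal (f i \<sigma> v)"
      using fb(4)[OF flow en i s] unfolding eq by blast
    have "AE v in lborel. a * exp (- b * (norm (v - y))^2) \<le> f i (t - T + T) v"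
      using s T by (intro b(2)[OF flow i _ y]) simp
    then show ?thesis
    proof eventually_elim
      fix v assume v: "a * exp (- b * (norm (v - y))^2) \<le> f i (t - T + T) v"
      have "(norm (v - y))^2 \<le> (norm v + norm y)^2" by (intro power_mono norm_triangle_ineq4) simp
      also have "\<dots> \<le> 2 * (norm v)^2 + 2 * (norm y)^2"
        using zero_le_power2[of "norm v - norm y"] by (simp add: power2_eq_square algebra_simps)
      also have "\<dots> \<le> 2 * (norm v)^2 + 2 * Y^2" using y(1) by (intro add_left_mono mult_left_mono power_mono) auto
      finally have "b * (norm (v - y))^2 \<le> b * (2 * (norm v)^2 + 2 * Y^2)" using b(1) by (intro mult_left_mono) auto
      then have "- (2 * b * Y^2) + - (2 * b * (norm v)^2) \<le> - b * (norm (v - y))^2" by (simp add: algebra_simps)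
      then have "a * exp (- (2 * b * Y^2) + - (2 * b * (norm v)^2)) \<le> a * exp (- b * (norm (v - y))^2)"
        using fb(1) by (intro mult_left_mono) auto
      then show "a * exp (- (2 * b * Y^2)) * exp (- (2 * b * (norm v)^2)) \<le> f i t v"
        using v unfolding exp_add by (simp add: mult.assoc)
    qed
  qed
  show ?thesis
    by (rule exI[of _ "a * exp (- (2 * b * Y^2))"], rule exI[of _ "2 * b"]) (use fb(1) b(1) main in auto)
qed

end

text \<open>The conserved energy is weighted by the particle masses and \<open>E0\<close> is not,
  which costs the product of the sums of \<open>m i\<close> and of \<open>1 / m i\<close>. Absolute
  values and the summands 1 make the bounds positive for arbitrary real \<open>M0\<close> and
  \<open>E0\<close>.\<close>

lemma mixture_flow_of_solution:
  assumes K: "collision_kernels N m \<gamma> h" and sol: "mixture_solution N m \<gamma> h f" and cons: "conservation_laws N m f"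
    and tot: "initial_totals N f M0 E0 H0" and \<delta>: "0 < \<delta>" "\<forall>i\<in>{1..N}. \<delta> \<le> (LINT v|lborel. f i 0 v)"
  shows "mixture_flow N m \<gamma> h f \<delta> (\<bar>M0\<bar> + 1) ((\<Sum>i\<in>{1..N}. m i) * (\<Sum>i\<in>{1..N}. 1 / m i) * \<bar>E0\<bar> + 1)"
proof -
  interpret collision_kernels N m \<gamma> h by (rule K)
  have fn: "0 \<le> f i t v" if "i \<in> {1..N}" "0 \<le> t" for i t v using sol that by (auto simp: mixture_solution_def)
  have en0: "0 \<le> (LINT v|lborel. f i t v * (norm v)^2)" if "i \<in> {1..N}" "0 \<le> t" for i t
    using fn[OF that] by (intro Bochner_Integration.integral_nonneg) auto
  have ma: "(LINT v|lborel. f i t v) = (LINT v|lborel. f i 0 v)" if "i \<in> {1..N}" "0 \<le> t" for i t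
    using cons that unfolding conservation_laws_def by blast
  have mp: "0 \<le> m i" "0 \<le> 1 / m i" if "i \<in> {1..N}" for i using mass_pos[OF that] by simp_all
  have sm: "0 \<le> (\<Sum>i\<in>{1..N}. m i)" "0 \<le> (\<Sum>i\<in>{1..N}. 1 / m i)"
    using sum_nonneg[of "{1..N}" m] sum_nonneg[of "{1..N}" "\<lambda>i. 1 / m i"] mp by blast+
  show ?thesis
  proof (rule mixture_flow.intro[OF K], rule mixture_flow_axioms.intro[OF sol _ _ _ \<delta>(1)])
    fix i t assume i: "i \<in> {1..N}" and t: "0 \<le> (t::real)"
    show "\<delta> \<le> (LINT v|lborel. f i t v)" unfolding ma[OF i t] using \<delta>(2) i by blast
    have "(LINT v|lborel. f i 0 v) \<le> (\<Sum>i\<in>{1..N}. LINT v|lborel. f i 0 v)"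
      using i fn by (intro member_le_sum) (auto intro!: Bochner_Integration.integral_nonneg)
    then show "(LINT v|lborel. f i t v) \<le> \<bar>M0\<bar> + 1" unfolding ma[OF i t] using tot by (simp add: initial_totals_def)
    have mi: "0 < m i" by (rule mass_pos[OF i])
    have "m i * (LINT v|lborel. f i t v * (norm v)^2) \<le> (\<Sum>i\<in>{1..N}. m i * (LINT v|lborel. f i t v * (norm v)^2))"
      using i by (intro member_le_sum[where f="\<lambda>i. m i * (LINT v|lborel. f i t v * (norm v)^2)"] mult_nonneg_nonneg mp en0 t) auto
    also have "\<dots> = (\<Sum>i\<in>{1..N}. m i * (LINT v|lborel. f i 0 v * (norm v)^2))"
      using cons t unfolding conservation_laws_def by blast
    also have "\<dots> \<le> (\<Sum>i\<in>{1..N}. (\<Sum>i\<in>{1..N}. m i) * (LINT v|lborel. f i 0 v * (norm v)^2))"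
      by (intro sum_mono mult_right_mono member_le_sum mp en0) auto
    also have "\<dots> = (\<Sum>i\<in>{1..N}. m i) * E0" using tot by (simp add: initial_totals_def sum_distrib_left)
    also have "\<dots> \<le> (\<Sum>i\<in>{1..N}. m i) * \<bar>E0\<bar>" using sm by (intro mult_left_mono) auto
    finally have "(LINT v|lborel. f i t v * (norm v)^2) \<le> (\<Sum>i\<in>{1..N}. m i) * \<bar>E0\<bar> * (1 / m i)"
      using mi by (simp add: field_simps)
    also have "\<dots> \<le> (\<Sum>i\<in>{1..N}. m i) * \<bar>E0\<bar> * (\<Sum>i\<in>{1..N}. 1 / m i)"
      using i sm by (intro mult_left_mono member_le_sum[where f="\<lambda>i. 1 / m i"] mult_nonneg_nonneg mp) auto
    finally show "(LINT v|lborel. f i t v * (norm v)^2) \<le> (\<Sum>i\<in>{1..N}. m i) * (\<Sum>i\<in>{1..N}. 1 / m i) * \<bar>E0\<bar> + 1"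
      by (simp add: mult_ac)
  next
    show "0 < \<bar>M0\<bar> + 1" by simp
    show "0 < (\<Sum>i\<in>{1..N}. m i) * (\<Sum>i\<in>{1..N}. 1 / m i) * \<bar>E0\<bar> + 1"
      using sm by (intro add_nonneg_pos mult_nonneg_nonneg) auto
  qed
qed

text \<open>\<open>M\<^sub>0\<close> controls only the sum of the species masses, and a species of
  small mass lies above no fixed Maxwellian, since each mass is conserved. This is the reason for
  \<open>\<delta>\<close>.\<close>

theorem theorem1p4:
  fixes N :: nat and m :: "nat \<Rightarrow> real" and \<gamma> :: real
    and h :: "nat \<Rightarrow> nat \<Rightarrow> real \<Rightarrow> real" and M\<^sub>0 E\<^sub>0 H\<^sub>0 \<delta> :: real
  assumes "\<forall>i\<in>{1..N}. 0 < m i"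
    and "strict_mono_on {1..N} m"
    and "cutoff_hard_potentials N \<gamma> h"
    and "0 < \<delta>"
  shows "\<exists>a b :: nat \<Rightarrow> real \<Rightarrow> real.
    (\<forall>i\<in>{1..N}. \<forall>t>0. 0 < a i t \<and> 0 < b i t) \<and>
    (\<forall>f. mixture_solution N m \<gamma> h f \<and> conservation_laws N m f \<and>
         initial_totals N f M\<^sub>0 E\<^sub>0 H\<^sub>0 \<and>
         (\<forall>i\<in>{1..N}. \<delta> \<le> (LINT v|lborel. f i 0 v)) \<longrightarrow>
       (\<forall>i\<in>{1..N}. \<forall>t>0. AE v in lborel.
          f i t v \<ge> a i t * exp (- (b i t * (norm v)\<^sup>2)))) \<and>
    (\<forall>i\<in>{1..N}. \<forall>t\<^sub>0>0. \<exists>A>0. \<exists>B>0. \<forall>t>t\<^sub>0. A \<le> a i t \<and> b i t \<le> B)"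
proof (cases "N = 0")
  case True
  then show ?thesis by simp
next
  case False
  then have N: "1 \<le> N" by simp
  have K: "collision_kernels N m \<gamma> h" using assms(1,3) by (simp add: collision_kernels_def)
  interpret collision_kernels N m \<gamma> h by (rule K)
  define M where "M = \<bar>M\<^sub>0\<bar> + 1"
  define E where "E = (\<Sum>i\<in>{1..N}. m i) * (\<Sum>i\<in>{1..N}. 1 / m i) * \<bar>E\<^sub>0\<bar> + 1"
  have pos: "0 < M" "0 < E"
  proof -
    have "0 \<le> m i" "0 \<le> 1 / m i" if "i \<in> {1..N}" for i using mass_pos[OF that] by simp_all
    then have "0 \<le> (\<Sum>i\<in>{1..N}. m i)" "0 \<le> (\<Sum>i\<in>{1..N}. 1 / m i)" by (blast intro: sum_nonneg)+
    then show "0 < M" "0 < E" unfolding M_def E_def by (simp, intro add_nonneg_pos mult_nonneg_nonneg) simp_all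
  qed
  define W where "W = (\<lambda>k A B. 0 < A \<and> 0 < B \<and> (\<forall>f i t. mixture_flow N m \<gamma> h f \<delta> M E \<longrightarrow>
     finite_entropy N f \<longrightarrow>
     entropy N f \<le> H\<^sub>0 \<longrightarrow> i \<in> {1..N} \<longrightarrow> 1 / (real k + 1) \<le> t \<longrightarrow>
     (AE v in lborel. A * exp (- (B * (norm v)\<^sup>2)) \<le> f i t v)))"
  have "\<exists>A B. W k A B" for k :: nat
    unfolding W_def by (rule maxwellian_lower_bound[OF N assms(4) pos]) simp
  then obtain A B where W: "W k (A k) (B k)" for k by metis
  have AB: "0 < A k" "0 < B k" for k using W[of k] by (simp_all add: W_def)
  \<comment> \<open>The bounds for delays \<open>1 / (k + 1)\<close> are glued into step functions
    of \<open>t\<close>. As \<open>n\<close> does not increase with \<open>t\<close>, only the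
    finitely many indices up to \<open>n t\<^sub>0\<close> occur beyond \<open>t\<^sub>0\<close>,
    which gives the uniformity.\<close>
  define n where "n = (\<lambda>t::real. LEAST k::nat. 1 / (real k + 1) < t)"
  have n: "1 / (real (n t) + 1) < t" if "0 < t" for t
  proof -
    obtain k where "inverse (real (Suc k)) < t" using reals_Archimedean \<open>0 < t\<close> by blast
    then have "1 / (real k + 1) < t" by (simp add: inverse_eq_divide add.commute)
    then show ?thesis unfolding n_def by (rule LeastI)
  qed
  have ae: "AE v in lborel. A (n t) * exp (- (B (n t) * (norm v)\<^sup>2)) \<le> f i t v"
    if f: "mixture_solution N m \<gamma> h f" "conservation_laws N m f" "initial_totals N f M\<^sub>0 E\<^sub>0 H\<^sub>0"
      "\<forall>i\<in>{1..N}. \<delta> \<le> (LINT v|lborel. f i 0 v)" and i: "i \<in> {1..N}" and t: "0 < t" for f i t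
  proof (rule W[of "n t", unfolded W_def, THEN conjunct2, THEN conjunct2, rule_format, OF _ _ _ i])
    show "mixture_flow N m \<gamma> h f \<delta> M E"
      unfolding M_def E_def by (rule mixture_flow_of_solution[OF K f(1-3) assms(4) f(4)])
    show "1 / (real (n t) + 1) \<le> t" using n[OF t] by simp
  qed (use f(3) in \<open>simp_all add: initial_totals_def\<close>)
  have unif: "\<exists>A'>0. \<exists>B'>0. \<forall>t>t\<^sub>0. A' \<le> A (n t) \<and> B (n t) \<le> B'" if t0: "0 < t\<^sub>0" for t\<^sub>0
  proof -
    have le: "n t \<le> n t\<^sub>0" if "t\<^sub>0 < t" for t
      unfolding n_def[THEN fun_cong, of t] by (rule Least_le) (use n[OF t0] that in simp)
    have "0 < Min (A ` {..n t\<^sub>0})" using AB(1) by (subst Min_gr_iff) auto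
    moreover have "0 < Max (B ` {..n t\<^sub>0})" using AB(2) by (subst Max_gr_iff) auto
    moreover have "Min (A ` {..n t\<^sub>0}) \<le> A (n t)" "B (n t) \<le> Max (B ` {..n t\<^sub>0})" if "t\<^sub>0 < t" for t
      using le[OF that] by (auto intro!: Min_le Max_ge)
    ultimately show ?thesis by blast
  qed
  show ?thesis
    by (rule exI[of _ "\<lambda>i t. A (n t)"], rule exI[of _ "\<lambda>i t. B (n t)"]) (use AB(1,2) ae unif in simp)
qed

end
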